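(* Let $\Bbbk$ be a field of characteristic $0$. The functors $$\mathscr{D}r_n\colon\mathscr{P}_n\mathscr{C}at^{\mathrm{dg}}_-(\Bbbk)\to\mathscr{C}at^{\mathrm{dg}}_-(\Bbbk),\qquad(\mathscr{C};\mathscr{C}_1,\dots,\mathscr{C}_n)\mapsto\mathscr{C}/(\mathscr{C}_1,\dots,\mathscr{C}_n),\qquad n\ge0,$$ give rise to a functor $\mathscr{D}r\colon\mathscr{P}\mathscr{C}at^{\mathrm{dg}}_-(\Bbbk)\to\mathscr{C}at^{\mathrm{dg}}_-(\Bbbk)$ (whose restriction to the fibre over $[n]$ is $\mathscr{D}r_n$). The functor $\mathscr{D}r$ has a colax-monoidal structure $$\beta_{X,Y}\colon\mathscr{D}r(X\otimes Y)\to\mathscr{D}r(X)\otimes\mathscr{D}r(Y)$$ such that $\beta_{X,Y}$ is a quasi-equivalence of dg categories for all $X,Y\in\mathscr{P}\mathscr{C}at^{\mathrm{dg}}_-(\Bbbk)$.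
   Context: $\mathscr{C}at^{\mathrm{dg}}_-(\Bbbk)$ is the category of small $\Bbbk$-linear dg categories $\mathscr{C}$ such that for all objects $X,X'$ there is an integer $N(X,X')$ with $\mathrm{Hom}^i(X,X')=0$ for $i>N(X,X')$. It is monoidal: $\mathscr{C}\otimes\mathscr{D}$ has objects $\mathrm{Ob}\,\mathscr{C}\times\mathrm{Ob}\,\mathscr{D}$ and $\mathrm{Hom}(X\times Y,X'\times Y')=\mathrm{Hom}_{\mathscr{C}}(X,X')\otimes_{\Bbbk}\mathrm{Hom}_{\mathscr{D}}(Y,Y')$. **$\mathscr{P}_n\mathscr{C}at^{\mathrm{dg}}_-(\Bbbk)$.** Objects are $(\mathscr{C};\mathscr{C}_1,\dots,\mathscr{C}_n)$ with $\mathscr{C}\in\mathscr{C}at^{\mathrm{dg}}_-(\Bbbk)$ and $\mathscr{C}_1,\dots,\mathscr{C}_n$ an ordered tuple of small (possibly empty) full dg subcategories; morphisms to $(\mathscr{D};\mathscr{D}_1,\dots,\mathscr{D}_n)$ are dg functors $f\colon\mathscr{C}\to\mathscr{D}$ with $f(\mathscr{C}_i)\subset\mathscr{D}_i$ for all $i$. **The category $\Delta_f$.** Objects $[m]=\{0<\dots<m\}$, $m\ge0$; morphisms are order-preserving maps preserving both end-points. It is monoidal with $[m]\otimes[m']=[m+m']$. **$\mathscr{P}\mathscr{C}at^{\mathrm{dg}}_-(\Bbbk)$** is the cofibred Grothendieck construction of the functor $\Theta\colon\Delta_f^{\mathrm{opp}}\to\mathrm{Cat}$, $[n]\mapsto\mathscr{P}_n\mathscr{C}at^{\mathrm{dg}}_-(\Bbbk)$,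 where the face map of $\Delta_f$ omitting $i$ sends $(\mathscr{C};\mathscr{C}_1,\dots,\mathscr{C}_{n+1})$ to $(\mathscr{C};\mathscr{C}_1,\dots,\mathscr{C}_i\cup\mathscr{C}_{i+1},\dots,\mathscr{C}_{n+1})$ ($\cup$ = full subcategory on the union of objects), and the degeneracy map hitting $i$ twice sends $(\mathscr{C};\mathscr{C}_1,\dots,\mathscr{C}_n)$ to $(\mathscr{C};\mathscr{C}_1,\dots,\mathscr{C}_i,\emptyset,\mathscr{C}_{i+1},\dots,\mathscr{C}_n)$. Explicitly: objects are pairs $([n],(\mathscr{C};\mathscr{C}_1,\dots,\mathscr{C}_n))$; a morphism to $([m],(\mathscr{D};\mathscr{D}_1,\dots,\mathscr{D}_m))$ is a pair $(\sigma,F)$ with $\sigma\colon[m]\to[n]$ in $\Delta_f$ and $F\colon\mathscr{C}\to\mathscr{D}$ a dg functor with $F(\mathscr{C}_i)\subset\mathscr{D}_j$ whenever $\sigma(j-1)<i\le\sigma(j)$. Its monoidal product is $$([n],(\mathscr{C};\mathscr{C}_1,\dots,\mathscr{C}_n))\otimes([m],(\mathscr{D};\mathscr{D}_1,\dots,\mathscr{D}_m))=([m+n],(\mathscr{C}\otimes\mathscr{D};\mathscr{C}_1\otimes\mathscr{D},\dots,\mathscr{C}_n\otimes\mathscr{D},\mathscr{C}\otimes\mathscr{D}_1,\dots,\mathscr{C}\otimes\mathscr{D}_m)).$$ **Refined Drinfeld dg quotient $\mathscr{C}/(\mathscr{C}_1,\dots,\mathscr{C}_n)$.** It has the same objects as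 $\mathscr{C}$; its morphisms are freely generated by the morphisms of $\mathscr{C}$ (with their composition) together with, for each $s\ge1$, each $1\le i_1<\dots<i_s\le n$ and each object $X\in\mathscr{C}_{i_1}\cap\dots\cap\mathscr{C}_{i_s}$, a new morphism $\varepsilon_X^{i_1\dots i_s}\colon X\to X$ of degree $-s$, with differential (Čech sign rule) $d\varepsilon_X^{i_1\dots i_s}=\sum_{t=1}^s(-1)^{s-t}\varepsilon_X^{i_1\dots\widehat{i_t}\dots i_s}$, where $\varepsilon_X^{\emptyset}=\mathrm{id}_X$ (so $d\varepsilon^i_X=\mathrm{id}_X$, $d\varepsilon^{ij}_X=\varepsilon^i_X-\varepsilon^j_X$, $d\varepsilon^{ijk}_X=\varepsilon^{ij}_X-\varepsilon^{ik}_X+\varepsilon^{jk}_X$), extended by the Leibniz rule. A colax-monoidal structure on a functor consists of natural maps $\beta_{X,Y}$ as displayed (and a map from the image of the unit to the unit) that are coassociative and counital.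
   Formalization: The target of Dr is the category of all small dg categories instead of Cat^dg_-: for one object with End = k[y]/y^2, |y|=2, d=0 and C_1 = C, the quotient has (yε)^n ≠ 0 in every degree n, so Dr does not land in Cat^dg_-. The domain is unchanged. *)

theory Defs
  imports "HOL-Algebra.Module" "HOL-Library.FuncSet"
begin

subsection \<open>Dg categories, dg functors, quasi-equivalences\<close>

definition scalars :: "'k::field ring" where
  "scalars = \<lparr>carrier = UNIV, mult = (*), one = 1, zero = 0, add = (+)\<rparr>"

definition koszul :: "int \<Rightarrow> 'k::field" where
  "koszul m = (if even m then 1 else - 1)"

text \<open>
  \<open>Hom C X Y n\<close> is the degree \<open>n\<close> component of the complex of morphisms \<open>X \<rightarrow> Y\<close>; its ring fields
  \<^term>\<open>mult\<close> and \<^term>\<open>one\<close> carry no information.  In \<open>Cmp C X Y Z m n g f\<close>, the composite of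
  \<open>f : X \<rightarrow> Y\<close> of degree \<open>n\<close> with \<open>g : Y \<rightarrow> Z\<close> of degree \<open>m\<close>, the endpoints and degrees have to be
  given because different components need not be disjoint.
\<close>

record ('k, 'u) dgcat =
  Ob :: "'u set"
  Hom :: "'u \<Rightarrow> 'u \<Rightarrow> int \<Rightarrow> ('k, 'u) module"
  Id :: "'u \<Rightarrow> 'u"
  Cmp :: "'u \<Rightarrow> 'u \<Rightarrow> 'u \<Rightarrow> int \<Rightarrow> int \<Rightarrow> 'u \<Rightarrow> 'u \<Rightarrow> 'u"
  Dif :: "'u \<Rightarrow> 'u \<Rightarrow> int \<Rightarrow> 'u \<Rightarrow> 'u"

abbreviation hom_set :: "('k, 'u) dgcat \<Rightarrow> 'u \<Rightarrow> 'u \<Rightarrow> int \<Rightarrow> 'u set" where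
  "hom_set C X Y n \<equiv> carrier (Hom C X Y n)"

abbreviation hadd :: "('k, 'u) dgcat \<Rightarrow> 'u \<Rightarrow> 'u \<Rightarrow> int \<Rightarrow> 'u \<Rightarrow> 'u \<Rightarrow> 'u" where
  "hadd C X Y n \<equiv> add (Hom C X Y n)"

abbreviation hscale :: "('k, 'u) dgcat \<Rightarrow> 'u \<Rightarrow> 'u \<Rightarrow> int \<Rightarrow> 'k \<Rightarrow> 'u \<Rightarrow> 'u" where
  "hscale C X Y n \<equiv> smult (Hom C X Y n)"

abbreviation hzero :: "('k, 'u) dgcat \<Rightarrow> 'u \<Rightarrow> 'u \<Rightarrow> int \<Rightarrow> 'u" where
  "hzero C X Y n \<equiv> zero (Hom C X Y n)"

definition linear_map :: "('k::field, 'u) module \<Rightarrow> ('k, 'u) module \<Rightarrow> ('u \<Rightarrow> 'u) \<Rightarrow> bool" where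
  "linear_map M N h \<longleftrightarrow>
     (\<forall>a\<in>carrier M. h a \<in> carrier N) \<and>
     (\<forall>a\<in>carrier M. \<forall>b\<in>carrier M. h (a \<oplus>\<^bsub>M\<^esub> b) = h a \<oplus>\<^bsub>N\<^esub> h b) \<and>
     (\<forall>c. \<forall>a\<in>carrier M. h (c \<odot>\<^bsub>M\<^esub> a) = c \<odot>\<^bsub>N\<^esub> h a)"

definition dg_category :: "('k::field, 'u) dgcat \<Rightarrow> bool" where
  "dg_category C \<longleftrightarrow>
     (\<forall>X\<in>Ob C. \<forall>Y\<in>Ob C. \<forall>n. Module.module scalars (Hom C X Y n)) \<and>
     (\<forall>X\<in>Ob C. Id C X \<in> hom_set C X X 0) \<and>
     (\<forall>X\<in>Ob C. \<forall>Y\<in>Ob C. \<forall>Z\<in>Ob C. \<forall>m n.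
        (\<forall>f\<in>hom_set C X Y n.
           linear_map (Hom C Y Z m) (Hom C X Z (m + n)) (\<lambda>g. Cmp C X Y Z m n g f)) \<and>
        (\<forall>g\<in>hom_set C Y Z m.
           linear_map (Hom C X Y n) (Hom C X Z (m + n)) (\<lambda>f. Cmp C X Y Z m n g f))) \<and>
     (\<forall>W\<in>Ob C. \<forall>X\<in>Ob C. \<forall>Y\<in>Ob C. \<forall>Z\<in>Ob C. \<forall>l m n.
        \<forall>h\<in>hom_set C Y Z l. \<forall>g\<in>hom_set C X Y m. \<forall>f\<in>hom_set C W X n.
          Cmp C W Y Z l (m + n) h (Cmp C W X Y m n g f)
            = Cmp C W X Z (l + m) n (Cmp C X Y Z l m h g) f) \<and>
     (\<forall>X\<in>Ob C. \<forall>Y\<in>Ob C. \<forall>n. \<forall>f\<in>hom_set C X Y n.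
        Cmp C X Y Y 0 n (Id C Y) f = f \<and> Cmp C X X Y n 0 f (Id C X) = f) \<and>
     (\<forall>X\<in>Ob C. \<forall>Y\<in>Ob C. \<forall>n. linear_map (Hom C X Y n) (Hom C X Y (n + 1)) (Dif C X Y n)) \<and>
     (\<forall>X\<in>Ob C. \<forall>Y\<in>Ob C. \<forall>n. \<forall>f\<in>hom_set C X Y n.
        Dif C X Y (n + 1) (Dif C X Y n f) = hzero C X Y (n + 1 + 1)) \<and>
     (\<forall>X\<in>Ob C. \<forall>Y\<in>Ob C. \<forall>Z\<in>Ob C. \<forall>m n. \<forall>g\<in>hom_set C Y Z m. \<forall>f\<in>hom_set C X Y n.
        Dif C X Z (m + n) (Cmp C X Y Z m n g f)
          = hadd C X Z (m + n + 1)
              (Cmp C X Y Z (m + 1) n (Dif C Y Z m g) f)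
              (hscale C X Z (m + n + 1) (koszul m) (Cmp C X Y Z m (n + 1) g (Dif C X Y n f))))"

definition bounded_above :: "('k, 'u) dgcat \<Rightarrow> bool" where
  "bounded_above C \<longleftrightarrow>
     (\<forall>X\<in>Ob C. \<forall>Y\<in>Ob C. \<exists>N. \<forall>i>N. hom_set C X Y i = {hzero C X Y i})"

text \<open>
  Dg functors are required to be undefined outside their domain, so that HOL equality of
  \<open>dgfun\<close> values is equality of dg functors.
\<close>

record 'u dgfun =
  fob :: "'u \<Rightarrow> 'u"
  far :: "'u \<Rightarrow> 'u \<Rightarrow> int \<Rightarrow> 'u \<Rightarrow> 'u"

definition mk_fun ::
  "('k, 'u) dgcat \<Rightarrow> ('u \<Rightarrow> 'u) \<Rightarrow> ('u \<Rightarrow> 'u \<Rightarrow> int \<Rightarrow> 'u \<Rightarrow> 'u) \<Rightarrow> 'u dgfun" where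
  "mk_fun C fo fa =
     \<lparr>fob = restrict fo (Ob C),
      far = (\<lambda>X Y n f. if X \<in> Ob C \<and> Y \<in> Ob C \<and> f \<in> hom_set C X Y n then fa X Y n f else undefined)\<rparr>"

definition dg_functor :: "('k::field, 'u) dgcat \<Rightarrow> ('k, 'u) dgcat \<Rightarrow> 'u dgfun \<Rightarrow> bool" where
  "dg_functor C D F \<longleftrightarrow>
     mk_fun C (fob F) (far F) = F \<and>
     (\<forall>X\<in>Ob C. fob F X \<in> Ob D) \<and>
     (\<forall>X\<in>Ob C. \<forall>Y\<in>Ob C. \<forall>n.
        linear_map (Hom C X Y n) (Hom D (fob F X) (fob F Y) n) (far F X Y n)) \<and>
     (\<forall>X\<in>Ob C. far F X X 0 (Id C X) = Id D (fob F X)) \<and>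
     (\<forall>X\<in>Ob C. \<forall>Y\<in>Ob C. \<forall>Z\<in>Ob C. \<forall>m n. \<forall>g\<in>hom_set C Y Z m. \<forall>f\<in>hom_set C X Y n.
        far F X Z (m + n) (Cmp C X Y Z m n g f)
          = Cmp D (fob F X) (fob F Y) (fob F Z) m n (far F Y Z m g) (far F X Y n f)) \<and>
     (\<forall>X\<in>Ob C. \<forall>Y\<in>Ob C. \<forall>n. \<forall>f\<in>hom_set C X Y n.
        far F X Y (n + 1) (Dif C X Y n f) = Dif D (fob F X) (fob F Y) n (far F X Y n f))"

definition id_fun :: "('k, 'u) dgcat \<Rightarrow> 'u dgfun" where
  "id_fun C = mk_fun C (\<lambda>X. X) (\<lambda>X Y n f. f)"

definition comp_fun :: "('k, 'u) dgcat \<Rightarrow> 'u dgfun \<Rightarrow> 'u dgfun \<Rightarrow> 'u dgfun" where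
  "comp_fun C G F =
     mk_fun C (\<lambda>X. fob G (fob F X)) (\<lambda>X Y n f. far G (fob F X) (fob F Y) n (far F X Y n f))"

definition cocycles :: "('k, 'u) dgcat \<Rightarrow> 'u \<Rightarrow> 'u \<Rightarrow> int \<Rightarrow> 'u set" where
  "cocycles C X Y n = {f \<in> hom_set C X Y n. Dif C X Y n f = hzero C X Y (n + 1)}"

definition coh_class :: "('k, 'u) dgcat \<Rightarrow> 'u \<Rightarrow> 'u \<Rightarrow> int \<Rightarrow> 'u \<Rightarrow> 'u set" where
  "coh_class C X Y n f = {hadd C X Y n f (Dif C X Y (n - 1) h) |h. h \<in> hom_set C X Y (n - 1)}"

definition cohomology :: "('k, 'u) dgcat \<Rightarrow> 'u \<Rightarrow> 'u \<Rightarrow> int \<Rightarrow> 'u set set" where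
  "cohomology C X Y n = coh_class C X Y n ` cocycles C X Y n"

definition coh_map ::
  "('k, 'u) dgcat \<Rightarrow> 'u dgfun \<Rightarrow> 'u \<Rightarrow> 'u \<Rightarrow> int \<Rightarrow> 'u set \<Rightarrow> 'u set" where
  "coh_map D F X Y n c = (\<Union>z\<in>c. coh_class D (fob F X) (fob F Y) n (far F X Y n z))"

definition homotopy_equivalent :: "('k, 'u) dgcat \<Rightarrow> 'u \<Rightarrow> 'u \<Rightarrow> bool" where
  "homotopy_equivalent C X Y \<longleftrightarrow>
     (\<exists>f\<in>cocycles C X Y 0. \<exists>g\<in>cocycles C Y X 0.
        coh_class C X X 0 (Cmp C X Y X 0 0 g f) = coh_class C X X 0 (Id C X) \<and>
        coh_class C Y Y 0 (Cmp C Y X Y 0 0 f g) = coh_class C Y Y 0 (Id C Y))"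

definition quasi_equivalence :: "('k::field, 'u) dgcat \<Rightarrow> ('k, 'u) dgcat \<Rightarrow> 'u dgfun \<Rightarrow> bool" where
  "quasi_equivalence C D F \<longleftrightarrow>
     dg_functor C D F \<and>
     (\<forall>X\<in>Ob C. \<forall>Y\<in>Ob C. \<forall>n.
        bij_betw (coh_map D F X Y n) (cohomology C X Y n) (cohomology D (fob F X) (fob F Y) n)) \<and>
     (\<forall>U\<in>Ob D. \<exists>X\<in>Ob C. homotopy_equivalent D (fob F X) U)"


subsection \<open>Monoidal categories and colax-monoidal functors\<close>

record ('o, 'm) moncat =
  obj :: "'o set"
  arr :: "'o \<Rightarrow> 'o \<Rightarrow> 'm set"
  ident :: "'o \<Rightarrow> 'm"
  compose :: "'o \<Rightarrow> 'o \<Rightarrow> 'o \<Rightarrow> 'm \<Rightarrow> 'm \<Rightarrow> 'm"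
  tobj :: "'o \<Rightarrow> 'o \<Rightarrow> 'o"
  tarr :: "'o \<Rightarrow> 'o \<Rightarrow> 'o \<Rightarrow> 'o \<Rightarrow> 'm \<Rightarrow> 'm \<Rightarrow> 'm"
  unit_obj :: "'o"
  associator :: "'o \<Rightarrow> 'o \<Rightarrow> 'o \<Rightarrow> 'm"
  lunitor :: "'o \<Rightarrow> 'm"
  runitor :: "'o \<Rightarrow> 'm"

text \<open>
  \<open>compose A X Y Z g f\<close> is \<open>g \<circ> f\<close> for \<open>f : X \<rightarrow> Y\<close> and \<open>g : Y \<rightarrow> Z\<close>;
  \<open>tarr A X X' Y Y' f g : X \<otimes> Y \<rightarrow> X' \<otimes> Y'\<close> for \<open>f : X \<rightarrow> X'\<close> and \<open>g : Y \<rightarrow> Y'\<close>;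
  \<open>associator A X Y Z : (X \<otimes> Y) \<otimes> Z \<rightarrow> X \<otimes> (Y \<otimes> Z)\<close>.
\<close>

definition is_functor ::
  "('o, 'm) moncat \<Rightarrow> ('p, 'q) moncat \<Rightarrow> ('o \<Rightarrow> 'p) \<Rightarrow> ('o \<Rightarrow> 'o \<Rightarrow> 'm \<Rightarrow> 'q) \<Rightarrow> bool" where
  "is_functor A B Fo Fm \<longleftrightarrow>
     (\<forall>X\<in>obj A. Fo X \<in> obj B) \<and>
     (\<forall>X\<in>obj A. \<forall>Y\<in>obj A. \<forall>f\<in>arr A X Y. Fm X Y f \<in> arr B (Fo X) (Fo Y)) \<and>
     (\<forall>X\<in>obj A. Fm X X (ident A X) = ident B (Fo X)) \<and>
     (\<forall>X\<in>obj A. \<forall>Y\<in>obj A. \<forall>Z\<in>obj A. \<forall>f\<in>arr A X Y. \<forall>g\<in>arr A Y Z.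
        Fm X Z (compose A X Y Z g f) = compose B (Fo X) (Fo Y) (Fo Z) (Fm Y Z g) (Fm X Y f))"

definition colax_monoidal ::
  "('o, 'm) moncat \<Rightarrow> ('p, 'q) moncat \<Rightarrow> ('o \<Rightarrow> 'p) \<Rightarrow> ('o \<Rightarrow> 'o \<Rightarrow> 'm \<Rightarrow> 'q)
     \<Rightarrow> ('o \<Rightarrow> 'o \<Rightarrow> 'q) \<Rightarrow> 'q \<Rightarrow> bool" where
  "colax_monoidal A B Fo Fm \<beta> \<eta> \<longleftrightarrow>
     (\<forall>X\<in>obj A. \<forall>Y\<in>obj A. \<beta> X Y \<in> arr B (Fo (tobj A X Y)) (tobj B (Fo X) (Fo Y))) \<and>
     \<eta> \<in> arr B (Fo (unit_obj A)) (unit_obj B) \<and>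
     (\<forall>X\<in>obj A. \<forall>X'\<in>obj A. \<forall>Y\<in>obj A. \<forall>Y'\<in>obj A. \<forall>f\<in>arr A X X'. \<forall>g\<in>arr A Y Y'.
        compose B (Fo (tobj A X Y)) (Fo (tobj A X' Y')) (tobj B (Fo X') (Fo Y'))
            (\<beta> X' Y') (Fm (tobj A X Y) (tobj A X' Y') (tarr A X X' Y Y' f g))
          = compose B (Fo (tobj A X Y)) (tobj B (Fo X) (Fo Y)) (tobj B (Fo X') (Fo Y'))
              (tarr B (Fo X) (Fo X') (Fo Y) (Fo Y') (Fm X X' f) (Fm Y Y' g)) (\<beta> X Y)) \<and>
     (\<forall>X\<in>obj A. \<forall>Y\<in>obj A. \<forall>Z\<in>obj A.
        let XY_Z = Fo (tobj A (tobj A X Y) Z); X_YZ = Fo (tobj A X (tobj A Y Z));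
            target = tobj B (Fo X) (tobj B (Fo Y) (Fo Z)) in
        compose B XY_Z (tobj B (tobj B (Fo X) (Fo Y)) (Fo Z)) target
            (associator B (Fo X) (Fo Y) (Fo Z))
            (compose B XY_Z (tobj B (Fo (tobj A X Y)) (Fo Z)) (tobj B (tobj B (Fo X) (Fo Y)) (Fo Z))
               (tarr B (Fo (tobj A X Y)) (tobj B (Fo X) (Fo Y)) (Fo Z) (Fo Z)
                  (\<beta> X Y) (ident B (Fo Z)))
               (\<beta> (tobj A X Y) Z))
          = compose B XY_Z X_YZ target
              (compose B X_YZ (tobj B (Fo X) (Fo (tobj A Y Z))) target
                 (tarr B (Fo X) (Fo X) (Fo (tobj A Y Z)) (tobj B (Fo Y) (Fo Z))
                    (ident B (Fo X)) (\<beta> Y Z))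
                 (\<beta> X (tobj A Y Z)))
              (Fm (tobj A (tobj A X Y) Z) (tobj A X (tobj A Y Z)) (associator A X Y Z))) \<and>
     (\<forall>X\<in>obj A.
        compose B (Fo (tobj A (unit_obj A) X)) (tobj B (unit_obj B) (Fo X)) (Fo X)
            (lunitor B (Fo X))
            (compose B (Fo (tobj A (unit_obj A) X)) (tobj B (Fo (unit_obj A)) (Fo X))
               (tobj B (unit_obj B) (Fo X))
               (tarr B (Fo (unit_obj A)) (unit_obj B) (Fo X) (Fo X) \<eta> (ident B (Fo X)))
               (\<beta> (unit_obj A) X))
          = Fm (tobj A (unit_obj A) X) X (lunitor A X)) \<and>
     (\<forall>X\<in>obj A.
        compose B (Fo (tobj A X (unit_obj A))) (tobj B (Fo X) (unit_obj B)) (Fo X)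
            (runitor B (Fo X))
            (compose B (Fo (tobj A X (unit_obj A))) (tobj B (Fo X) (Fo (unit_obj A)))
               (tobj B (Fo X) (unit_obj B))
               (tarr B (Fo X) (Fo X) (Fo (unit_obj A)) (unit_obj B) (ident B (Fo X)) \<eta>)
               (\<beta> X (unit_obj A)))
          = Fm (tobj A X (unit_obj A)) X (runitor A X))"


subsection \<open>A universe closed under tensor products and Drinfeld quotients\<close>

text \<open>
  A small dg category is one whose objects and morphisms are elements of \<open>('a, 'k) univ\<close>, for an
  arbitrary type \<open>'a\<close> of atoms.  Besides atoms, the universe contains the objects \<open>Pair X Y\<close> of
  tensor products and formal expressions for morphisms: \<open>Tensor p f q g\<close> stands for \<open>f \<otimes> g\<close> with
  \<open>f\<close> of degree \<open>p\<close> and \<open>g\<close> of degree \<open>q\<close>; \<open>Incl f\<close> for a morphism \<open>f\<close> of a dg category seen in a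
  Drinfeld quotient of it; \<open>Eps X [i1, ..., is]\<close> for the new generator \<open>\<epsilon>\<^sub>X\<close> with upper indices
  \<open>i1 < ... < is\<close>; and \<open>Comp Y m n g f\<close> for the composite of \<open>f : X \<rightarrow> Y\<close> of degree \<open>n\<close> with
  \<open>g : Y \<rightarrow> Z\<close> of degree \<open>m\<close>.  Spaces of expressions modulo relations are realised inside the
  universe by choosing one representative of each class.
\<close>

datatype ('a, 'k) univ =
    Atom 'a
  | Star
  | Scal (scal: 'k)
  | Pair (pfst: "('a, 'k) univ") (psnd: "('a, 'k) univ")
  | Tensor int "('a, 'k) univ" int "('a, 'k) univ"
  | Incl "('a, 'k) univ"
  | Eps "('a, 'k) univ" "nat list"
  | Comp "('a, 'k) univ" int int "('a, 'k) univ" "('a, 'k) univ"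
  | FSum "('a, 'k) univ" "('a, 'k) univ"
  | FScale 'k "('a, 'k) univ"

type_synonym ('a, 'k) dg = "('k, ('a, 'k) univ) dgcat"
type_synonym ('a, 'k) dgf = "('a, 'k) univ dgfun"

definition rep :: "('u \<Rightarrow> 'u \<Rightarrow> bool) \<Rightarrow> 'u \<Rightarrow> 'u" where
  "rep R t = (SOME u. R t u)"

text \<open>Here \<open>R\<close> is a partial equivalence relation, whose domain consists of the well-formed expressions.\<close>

definition quot_module ::
  "(('a, 'k) univ \<Rightarrow> ('a, 'k) univ \<Rightarrow> bool) \<Rightarrow> ('a, 'k) univ \<Rightarrow> ('k, ('a, 'k) univ) module" where
  "quot_module R z =
     \<lparr>carrier = rep R ` {t. R t t}, mult = undefined, one = undefined, zero = rep R z,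
      add = (\<lambda>a b. rep R (FSum a b)), smult = (\<lambda>c a. rep R (FScale c a))\<rparr>"


subsection \<open>The monoidal category of small dg categories\<close>

definition unit_dg :: "('a, 'k::field) dg" where
  "unit_dg =
     \<lparr>Ob = {Star},
      Hom = (\<lambda>X Y n. \<lparr>carrier = (if n = 0 then range Scal else {Scal 0}),
                      mult = undefined, one = undefined, zero = Scal 0,
                      add = (\<lambda>a b. Scal (scal a + scal b)), smult = (\<lambda>c a. Scal (c * scal a))\<rparr>),
      Id = (\<lambda>X. Scal 1),
      Cmp = (\<lambda>X Y Z m n g f. Scal (scal g * scal f)),
      Dif = (\<lambda>X Y n f. Scal 0)\<rparr>"

text \<open>
  The relation defining the degree \<open>n\<close> component of \<open>Hom(X, X') \<otimes> Hom(Y, Y')\<close>, that is, the direct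
  sum over \<open>p + q = n\<close> of the tensor products over \<open>'k\<close> of the degree \<open>p\<close> and \<open>q\<close> components, for
  \<open>V = Pair X Y\<close> and \<open>W = Pair X' Y'\<close>.
\<close>

inductive tensor_eq ::
  "('a, 'k::field) dg \<Rightarrow> ('a, 'k) dg \<Rightarrow> ('a, 'k) univ \<Rightarrow> ('a, 'k) univ \<Rightarrow> int
     \<Rightarrow> ('a, 'k) univ \<Rightarrow> ('a, 'k) univ \<Rightarrow> bool"
  for C D V W n where
  gen: "\<lbrakk>f \<in> hom_set C (pfst V) (pfst W) p; g \<in> hom_set D (psnd V) (psnd W) q; p + q = n\<rbrakk>
     \<Longrightarrow> tensor_eq C D V W n (Tensor p f q g) (Tensor p f q g)"
| sym: "tensor_eq C D V W n t u \<Longrightarrow> tensor_eq C D V W n u t"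
| trans: "\<lbrakk>tensor_eq C D V W n t u; tensor_eq C D V W n u v\<rbrakk> \<Longrightarrow> tensor_eq C D V W n t v"
| sum_cong: "\<lbrakk>tensor_eq C D V W n t t'; tensor_eq C D V W n u u'\<rbrakk>
     \<Longrightarrow> tensor_eq C D V W n (FSum t u) (FSum t' u')"
| scale_cong: "tensor_eq C D V W n t t' \<Longrightarrow> tensor_eq C D V W n (FScale c t) (FScale c t')"
| sum_assoc: "\<lbrakk>tensor_eq C D V W n t t; tensor_eq C D V W n u u; tensor_eq C D V W n v v\<rbrakk>
     \<Longrightarrow> tensor_eq C D V W n (FSum (FSum t u) v) (FSum t (FSum u v))"
| sum_comm: "\<lbrakk>tensor_eq C D V W n t t; tensor_eq C D V W n u u\<rbrakk>
     \<Longrightarrow> tensor_eq C D V W n (FSum t u) (FSum u t)"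
| sum_zero: "\<lbrakk>tensor_eq C D V W n t t; tensor_eq C D V W n u u\<rbrakk>
     \<Longrightarrow> tensor_eq C D V W n (FSum t (FScale 0 u)) t"
| scale_sum: "\<lbrakk>tensor_eq C D V W n t t; tensor_eq C D V W n u u\<rbrakk>
     \<Longrightarrow> tensor_eq C D V W n (FScale c (FSum t u)) (FSum (FScale c t) (FScale c u))"
| scale_add: "tensor_eq C D V W n t t
     \<Longrightarrow> tensor_eq C D V W n (FScale (c + c') t) (FSum (FScale c t) (FScale c' t))"
| scale_mult: "tensor_eq C D V W n t t
     \<Longrightarrow> tensor_eq C D V W n (FScale (c * c') t) (FScale c (FScale c' t))"
| scale_one: "tensor_eq C D V W n t t \<Longrightarrow> tensor_eq C D V W n (FScale 1 t) t"
| add_left: "\<lbrakk>f \<in> hom_set C (pfst V) (pfst W) p; f' \<in> hom_set C (pfst V) (pfst W) p;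
      g \<in> hom_set D (psnd V) (psnd W) q; p + q = n\<rbrakk>
     \<Longrightarrow> tensor_eq C D V W n (Tensor p (hadd C (pfst V) (pfst W) p f f') q g)
           (FSum (Tensor p f q g) (Tensor p f' q g))"
| add_right: "\<lbrakk>f \<in> hom_set C (pfst V) (pfst W) p; g \<in> hom_set D (psnd V) (psnd W) q;
      g' \<in> hom_set D (psnd V) (psnd W) q; p + q = n\<rbrakk>
     \<Longrightarrow> tensor_eq C D V W n (Tensor p f q (hadd D (psnd V) (psnd W) q g g'))
           (FSum (Tensor p f q g) (Tensor p f q g'))"
| scale_left: "\<lbrakk>f \<in> hom_set C (pfst V) (pfst W) p; g \<in> hom_set D (psnd V) (psnd W) q; p + q = n\<rbrakk>
     \<Longrightarrow> tensor_eq C D V W n (Tensor p (hscale C (pfst V) (pfst W) p c f) q g)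
           (FScale c (Tensor p f q g))"
| scale_right: "\<lbrakk>f \<in> hom_set C (pfst V) (pfst W) p; g \<in> hom_set D (psnd V) (psnd W) q; p + q = n\<rbrakk>
     \<Longrightarrow> tensor_eq C D V W n (Tensor p f q (hscale D (psnd V) (psnd W) q c g))
           (FScale c (Tensor p f q g))"

definition tensor_hom ::
  "('a, 'k::field) dg \<Rightarrow> ('a, 'k) dg \<Rightarrow> ('a, 'k) univ \<Rightarrow> ('a, 'k) univ \<Rightarrow> int
     \<Rightarrow> ('k, ('a, 'k) univ) module" where
  "tensor_hom C D V W n =
     quot_module (tensor_eq C D V W n)
       (Tensor n (hzero C (pfst V) (pfst W) n) 0 (hzero D (psnd V) (psnd W) 0))"

definition pure_tensor ::
  "('a, 'k::field) dg \<Rightarrow> ('a, 'k) dg \<Rightarrow> ('a, 'k) univ \<Rightarrow> ('a, 'k) univ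
     \<Rightarrow> int \<Rightarrow> ('a, 'k) univ \<Rightarrow> int \<Rightarrow> ('a, 'k) univ \<Rightarrow> ('a, 'k) univ" where
  "pure_tensor C D V W p f q g = rep (tensor_eq C D V W (p + q)) (Tensor p f q g)"

text \<open>
  The linear map to \<open>M\<close> whose value on \<open>f \<otimes> g\<close>, with \<open>f\<close> of degree \<open>p\<close> and \<open>g\<close> of degree \<open>q\<close>, is
  \<open>h p f q g\<close>, computed on expressions; all uses below are for \<open>h\<close> bilinear in \<open>f\<close> and \<open>g\<close>.
\<close>

fun tensor_ext ::
  "('k, ('a, 'k) univ) module \<Rightarrow> (int \<Rightarrow> ('a, 'k) univ \<Rightarrow> int \<Rightarrow> ('a, 'k) univ \<Rightarrow> ('a, 'k) univ)
     \<Rightarrow> ('a, 'k) univ \<Rightarrow> ('a, 'k) univ" where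
  "tensor_ext M h (Tensor p f q g) = h p f q g"
| "tensor_ext M h (FSum t u) = tensor_ext M h t \<oplus>\<^bsub>M\<^esub> tensor_ext M h u"
| "tensor_ext M h (FScale c t) = c \<odot>\<^bsub>M\<^esub> tensor_ext M h t"
| "tensor_ext M h _ = undefined"

text \<open>
  Composition is \<open>(g \<otimes> h)(g' \<otimes> h') = (-1)^(|h||g'|) gg' \<otimes> hh'\<close>, and
  \<open>d(f \<otimes> g) = df \<otimes> g + (-1)^|f| f \<otimes> dg\<close>.
\<close>

definition tensor_dg :: "('a, 'k::field) dg \<Rightarrow> ('a, 'k) dg \<Rightarrow> ('a, 'k) dg" where
  "tensor_dg C D =
     \<lparr>Ob = {Pair X Y |X Y. X \<in> Ob C \<and> Y \<in> Ob D},
      Hom = tensor_hom C D,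
      Id = (\<lambda>V. pure_tensor C D V V 0 (Id C (pfst V)) 0 (Id D (psnd V))),
      Cmp = (\<lambda>U V W m n t u.
        tensor_ext (tensor_hom C D U W (m + n)) (\<lambda>p g q h.
          tensor_ext (tensor_hom C D U W (m + n)) (\<lambda>p' g' q' h'.
            koszul (q * p') \<odot>\<^bsub>tensor_hom C D U W (m + n)\<^esub>
              pure_tensor C D U W
                (p + p') (Cmp C (pfst U) (pfst V) (pfst W) p p' g g')
                (q + q') (Cmp D (psnd U) (psnd V) (psnd W) q q' h h')) u) t),
      Dif = (\<lambda>V W n t.
        tensor_ext (tensor_hom C D V W (n + 1)) (\<lambda>p f q g.
          pure_tensor C D V W (p + 1) (Dif C (pfst V) (pfst W) p f) q g
            \<oplus>\<^bsub>tensor_hom C D V W (n + 1)\<^esub>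
          (koszul p \<odot>\<^bsub>tensor_hom C D V W (n + 1)\<^esub>
             pure_tensor C D V W p f (q + 1) (Dif D (psnd V) (psnd W) q g))) t)\<rparr>"

definition tensor_fun ::
  "('a, 'k::field) dg \<Rightarrow> ('a, 'k) dg \<Rightarrow> ('a, 'k) dg \<Rightarrow> ('a, 'k) dg
     \<Rightarrow> ('a, 'k) dgf \<Rightarrow> ('a, 'k) dgf \<Rightarrow> ('a, 'k) dgf" where
  "tensor_fun C C' D D' F G =
     (let fo = (\<lambda>V. Pair (fob F (pfst V)) (fob G (psnd V))) in
      mk_fun (tensor_dg C D) fo
        (\<lambda>V W n. tensor_ext (tensor_hom C' D' (fo V) (fo W) n) (\<lambda>p f q g.
           pure_tensor C' D' (fo V) (fo W)
             p (far F (pfst V) (pfst W) p f) q (far G (psnd V) (psnd W) q g))))"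

definition tensor_assoc ::
  "('a, 'k::field) dg \<Rightarrow> ('a, 'k) dg \<Rightarrow> ('a, 'k) dg \<Rightarrow> ('a, 'k) dgf" where
  "tensor_assoc C D E =
     (let fo = (\<lambda>V. Pair (pfst (pfst V)) (Pair (psnd (pfst V)) (psnd V))) in
      mk_fun (tensor_dg (tensor_dg C D) E) fo
        (\<lambda>V W n. tensor_ext (tensor_hom C (tensor_dg D E) (fo V) (fo W) n) (\<lambda>r a s h.
           tensor_ext (tensor_hom C (tensor_dg D E) (fo V) (fo W) n) (\<lambda>p f q g.
             pure_tensor C (tensor_dg D E) (fo V) (fo W)
               p f (q + s) (pure_tensor D E (psnd (fo V)) (psnd (fo W)) q g s h)) a)))"

definition tensor_lunit :: "('a, 'k::field) dg \<Rightarrow> ('a, 'k) dgf" where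
  "tensor_lunit C =
     mk_fun (tensor_dg unit_dg C) psnd
       (\<lambda>V W n. tensor_ext (Hom C (psnd V) (psnd W) n) (\<lambda>p a q f.
          if p = 0 then hscale C (psnd V) (psnd W) n (scal a) f else hzero C (psnd V) (psnd W) n))"

definition tensor_runit :: "('a, 'k::field) dg \<Rightarrow> ('a, 'k) dgf" where
  "tensor_runit C =
     mk_fun (tensor_dg C unit_dg) pfst
       (\<lambda>V W n. tensor_ext (Hom C (pfst V) (pfst W) n) (\<lambda>p f q a.
          if q = 0 then hscale C (pfst V) (pfst W) n (scal a) f else hzero C (pfst V) (pfst W) n))"

text \<open>
  \<open>DGCat\<close> consists of all small dg categories, \<open>DGCat_minus\<close> is its full monoidal subcategory
  of those whose morphism complexes are bounded above.
\<close>

definition DGCat :: "(('a, 'k::field) dg, ('a, 'k) dgf) moncat" where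
  "DGCat =
     \<lparr>obj = {C. dg_category C},
      arr = (\<lambda>C D. {F. dg_functor C D F}),
      ident = id_fun,
      compose = (\<lambda>C D E G F. comp_fun C G F),
      tobj = tensor_dg,
      tarr = tensor_fun,
      unit_obj = unit_dg,
      associator = tensor_assoc,
      lunitor = tensor_lunit,
      runitor = tensor_runit\<rparr>"

definition DGCat_minus :: "(('a, 'k::field) dg, ('a, 'k) dgf) moncat" where
  "DGCat_minus = DGCat\<lparr>obj := {C. dg_category C \<and> bounded_above C}\<rparr>"


subsection \<open>The category of dg categories with tuples of full dg subcategories\<close>

text \<open>
  Full dg subcategories are given by their sets of objects.  \<open>(C, [C1, ..., Cn])\<close> stands both for
  \<open>(C; C1, ..., Cn)\<close> and for the object \<open>([n], (C; C1, ..., Cn))\<close> of the Grothendieck construction,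
  \<open>n\<close> being the length of the list; \<open>Ci\<close> is the list element number \<open>i - 1\<close>.
\<close>

type_synonym ('a, 'k) pdg = "('a, 'k) dg \<times> ('a, 'k) univ set list"
type_synonym ('a, 'k) pdgf = "(nat \<Rightarrow> nat) \<times> ('a, 'k) dgf"

definition pdg_obj :: "nat \<Rightarrow> ('a, 'k::field) pdg set" where
  "pdg_obj n = {(C, S). C \<in> obj DGCat_minus \<and> length S = n \<and> (\<forall>A\<in>set S. A \<subseteq> Ob C)}"

definition pdg_arr :: "nat \<Rightarrow> ('a, 'k::field) pdg \<Rightarrow> ('a, 'k) pdg \<Rightarrow> ('a, 'k) dgf set" where
  "pdg_arr n = (\<lambda>(C, S) (D, T).
     {F \<in> arr DGCat_minus C D. \<forall>i\<in>{1..n}. fob F ` (S ! (i - 1)) \<subseteq> T ! (i - 1)})"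

definition Delta_f :: "nat \<Rightarrow> nat \<Rightarrow> (nat \<Rightarrow> nat) set" where
  "Delta_f m n = {\<sigma> \<in> {0..m} \<rightarrow>\<^sub>E {0..n}. mono_on {0..m} \<sigma> \<and> \<sigma> 0 = 0 \<and> \<sigma> m = n}"

definition Delta_id :: "nat \<Rightarrow> nat \<Rightarrow> nat" where
  "Delta_id n = restrict (\<lambda>j. j) {0..n}"

definition PDGCat_minus :: "(('a, 'k::field) pdg, ('a, 'k) pdgf) moncat" where
  "PDGCat_minus =
     \<lparr>obj = (\<Union>n. pdg_obj n),
      arr = (\<lambda>(C, S) (D, T).
        {(\<sigma>, F). \<sigma> \<in> Delta_f (length T) (length S) \<and> F \<in> arr DGCat_minus C D \<and>
           (\<forall>j\<in>{1..length T}. \<forall>i. \<sigma> (j - 1) < i \<and> i \<le> \<sigma> j \<longrightarrow>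
              fob F ` (S ! (i - 1)) \<subseteq> T ! (j - 1))}),
      ident = (\<lambda>(C, S). (Delta_id (length S), ident DGCat_minus C)),
      compose = (\<lambda>(C, S) (D, T) (E, U) (\<tau>, G) (\<sigma>, F).
        (restrict (\<lambda>j. \<sigma> (\<tau> j)) {0..length U}, compose DGCat_minus C D E G F)),
      tobj = (\<lambda>(C, S) (D, T).
        (tobj DGCat_minus C D,
         map (\<lambda>A. {Pair X Y |X Y. X \<in> A \<and> Y \<in> Ob D}) S @
         map (\<lambda>B. {Pair X Y |X Y. X \<in> Ob C \<and> Y \<in> B}) T)),
      tarr = (\<lambda>(C, S) (C', S') (D, T) (D', T') (\<sigma>, F) (\<tau>, G).
        (restrict (\<lambda>j. if j \<le> length S' then \<sigma> j else length S + \<tau> (j - length S'))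
           {0..length S' + length T'},
         tarr DGCat_minus C C' D D' F G)),
      unit_obj = (unit_obj DGCat_minus, []),
      associator = (\<lambda>(C, S) (D, T) (E, U).
        (Delta_id (length S + length T + length U), associator DGCat_minus C D E)),
      lunitor = (\<lambda>(C, S). (Delta_id (length S), lunitor DGCat_minus C)),
      runitor = (\<lambda>(C, S). (Delta_id (length S), runitor DGCat_minus C))\<rparr>"


subsection \<open>The refined Drinfeld dg quotient\<close>

definition eps_index ::
  "('a, 'k) univ set list \<Rightarrow> ('a, 'k) univ \<Rightarrow> nat list \<Rightarrow> bool" where
  "eps_index S X I \<longleftrightarrow>
     I \<noteq> [] \<and> sorted_wrt (<) I \<and> (\<forall>i\<in>set I. 1 \<le> i \<and> i \<le> length S \<and> X \<in> S ! (i - 1))"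

text \<open>
  The relation defining the degree \<open>n\<close> component of \<open>Hom(X, Y)\<close> in \<open>C/(C1, ..., Cn)\<close>: the \<open>'k\<close>-linear
  graded category generated by the morphisms of \<open>C\<close> and the \<open>\<epsilon>\<close>'s, subject only to the
  relations that hold in \<open>C\<close>.
\<close>

inductive drinfeld_eq ::
  "('a, 'k::field) dg \<Rightarrow> ('a, 'k) univ set list \<Rightarrow> ('a, 'k) univ \<Rightarrow> ('a, 'k) univ \<Rightarrow> int
     \<Rightarrow> ('a, 'k) univ \<Rightarrow> ('a, 'k) univ \<Rightarrow> bool"
  for C S where
  incl: "\<lbrakk>X \<in> Ob C; Y \<in> Ob C; f \<in> hom_set C X Y n\<rbrakk>
     \<Longrightarrow> drinfeld_eq C S X Y n (Incl f) (Incl f)"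
| eps: "\<lbrakk>X \<in> Ob C; eps_index S X I\<rbrakk>
     \<Longrightarrow> drinfeld_eq C S X X (- int (length I)) (Eps X I) (Eps X I)"
| sym: "drinfeld_eq C S X Y n t u \<Longrightarrow> drinfeld_eq C S X Y n u t"
| trans: "\<lbrakk>drinfeld_eq C S X Y n t u; drinfeld_eq C S X Y n u v\<rbrakk> \<Longrightarrow> drinfeld_eq C S X Y n t v"
| sum_cong: "\<lbrakk>drinfeld_eq C S X Y n t t'; drinfeld_eq C S X Y n u u'\<rbrakk>
     \<Longrightarrow> drinfeld_eq C S X Y n (FSum t u) (FSum t' u')"
| scale_cong: "drinfeld_eq C S X Y n t t' \<Longrightarrow> drinfeld_eq C S X Y n (FScale c t) (FScale c t')"
| comp_cong: "\<lbrakk>drinfeld_eq C S Y Z m t t'; drinfeld_eq C S X Y n u u'\<rbrakk>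
     \<Longrightarrow> drinfeld_eq C S X Z (m + n) (Comp Y m n t u) (Comp Y m n t' u')"
| sum_assoc: "\<lbrakk>drinfeld_eq C S X Y n t t; drinfeld_eq C S X Y n u u; drinfeld_eq C S X Y n v v\<rbrakk>
     \<Longrightarrow> drinfeld_eq C S X Y n (FSum (FSum t u) v) (FSum t (FSum u v))"
| sum_comm: "\<lbrakk>drinfeld_eq C S X Y n t t; drinfeld_eq C S X Y n u u\<rbrakk>
     \<Longrightarrow> drinfeld_eq C S X Y n (FSum t u) (FSum u t)"
| sum_zero: "\<lbrakk>drinfeld_eq C S X Y n t t; drinfeld_eq C S X Y n u u\<rbrakk>
     \<Longrightarrow> drinfeld_eq C S X Y n (FSum t (FScale 0 u)) t"
| scale_sum: "\<lbrakk>drinfeld_eq C S X Y n t t; drinfeld_eq C S X Y n u u\<rbrakk>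
     \<Longrightarrow> drinfeld_eq C S X Y n (FScale c (FSum t u)) (FSum (FScale c t) (FScale c u))"
| scale_add: "drinfeld_eq C S X Y n t t
     \<Longrightarrow> drinfeld_eq C S X Y n (FScale (c + c') t) (FSum (FScale c t) (FScale c' t))"
| scale_mult: "drinfeld_eq C S X Y n t t
     \<Longrightarrow> drinfeld_eq C S X Y n (FScale (c * c') t) (FScale c (FScale c' t))"
| scale_one: "drinfeld_eq C S X Y n t t \<Longrightarrow> drinfeld_eq C S X Y n (FScale 1 t) t"
| comp_sum_left: "\<lbrakk>drinfeld_eq C S Y Z m t t; drinfeld_eq C S Y Z m t' t'; drinfeld_eq C S X Y n u u\<rbrakk>
     \<Longrightarrow> drinfeld_eq C S X Z (m + n) (Comp Y m n (FSum t t') u)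
           (FSum (Comp Y m n t u) (Comp Y m n t' u))"
| comp_sum_right: "\<lbrakk>drinfeld_eq C S Y Z m t t; drinfeld_eq C S X Y n u u; drinfeld_eq C S X Y n u' u'\<rbrakk>
     \<Longrightarrow> drinfeld_eq C S X Z (m + n) (Comp Y m n t (FSum u u'))
           (FSum (Comp Y m n t u) (Comp Y m n t u'))"
| comp_scale_left: "\<lbrakk>drinfeld_eq C S Y Z m t t; drinfeld_eq C S X Y n u u\<rbrakk>
     \<Longrightarrow> drinfeld_eq C S X Z (m + n) (Comp Y m n (FScale c t) u) (FScale c (Comp Y m n t u))"
| comp_scale_right: "\<lbrakk>drinfeld_eq C S Y Z m t t; drinfeld_eq C S X Y n u u\<rbrakk>
     \<Longrightarrow> drinfeld_eq C S X Z (m + n) (Comp Y m n t (FScale c u)) (FScale c (Comp Y m n t u))"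
| comp_assoc: "\<lbrakk>drinfeld_eq C S Y Z l t t; drinfeld_eq C S X Y m u u; drinfeld_eq C S W X n v v\<rbrakk>
     \<Longrightarrow> drinfeld_eq C S W Z (l + m + n) (Comp Y l (m + n) t (Comp X m n u v))
           (Comp X (l + m) n (Comp Y l m t u) v)"
| comp_id_left: "drinfeld_eq C S X Y n t t
     \<Longrightarrow> drinfeld_eq C S X Y n (Comp Y 0 n (Incl (Id C Y)) t) t"
| comp_id_right: "drinfeld_eq C S X Y n t t
     \<Longrightarrow> drinfeld_eq C S X Y n (Comp X n 0 t (Incl (Id C X))) t"
| incl_add: "\<lbrakk>X \<in> Ob C; Y \<in> Ob C; f \<in> hom_set C X Y n; g \<in> hom_set C X Y n\<rbrakk>
     \<Longrightarrow> drinfeld_eq C S X Y n (Incl (hadd C X Y n f g)) (FSum (Incl f) (Incl g))"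
| incl_scale: "\<lbrakk>X \<in> Ob C; Y \<in> Ob C; f \<in> hom_set C X Y n\<rbrakk>
     \<Longrightarrow> drinfeld_eq C S X Y n (Incl (hscale C X Y n c f)) (FScale c (Incl f))"
| incl_comp: "\<lbrakk>X \<in> Ob C; Y \<in> Ob C; Z \<in> Ob C; g \<in> hom_set C Y Z m; f \<in> hom_set C X Y n\<rbrakk>
     \<Longrightarrow> drinfeld_eq C S X Z (m + n) (Comp Y m n (Incl g) (Incl f)) (Incl (Cmp C X Y Z m n g f))"

text \<open>\<open>\<epsilon>\<^sub>X\<close> with no upper indices is the identity of \<open>X\<close>.\<close>

definition eps_expr :: "('a, 'k) dg \<Rightarrow> ('a, 'k) univ \<Rightarrow> nat list \<Rightarrow> ('a, 'k) univ" where
  "eps_expr C X I = (if I = [] then Incl (Id C X) else Eps X I)"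

text \<open>
  The differential of an expression of type \<open>X \<rightarrow> Z\<close> and degree \<open>k\<close>.  In the second clause \<open>t\<close> counts
  positions from \<open>0\<close>, so that the sign \<open>(-1)^(s-t)\<close> becomes \<open>(-1)^(s-(t+1))\<close>.
\<close>

fun drinfeld_dif ::
  "('a, 'k::field) dg \<Rightarrow> ('a, 'k) univ \<Rightarrow> ('a, 'k) univ \<Rightarrow> int \<Rightarrow> ('a, 'k) univ \<Rightarrow> ('a, 'k) univ" where
  "drinfeld_dif C X Z k (Incl f) = Incl (Dif C X Z k f)"
| "drinfeld_dif C X Z k (Eps A I) =
     foldr FSum
       (map (\<lambda>t. FScale (koszul (int (length I) - int (t + 1))) (eps_expr C A (take t I @ drop (t + 1) I)))
          [0..<length I])
       (Incl (hzero C X Z (k + 1)))"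
| "drinfeld_dif C X Z k (Comp Y m n t u) =
     FSum (Comp Y (m + 1) n (drinfeld_dif C Y Z m t) u)
       (FScale (koszul m) (Comp Y m (n + 1) t (drinfeld_dif C X Y n u)))"
| "drinfeld_dif C X Z k (FSum t u) = FSum (drinfeld_dif C X Z k t) (drinfeld_dif C X Z k u)"
| "drinfeld_dif C X Z k (FScale c t) = FScale c (drinfeld_dif C X Z k t)"
| "drinfeld_dif C X Z k _ = undefined"

definition drinfeld :: "('a, 'k::field) pdg \<Rightarrow> ('a, 'k) dg" where
  "drinfeld = (\<lambda>(C, S).
     \<lparr>Ob = Ob C,
      Hom = (\<lambda>X Y n. quot_module (drinfeld_eq C S X Y n) (Incl (hzero C X Y n))),
      Id = (\<lambda>X. rep (drinfeld_eq C S X X 0) (Incl (Id C X))),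
      Cmp = (\<lambda>X Y Z m n t u. rep (drinfeld_eq C S X Z (m + n)) (Comp Y m n t u)),
      Dif = (\<lambda>X Y n t. rep (drinfeld_eq C S X Y (n + 1)) (drinfeld_dif C X Y n t))\<rparr>)"

text \<open>The action of \<open>F\<close> on expressions of type \<open>X \<rightarrow> Z\<close> and degree \<open>k\<close>.\<close>

fun drinfeld_map ::
  "('a, 'k) dgf \<Rightarrow> ('a, 'k) univ \<Rightarrow> ('a, 'k) univ \<Rightarrow> int \<Rightarrow> ('a, 'k) univ \<Rightarrow> ('a, 'k) univ" where
  "drinfeld_map F X Z k (Incl f) = Incl (far F X Z k f)"
| "drinfeld_map F X Z k (Eps A I) = Eps (fob F A) I"
| "drinfeld_map F X Z k (Comp Y m n t u) =
     Comp (fob F Y) m n (drinfeld_map F Y Z m t) (drinfeld_map F X Y n u)"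
| "drinfeld_map F X Z k (FSum t u) = FSum (drinfeld_map F X Z k t) (drinfeld_map F X Z k u)"
| "drinfeld_map F X Z k (FScale c t) = FScale c (drinfeld_map F X Z k t)"
| "drinfeld_map F X Z k _ = undefined"

text \<open>The value of the functor \<open>Dr\<^sub>n\<close> on a morphism \<open>F : (C; C1, ..., Cn) \<rightarrow> (D; D1, ..., Dn)\<close>.\<close>

definition drinfeld_fun :: "('a, 'k::field) pdg \<Rightarrow> ('a, 'k) pdg \<Rightarrow> ('a, 'k) dgf \<Rightarrow> ('a, 'k) dgf" where
  "drinfeld_fun P Q F =
     mk_fun (drinfeld P) (fob F)
       (\<lambda>X Y n t. rep (drinfeld_eq (fst Q) (snd Q) (fob F X) (fob F Y) n) (drinfeld_map F X Y n t))"


subsection \<open>Drinfeld quotients need not have morphism complexes bounded above\<close>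

text \<open>
  For the dg category with one object, endomorphism algebra \<open>k[y]/y\<^sup>2\<close> with \<open>y\<close> of degree 2, and zero
  differential, the quotient by itself contains the morphisms \<open>(y \<epsilon>)\<^sup>n\<close> of degree \<open>n\<close>, which are
  nonzero as seen from \<open>y \<mapsto> E\<^sub>1\<^sub>2\<close> and \<open>\<epsilon> \<mapsto> E\<^sub>2\<^sub>1\<close>.  Hence \<^const>\<open>drinfeld\<close> maps
  \<^const>\<open>PDGCat_minus\<close> to \<^const>\<open>DGCat\<close> but not to \<^const>\<open>DGCat_minus\<close>.
\<close>

definition cx_dg :: "('a, 'k::field) dg" where
  "cx_dg =
     \<lparr>Ob = {Star},
      Hom = (\<lambda>X Y n. \<lparr>carrier = (if n = 0 \<or> n = 2 then range Scal else {Scal 0}),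
                      mult = undefined, one = undefined, zero = Scal 0,
                      add = (\<lambda>a b. Scal (scal a + scal b)), smult = (\<lambda>c a. Scal (c * scal a))\<rparr>),
      Id = (\<lambda>X. Scal 1),
      Cmp = (\<lambda>X Y Z m n g f. Scal (if m = 0 \<or> n = 0 then scal g * scal f else 0)),
      Dif = (\<lambda>X Y n f. Scal 0)\<rparr>"

lemma cring_scalars: "cring (scalars :: 'k::field ring)"
  unfolding scalars_def
  by (rule cringI) (auto intro!: abelian_groupI comm_monoidI simp: algebra_simps intro: exI[of _ "- _"] ,
     (metis add.right_inverse add.commute)?)

lemma module_cx: "Module.module scalars (\<lparr>carrier = (if b then range Scal else {Scal 0}),
                      mult = undefined, one = undefined, zero = Scal 0,
                      add = (\<lambda>a b. Scal (scal a + scal b)), smult = (\<lambda>c a. Scal (c * scal a))\<rparr>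
     :: ('k::field, ('a,'k) univ) module)"
  apply (rule moduleI[OF cring_scalars])
   apply (rule abelian_groupI)
        apply (auto simp: scalars_def algebra_simps split: if_splits)
  by (metis add.right_inverse add.commute)

lemma dg_category_cx: "dg_category (cx_dg :: ('a,'k::field) dg)"
  unfolding dg_category_def
  by (auto simp: cx_dg_def linear_map_def algebra_simps koszul_def split: if_splits
     intro: module_cx[where b=True, simplified] module_cx[where b=False, simplified])

fun mat_mul :: "'k::field \<times> 'k \<times> 'k \<times> 'k \<Rightarrow> 'k \<times> 'k \<times> 'k \<times> 'k \<Rightarrow> 'k \<times> 'k \<times> 'k \<times> 'k" where
  "mat_mul (a, b, c, d) (a', b', c', d') =
     (a * a' + b * c', a * b' + b * d', c * a' + d * c', c * b' + d * d')"
fun mat_add :: "'k::field \<times> 'k \<times> 'k \<times> 'k \<Rightarrow> 'k \<times> 'k \<times> 'k \<times> 'k \<Rightarrow> 'k \<times> 'k \<times> 'k \<times> 'k" where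
  "mat_add (a, b, c, d) (a', b', c', d') = (a + a', b + b', c + c', d + d')"
fun mat_scale :: "'k::field \<Rightarrow> 'k \<times> 'k \<times> 'k \<times> 'k \<Rightarrow> 'k \<times> 'k \<times> 'k \<times> 'k" where
  "mat_scale r (a, b, c, d) = (r * a, r * b, r * c, r * d)"

fun cx_eval :: "int \<Rightarrow> ('a, 'k::field) univ \<Rightarrow> 'k \<times> 'k \<times> 'k \<times> 'k" where
  "cx_eval n (Incl f) =
     (if n = 0 then (scal f, 0, 0, scal f) else if n = 2 then (0, scal f, 0, 0) else (0, 0, 0, 0))"
| "cx_eval n (Eps X I) = (0, 0, 1, 0)"
| "cx_eval n (Comp Y p q t u) = mat_mul (cx_eval p t) (cx_eval q u)"
| "cx_eval n (FSum t u) = mat_add (cx_eval n t) (cx_eval n u)"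
| "cx_eval n (FScale c t) = mat_scale c (cx_eval n t)"
| "cx_eval n _ = undefined"

lemma mat_mul_add_left: "mat_mul (mat_add a b) c = mat_add (mat_mul a c) (mat_mul b c)"
  by (cases a; cases b; cases c) (simp add: algebra_simps)
lemma mat_mul_add_right: "mat_mul c (mat_add a b) = mat_add (mat_mul c a) (mat_mul c b)"
  by (cases a; cases b; cases c) (simp add: algebra_simps)
lemma mat_mul_scale: "mat_mul (mat_scale r a) c = mat_scale r (mat_mul a c)"
  "mat_mul a (mat_scale r c) = mat_scale r (mat_mul a c)"
  by (cases a; cases c; simp add: algebra_simps)+
lemma mat_mul_assoc: "mat_mul a (mat_mul b c) = mat_mul (mat_mul a b) c"
  by (cases a; cases b; cases c) (simp add: algebra_simps)
lemma mat_lin: "mat_add (mat_add a b) c = mat_add a (mat_add b c)" "mat_add a b = mat_add b a"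
  "mat_add a (mat_scale 0 b) = a" "mat_scale r (mat_add a b) = mat_add (mat_scale r a) (mat_scale r b)"
  "mat_scale (r + s) a = mat_add (mat_scale r a) (mat_scale s a)"
  "mat_scale (r * s) a = mat_scale r (mat_scale s a)" "mat_scale 1 a = a"
  by (cases a; cases b; cases c; simp add: algebra_simps)+
lemma mat_one: "mat_mul (1,0,0,1) a = a" "mat_mul a (1,0,0,1) = a"
  by (cases a; simp)+

lemma cx_eval_sound:
  "drinfeld_eq cx_dg S X Y n t u \<Longrightarrow> cx_eval n t = cx_eval n u"
proof (induction rule: drinfeld_eq.induct)
  case (incl_comp X Y Z g m f n)
  then show ?case by (auto simp: cx_dg_def split: if_splits)
next
  case (sum_comm X Y n t u)
  then show ?case using mat_lin(2) by simp
qed (simp_all add: mat_mul_add_left mat_mul_add_right mat_mul_scale mat_mul_assoc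
   mat_lin(1,3-7) mat_one, simp_all add: cx_dg_def mat_one)

fun cx_word :: "nat \<Rightarrow> ('a, 'k::field) univ" where
  "cx_word 0 = Incl (Scal 1)"
| "cx_word (Suc k) = Comp Star 1 (int k) (Comp Star 2 (-1) (Incl (Scal 1)) (Eps Star [1])) (cx_word k)"

lemma cx_word_typed:
  fixes k :: nat shows "drinfeld_eq cx_dg [{Star}] Star Star (int k) (cx_word k) (cx_word k :: ('a,'k::field) univ)"
proof (induction k)
  case 0
  then show ?case by (auto intro!: drinfeld_eq.incl simp: cx_dg_def)
next
  case (Suc k)
  have "drinfeld_eq cx_dg [{Star}] Star Star (2 + (-1)) (Comp Star 2 (-1) (Incl (Scal 1)) (Eps Star [1]))
     (Comp Star 2 (-1) (Incl (Scal 1 :: ('a,'k) univ)) (Eps Star [1]))"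
    using drinfeld_eq.eps[of Star cx_dg "[{Star}]" "[1]"]
    by (intro drinfeld_eq.comp_cong drinfeld_eq.incl) (auto simp: cx_dg_def eps_index_def)
  then have "drinfeld_eq cx_dg [{Star}] Star Star (1 + int k) (cx_word (Suc k)) (cx_word (Suc k) :: ('a,'k) univ)"
    using Suc by (auto intro!: drinfeld_eq.comp_cong)
  then show ?case by (simp add: add.commute)
qed

lemma cx_word_eval: "\<exists>b d. cx_eval (int k) (cx_word k :: ('a,'k::field) univ) = (1, b, 0, d)"
proof (induction k)
  case (Suc k)
  then show ?case by auto
qed auto

lemma rep_eq:
  assumes "R t t" shows "R t (rep R t)" unfolding rep_def using someI[of "R t"] assms by blast

theorem drinfeld_not_bounded_above:
  "\<exists>P \<in> obj (PDGCat_minus :: (('a,'k::field) pdg, ('a,'k) pdgf) moncat). \<not> bounded_above (drinfeld P)"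
proof (intro bexI notI)
  let ?P = "(cx_dg, [{Star}]) :: ('a,'k) pdg"
  let ?E = "\<lambda>i. drinfeld_eq (cx_dg :: ('a,'k) dg) [{Star}] Star Star i"
  show "?P \<in> obj PDGCat_minus"
    by (auto simp: PDGCat_minus_def pdg_obj_def DGCat_minus_def DGCat_def dg_category_cx bounded_above_def,
       auto simp: cx_dg_def intro!: exI[of _ 2])
  assume "bounded_above (drinfeld ?P)"
  then obtain N where N: "\<And>i. i > N \<Longrightarrow> hom_set (drinfeld ?P) Star Star i = {hzero (drinfeld ?P) Star Star i}"
    by (auto simp: bounded_above_def drinfeld_def cx_dg_def)
  define k where "k = Suc (nat N)"
  have kN: "int k > N" unfolding k_def by linarith
  have "rep (?E (int k)) (cx_word k) \<in> hom_set (drinfeld ?P) Star Star (int k)"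
    using cx_word_typed by (auto simp: drinfeld_def quot_module_def)
  then have eq: "rep (?E (int k)) (cx_word k) = rep (?E (int k)) (Incl (Scal 0))"
    using N[OF kN] by (simp add: drinfeld_def quot_module_def) (simp add: cx_dg_def)
  have z: "?E (int k) (Incl (Scal 0)) (Incl (Scal 0))"
    by (auto intro!: drinfeld_eq.incl simp: cx_dg_def)
  have "?E (int k) (cx_word k) (Incl (Scal 0))"
    using rep_eq[of "?E (int k)", OF cx_word_typed] rep_eq[of "?E (int k)", OF z] eq
    by (metis drinfeld_eq.sym drinfeld_eq.trans)
  from cx_eval_sound[OF this] cx_word_eval[where ?'a='a and ?'k='k, of k] show False by (auto split: if_splits)
qed

end

theory Submission
 imports Defs "HOL-Library.Function_Algebras" "HOL.Vector_Spaces"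
begin

text \<open>
 A dg functor out of \<open>C/(C1, ..., Cn)\<close> is a dg functor on \<open>C\<close> together with images of the generators
 \<open>\<epsilon>\<^sub>X\<close> whose differentials obey the Cech rule (locale \<open>drilift\<close>), and it is determined by these data
 (\<open>dri.Q_functor_eqI\<close>). This gives all functors and reduces all coherence identities to generators.

 \<^item> For a morphism \<open>(\<sigma>, F)\<close>, the index \<open>i\<close> goes to the \<open>j\<close> with \<open>\<sigma> (j - 1) < i \<le> \<sigma> j\<close>, and \<open>\<epsilon>\<^sub>X\<close> goes to
 the generator at \<open>F X\<close> with the new indices, or to \<open>0\<close> when two indices become equal. The latter is
 compatible with differentials: equal indices are adjacent, the two terms omitting one of them cancel,
 and all other terms still contain a repetition.

 \<^item> The comparison \<open>\<beta>\<close> extends \<open>C \<otimes> D \<rightarrow> Dr(C) \<otimes> Dr(D)\<close>. An index list for the tensor product is a list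
 \<open>I\<close> for the first factor followed by a shifted list \<open>J\<close> for the second one, and the generator goes to
 \<open>(-1)^(|I||J|) \<epsilon>\<^sub>X \<otimes> \<epsilon>\<^sub>Y\<close> with indices \<open>I\<close> and \<open>J\<close>.

 To see that \<open>\<beta>\<close> is a quasi-equivalence, let \<open>Q = C/(C1, ..., Cn)\<close> and let \<open>R\<close> be a left dg \<open>C\<close>-module such
 that \<open>R(X)\<close> has a linear contraction \<open>\<kappa>\<close> for each object \<open>X\<close> of each \<open>Ci\<close>. The left \<open>C\<close>-module \<open>Q(Y, -)\<close> is
 generated by the identity under the operations \<open>q \<mapsto> \<epsilon> q\<close> and the action of \<open>C\<close>, subject to no relations
 but linearity. So for every \<open>C\<close>-linear \<open>g\<close> of degree \<open>n + 1\<close> and every \<open>r\<close> there is exactly one \<open>C\<close>-linear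
 \<open>h = G(g, r)\<close> of degree \<open>n\<close> with \<open>h(1) = r\<close> and \<open>h(\<epsilon> q) = \<kappa>(g(\<epsilon> q) + (-1)^n h(d\<epsilon> q))\<close>. By induction
 \<open>d G(g, r) = g - G(dg, g(1) - dr)\<close> (\<open>ctr.dH_G\<close>). Consequently a cocycle \<open>r\<close> extends to a closed map, and a
 closed map vanishing at the identity is nullhomotopic.

 The same holds for maps out of \<open>Q(x, -) \<otimes> Q'(y, -)\<close>, with \<open>Q'\<close> the quotient of \<open>D\<close>: they are maps from
 \<open>Q(x, -)\<close> to the \<open>C\<close>-module of \<open>D\<close>-linear maps from \<open>Q'(y, -)\<close>, which is itself contractible where it has to
 be, by \<open>F \<mapsto> G(F, \<kappa>(F(1)))\<close> (locale \<open>bictr\<close>). Now both \<open>Dr(C \<otimes> D)(V, -)\<close> and \<open>(Dr(C) \<otimes> Dr(D))(V, -)\<close>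
 are modules over \<open>C \<otimes> D\<close> with contractions, namely composition with some \<open>\<epsilon>\<close> with one index. Hence there
 is a closed map \<open>\<gamma>\<close> from the latter to the former preserving the identity, and \<open>\<beta>\<gamma> - 1\<close> and \<open>\<gamma>\<beta> - 1\<close>
 are nullhomotopic because they vanish at the identity. As \<open>\<beta>\<close> is the identity on objects, this
 is all that is needed (\<open>quasi_equivalenceI\<close>).

 Linear identities between morphisms are checked in double duals: these lie in a type of class
 \<open>ab_group_add\<close>, where rewriting deals with sums and signs.\<close>

abbreviation len :: "'b list => int" where
 "len xs == int (length xs)"

declare plus_fun_apply [simp del] zero_fun_apply [simp del] minus_apply [simp del] uminus_apply [simp del]

lemmas fun_app = plus_fun_apply zero_fun_apply minus_apply uminus_apply

section \<open>Vector spaces inside their double duals\<close>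

definition linfun :: "('k::field, 'u) module => ('u => 'k) => bool" where
 "linfun M \<phi> \<longleftrightarrow>
   (ALL a:carrier M. ALL b:carrier M. \<phi> (a \<oplus>\<^bsub>M\<^esub> b) = \<phi> a + \<phi> b) &
   (ALL c. ALL a:carrier M. \<phi> (c \<odot>\<^bsub>M\<^esub> a) = c * \<phi> a)"

text \<open>The double dual is embedded into all functions, with value \<open>0\<close> on nonlinear ones, in order to have one type
 for all spaces.\<close>

definition emb :: "('k::field, 'u) module => 'u => ('u => 'k) => 'k" where
 "emb M a = (%\<phi>. if linfun M \<phi> then \<phi> a else 0)"

definition fsc :: "'k::field => ('x => 'k) => 'x => 'k" where
 "fsc c f = (%x. c * f x)"

locale kmod =
 fixes M :: "('k::field, 'u) module" (structure)
 assumes kmod: "Module.module scalars M"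
begin

sublocale md: Module.module "scalars :: 'k ring" M by (rule kmod)

lemma add_closed [simp]: "[|a : carrier M; b : carrier M|] ==> a \<oplus> b : carrier M"
 by simp

lemma smult_closed [simp]: "a : carrier M ==> c \<odot> a : carrier M"
 by (rule md.smult_closed) (simp_all add: scalars_def)

lemma zero_closed [simp]: "\<zero> : carrier M"
 by simp

lemma smult_one: "a : carrier M ==> 1 \<odot> a = a"
 using md.smult_one[of a] by (simp add: scalars_def)

lemma smult_add: "a : carrier M ==> (c + d) \<odot> a = c \<odot> a \<oplus> d \<odot> a"
 using md.smult_l_distr[of c d a] by (simp add: scalars_def)

lemma smult_smult: "a : carrier M ==> (c * d) \<odot> a = c \<odot> (d \<odot> a)"
 using md.smult_assoc1[of c d a] by (simp add: scalars_def)

lemma smult_distr: "[|a : carrier M; b : carrier M|] ==>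
  c \<odot> (a \<oplus> b) = c \<odot> a \<oplus> c \<odot> b"
 using md.smult_r_distr[of c a b] by (simp add: scalars_def)

lemma smult_zero_left: "a : carrier M ==> 0 \<odot> a = \<zero>"
 using md.smult_l_null[of a] by (simp add: scalars_def)

lemma smult_zero_right: "c \<odot> \<zero> = \<zero>"
 using smult_smult[of "\<zero>" c 0] smult_zero_left[of "\<zero>"] by simp

lemma add_neg: "a : carrier M ==> a \<oplus> (- 1) \<odot> a = \<zero>"
 using smult_add[of a 1 "- 1"] smult_zero_left[of a] by (simp add: smult_one)

text \<open>A subspace that is maximal among those not containing \<open>a\<close> has codimension one, and the
 coefficient of \<open>a\<close> modulo it is the required functional.\<close>

lemma functional_nonzero:
 assumes a: "a : carrier M" "a ~= \<zero>"
 shows "EX \<phi>. linfun M \<phi> & \<phi> a ~= 0"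
proof -
 define sub where "sub H \<longleftrightarrow> H \<subseteq> carrier M & \<zero> : H & (ALL x:H. ALL y:H. x \<oplus> y : H) &
  (ALL c. ALL x:H. c \<odot> x : H) & a ~: H" for H
 have sub0: "sub {\<zero>}" using a by (auto simp: sub_def smult_zero_right)
 have "EX H:Collect sub. ALL K:Collect sub. H \<subseteq> K --> K = H"
 proof (rule subset_Zorn_nonempty)
  show "Collect sub ~= {}" using sub0 by auto
 next
  fix Ch assume Ch: "Ch ~= {}" "subset.chain (Collect sub) Ch"
  have s: "sub H" if "H : Ch" for H using Ch that by (auto simp: subset.chain_def)
  have tot: "H \<subseteq> K | K \<subseteq> H" if "H : Ch" "K : Ch" for H K
   using Ch that by (auto simp: subset.chain_def)
  have "x \<oplus> y : \<Union>Ch" if xy: "x : H" "H : Ch" "y : K" "K : Ch" for x y H K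
  proof (cases "H \<subseteq> K")
   case True then have "x \<oplus> y : K" using xy s[of K] by (auto simp: sub_def)
   then show ?thesis using xy by blast
  next
   case False then have "x \<oplus> y : H" using xy tot[of H K] s[of H] by (auto simp: sub_def)
   then show ?thesis using xy by blast
  qed
  then have add: "!!x y. x : \<Union>Ch ==> y : \<Union>Ch ==> x \<oplus> y : \<Union>Ch" by blast
  obtain H0 where H0: "H0 : Ch" using Ch(1) by auto
  have "H \<subseteq> carrier M" "a ~: H" if "H : Ch" for H using s[OF that] by (auto simp: sub_def)
  then have "\<Union>Ch \<subseteq> carrier M" "a ~: \<Union>Ch" by blast+
  moreover have "\<zero> : \<Union>Ch" using s[OF H0] H0 by (auto simp: sub_def)
  moreover have "c \<odot> x : \<Union>Ch" if "x : \<Union>Ch" for c x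
  proof -
   from that obtain H where "H : Ch" "x : H" by auto
   then have "c \<odot> x : H" using s[of H] by (simp add: sub_def)
   then show ?thesis using \<open>H : Ch\<close> by auto
  qed
  ultimately show "\<Union>Ch : Collect sub" unfolding mem_Collect_eq sub_def using add by simp
 qed
 then obtain H where H: "sub H" and mx: "!!K. sub K ==> H \<subseteq> K ==> K = H" by auto
 have HM: "H \<subseteq> carrier M" and H0: "\<zero> : H" and Hadd: "!!x y. x : H ==> y : H ==> x \<oplus> y : H"
  and Hsc: "!!c x. x : H ==> c \<odot> x : H" and aH: "a ~: H"
  using H by (auto simp: sub_def)
 have HMx [simp]: "x : H ==> x : carrier M" for x using HM by auto
 have decomp: "EX c. x \<oplus> (- c) \<odot> a : H" if x: "x : carrier M" for x
 proof (cases "x : H")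
  case True
  then show ?thesis using a by (intro exI[of _ 0]) (simp add: smult_zero_left)
 next
  case False
  let ?K = "{h \<oplus> t \<odot> x |h t. h : H}"
  have K0: "H \<subseteq> ?K"
  proof
   fix h assume "h : H"
   then show "h : ?K" using x by (auto intro!: exI[of _ h] exI[of _ 0] simp: smult_zero_left)
  qed
  have "x : ?K" using x H0 by (auto intro!: exI[of _ "\<zero>"] exI[of _ 1] simp: smult_one)
  with False K0 have "~ sub ?K" using mx[of ?K] by auto
  moreover have "?K \<subseteq> carrier M" using x by auto
  moreover have "\<zero> : ?K" using K0 H0 by auto
  moreover have "u \<oplus> v : ?K" if uv: "u : ?K" "v : ?K" for u v
  proof -
   from uv obtain h t h' t' where e: "h : H" "h' : H" "u = h \<oplus> t \<odot> x" "v = h' \<oplus> t' \<odot> x" by auto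
   then have "u \<oplus> v = (h \<oplus> h') \<oplus> (t + t') \<odot> x"
    using x by (simp add: smult_add md.M.a_ac)
   then show ?thesis using e Hadd by auto
  qed
  moreover have "c \<odot> u : ?K" if u: "u : ?K" for c u
  proof -
   from u obtain h t where e: "h : H" "u = h \<oplus> t \<odot> x" by auto
   then have "c \<odot> u = c \<odot> h \<oplus> (c * t) \<odot> x" using x by (simp add: smult_distr smult_smult)
   then show ?thesis using e Hsc by auto
  qed
  ultimately have "a : ?K" unfolding sub_def by blast
  then obtain h t where ht: "h : H" "a = h \<oplus> t \<odot> x" by auto
  have "t ~= 0" using ht aH x by (auto simp: smult_zero_left)
  have "x \<oplus> (- inverse t) \<odot> a = (- inverse t) \<odot> h \<oplus> (x \<oplus> (- inverse t * t) \<odot> x)"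
   using ht x by (simp add: smult_distr smult_smult[symmetric] md.M.a_ac)
  also have "... = (- inverse t) \<odot> h" using ht x \<open>t ~= 0\<close> by (simp add: add_neg)
  finally show ?thesis using Hsc[OF ht(1)] by metis
 qed
 have uniq: "c = c'" if cc: "x : carrier M" "x \<oplus> (- c) \<odot> a : H" "x \<oplus> (- c') \<odot> a : H" for x c c'
 proof (rule ccontr)
  assume ne: "c ~= c'"
  have "(x \<oplus> (- c) \<odot> a) \<oplus> (- 1) \<odot> (x \<oplus> (- c') \<odot> a)
    = (x \<oplus> (- 1) \<odot> x) \<oplus> (- c + c') \<odot> a"
   using cc(1) a unfolding smult_add[OF a(1)] by (simp add: smult_distr smult_smult[symmetric] md.M.a_ac)
  also have "... = (c' - c) \<odot> a" using cc(1) a by (simp add: add_neg)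
  finally have "(c' - c) \<odot> a : H" using Hadd[OF cc(2) Hsc[OF cc(3), of "-1"]] by simp
  then have "inverse (c' - c) \<odot> ((c' - c) \<odot> a) : H" by (rule Hsc)
  then have "a : H" using ne a by (simp add: smult_smult[symmetric] smult_one)
  then show False using aH by simp
 qed
 define \<phi> where "\<phi> x = (THE c. x \<oplus> (- c) \<odot> a : H)" for x
 have phiI: "\<phi> x = c" if "x : carrier M" "x \<oplus> (- c) \<odot> a : H" for x c
  unfolding \<phi>_def using that uniq by (intro the_equality) blast+
 have phi: "x \<oplus> (- \<phi> x) \<odot> a : H" if "x : carrier M" for x
  using decomp[OF that] phiI[OF that] by auto
 have "linfun M \<phi>"
  unfolding linfun_def
 proof (intro conjI ballI allI)
  fix x y assume xy: "x : carrier M" "y : carrier M"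
  have "(x \<oplus> y) \<oplus> (- (\<phi> x + \<phi> y)) \<odot> a = (x \<oplus> (- \<phi> x) \<odot> a) \<oplus> (y \<oplus> (- \<phi> y) \<odot> a)"
   using xy a smult_add[of a "- \<phi> x" "- \<phi> y"] by (simp add: md.M.a_ac)
  then show "\<phi> (x \<oplus> y) = \<phi> x + \<phi> y" using xy Hadd[OF phi phi] by (intro phiI) auto
 next
  fix c x assume x: "x : carrier M"
  have "c \<odot> x \<oplus> (- (c * \<phi> x)) \<odot> a = c \<odot> (x \<oplus> (- \<phi> x) \<odot> a)"
   using x a by (simp add: smult_distr smult_smult[symmetric])
  then show "\<phi> (c \<odot> x) = c * \<phi> x" using x Hsc[OF phi] by (intro phiI) auto
 qed
 moreover have "\<phi> a = 1" using a H0 by (intro phiI) (auto simp: add_neg)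
 ultimately show ?thesis by (intro exI[of _ \<phi>]) simp
qed

lemma emb_add [simp]: "[|a : carrier M; b : carrier M|] ==> emb M (a \<oplus> b) = emb M a + emb M b"
 by (auto simp: emb_def linfun_def fun_eq_iff fun_app)

lemma emb_smult [simp]: "a : carrier M ==> emb M (c \<odot> a) = fsc c (emb M a)"
 by (auto simp: emb_def linfun_def fsc_def fun_eq_iff fun_app)

lemma emb_zero [simp]: "emb M \<zero> = 0"
proof -
 have "emb M (0 \<odot> \<zero>) = 0" by (subst emb_smult) (auto simp: fsc_def fun_eq_iff fun_app)
 then show ?thesis by (simp add: smult_zero_left)
qed

text \<open>Functionals separate points, so no information is lost in the double dual.\<close>

lemma emb_inj: "[|a : carrier M; b : carrier M; emb M a = emb M b|] ==> a = b"
proof (rule ccontr)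
 assume ab: "a : carrier M" "b : carrier M" "emb M a = emb M b" "a ~= b"
 let ?d = "a \<oplus> (- 1) \<odot> b"
 have "?d ~= \<zero>"
 proof
  assume "?d = \<zero>"
  then have "?d \<oplus> b = b" using ab by simp
  moreover have "?d \<oplus> b = a \<oplus> (b \<oplus> (- 1) \<odot> b)" using ab by (simp add: md.M.a_ac)
  ultimately show False using ab by (simp add: add_neg)
 qed
 then obtain \<phi> where "linfun M \<phi>" "\<phi> ?d ~= 0" using functional_nonzero[of ?d] ab by auto
 then have "emb M ?d \<phi> ~= 0" by (simp add: emb_def)
 moreover have "emb M ?d = 0" using ab by (auto simp: fsc_def fun_eq_iff fun_app)
 ultimately show False by (simp add: fun_app)
qed

end

lemma fsc_simps [simp]:
 "fsc c (f + g) = fsc c f + fsc c g" "fsc c (f - g) = fsc c f - fsc c g" "fsc c (- f) = - fsc c f"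
 "fsc c 0 = 0" "fsc 1 f = f" "fsc 0 f = 0" "fsc c (fsc d f) = fsc (c * d) f"
 "fsc (- 1) f = - f" "fsc (c + d) f = fsc c f + fsc d f" "fsc (- c) f = - fsc c f"
 by (auto simp: fsc_def fun_eq_iff algebra_simps fun_app)

text \<open>The sign \<open>(-1)^m\<close> on a group, so that signs commute with everything additive.\<close>

definition sg :: "int => 'r::ab_group_add => 'r" where
 "sg m r = (if even m then r else - r)"

lemma fsc_koszul [simp]: "fsc (koszul m) f = sg m f"
 by (auto simp: sg_def koszul_def)

lemma kmodI:
 fixes M :: "('k::field, 'u) module" (structure)
 assumes "!!a b. [|a : carrier M; b : carrier M|] ==> a \<oplus> b : carrier M"
  and "!!a c. a : carrier M ==> c \<odot> a : carrier M"
  and "\<zero> : carrier M"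
  and "!!a b c. [|a : carrier M; b : carrier M; c : carrier M|] ==> (a \<oplus> b) \<oplus> c = a \<oplus> (b \<oplus> c)"
  and "!!a b. [|a : carrier M; b : carrier M|] ==> a \<oplus> b = b \<oplus> a"
  and "!!a. a : carrier M ==> a \<oplus> \<zero> = a"
  and "!!a. a : carrier M ==> 0 \<odot> a = \<zero>"
  and "!!a. a : carrier M ==> 1 \<odot> a = a"
  and "!!a c d. a : carrier M ==> (c + d) \<odot> a = c \<odot> a \<oplus> d \<odot> a"
  and "!!a c d. a : carrier M ==> (c * d) \<odot> a = c \<odot> (d \<odot> a)"
  and "!!a b c. [|a : carrier M; b : carrier M|] ==> c \<odot> (a \<oplus> b) = c \<odot> a \<oplus> c \<odot> b"
 shows "Module.module scalars M"
proof (rule moduleI[OF cring_scalars])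
 show "abelian_group M"
 proof (rule abelian_groupI)
  fix x assume x: "x : carrier M"
  have "(- 1) \<odot> x \<oplus> x = \<zero>"
   using assms(9)[OF x, of "- 1" 1] assms(7)[OF x] assms(8)[OF x] by simp
  then show "EX y:carrier M. y \<oplus> x = \<zero>" using assms(2)[OF x] by blast
 next
  fix x assume x: "x : carrier M"
  show "\<zero> \<oplus> x = x" using assms(5)[OF assms(3) x] assms(6)[OF x] by simp
 qed (use assms(1,3,4,5) in "simp_all")
qed (use assms(2,8,9,10,11) in "simp_all add: scalars_def")

section \<open>Graded linear categories and dg categories\<close>

definition hv :: "('k::field, 'u) dgcat => 'u => 'u => int => 'u => ('u => 'k) => 'k" where
 "hv C X Y n f = emb (Hom C X Y n) f"

locale gcat =
 fixes C :: "('k::field, 'u) dgcat"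
 assumes hom_module: "!!X Y n. [|X : Ob C; Y : Ob C|] ==> Module.module scalars (Hom C X Y n)"
  and id_closed [simp]: "!!X. X : Ob C ==> Id C X : hom_set C X X 0"
  and cmp_lin_left: "!!X Y Z m n f. [|X : Ob C; Y : Ob C; Z : Ob C; f : hom_set C X Y n|] ==>
      linear_map (Hom C Y Z m) (Hom C X Z (m + n)) (%g. Cmp C X Y Z m n g f)"
  and cmp_lin_right: "!!X Y Z m n g. [|X : Ob C; Y : Ob C; Z : Ob C; g : hom_set C Y Z m|] ==>
      linear_map (Hom C X Y n) (Hom C X Z (m + n)) (%f. Cmp C X Y Z m n g f)"
  and cmp_assoc: "!!W X Y Z l m n h g f. [|W : Ob C; X : Ob C; Y : Ob C; Z : Ob C;
      h : hom_set C Y Z l; g : hom_set C X Y m; f : hom_set C W X n|] ==>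
     Cmp C W Y Z l (m + n) h (Cmp C W X Y m n g f)
      = Cmp C W X Z (l + m) n (Cmp C X Y Z l m h g) f"
  and cmp_id_left [simp]: "!!X Y n f. [|X : Ob C; Y : Ob C; f : hom_set C X Y n|] ==> Cmp C X Y Y 0 n (Id C Y) f = f"
  and cmp_id_right [simp]: "!!X Y n f. [|X : Ob C; Y : Ob C; f : hom_set C X Y n|] ==> Cmp C X X Y n 0 f (Id C X) = f"
begin

lemma kmod_hom: "[|X : Ob C; Y : Ob C|] ==> kmod (Hom C X Y n)"
 by (rule kmod.intro) (rule hom_module)

lemma hadd_closed [simp]: "[|X : Ob C; Y : Ob C; f : hom_set C X Y n; g : hom_set C X Y n|] ==>
  hadd C X Y n f g : hom_set C X Y n"
 by (rule kmod.add_closed[OF kmod_hom])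
lemma hscale_closed [simp]: "[|X : Ob C; Y : Ob C; f : hom_set C X Y n|] ==> hscale C X Y n c f : hom_set C X Y n"
 by (rule kmod.smult_closed[OF kmod_hom])
lemma hzero_closed [simp]: "[|X : Ob C; Y : Ob C|] ==> hzero C X Y n : hom_set C X Y n"
 by (rule kmod.zero_closed[OF kmod_hom])

lemma cmp_closed [simp]:
 "[|X : Ob C; Y : Ob C; Z : Ob C; g : hom_set C Y Z m; f : hom_set C X Y n; k = m + n|] ==>
  Cmp C X Y Z m n g f : hom_set C X Z k"
 using cmp_lin_right[of X Y Z g m n] by (auto simp: linear_map_def)

lemma hv_add [simp]: "[|X : Ob C; Y : Ob C; f : hom_set C X Y n; g : hom_set C X Y n|] ==>
  hv C X Y n (hadd C X Y n f g) = hv C X Y n f + hv C X Y n g"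
 unfolding hv_def by (rule kmod.emb_add[OF kmod_hom])
lemma hv_scale [simp]: "[|X : Ob C; Y : Ob C; f : hom_set C X Y n|] ==>
  hv C X Y n (hscale C X Y n c f) = fsc c (hv C X Y n f)"
 unfolding hv_def by (rule kmod.emb_smult[OF kmod_hom])
lemma hv_zero [simp]: "[|X : Ob C; Y : Ob C|] ==> hv C X Y n (hzero C X Y n) = 0"
 unfolding hv_def by (rule kmod.emb_zero[OF kmod_hom])
lemma hv_inj: "[|hv C X Y n f = hv C X Y n g; X : Ob C; Y : Ob C; f : hom_set C X Y n; g : hom_set C X Y n|] ==> f = g"
 unfolding hv_def using kmod.emb_inj[OF kmod_hom] by blast

lemma cmp_add_left [simp]:
 "[|X : Ob C; Y : Ob C; Z : Ob C; g : hom_set C Y Z m; g' : hom_set C Y Z m; f : hom_set C X Y n|] ==>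
  Cmp C X Y Z m n (hadd C Y Z m g g') f = hadd C X Z (m + n) (Cmp C X Y Z m n g f) (Cmp C X Y Z m n g' f)"
 using cmp_lin_left[of X Y Z f n m] by (auto simp: linear_map_def)
lemma cmp_add_right [simp]:
 "[|X : Ob C; Y : Ob C; Z : Ob C; g : hom_set C Y Z m; f : hom_set C X Y n; f' : hom_set C X Y n|] ==>
  Cmp C X Y Z m n g (hadd C X Y n f f') = hadd C X Z (m + n) (Cmp C X Y Z m n g f) (Cmp C X Y Z m n g f')"
 using cmp_lin_right[of X Y Z g m n] by (auto simp: linear_map_def)
lemma cmp_scale_left [simp]:
 "[|X : Ob C; Y : Ob C; Z : Ob C; g : hom_set C Y Z m; f : hom_set C X Y n|] ==>
  Cmp C X Y Z m n (hscale C Y Z m c g) f = hscale C X Z (m + n) c (Cmp C X Y Z m n g f)"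
 using cmp_lin_left[of X Y Z f n m] by (auto simp: linear_map_def)
lemma cmp_scale_right [simp]:
 "[|X : Ob C; Y : Ob C; Z : Ob C; g : hom_set C Y Z m; f : hom_set C X Y n|] ==>
  Cmp C X Y Z m n g (hscale C X Y n c f) = hscale C X Z (m + n) c (Cmp C X Y Z m n g f)"
 using cmp_lin_right[of X Y Z g m n] by (auto simp: linear_map_def)

lemma hscale_zero: "[|X : Ob C; Y : Ob C; f : hom_set C X Y n|] ==> hscale C X Y n 0 f = hzero C X Y n"
 by (rule kmod.smult_zero_left[OF kmod_hom])
lemma cmp_zero_left [simp]:
 "[|X : Ob C; Y : Ob C; Z : Ob C; f : hom_set C X Y n|] ==>
  Cmp C X Y Z m n (hzero C Y Z m) f = hzero C X Z (m + n)"
 using cmp_scale_left[of X Y Z "hzero C Y Z m" m f n 0] by (simp add: hscale_zero)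
lemma cmp_zero_right [simp]:
 "[|X : Ob C; Y : Ob C; Z : Ob C; g : hom_set C Y Z m|] ==>
  Cmp C X Y Z m n g (hzero C X Y n) = hzero C X Z (m + n)"
 using cmp_scale_right[of X Y Z g m "hzero C X Y n" n 0] by (simp add: hscale_zero)

end

locale dgc = gcat C for C :: "('k::field, 'u) dgcat" +
 assumes dif_lin: "!!X Y n. [|X : Ob C; Y : Ob C|] ==> linear_map (Hom C X Y n) (Hom C X Y (n + 1)) (Dif C X Y n)"
  and dif_dif [simp]: "!!X Y n f. [|X : Ob C; Y : Ob C; f : hom_set C X Y n|] ==>
    Dif C X Y (n + 1) (Dif C X Y n f) = hzero C X Y (n + 1 + 1)"
  and dif_cmp: "!!X Y Z m n g f. [|X : Ob C; Y : Ob C; Z : Ob C; g : hom_set C Y Z m; f : hom_set C X Y n|] ==>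
    Dif C X Z (m + n) (Cmp C X Y Z m n g f)
     = hadd C X Z (m + n + 1)
       (Cmp C X Y Z (m + 1) n (Dif C Y Z m g) f)
       (hscale C X Z (m + n + 1) (koszul m) (Cmp C X Y Z m (n + 1) g (Dif C X Y n f)))"
begin

lemma dif_closed [simp]: "[|X : Ob C; Y : Ob C; f : hom_set C X Y n; k = n + 1|] ==> Dif C X Y n f : hom_set C X Y k"
 using dif_lin[of X Y n] by (auto simp: linear_map_def)
lemma dif_add [simp]: "[|X : Ob C; Y : Ob C; f : hom_set C X Y n; g : hom_set C X Y n|] ==>
  Dif C X Y n (hadd C X Y n f g) = hadd C X Y (n + 1) (Dif C X Y n f) (Dif C X Y n g)"
 using dif_lin[of X Y n] by (auto simp: linear_map_def)
lemma dif_scale [simp]: "[|X : Ob C; Y : Ob C; f : hom_set C X Y n|] ==>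
  Dif C X Y n (hscale C X Y n c f) = hscale C X Y (n + 1) c (Dif C X Y n f)"
 using dif_lin[of X Y n] by (auto simp: linear_map_def)
lemma dif_zero [simp]: "[|X : Ob C; Y : Ob C|] ==> Dif C X Y n (hzero C X Y n) = hzero C X Y (n + 1)"
 using dif_scale[of X Y "hzero C X Y n" n 0] by (simp add: hscale_zero)

lemma dif_id [simp]: "X : Ob C ==> Dif C X X 0 (Id C X) = hzero C X X 1"
proof -
 assume X: "X : Ob C"
 have "Dif C X X (0 + 0) (Cmp C X X X 0 0 (Id C X) (Id C X)) =
  hadd C X X 1 (Dif C X X 0 (Id C X)) (Dif C X X 0 (Id C X))"
  using X by (subst dif_cmp) (auto simp: koszul_def kmod.smult_one[OF kmod_hom])
 then have "Dif C X X 0 (Id C X) = hadd C X X 1 (Dif C X X 0 (Id C X)) (Dif C X X 0 (Id C X))"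
  using X by simp
 then have "hv C X X 1 (Dif C X X 0 (Id C X)) = hv C X X 1 (Dif C X X 0 (Id C X)) + hv C X X 1 (Dif C X X 0 (Id C X))"
  using hv_add[OF X X, of "Dif C X X 0 (Id C X)" 1] X by (metis dif_closed add_0 id_closed)
 then have "hv C X X 1 (Dif C X X 0 (Id C X)) = hv C X X 1 (hzero C X X 1)" using X by simp
 then show ?thesis using X by (intro hv_inj[of X X 1]) auto
qed

end

lemma dgc_iff: "dgc C \<longleftrightarrow> dg_category C"
 unfolding dgc_def dgc_axioms_def gcat_def dg_category_def by meson

section \<open>Quotients of expressions by linear relations\<close>

text \<open>The relations defining tensor products and Drinfeld quotients are partial equivalence relations, whose domain
 consists of the well-formed expressions; their linear rules make the quotient a vector space.\<close>

locale linper =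
 fixes R :: "('a, 'k::field) univ => ('a, 'k) univ => bool" and z
 assumes sym: "R t u ==> R u t"
  and trans: "[|R t u; R u v|] ==> R t v"
  and sum_cong: "[|R t t'; R u u'|] ==> R (FSum t u) (FSum t' u')"
  and scale_cong: "R t t' ==> R (FScale c t) (FScale c t')"
  and sum_assoc: "[|R t t; R u u; R v v|] ==> R (FSum (FSum t u) v) (FSum t (FSum u v))"
  and sum_comm: "[|R t t; R u u|] ==> R (FSum t u) (FSum u t)"
  and sum_zero: "[|R t t; R u u|] ==> R (FSum t (FScale 0 u)) t"
  and scale_sum: "[|R t t; R u u|] ==> R (FScale c (FSum t u)) (FSum (FScale c t) (FScale c u))"
  and scale_add: "R t t ==> R (FScale (c + c') t) (FSum (FScale c t) (FScale c' t))"
  and scale_mult: "R t t ==> R (FScale (c * c') t) (FScale c (FScale c' t))"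
  and scale_one: "R t t ==> R (FScale 1 t) t"
  and zero: "R z (FScale 0 z)"
begin

lemma refl1: "R t u ==> R t t"
 by (rule trans[OF _ sym])

lemma refl2: "R t u ==> R u u"
 by (rule trans[OF sym])

lemma rep_cong: "R t u ==> rep R t = rep R u"
proof -
 assume tu: "R t u"
 have "R t v \<longleftrightarrow> R u v" for v using trans[OF tu, of v] trans[OF sym[OF tu], of v] by blast
 then have "R t = R u" by (simp add: fun_eq_iff fun_app)
 then show "rep R t = rep R u" by (simp add: rep_def)
qed

lemma rep_rel: assumes "R t t" shows "R t (rep R t)" "R (rep R t) t" "R (rep R t) (rep R t)"
proof -
 show 1: "R t (rep R t)" by (rule rep_eq[of R t, OF assms])
 show "R (rep R t) t" by (rule sym[OF 1])
 show "R (rep R t) (rep R t)" by (rule refl2[OF 1])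
qed

lemma rep_eq_iff: assumes t: "R t t" and u: "R u u" shows "rep R t = rep R u \<longleftrightarrow> R t u"
proof
 assume "rep R t = rep R u"
 then have "R (rep R t) u" using rep_rel(2)[OF u] by simp
 then show "R t u" by (rule trans[OF rep_rel(1)[OF t]])
qed (rule rep_cong)

abbreviation "M == quot_module R z"

lemma rep_closed [simp]: "R t t ==> rep R t : carrier M"
 by (auto simp: quot_module_def)

lemma add_rep: "[|R t t; R u u|] ==> rep R t \<oplus>\<^bsub>M\<^esub> rep R u = rep R (FSum t u)"
 unfolding quot_module_def using rep_cong[OF sum_cong[OF rep_rel(1) rep_rel(1)]] by simp

lemma smult_rep: "R t t ==> c \<odot>\<^bsub>M\<^esub> rep R t = rep R (FScale c t)"
 unfolding quot_module_def using rep_cong[OF scale_cong[OF rep_rel(1)]] by simp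

lemma zero_rep: "\<zero>\<^bsub>M\<^esub> = rep R z"
 by (simp add: quot_module_def)

lemma z: "R z z" by (rule refl1[OF zero])

lemma scale_zero: "R t t ==> R (FScale 0 t) z"
proof -
 assume t: "R t t"
 have 1: "R (FScale 0 t) (FSum (FScale 0 t) (FScale 0 z))" by (rule sym[OF sum_zero[OF scale_cong[OF t] z]])
 have 2: "R (FSum (FScale 0 t) (FScale 0 z)) (FSum (FScale 0 z) (FScale 0 t))" by (rule sum_comm[OF scale_cong[OF t] scale_cong[OF z]])
 have 3: "R (FSum (FScale 0 z) (FScale 0 t)) (FScale 0 z)" by (rule sum_zero[OF scale_cong[OF z] t])
 show ?thesis by (rule trans[OF 1 trans[OF 2 trans[OF 3 sym[OF zero]]]])
qed

lemma carrierE: assumes "a : carrier M" obtains t where "R t t" "a = rep R t"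
 using assms by (auto simp: quot_module_def)

lemma quot_module: "Module.module scalars M"
proof (rule kmodI)
 note c = sum_cong scale_cong
 note r = add_rep smult_rep zero_rep c z
 show "\<zero>\<^bsub>M\<^esub> : carrier M" using z by (simp add: zero_rep)
 fix a assume "a : carrier M" then obtain t where t: "R t t" "a = rep R t" by (rule carrierE)
 show "0 \<odot>\<^bsub>M\<^esub> a = \<zero>\<^bsub>M\<^esub>" using t by (simp add: r rep_cong[OF scale_zero])
 show "1 \<odot>\<^bsub>M\<^esub> a = a" using t by (simp add: r rep_cong[OF scale_one])
 show "a \<oplus>\<^bsub>M\<^esub> \<zero>\<^bsub>M\<^esub> = a"
  using t rep_cong[OF trans[OF sum_cong[OF t(1) zero] sum_zero[OF t(1) z]]] by (simp add: r)
 show "c \<odot>\<^bsub>M\<^esub> a : carrier M" for c using t by (simp add: r)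
 show "(c + d) \<odot>\<^bsub>M\<^esub> a = c \<odot>\<^bsub>M\<^esub> a \<oplus>\<^bsub>M\<^esub> d \<odot>\<^bsub>M\<^esub> a" for c d using t by (simp add: r rep_cong[OF scale_add])
 show "(c * d) \<odot>\<^bsub>M\<^esub> a = c \<odot>\<^bsub>M\<^esub> (d \<odot>\<^bsub>M\<^esub> a)" for c d using t by (simp add: r rep_cong[OF scale_mult])
 fix b assume "b : carrier M" then obtain u where u: "R u u" "b = rep R u" by (rule carrierE)
 show "a \<oplus>\<^bsub>M\<^esub> b : carrier M" using t u by (simp add: r)
 show "a \<oplus>\<^bsub>M\<^esub> b = b \<oplus>\<^bsub>M\<^esub> a" using t u by (simp add: r rep_cong[OF sum_comm[OF t(1) u(1)]])
 show "c \<odot>\<^bsub>M\<^esub> (a \<oplus>\<^bsub>M\<^esub> b) = c \<odot>\<^bsub>M\<^esub> a \<oplus>\<^bsub>M\<^esub> c \<odot>\<^bsub>M\<^esub> b" for c using t u by (simp add: r rep_cong[OF scale_sum])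
 fix c assume "c : carrier M" then obtain v where v: "R v v" "c = rep R v" by (rule carrierE)
 show "(a \<oplus>\<^bsub>M\<^esub> b) \<oplus>\<^bsub>M\<^esub> c = a \<oplus>\<^bsub>M\<^esub> (b \<oplus>\<^bsub>M\<^esub> c)" using t u v by (simp add: r rep_cong[OF sum_assoc])
qed

end

section \<open>Dg functors\<close>

locale dgfunctor = S: dgc C + T: dgc D for C D :: "('k::field, 'u) dgcat" +
 fixes F :: "'u dgfun"
 assumes dg_functor: "dg_functor C D F"
begin

lemma fob_closed [simp]: "X : Ob C ==> fob F X : Ob D"
 using dg_functor by (simp add: dg_functor_def)
lemma far_lin: "[|X : Ob C; Y : Ob C|] ==> linear_map (Hom C X Y n) (Hom D (fob F X) (fob F Y) n) (far F X Y n)"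
 using dg_functor by (simp add: dg_functor_def)
lemma far_closed [simp]: "[|X : Ob C; Y : Ob C; f : hom_set C X Y n|] ==> far F X Y n f : hom_set D (fob F X) (fob F Y) n"
 using far_lin by (simp add: linear_map_def)
lemma far_add [simp]: "[|X : Ob C; Y : Ob C; f : hom_set C X Y n; g : hom_set C X Y n|] ==>
  far F X Y n (hadd C X Y n f g) = hadd D (fob F X) (fob F Y) n (far F X Y n f) (far F X Y n g)"
 using far_lin by (simp add: linear_map_def)
lemma far_scale [simp]: "[|X : Ob C; Y : Ob C; f : hom_set C X Y n|] ==>
  far F X Y n (hscale C X Y n c f) = hscale D (fob F X) (fob F Y) n c (far F X Y n f)"
 using far_lin by (simp add: linear_map_def)
lemma far_zero [simp]: "[|X : Ob C; Y : Ob C|] ==>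
  far F X Y n (hzero C X Y n) = hzero D (fob F X) (fob F Y) n"
 using far_scale[of X Y "hzero C X Y n" n 0] by (simp add: S.hscale_zero T.hscale_zero)
lemma far_id [simp]: "X : Ob C ==> far F X X 0 (Id C X) = Id D (fob F X)"
 using dg_functor by (simp add: dg_functor_def)
lemma far_cmp: "[|X : Ob C; Y : Ob C; Z : Ob C; g : hom_set C Y Z m; f : hom_set C X Y n|] ==>
  far F X Z (m + n) (Cmp C X Y Z m n g f)
   = Cmp D (fob F X) (fob F Y) (fob F Z) m n (far F Y Z m g) (far F X Y n f)"
 using dg_functor by (simp add: dg_functor_def)
lemma far_dif: "[|X : Ob C; Y : Ob C; f : hom_set C X Y n|] ==>
  far F X Y (n + 1) (Dif C X Y n f) = Dif D (fob F X) (fob F Y) n (far F X Y n f)"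
 using dg_functor by (simp add: dg_functor_def)

end

lemma mk_fun_simps [simp]:
 "X : Ob C ==> fob (mk_fun C fo fa) X = fo X"
 "[|X : Ob C; Y : Ob C; f : hom_set C X Y n|] ==> far (mk_fun C fo fa) X Y n f = fa X Y n f"
 by (simp_all add: mk_fun_def)

lemma mk_fun_cong:
 assumes "!!X. X : Ob C ==> fo X = fo' X"
  and "!!X Y n f. [|X : Ob C; Y : Ob C; f : hom_set C X Y n|] ==> fa X Y n f = fa' X Y n f"
 shows "mk_fun C fo fa = mk_fun C fo' fa'"
 using assms by (auto simp: mk_fun_def restrict_def fun_eq_iff)

lemma dg_functor_mk_fun:
 assumes C: "dgc C"
  and fo: "!!X. X : Ob C ==> fo X : Ob D"
  and lin: "!!X Y n. [|X : Ob C; Y : Ob C|] ==> linear_map (Hom C X Y n) (Hom D (fo X) (fo Y) n) (fa X Y n)"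
  and ident: "!!X. X : Ob C ==> fa X X 0 (Id C X) = Id D (fo X)"
  and cmp: "!!X Y Z m n g f. [|X : Ob C; Y : Ob C; Z : Ob C; g : hom_set C Y Z m; f : hom_set C X Y n|] ==>
   fa X Z (m + n) (Cmp C X Y Z m n g f) = Cmp D (fo X) (fo Y) (fo Z) m n (fa Y Z m g) (fa X Y n f)"
  and dif: "!!X Y n f. [|X : Ob C; Y : Ob C; f : hom_set C X Y n|] ==>
   fa X Y (n + 1) (Dif C X Y n f) = Dif D (fo X) (fo Y) n (fa X Y n f)"
 shows "dg_functor C D (mk_fun C fo fa)"
proof -
 interpret dgc C by fact
 show ?thesis
  unfolding dg_functor_def
 proof (intro conjI ballI allI)
  show "mk_fun C (fob (mk_fun C fo fa)) (far (mk_fun C fo fa)) = mk_fun C fo fa"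
   by (rule mk_fun_cong) simp_all
 next
  fix X Y n assume XY: "X : Ob C" "Y : Ob C"
  show "linear_map (Hom C X Y n) (Hom D (fob (mk_fun C fo fa) X) (fob (mk_fun C fo fa) Y) n) (far (mk_fun C fo fa) X Y n)"
   using lin[OF XY, of n] XY by (simp add: linear_map_def)
 qed (simp_all add: fo ident cmp dif)
qed

lemma dg_functor_eqI:
 assumes "dg_functor C D F" "dg_functor C D' G"
  and "!!X. X : Ob C ==> fob F X = fob G X"
  and "!!X Y n f. [|X : Ob C; Y : Ob C; f : hom_set C X Y n|] ==> far F X Y n f = far G X Y n f"
 shows "F = G"
proof -
 have "F = mk_fun C (fob F) (far F)" "G = mk_fun C (fob G) (far G)"
  using assms(1,2) by (simp_all add: dg_functor_def)
 moreover have "mk_fun C (fob F) (far F) = mk_fun C (fob G) (far G)"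
  by (rule mk_fun_cong) (use assms(3,4) in auto)
 ultimately show ?thesis by simp
qed

lemma dg_functor_id: assumes "dgc C" shows "dg_functor C C (id_fun C)"
 unfolding id_fun_def by (rule dg_functor_mk_fun) (use assms in "auto simp: linear_map_def")

lemma dg_functor_comp:
 assumes C: "dgc C" and D: "dgc D" and E: "dgc E" and F: "dg_functor C D F" and G: "dg_functor D E G"
 shows "dg_functor C E (comp_fun C G F)"
proof -
 interpret F: dgfunctor C D F by (intro dgfunctor.intro dgfunctor_axioms.intro assms)
 interpret G: dgfunctor D E G by (intro dgfunctor.intro dgfunctor_axioms.intro assms)
 show ?thesis
  unfolding comp_fun_def
  by (rule dg_functor_mk_fun) (simp_all add: C linear_map_def F.far_cmp G.far_cmp F.far_dif G.far_dif)
qed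

section \<open>Linear maps\<close>

lemma linear_map_comp: "[|linear_map M N g; linear_map N P h|] ==> linear_map M P (%x. h (g x))"
 by (simp add: linear_map_def)

lemma linear_map_cong: "[|linear_map M N g; kmod M; !!x. x : carrier M ==> h x = g x|] ==> linear_map M N h"
 by (simp add: linear_map_def kmod.add_closed kmod.smult_closed)

lemma linear_mapI:
 assumes N: "kmod N" and M: "kmod M" and c: "!!a. a : carrier M ==> h a : carrier N"
  and "!!a b. [|a : carrier M; b : carrier M|] ==> emb N (h (a \<oplus>\<^bsub>M\<^esub> b)) = emb N (h a) + emb N (h b)"
  and "!!c a. a : carrier M ==> emb N (h (c \<odot>\<^bsub>M\<^esub> a)) = fsc c (emb N (h a))"
 shows "linear_map M N h"
 unfolding linear_map_def
proof (intro conjI ballI allI)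
 note M = kmod.add_closed[OF M] kmod.smult_closed[OF M]
 fix a assume a: "a : carrier M"
 show "h a : carrier N" using c a .
 show "h (x \<odot>\<^bsub>M\<^esub> a) = x \<odot>\<^bsub>N\<^esub> h a" for x
  using a assms by (intro kmod.emb_inj[OF N]) (simp_all add: kmod.emb_smult kmod.smult_closed)
 fix b assume b: "b : carrier M"
 show "h (a \<oplus>\<^bsub>M\<^esub> b) = h a \<oplus>\<^bsub>N\<^esub> h b"
  using a b assms by (intro kmod.emb_inj[OF N]) (simp_all add: kmod.emb_add kmod.add_closed)
qed

lemma linear_map_add:
 assumes "kmod M" "kmod N" "linear_map M N g" "linear_map M N h"
 shows "linear_map M N (%x. g x \<oplus>\<^bsub>N\<^esub> h x)"
 by (rule linear_mapI) (use assms in "simp_all add: linear_map_def kmod.emb_add kmod.emb_smult kmod.add_closed kmod.smult_closed")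

lemma linear_map_scale:
 assumes "kmod M" "kmod N" "linear_map M N g"
 shows "linear_map M N (%x. c \<odot>\<^bsub>N\<^esub> g x)"
 by (rule linear_mapI) (use assms in "simp_all add: linear_map_def kmod.emb_add kmod.emb_smult kmod.add_closed kmod.smult_closed mult.commute")

lemma linear_map_zero: assumes "kmod N" shows "linear_map M N (%x. \<zero>\<^bsub>N\<^esub>)"
 using assms kmod.emb_inj[OF assms] unfolding linear_map_def
 by (auto simp: kmod.smult_zero_right intro!: kmod.emb_inj[OF assms] simp: kmod.emb_add kmod.zero_closed kmod.emb_zero kmod.add_closed)

lemma sg_simps [simp]:
 "sg m (sg n r) = sg (m + n) r" "sg m (r + s) = sg m r + sg m s" "sg m (r - s) = sg m r - sg m s"
 "sg m (- r) = - sg m r" "sg m 0 = 0" "sg 0 r = r" "sg 1 r = - r"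
 by (auto simp: sg_def)

lemma fsc_sg [simp]: "fsc c (sg m r) = sg m (fsc c r)"
 "fsc (koszul m * c) r = sg m (fsc c r)" "fsc (c * koszul m) r = sg m (fsc c r)"
 by (simp_all add: sg_def koszul_def)

section \<open>Tensor products\<close>

definition bilin_into ::
 "('a, 'k::field) dg => ('a, 'k) dg => ('a, 'k) univ => ('a, 'k) univ => int
   => ('k, ('a, 'k) univ) module => (int => ('a, 'k) univ => int => ('a, 'k) univ => ('a, 'k) univ) => bool" where
 "bilin_into C D V W n M h \<longleftrightarrow>
   (ALL p q. p + q = n -->
    (ALL f:hom_set C (pfst V) (pfst W) p. linear_map (Hom D (psnd V) (psnd W) q) M (%g. h p f q g)) &
    (ALL g:hom_set D (psnd V) (psnd W) q. linear_map (Hom C (pfst V) (pfst W) p) M (%f. h p f q g)))"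

locale tens = C: dgc C + D: dgc D for C D :: "('a, 'k::field) dg"
begin

abbreviation "T == tensor_dg C D"
abbreviation "pt == pure_tensor C D"

lemma Ob_T: "Ob T = {Pair X Y |X Y. X : Ob C & Y : Ob D}"
 by (simp add: tensor_dg_def)
lemma pair_in_Ob [simp]: "Pair X Y : Ob T \<longleftrightarrow> X : Ob C & Y : Ob D"
 by (simp add: Ob_T)
lemma fst_Ob [simp]: "V : Ob T ==> pfst V : Ob C" and snd_Ob [simp]: "V : Ob T ==> psnd V : Ob D"
 and pair_Ob [simp]: "V : Ob T ==> Pair (pfst V) (psnd V) = V"
 by (auto simp: Ob_T)
lemma Hom_T: "Hom T V W n = tensor_hom C D V W n"
 by (simp add: tensor_dg_def)

context
 fixes V W assumes V [simp]: "V : Ob T" and W [simp]: "W : Ob T"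
begin

lemma linper: "linper (tensor_eq C D V W n) (Tensor n (hzero C (pfst V) (pfst W) n) 0 (hzero D (psnd V) (psnd W) 0))"
proof
 show "tensor_eq C D V W n (Tensor n (hzero C (pfst V) (pfst W) n) 0 (hzero D (psnd V) (psnd W) 0))
   (FScale 0 (Tensor n (hzero C (pfst V) (pfst W) n) 0 (hzero D (psnd V) (psnd W) 0)))"
  using tensor_eq.scale_left[of "hzero C (pfst V) (pfst W) n" C V W n "hzero D (psnd V) (psnd W) 0" D 0 n 0]
  by (simp add: C.hscale_zero)
qed (fact tensor_eq.sym tensor_eq.trans tensor_eq.sum_cong tensor_eq.scale_cong tensor_eq.sum_assoc
 tensor_eq.sum_comm tensor_eq.sum_zero tensor_eq.scale_sum tensor_eq.scale_add tensor_eq.scale_mult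
 tensor_eq.scale_one)+

lemma kmod_T: "kmod (Hom T V W n)"
 unfolding Hom_T tensor_hom_def by (rule kmod.intro) (rule linper.quot_module[OF linper])

lemma tensor_gen: "[|f : hom_set C (pfst V) (pfst W) p; g : hom_set D (psnd V) (psnd W) q; p + q = n|]
   ==> tensor_eq C D V W n (Tensor p f q g) (Tensor p f q g)"
 by (rule tensor_eq.gen)

lemma pt_rep: "p + q = n ==> pt V W p f q g = rep (tensor_eq C D V W n) (Tensor p f q g)"
 by (auto simp: pure_tensor_def)

lemma pt_closed [simp]: "[|f : hom_set C (pfst V) (pfst W) p; g : hom_set D (psnd V) (psnd W) q; n = p + q|]
   ==> pt V W p f q g : hom_set T V W n"
 unfolding Hom_T tensor_hom_def pure_tensor_def using linper.rep_closed[OF linper tensor_gen] by blast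

lemma pt_add_left: "[|f : hom_set C (pfst V) (pfst W) p; f' : hom_set C (pfst V) (pfst W) p;
  g : hom_set D (psnd V) (psnd W) q|]
  ==> pt V W p (hadd C (pfst V) (pfst W) p f f') q g = hadd T V W (p + q) (pt V W p f q g) (pt V W p f' q g)"
 unfolding Hom_T tensor_hom_def pure_tensor_def
 by (subst linper.add_rep[OF linper]) (auto intro!: tensor_gen linper.rep_cong[OF linper] tensor_eq.add_left)
lemma pt_add_right: "[|f : hom_set C (pfst V) (pfst W) p;
  g : hom_set D (psnd V) (psnd W) q; g' : hom_set D (psnd V) (psnd W) q|]
  ==> pt V W p f q (hadd D (psnd V) (psnd W) q g g') = hadd T V W (p + q) (pt V W p f q g) (pt V W p f q g')"
 unfolding Hom_T tensor_hom_def pure_tensor_def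
 by (subst linper.add_rep[OF linper]) (auto intro!: tensor_gen linper.rep_cong[OF linper] tensor_eq.add_right)
lemma pt_scale_left: "[|f : hom_set C (pfst V) (pfst W) p; g : hom_set D (psnd V) (psnd W) q|]
  ==> pt V W p (hscale C (pfst V) (pfst W) p c f) q g = hscale T V W (p + q) c (pt V W p f q g)"
 unfolding Hom_T tensor_hom_def pure_tensor_def
 by (subst linper.smult_rep[OF linper]) (auto intro!: tensor_gen linper.rep_cong[OF linper] tensor_eq.scale_left)
lemma pt_scale_right: "[|f : hom_set C (pfst V) (pfst W) p; g : hom_set D (psnd V) (psnd W) q|]
  ==> pt V W p f q (hscale D (psnd V) (psnd W) q c g) = hscale T V W (p + q) c (pt V W p f q g)"
 unfolding Hom_T tensor_hom_def pure_tensor_def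
 by (subst linper.smult_rep[OF linper]) (auto intro!: tensor_gen linper.rep_cong[OF linper] tensor_eq.scale_right)

lemma tensor_hom_induct0:
 assumes x: "x : hom_set T V W n"
  and pure: "!!p f q g. [|f : hom_set C (pfst V) (pfst W) p; g : hom_set D (psnd V) (psnd W) q; p + q = n|] ==>
   P (pt V W p f q g)"
  and add: "!!x y. [|x : hom_set T V W n; y : hom_set T V W n; P x; P y|] ==> P (hadd T V W n x y)"
  and scale: "!!c x. [|x : hom_set T V W n; P x|] ==> P (hscale T V W n c x)"
 shows "P x"
proof -
 let ?R = "tensor_eq C D V W n"
 note rc = linper.rep_cong[OF linper, of n]
 have S: "P (rep ?R (FSum t u))" if "?R t t" "?R u u" "P (rep ?R t)" "P (rep ?R u)" for t u
  using add[of "rep ?R t" "rep ?R u"] that linper.rep_closed[OF linper]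
  by (simp add: Hom_T tensor_hom_def linper.add_rep[OF linper])
 have K: "P (rep ?R (FScale c t))" if "?R t t" "P (rep ?R t)" for c t
  using scale[of "rep ?R t" c] that linper.rep_closed[OF linper]
  by (simp add: Hom_T tensor_hom_def linper.smult_rep[OF linper])
 have G: "P (rep ?R (Tensor p f q g))"
  if "f : hom_set C (pfst V) (pfst W) p" "g : hom_set D (psnd V) (psnd W) q" "p + q = n" for p f q g
  using pure[OF that] that(3) by (simp add: pt_rep)
 note typed = linper.refl1[OF linper] linper.refl2[OF linper] tensor_eq.sum_cong tensor_eq.scale_cong tensor_gen
 have *: "P (rep ?R t) & P (rep ?R u)" if "?R t u" for t u
  using that
 proof (induction rule: tensor_eq.induct)
  case (sum_cong t t' u u')
  then show ?case using S[of t u] S[of t' u'] typed(1,2) by blast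
 next
  case (scale_cong t t' c)
  then show ?case using K[of t] K[of t'] typed(1,2) by blast
 qed (simp_all add: S K G typed(3-) C.hadd_closed D.hadd_closed C.hscale_closed D.hscale_closed)
 from x obtain t where "?R t t" "x = rep ?R t"
  using linper.carrierE[OF linper] by (auto simp: Hom_T tensor_hom_def)
 then show ?thesis using * by blast
qed

end

lemma tensor_hom_induct [consumes 3, case_names pure add scale]:
 assumes "V : Ob T" "W : Ob T" and "x : hom_set T V W n"
  and "!!p f q g. [|f : hom_set C (pfst V) (pfst W) p; g : hom_set D (psnd V) (psnd W) q; p + q = n|] ==>
   P (pt V W p f q g)"
  and "!!x y. [|x : hom_set T V W n; y : hom_set T V W n; P x; P y|] ==> P (hadd T V W n x y)"
  and "!!c x. [|x : hom_set T V W n; P x|] ==> P (hscale T V W n c x)"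
 shows "P x"
 using tensor_hom_induct0[OF assms(1,2,3), of P] assms(4-) by blast

lemma hvT_add [simp]: "[|V : Ob T; W : Ob T; f : hom_set T V W n; g : hom_set T V W n|] ==>
  hv T V W n (hadd T V W n f g) = hv T V W n f + hv T V W n g"
 unfolding hv_def by (rule kmod.emb_add[OF kmod_T])
lemma hvT_scale [simp]: "[|V : Ob T; W : Ob T; f : hom_set T V W n|] ==>
  hv T V W n (hscale T V W n c f) = fsc c (hv T V W n f)"
 unfolding hv_def by (rule kmod.emb_smult[OF kmod_T])
lemma hvT_inj: "[|hv T X Y n f = hv T X Y n g; X : Ob T; Y : Ob T; f : hom_set T X Y n; g : hom_set T X Y n|] ==> f = g"
 unfolding hv_def using kmod.emb_inj[OF kmod_T] by blast

lemma T_add_closed [simp]: "[|V : Ob T; W : Ob T; f : hom_set T V W n; g : hom_set T V W n|] ==>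
  hadd T V W n f g : hom_set T V W n"
 by (rule kmod.add_closed[OF kmod_T])
lemma T_scale_closed [simp]: "[|V : Ob T; W : Ob T; f : hom_set T V W n|] ==> hscale T V W n c f : hom_set T V W n"
 by (rule kmod.smult_closed[OF kmod_T])

lemma hv_pt [simp]:
 assumes VW: "V : Ob T" "W : Ob T" and f: "f : hom_set C (pfst V) (pfst W) p" and g: "g : hom_set D (psnd V) (psnd W) q"
  and k: "k = p + q"
 shows "f' : hom_set C (pfst V) (pfst W) p ==>
   hv T V W k (pt V W p (hadd C (pfst V) (pfst W) p f f') q g) = hv T V W k (pt V W p f q g) + hv T V W k (pt V W p f' q g)"
  and "g' : hom_set D (psnd V) (psnd W) q ==>
   hv T V W k (pt V W p f q (hadd D (psnd V) (psnd W) q g g')) = hv T V W k (pt V W p f q g) + hv T V W k (pt V W p f q g')"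
  and "hv T V W k (pt V W p (hscale C (pfst V) (pfst W) p c f) q g) = fsc c (hv T V W k (pt V W p f q g))"
  and "hv T V W k (pt V W p f q (hscale D (psnd V) (psnd W) q c g)) = fsc c (hv T V W k (pt V W p f q g))"
 unfolding k using assms by (simp_all add: pt_add_left pt_add_right pt_scale_left pt_scale_right)

lemma hv_pt_zero [simp]:
 assumes VW: "V : Ob T" "W : Ob T" and k: "k = p + q"
 shows "g : hom_set D (psnd V) (psnd W) q ==> hv T V W k (pt V W p (hzero C (pfst V) (pfst W) p) q g) = 0"
  and "f : hom_set C (pfst V) (pfst W) p ==> hv T V W k (pt V W p f q (hzero D (psnd V) (psnd W) q)) = 0"
 using hv_pt(3)[of V W "hzero C (pfst V) (pfst W) p" p g q k 0] hv_pt(4)[of V W f p "hzero D (psnd V) (psnd W) q" q k 0] assms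
 by (simp_all add: C.hscale_zero D.hscale_zero)

lemma tensor_ext_sound:
 assumes M: "kmod M" and b: "bilin_into C D V W n M h" and VW: "V : Ob T" "W : Ob T"
  and tu: "tensor_eq C D V W n t u"
 shows "tensor_ext M h t : carrier M & tensor_ext M h u : carrier M & tensor_ext M h t = tensor_ext M h u"
 using tu
proof (induction rule: tensor_eq.induct)
 case (sum_comm t u)
 then show ?case by (simp add: abelian_monoid.a_comm[OF abelian_group.axioms(1)[OF Module.module.axioms(2)[OF kmod.kmod[OF M]]]] kmod.add_closed[OF M])
next
 case (sum_assoc t u v)
 then show ?case by (simp add: abelian_monoid.a_assoc[OF abelian_group.axioms(1)[OF Module.module.axioms(2)[OF kmod.kmod[OF M]]]] kmod.add_closed[OF M])
next
 case (sum_zero t u)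
 then show ?case by (simp add: kmod.smult_zero_left[OF M] kmod.add_closed[OF M] kmod.zero_closed[OF M]
  abelian_monoid.r_zero[OF abelian_group.axioms(1)[OF Module.module.axioms(2)[OF kmod.kmod[OF M]]]])
qed (use b VW in "auto simp: bilin_into_def linear_map_def kmod.add_closed[OF M] kmod.smult_closed[OF M]
  kmod.smult_one[OF M] kmod.smult_add[OF M] kmod.smult_smult[OF M] kmod.smult_distr[OF M]")

lemma tensor_ext_rep:
 assumes M: "kmod M" and b: "bilin_into C D V W n M h" and VW: "V : Ob T" "W : Ob T"
  and t: "tensor_eq C D V W n t t"
 shows "tensor_ext M h (rep (tensor_eq C D V W n) t) = tensor_ext M h t"
 using tensor_ext_sound[OF M b VW linper.rep_rel(2)[OF linper[OF VW] t]] by simp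

lemma tensor_ext_pt:
 assumes M: "kmod M" and b: "bilin_into C D V W n M h" and VW: "V : Ob T" "W : Ob T"
  and "f : hom_set C (pfst V) (pfst W) p" "g : hom_set D (psnd V) (psnd W) q" "p + q = n"
 shows "tensor_ext M h (pt V W p f q g) = h p f q g"
 using tensor_ext_rep[OF M b VW tensor_gen] assms by (simp add: pt_rep)

lemma tensor_ext_lin:
 assumes M: "kmod M" and b: "bilin_into C D V W n M h" and VW: "V : Ob T" "W : Ob T"
 shows "linear_map (Hom T V W n) M (tensor_ext M h)"
proof -
 let ?R = "tensor_eq C D V W n"
 note l = linper[OF VW, of n]
 note e = tensor_ext_rep[OF M b VW]
 note c = tensor_ext_sound[OF M b VW]
 show ?thesis
  unfolding linear_map_def
 proof (intro conjI ballI allI)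
  fix x assume "x : carrier (Hom T V W n)"
  then obtain t where t: "?R t t" "x = rep ?R t"
   using linper.carrierE[OF l] by (auto simp: Hom_T tensor_hom_def)
  show "tensor_ext M h x : carrier M" using c[OF t(1)] t by (simp add: e)
  show "tensor_ext M h (a \<odot>\<^bsub>Hom T V W n\<^esub> x) = a \<odot>\<^bsub>M\<^esub> tensor_ext M h x" for a
   using t by (simp add: Hom_T tensor_hom_def linper.smult_rep[OF l] e tensor_eq.scale_cong)
  fix y assume "y : carrier (Hom T V W n)"
  then obtain u where u: "?R u u" "y = rep ?R u"
   using linper.carrierE[OF l] by (auto simp: Hom_T tensor_hom_def)
  show "tensor_ext M h (x \<oplus>\<^bsub>Hom T V W n\<^esub> y) = tensor_ext M h x \<oplus>\<^bsub>M\<^esub> tensor_ext M h y"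
   using t u by (simp add: Hom_T tensor_hom_def linper.add_rep[OF l] e tensor_eq.sum_cong)
 qed
qed

lemma tensor_lin_eq:
 assumes M: "kmod M" and VW: "V : Ob T" "W : Ob T"
  and g: "linear_map (Hom T V W n) M g" and h: "linear_map (Hom T V W n) M h"
  and eq: "!!p a q b. [|a : hom_set C (pfst V) (pfst W) p; b : hom_set D (psnd V) (psnd W) q; p + q = n|] ==>
   g (pt V W p a q b) = h (pt V W p a q b)"
  and x: "x : hom_set T V W n"
 shows "g x = h x"
 using VW x by (induction rule: tensor_hom_induct) (use g h eq VW in "simp_all add: linear_map_def")

lemma bilinI:
 assumes VW: "V : Ob T" "W : Ob T" and "kmod (Hom E X Y k)"
  and "!!p q f g. [|p + q = n; f : hom_set C (pfst V) (pfst W) p; g : hom_set D (psnd V) (psnd W) q|] ==> h p f q g : hom_set E X Y k"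
  and "!!p q f f' g. [|p + q = n; f : hom_set C (pfst V) (pfst W) p; f' : hom_set C (pfst V) (pfst W) p; g : hom_set D (psnd V) (psnd W) q|] ==>
    hv E X Y k (h p (hadd C (pfst V) (pfst W) p f f') q g) = hv E X Y k (h p f q g) + hv E X Y k (h p f' q g)"
  and "!!p q c f g. [|p + q = n; f : hom_set C (pfst V) (pfst W) p; g : hom_set D (psnd V) (psnd W) q|] ==>
    hv E X Y k (h p (hscale C (pfst V) (pfst W) p c f) q g) = fsc c (hv E X Y k (h p f q g))"
  and "!!p q f g g'. [|p + q = n; f : hom_set C (pfst V) (pfst W) p; g : hom_set D (psnd V) (psnd W) q; g' : hom_set D (psnd V) (psnd W) q|] ==>
    hv E X Y k (h p f q (hadd D (psnd V) (psnd W) q g g')) = hv E X Y k (h p f q g) + hv E X Y k (h p f q g')"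
  and "!!p q c f g. [|p + q = n; f : hom_set C (pfst V) (pfst W) p; g : hom_set D (psnd V) (psnd W) q|] ==>
    hv E X Y k (h p f q (hscale D (psnd V) (psnd W) q c g)) = fsc c (hv E X Y k (h p f q g))"
 shows "bilin_into C D V W n (Hom E X Y k) h"
 unfolding bilin_into_def
 by (intro conjI allI impI ballI linear_mapI C.kmod_hom D.kmod_hom fst_Ob snd_Ob assms)
  (use assms in "simp_all add: hv_def")

abbreviation "cmpk m n U V W == (%p g q h p' g' q' h'.
      koszul (q * p') \<odot>\<^bsub>Hom T U W (m + n)\<^esub>
       pt U W
        (p + p') (Cmp C (pfst U) (pfst V) (pfst W) p p' g g')
        (q + q') (Cmp D (psnd U) (psnd V) (psnd W) q q' h h'))"

lemma Cmp_T: "Cmp T U V W m n t u =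
  tensor_ext (Hom T U W (m + n)) (%p g q h. tensor_ext (Hom T U W (m + n)) (cmpk m n U V W p g q h) u) t"
 by (simp add: tensor_dg_def)

context
 fixes U V W and m n :: int assumes U [simp]: "U : Ob T" and V [simp]: "V : Ob T" and W [simp]: "W : Ob T"
begin

lemma cmpk_bilin:
 assumes "g : hom_set C (pfst V) (pfst W) p" "h : hom_set D (psnd V) (psnd W) q" "p + q = m"
 shows "bilin_into C D U V n (Hom T U W (m + n)) (cmpk m n U V W p g q h)"
 by (rule bilinI) (use assms in "simp_all add: kmod_T fsc_sg")

lemma cmpk_ext_bilin:
 assumes u: "u : hom_set T U V n"
 shows "bilin_into C D V W m (Hom T U W (m + n)) (%p g q h. tensor_ext (Hom T U W (m + n)) (cmpk m n U V W p g q h) u)"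
proof -
 define e where "e = (%p g q h. tensor_ext (Hom T U W (m + n)) (cmpk m n U V W p g q h))"
 have lin: "linear_map (Hom T U V n) (Hom T U W (m + n)) (e p g q h)"
  if "g : hom_set C (pfst V) (pfst W) p" "h : hom_set D (psnd V) (psnd W) q" "p + q = m" for p g q h
  unfolding e_def by (rule tensor_ext_lin[OF kmod_T cmpk_bilin]) (use that in simp_all)
 have val: "e p g q h (pt U V p' g' q' h') = cmpk m n U V W p g q h p' g' q' h'"
  if "g : hom_set C (pfst V) (pfst W) p" "h : hom_set D (psnd V) (psnd W) q" "p + q = m"
    "g' : hom_set C (pfst U) (pfst V) p'" "h' : hom_set D (psnd U) (psnd V) q'" "p' + q' = n" for p g q h p' g' q' h'
  unfolding e_def by (rule tensor_ext_pt[OF kmod_T cmpk_bilin]) (use that in simp_all)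
 have closed [simp]: "e p g q h u : hom_set T U W (m + n)" if "u : hom_set T U V n"
  "g : hom_set C (pfst V) (pfst W) p" "h : hom_set D (psnd V) (psnd W) q" "p + q = m" for p g q h u
  using lin[OF that(2-4)] that(1) by (simp add: linear_map_def)
 have hva: "hv T U W (m + n) (e p g q h (hadd T U V n x y)) = hv T U W (m + n) (e p g q h x) + hv T U W (m + n) (e p g q h y)"
  if "g : hom_set C (pfst V) (pfst W) p" "h : hom_set D (psnd V) (psnd W) q" "p + q = m" "x : hom_set T U V n" "y : hom_set T U V n" for p g q h x y
  using lin[OF that(1-3)] that by (simp add: linear_map_def)
 have hvs: "hv T U W (m + n) (e p g q h (hscale T U V n c x)) = fsc c (hv T U W (m + n) (e p g q h x))"
  if "g : hom_set C (pfst V) (pfst W) p" "h : hom_set D (psnd V) (psnd W) q" "p + q = m" "x : hom_set T U V n" for p g q h x c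
  using lin[OF that(1-3)] that by (simp add: linear_map_def)
 have "bilin_into C D V W m (Hom T U W (m + n)) (%p g q h. e p g q h u)"
 proof (rule bilinI)
  fix p q f f' g assume a: "p + q = m" "f : hom_set C (pfst V) (pfst W) p" "f' : hom_set C (pfst V) (pfst W) p" "g : hom_set D (psnd V) (psnd W) q"
  show "hv T U W (m + n) (e p (hadd C (pfst V) (pfst W) p f f') q g u) = hv T U W (m + n) (e p f q g u) + hv T U W (m + n) (e p f' q g u)"
   using U V u by (induction rule: tensor_hom_induct) (use a in "simp_all add: hva hvs val algebra_simps")
 next
  fix p q f g g' assume a: "p + q = m" "f : hom_set C (pfst V) (pfst W) p" "g : hom_set D (psnd V) (psnd W) q" "g' : hom_set D (psnd V) (psnd W) q"
  show "hv T U W (m + n) (e p f q (hadd D (psnd V) (psnd W) q g g') u) = hv T U W (m + n) (e p f q g u) + hv T U W (m + n) (e p f q g' u)"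
   using U V u by (induction rule: tensor_hom_induct) (use a in "simp_all add: hva hvs val algebra_simps")
 next
  fix p q c f g assume a: "p + q = m" "f : hom_set C (pfst V) (pfst W) p" "g : hom_set D (psnd V) (psnd W) q"
  show "hv T U W (m + n) (e p (hscale C (pfst V) (pfst W) p c f) q g u) = fsc c (hv T U W (m + n) (e p f q g u))"
   using U V u by (induction rule: tensor_hom_induct) (use a in "simp_all add: hva hvs val fsc_sg mult.commute")
  show "hv T U W (m + n) (e p f q (hscale D (psnd V) (psnd W) q c g) u) = fsc c (hv T U W (m + n) (e p f q g u))"
   using U V u by (induction rule: tensor_hom_induct) (use a in "simp_all add: hva hvs val fsc_sg mult.commute")
 qed (use u in "simp_all add: kmod_T")
 then show ?thesis by (simp add: e_def)
qed

lemma cmpT_lin_left: "u : hom_set T U V n ==> linear_map (Hom T V W m) (Hom T U W (m + n)) (%t. Cmp T U V W m n t u)"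
 unfolding Cmp_T by (rule tensor_ext_lin[OF kmod_T cmpk_ext_bilin]) simp_all

lemma cmpT_lin_right: assumes t: "t : hom_set T V W m"
 shows "linear_map (Hom T U V n) (Hom T U W (m + n)) (%u. Cmp T U V W m n t u)"
 using V W t
proof (induction rule: tensor_hom_induct)
 case (pure p f q g)
 show ?case
  by (rule linear_map_cong[OF tensor_ext_lin[OF kmod_T cmpk_bilin[OF pure]]])
   (use pure in "simp_all add: kmod_T Cmp_T tensor_ext_pt[OF kmod_T cmpk_ext_bilin]")
next
 case (add x y)
 show ?case
  by (rule linear_map_cong[OF linear_map_add[OF _ _ add(3,4)]])
   (use add cmpT_lin_left in "simp_all add: kmod_T linear_map_def")
next
 case (scale c x)
 show ?case
  by (rule linear_map_cong[OF linear_map_scale[OF _ _ scale(2)]])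
   (use scale cmpT_lin_left in "simp_all add: kmod_T linear_map_def")
qed

lemma cmp_pt:
 assumes "g : hom_set C (pfst V) (pfst W) p" "h : hom_set D (psnd V) (psnd W) q" "p + q = m"
    "g' : hom_set C (pfst U) (pfst V) p'" "h' : hom_set D (psnd U) (psnd V) q'" "p' + q' = n"
 shows "Cmp T U V W m n (pt V W p g q h) (pt U V p' g' q' h') = hscale T U W (m + n) (koszul (q * p'))
   (pt U W (p + p') (Cmp C (pfst U) (pfst V) (pfst W) p p' g g')
       (q + q') (Cmp D (psnd U) (psnd V) (psnd W) q q' h h'))"
 using assms unfolding Cmp_T
 by (simp add: tensor_ext_pt[OF kmod_T cmpk_ext_bilin] tensor_ext_pt[OF kmod_T cmpk_bilin])

end

lemma Id_T: "Id T V = pt V V 0 (Id C (pfst V)) 0 (Id D (psnd V))"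
 by (simp add: tensor_dg_def)

lemma cmpT_closed: "[|U : Ob T; V : Ob T; W : Ob T; t : hom_set T V W m; u : hom_set T U V n|] ==>
  Cmp T U V W m n t u : hom_set T U W (m + n)"
 using cmpT_lin_left[of U V W u n m] by (simp add: linear_map_def)

lemma pt_eqI:
 assumes "hv T V W k x = hv T V W k y" "V : Ob T" "W : Ob T" "x : hom_set T V W k" "y : hom_set T V W k"
 shows "x = y"
 using assms by (rule hvT_inj)

lemma cmp_assoc_pt:
 assumes Ob: "U : Ob T" "V : Ob T" "W : Ob T" "Z : Ob T"
  and x: "a : hom_set C (pfst W) (pfst Z) p" "b : hom_set D (psnd W) (psnd Z) q"
  and y: "a' : hom_set C (pfst V) (pfst W) p'" "b' : hom_set D (psnd V) (psnd W) q'"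
  and z: "a'' : hom_set C (pfst U) (pfst V) p''" "b'' : hom_set D (psnd U) (psnd V) q''"
 shows "Cmp T U W Z (p + q) (p' + q' + (p'' + q'')) (pt W Z p a q b)
      (Cmp T U V W (p' + q') (p'' + q'') (pt V W p' a' q' b') (pt U V p'' a'' q'' b''))
    = Cmp T U V Z (p + q + (p' + q')) (p'' + q'')
      (Cmp T V W Z (p + q) (p' + q') (pt W Z p a q b) (pt V W p' a' q' b')) (pt U V p'' a'' q'' b'')"
  (is "?l = ?r")
proof -
 let ?k = "p + q + (p' + q' + (p'' + q''))"
 have 1: "?l = hscale T U Z ?k (koszul (q' * p'')) (Cmp T U W Z (p + q) (p' + q' + (p'' + q'')) (pt W Z p a q b)
   (pt U W (p' + p'') (Cmp C (pfst U) (pfst V) (pfst W) p' p'' a' a'') (q' + q'') (Cmp D (psnd U) (psnd V) (psnd W) q' q'' b' b'')))"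
  using assms cmpT_lin_right[of U W Z "pt W Z p a q b" "p + q" "p' + q' + (p'' + q'')"] by (simp add: cmp_pt linear_map_def)
 have 2: "?r = hscale T U Z ?k (koszul (q * p')) (Cmp T U V Z (p + q + (p' + q')) (p'' + q'')
   (pt V Z (p + p') (Cmp C (pfst V) (pfst W) (pfst Z) p p' a a') (q + q') (Cmp D (psnd V) (psnd W) (psnd Z) q q' b b'))
   (pt U V p'' a'' q'' b''))"
  using assms cmpT_lin_left[of U V Z "pt U V p'' a'' q'' b''" "p'' + q''" "p + q + (p' + q')"] by (simp add: cmp_pt linear_map_def add.assoc)
 show ?thesis
  unfolding 1 2
  by (rule pt_eqI[of U Z ?k])
   (use assms in "simp_all add: cmp_pt C.cmp_assoc D.cmp_assoc algebra_simps")
qed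

lemma cmp_assoc_T:
 assumes Ob: "U : Ob T" "V : Ob T" "W : Ob T" "Z : Ob T"
  and x: "x : hom_set T W Z l" and y: "y : hom_set T V W m" and z: "z : hom_set T U V n"
 shows "Cmp T U W Z l (m + n) x (Cmp T U V W m n y z) = Cmp T U V Z (l + m) n (Cmp T V W Z l m x y) z"
proof (rule tensor_lin_eq[OF kmod_T _ _ _ _ _ x])
 show "linear_map (Hom T W Z l) (Hom T U Z (l + (m + n))) (%x. Cmp T U W Z l (m + n) x (Cmp T U V W m n y z))"
  by (rule cmpT_lin_left) (use assms cmpT_closed in simp_all)
 show "linear_map (Hom T W Z l) (Hom T U Z (l + (m + n))) (%x. Cmp T U V Z (l + m) n (Cmp T V W Z l m x y) z)"
  using linear_map_comp[OF cmpT_lin_left[of V W Z y m l] cmpT_lin_left[of U V Z z n "l + m"]] assms by (simp add: add.assoc)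
 fix p a q b assume ab: "a : hom_set C (pfst W) (pfst Z) p" "b : hom_set D (psnd W) (psnd Z) q" "p + q = l"
 let ?x = "pt W Z p a q b"
 have x: "?x : hom_set T W Z l" using ab Ob by simp
 show "Cmp T U W Z l (m + n) ?x (Cmp T U V W m n y z) = Cmp T U V Z (l + m) n (Cmp T V W Z l m ?x y) z"
 proof (rule tensor_lin_eq[OF kmod_T _ _ _ _ _ y])
  show "linear_map (Hom T V W m) (Hom T U Z (l + (m + n))) (%y. Cmp T U W Z l (m + n) ?x (Cmp T U V W m n y z))"
   by (rule linear_map_comp[OF cmpT_lin_left cmpT_lin_right]) (use assms x in simp_all)
  show "linear_map (Hom T V W m) (Hom T U Z (l + (m + n))) (%y. Cmp T U V Z (l + m) n (Cmp T V W Z l m ?x y) z)"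
   using linear_map_comp[OF cmpT_lin_right[of V W Z ?x l m] cmpT_lin_left[of U V Z z n "l + m"]] assms x by (simp add: add.assoc)
  fix p' a' q' b' assume ab': "a' : hom_set C (pfst V) (pfst W) p'" "b' : hom_set D (psnd V) (psnd W) q'" "p' + q' = m"
  let ?y = "pt V W p' a' q' b'"
  have y: "?y : hom_set T V W m" using ab' Ob by simp
  show "Cmp T U W Z l (m + n) ?x (Cmp T U V W m n ?y z) = Cmp T U V Z (l + m) n (Cmp T V W Z l m ?x ?y) z"
  proof (rule tensor_lin_eq[OF kmod_T _ _ _ _ _ z])
   show "linear_map (Hom T U V n) (Hom T U Z (l + (m + n))) (%z. Cmp T U W Z l (m + n) ?x (Cmp T U V W m n ?y z))"
    by (rule linear_map_comp[OF cmpT_lin_right cmpT_lin_right]) (use assms x y in simp_all)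
   show "linear_map (Hom T U V n) (Hom T U Z (l + (m + n))) (%z. Cmp T U V Z (l + m) n (Cmp T V W Z l m ?x ?y) z)"
    using cmpT_lin_right[of U V Z "Cmp T V W Z l m ?x ?y" "l + m" n] assms x y cmpT_closed by (simp add: add.assoc)
   fix p'' a'' q'' b'' assume ab'': "a'' : hom_set C (pfst U) (pfst V) p''" "b'' : hom_set D (psnd U) (psnd V) q''" "p'' + q'' = n"
   show "Cmp T U W Z l (m + n) ?x (Cmp T U V W m n ?y (pt U V p'' a'' q'' b''))
     = Cmp T U V Z (l + m) n (Cmp T V W Z l m ?x ?y) (pt U V p'' a'' q'' b'')"
    using cmp_assoc_pt[OF Ob ab(1,2) ab'(1,2) ab''(1,2)] unfolding ab(3) ab'(3) ab''(3) .
  qed (use Ob in simp_all)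
 qed (use Ob in simp_all)
qed (use Ob in simp_all)

sublocale T: gcat T
proof (rule gcat.intro)
 fix X Y n assume "X : Ob T" "Y : Ob T"
 then show "Module.module scalars (Hom T X Y n)" using kmod_T kmod.kmod by blast
next
 fix X assume "X : Ob T"
 then show "Id T X : hom_set T X X 0" by (simp add: Id_T)
next
 fix X Y n f assume XY: "X : Ob T" "Y : Ob T" and f: "f : hom_set T X Y n"
 have X: "Id T X : hom_set T X X 0" and Y: "Id T Y : hom_set T Y Y 0" using XY by (simp_all add: Id_T)
 have i: "linear_map (Hom T X Y n) (Hom T X Y n) (%f. f)" by (simp add: linear_map_def)
 show "Cmp T X Y Y 0 n (Id T Y) f = f"
  by (rule tensor_lin_eq[OF kmod_T XY _ i _ f])
   (use XY cmpT_lin_right[of X Y Y "Id T Y" 0 n] Y in "auto simp: Id_T cmp_pt koszul_def kmod.smult_one[OF kmod_T]")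
 show "Cmp T X X Y n 0 f (Id T X) = f"
  by (rule tensor_lin_eq[OF kmod_T XY _ i _ f])
   (use XY cmpT_lin_left[of X X Y "Id T X" 0 n] X in "auto simp: Id_T cmp_pt koszul_def kmod.smult_one[OF kmod_T]")
qed (auto intro: cmpT_lin_left cmpT_lin_right cmp_assoc_T)

subsection \<open>The differential of a tensor product\<close>

abbreviation "difk n V W == (%p f q g.
     pt V W (p + 1) (Dif C (pfst V) (pfst W) p f) q g
      \<oplus>\<^bsub>Hom T V W (n + 1)\<^esub>
     (koszul p \<odot>\<^bsub>Hom T V W (n + 1)\<^esub>
       pt V W p f (q + 1) (Dif D (psnd V) (psnd W) q g)))"

lemma Dif_T: "Dif T V W n = tensor_ext (Hom T V W (n + 1)) (difk n V W)"
 by (simp add: tensor_dg_def)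

lemma difk_bilin: "[|V : Ob T; W : Ob T|] ==> bilin_into C D V W n (Hom T V W (n + 1)) (difk n V W)"
 by (rule bilinI) (auto simp: kmod_T algebra_simps)

lemma dif_pt: "[|V : Ob T; W : Ob T; f : hom_set C (pfst V) (pfst W) p; g : hom_set D (psnd V) (psnd W) q; p + q = n|] ==>
  Dif T V W n (pt V W p f q g) = difk n V W p f q g"
 unfolding Dif_T by (rule tensor_ext_pt[OF kmod_T difk_bilin])

lemma difT_lin: "[|V : Ob T; W : Ob T|] ==> linear_map (Hom T V W n) (Hom T V W (n + 1)) (Dif T V W n)"
 unfolding Dif_T by (rule tensor_ext_lin[OF kmod_T difk_bilin])

lemma difT_closed: "[|V : Ob T; W : Ob T; x : hom_set T V W n; k = n + 1|] ==> Dif T V W n x : hom_set T V W k"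
 using difT_lin[of V W n] by (simp add: linear_map_def)

lemma hv_difT:
 assumes "V : Ob T" "W : Ob T" "k = n + 1"
 shows "[|x : hom_set T V W n; y : hom_set T V W n|] ==> hv T V W k (Dif T V W n (hadd T V W n x y)) = hv T V W k (Dif T V W n x) + hv T V W k (Dif T V W n y)"
  and "x : hom_set T V W n ==> hv T V W k (Dif T V W n (hscale T V W n c x)) = fsc c (hv T V W k (Dif T V W n x))"
 using difT_lin[of V W n] difT_closed assms by (simp_all add: linear_map_def)

lemma leibniz_signs:
 "sg (q * p') (A + sg p B + sg (p + p') (E + sg q F)) =
  sg (q * p') A + sg p (sg ((q + 1) * p') E) + sg (p + q) (sg (q * (p' + 1)) B + sg p' (sg (q * p') F))"
 by (cases "even p"; cases "even q"; cases "even p'"; simp add: sg_def)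

lemma leibniz_pt:
 assumes Ob: "U : Ob T" "V : Ob T" "W : Ob T"
  and y: "a : hom_set C (pfst V) (pfst W) p" "b : hom_set D (psnd V) (psnd W) q"
  and z: "a' : hom_set C (pfst U) (pfst V) p'" "b' : hom_set D (psnd U) (psnd V) q'"
 defines "m == p + q" and "n == p' + q'"
 defines "x == pt V W p a q b" and "x' == pt U V p' a' q' b'"
 shows "Dif T U W (m + n) (Cmp T U V W m n x x') =
  hadd T U W (m + n + 1) (Cmp T U V W (m + 1) n (Dif T V W m x) x')
    (hscale T U W (m + n + 1) (koszul m) (Cmp T U V W m (n + 1) x (Dif T U V n x')))"
proof (rule pt_eqI[of U W "m + n + 1"])
 have [simp]: "x : hom_set T V W m" "x' : hom_set T U V n" using assms by simp_all
 note c = difT_closed T.cmp_closed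
 have l: "hv T U W (m + n + 1) (Dif T U W (m + n) (Cmp T U V W m n x x')) = sg (q * p') (
   hv T U W (m + n + 1) (pt U W (p + p' + 1) (Cmp C (pfst U) (pfst V) (pfst W) (p + 1) p' (Dif C (pfst V) (pfst W) p a) a')
    (q + q') (Cmp D (psnd U) (psnd V) (psnd W) q q' b b'))
  + sg p (hv T U W (m + n + 1) (pt U W (p + p' + 1) (Cmp C (pfst U) (pfst V) (pfst W) p (p' + 1) a (Dif C (pfst U) (pfst V) p' a'))
    (q + q') (Cmp D (psnd U) (psnd V) (psnd W) q q' b b')))
  + sg (p + p') (hv T U W (m + n + 1) (pt U W (p + p') (Cmp C (pfst U) (pfst V) (pfst W) p p' a a')
    (q + q' + 1) (Cmp D (psnd U) (psnd V) (psnd W) (q + 1) q' (Dif D (psnd V) (psnd W) q b) b'))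
   + sg q (hv T U W (m + n + 1) (pt U W (p + p') (Cmp C (pfst U) (pfst V) (pfst W) p p' a a')
    (q + q' + 1) (Cmp D (psnd U) (psnd V) (psnd W) q (q' + 1) b (Dif D (psnd U) (psnd V) q' b'))))))"
  using assms(1-7) unfolding m_def n_def x_def x'_def
  by (simp add: cmp_pt hv_difT dif_pt C.dif_cmp D.dif_cmp algebra_simps)
 have r1: "hv T U W (m + n + 1) (Cmp T U V W (m + 1) n (Dif T V W m x) x') =
   sg (q * p') (hv T U W (m + n + 1) (pt U W (p + p' + 1) (Cmp C (pfst U) (pfst V) (pfst W) (p + 1) p' (Dif C (pfst V) (pfst W) p a) a')
    (q + q') (Cmp D (psnd U) (psnd V) (psnd W) q q' b b')))
  + sg p (sg ((q + 1) * p') (hv T U W (m + n + 1) (pt U W (p + p') (Cmp C (pfst U) (pfst V) (pfst W) p p' a a')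
    (q + q' + 1) (Cmp D (psnd U) (psnd V) (psnd W) (q + 1) q' (Dif D (psnd V) (psnd W) q b) b'))))"
  using assms(1-7) unfolding m_def n_def x_def x'_def
  by (simp add: cmp_pt dif_pt algebra_simps)
 have r2: "hv T U W (m + n + 1) (Cmp T U V W m (n + 1) x (Dif T U V n x')) =
   sg (q * (p' + 1)) (hv T U W (m + n + 1) (pt U W (p + p' + 1) (Cmp C (pfst U) (pfst V) (pfst W) p (p' + 1) a (Dif C (pfst U) (pfst V) p' a'))
    (q + q') (Cmp D (psnd U) (psnd V) (psnd W) q q' b b')))
  + sg p' (sg (q * p') (hv T U W (m + n + 1) (pt U W (p + p') (Cmp C (pfst U) (pfst V) (pfst W) p p' a a')
    (q + q' + 1) (Cmp D (psnd U) (psnd V) (psnd W) q (q' + 1) b (Dif D (psnd U) (psnd V) q' b')))))"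
  using assms(1-7) unfolding m_def n_def x_def x'_def
  by (simp add: cmp_pt dif_pt algebra_simps)
 show "hv T U W (m + n + 1) (Dif T U W (m + n) (Cmp T U V W m n x x')) =
  hv T U W (m + n + 1) (hadd T U W (m + n + 1) (Cmp T U V W (m + 1) n (Dif T V W m x) x')
    (hscale T U W (m + n + 1) (koszul m) (Cmp T U V W m (n + 1) x (Dif T U V n x'))))"
  using Ob by (simp add: c) (simp only: l r1 r2 leibniz_signs m_def[symmetric])
qed (use Ob assms difT_closed T.cmp_closed in simp_all)

sublocale T: dgc T
proof (rule dgc.intro[OF T.gcat_axioms dgc_axioms.intro])
 fix X Y n assume XY: "X : Ob T" "Y : Ob T"
 show lin: "linear_map (Hom T X Y n) (Hom T X Y (n + 1)) (Dif T X Y n)" using XY by (rule difT_lin)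
 fix f assume f: "f : hom_set T X Y n"
 show "Dif T X Y (n + 1) (Dif T X Y n f) = hzero T X Y (n + 1 + 1)"
 proof (rule tensor_lin_eq[OF kmod_T XY _ _ _ f])
  show "linear_map (Hom T X Y n) (Hom T X Y (n + 1 + 1)) (%f. Dif T X Y (n + 1) (Dif T X Y n f))"
   using linear_map_comp[OF difT_lin[OF XY] difT_lin[OF XY]] .
  show "linear_map (Hom T X Y n) (Hom T X Y (n + 1 + 1)) (%f. hzero T X Y (n + 1 + 1))"
   by (rule linear_map_zero) (use XY in "rule kmod_T")
  fix p a q b assume ab: "a : hom_set C (pfst X) (pfst Y) p" "b : hom_set D (psnd X) (psnd Y) q" "p + q = n"
  show "Dif T X Y (n + 1) (Dif T X Y n (pt X Y p a q b)) = hzero T X Y (n + 1 + 1)"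
   by (rule pt_eqI[of X Y "n + 1 + 1"])
    (use XY ab in "simp_all add: dif_pt hv_difT difT_closed T.hadd_closed T.hscale_closed,
      auto simp: sg_def algebra_simps")
 qed (use XY kmod_T in simp_all)
next
 fix X Y Z m n g f assume Ob: "X : Ob T" "Y : Ob T" "Z : Ob T" and g: "g : hom_set T Y Z m" and f: "f : hom_set T X Y n"
 let ?M = "Hom T X Z (m + n + 1)"
 note kT = kmod_T[OF Ob(1,2)] kmod_T[OF Ob(2,3)] kmod_T[OF Ob(1,3)]
 have R: "linear_map (Hom T Y Z m) ?M (%g. hadd T X Z (m + n + 1) (Cmp T X Y Z (m + 1) n (Dif T Y Z m g) f)
   (hscale T X Z (m + n + 1) (koszul m) (Cmp T X Y Z m (n + 1) g (Dif T X Y n f))))" if f: "f : hom_set T X Y n" for f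
  by (rule linear_map_add[OF kT(2,3) _ linear_map_scale[OF kT(2,3)]])
   (use linear_map_comp[OF difT_lin[of Y Z m] cmpT_lin_left[of X Y Z f n "m + 1"]]
     cmpT_lin_left[of X Y Z "Dif T X Y n f" "n + 1" m] Ob f difT_closed in "simp_all add: algebra_simps")
 have L: "linear_map (Hom T Y Z m) ?M (%g. Dif T X Z (m + n) (Cmp T X Y Z m n g f))" if f: "f : hom_set T X Y n" for f
  by (rule linear_map_comp[OF cmpT_lin_left difT_lin]) (use Ob f in simp_all)
 show "Dif T X Z (m + n) (Cmp T X Y Z m n g f)
     = hadd T X Z (m + n + 1)
       (Cmp T X Y Z (m + 1) n (Dif T Y Z m g) f)
       (hscale T X Z (m + n + 1) (koszul m) (Cmp T X Y Z m (n + 1) g (Dif T X Y n f)))"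
 proof (rule tensor_lin_eq[OF kT(3) Ob(2,3) L[OF f] R[OF f] _ g])
  fix p a q b assume ab: "a : hom_set C (pfst Y) (pfst Z) p" "b : hom_set D (psnd Y) (psnd Z) q" "p + q = m"
  let ?g = "pt Y Z p a q b"
  have g: "?g : hom_set T Y Z m" using ab Ob by simp
  have R: "linear_map (Hom T X Y n) ?M (%f. hadd T X Z (m + n + 1) (Cmp T X Y Z (m + 1) n (Dif T Y Z m ?g) f)
    (hscale T X Z (m + n + 1) (koszul m) (Cmp T X Y Z m (n + 1) ?g (Dif T X Y n f))))"
   by (rule linear_map_add[OF kT(1,3) _ linear_map_scale[OF kT(1,3)]])
    (use linear_map_comp[OF difT_lin[of X Y n] cmpT_lin_right[of X Y Z ?g m "n + 1"]]
      cmpT_lin_right[of X Y Z "Dif T Y Z m ?g" "m + 1" n] Ob g difT_closed in "simp_all add: algebra_simps")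
  have L: "linear_map (Hom T X Y n) ?M (%f. Dif T X Z (m + n) (Cmp T X Y Z m n ?g f))"
   by (rule linear_map_comp[OF cmpT_lin_right difT_lin]) (use Ob g in simp_all)
  show "Dif T X Z (m + n) (Cmp T X Y Z m n ?g f)
     = hadd T X Z (m + n + 1)
       (Cmp T X Y Z (m + 1) n (Dif T Y Z m ?g) f)
       (hscale T X Z (m + n + 1) (koszul m) (Cmp T X Y Z m (n + 1) ?g (Dif T X Y n f)))"
  proof (rule tensor_lin_eq[OF kT(3) Ob(1,2) L R _ f])
   fix p' a' q' b' assume ab': "a' : hom_set C (pfst X) (pfst Y) p'" "b' : hom_set D (psnd X) (psnd Y) q'" "p' + q' = n"
   show "Dif T X Z (m + n) (Cmp T X Y Z m n ?g (pt X Y p' a' q' b'))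
     = hadd T X Z (m + n + 1)
       (Cmp T X Y Z (m + 1) n (Dif T Y Z m ?g) (pt X Y p' a' q' b'))
       (hscale T X Z (m + n + 1) (koszul m) (Cmp T X Y Z m (n + 1) ?g (Dif T X Y n (pt X Y p' a' q' b'))))"
    using leibniz_pt[OF Ob ab(1,2) ab'(1,2)] ab(3) ab'(3) by simp
  qed
 qed
qed

end

subsection \<open>Dg functors out of tensor products\<close>

lemma (in gcat) leibniz_regroup:
 assumes "X : Ob C" "Y : Ob C" "a : hom_set C X Y n" "b : hom_set C X Y n" "g : hom_set C X Y n" "x : hom_set C X Y n"
  and "hv C X Y n x = hv C X Y n b + sg s (hv C X Y n g)" and "r + s = p"
 shows "hadd C X Y n a (hscale C X Y n (koszul r) x)
  = hadd C X Y n (hadd C X Y n a (hscale C X Y n (koszul r) b)) (hscale C X Y n (koszul p) g)"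
 by (rule hv_inj[of X Y n]) (use assms in "simp_all add: algebra_simps")

context tens
begin

lemma dgc_T: "dgc T"
 by (rule T.dgc_axioms)

text \<open>Every structural dg functor out of a tensor product has this form.\<close>

definition tmap :: "('a, 'k) dg => (('a, 'k) univ => ('a, 'k) univ) =>
  (('a, 'k) univ => ('a, 'k) univ => int => int => ('a, 'k) univ => int => ('a, 'k) univ => ('a, 'k) univ) => ('a, 'k) dgf" where
 "tmap E fo h = mk_fun T fo (%V W n. tensor_ext (Hom E (fo V) (fo W) n) (h V W n))"

context
 fixes E :: "('a, 'k) dg" and fo
  and h :: "('a, 'k) univ => ('a, 'k) univ => int => int => ('a, 'k) univ => int => ('a, 'k) univ => ('a, 'k) univ"
 assumes E: "dgc E"
  and fo: "!!V. V : Ob T ==> fo V : Ob E"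
  and bil: "!!V W n. [|V : Ob T; W : Ob T|] ==> bilin_into C D V W n (Hom E (fo V) (fo W) n) (h V W n)"
begin

lemma tmap_pt: "[|V : Ob T; W : Ob T; f : hom_set C (pfst V) (pfst W) p; g : hom_set D (psnd V) (psnd W) q; n = p + q|] ==>
  far (tmap E fo h) V W n (pt V W p f q g) = h V W n p f q g"
 unfolding tmap_def mk_fun_simps(2)[OF _ _ pt_closed]
 by (simp, rule tensor_ext_pt[OF gcat.kmod_hom[OF dgc.axioms(1)[OF E]] bil]) (simp_all add: fo)

lemma tmap_functor:
 assumes ident: "!!V. V : Ob T ==> h V V 0 0 (Id C (pfst V)) 0 (Id D (psnd V)) = Id E (fo V)"
  and cmp: "!!U V W p q p' q' g k g' k'. [|U : Ob T; V : Ob T; W : Ob T;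
    g : hom_set C (pfst V) (pfst W) p; k : hom_set D (psnd V) (psnd W) q;
    g' : hom_set C (pfst U) (pfst V) p'; k' : hom_set D (psnd U) (psnd V) q'|] ==>
    Cmp E (fo U) (fo V) (fo W) (p + q) (p' + q') (h V W (p + q) p g q k) (h U V (p' + q') p' g' q' k')
     = hscale E (fo U) (fo W) (p + q + (p' + q')) (koszul (q * p')) (h U W (p + q + (p' + q'))
       (p + p') (Cmp C (pfst U) (pfst V) (pfst W) p p' g g')
       (q + q') (Cmp D (psnd U) (psnd V) (psnd W) q q' k k'))"
  and dif: "!!V W p q f g. [|V : Ob T; W : Ob T; f : hom_set C (pfst V) (pfst W) p; g : hom_set D (psnd V) (psnd W) q|] ==>
    Dif E (fo V) (fo W) (p + q) (h V W (p + q) p f q g)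
     = hadd E (fo V) (fo W) (p + q + 1) (h V W (p + q + 1) (p + 1) (Dif C (pfst V) (pfst W) p f) q g)
      (hscale E (fo V) (fo W) (p + q + 1) (koszul p) (h V W (p + q + 1) p f (q + 1) (Dif D (psnd V) (psnd W) q g)))"
 shows "dg_functor T E (tmap E fo h)"
proof -
 interpret E: dgc E by fact
 let ?F = "%V W n. tensor_ext (Hom E (fo V) (fo W) n) (h V W n)"
 have val: "?F V W n (pt V W p f q g) = h V W n p f q g"
  if "V : Ob T" "W : Ob T" "f : hom_set C (pfst V) (pfst W) p" "g : hom_set D (psnd V) (psnd W) q" "n = p + q" for V W n p f q g
  by (rule tensor_ext_pt[OF E.kmod_hom bil]) (use that fo in simp_all)
 have lin: "linear_map (Hom T V W n) (Hom E (fo V) (fo W) n) (?F V W n)" if "V : Ob T" "W : Ob T" for V W n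
  by (rule tensor_ext_lin[OF E.kmod_hom bil]) (use that fo in simp_all)
 show ?thesis
  unfolding tmap_def
 proof (rule dg_functor_mk_fun[OF T.dgc_axioms fo lin])
  fix V assume "V : Ob T"
  then show "?F V V 0 (Id T V) = Id E (fo V)" using ident by (simp add: Id_T val)
 next
  fix U V W m n g f assume Ob: "U : Ob T" "V : Ob T" "W : Ob T" and g: "g : hom_set T V W m" and f: "f : hom_set T U V n"
  note kT = kmod_T[OF Ob(1,2)] kmod_T[OF Ob(2,3)] kmod_T[OF Ob(1,3)]
  have kE: "kmod (Hom E (fo U) (fo W) (m + n))" using Ob fo by (intro E.kmod_hom) auto
  have clos: "?F V W m x : hom_set E (fo V) (fo W) m" if "V : Ob T" "W : Ob T" "x : hom_set T V W m" for V W m x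
   using lin[OF that(1,2)] that(3) by (simp add: linear_map_def)
  show "?F U W (m + n) (Cmp T U V W m n g f) = Cmp E (fo U) (fo V) (fo W) m n (?F V W m g) (?F U V n f)"
  proof (rule tensor_lin_eq[OF kE Ob(2,3) _ _ _ g])
   show "linear_map (Hom T V W m) (Hom E (fo U) (fo W) (m + n)) (%g. ?F U W (m + n) (Cmp T U V W m n g f))"
    by (rule linear_map_comp[OF T.cmp_lin_left lin]) (use Ob f in auto)
   show "linear_map (Hom T V W m) (Hom E (fo U) (fo W) (m + n)) (%g. Cmp E (fo U) (fo V) (fo W) m n (?F V W m g) (?F U V n f))"
    by (rule linear_map_comp[OF lin E.cmp_lin_left]) (use Ob f fo clos in auto)
   fix p a q b assume ab: "a : hom_set C (pfst V) (pfst W) p" "b : hom_set D (psnd V) (psnd W) q" "p + q = m"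
   let ?g = "pt V W p a q b"
   have g: "?g : hom_set T V W m" using ab Ob by simp
   show "?F U W (m + n) (Cmp T U V W m n ?g f) = Cmp E (fo U) (fo V) (fo W) m n (?F V W m ?g) (?F U V n f)"
   proof (rule tensor_lin_eq[OF kE Ob(1,2) _ _ _ f])
    show "linear_map (Hom T U V n) (Hom E (fo U) (fo W) (m + n)) (%f. ?F U W (m + n) (Cmp T U V W m n ?g f))"
     by (rule linear_map_comp[OF T.cmp_lin_right lin]) (use Ob g in auto)
    show "linear_map (Hom T U V n) (Hom E (fo U) (fo W) (m + n)) (%f. Cmp E (fo U) (fo V) (fo W) m n (?F V W m ?g) (?F U V n f))"
     by (rule linear_map_comp[OF lin E.cmp_lin_right]) (use Ob g fo clos in auto)
    fix p' a' q' b' assume ab': "a' : hom_set C (pfst U) (pfst V) p'" "b' : hom_set D (psnd U) (psnd V) q'" "p' + q' = n"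
    have "?F U W (m + n) (Cmp T U V W m n ?g (pt U V p' a' q' b')) =
     ?F U W (m + n) (hscale T U W (m + n) (koszul (q * p')) (pt U W (p + p') (Cmp C (pfst U) (pfst V) (pfst W) p p' a a')
       (q + q') (Cmp D (psnd U) (psnd V) (psnd W) q q' b b')))"
     by (simp add: cmp_pt[OF Ob ab ab'])
    also have "... = hscale E (fo U) (fo W) (m + n) (koszul (q * p')) (h U W (m + n)
       (p + p') (Cmp C (pfst U) (pfst V) (pfst W) p p' a a')
       (q + q') (Cmp D (psnd U) (psnd V) (psnd W) q q' b b'))"
     using lin[OF Ob(1,3), of "m + n"] Ob ab ab' by (simp add: linear_map_def val)
    also have "... = Cmp E (fo U) (fo V) (fo W) m n (h V W m p a q b) (h U V n p' a' q' b')"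
     using cmp[OF Ob ab(1,2) ab'(1,2)] unfolding ab(3) ab'(3) by simp
    finally show "?F U W (m + n) (Cmp T U V W m n ?g (pt U V p' a' q' b')) = Cmp E (fo U) (fo V) (fo W) m n (?F V W m ?g) (?F U V n (pt U V p' a' q' b'))"
     using Ob ab ab' by (simp add: val)
   qed
  qed
 next
  fix V W n f assume Ob: "V : Ob T" "W : Ob T" and f: "f : hom_set T V W n"
  show "?F V W (n + 1) (Dif T V W n f) = Dif E (fo V) (fo W) n (?F V W n f)"
  proof (rule tensor_lin_eq[OF E.kmod_hom Ob _ _ _ f])
   show "linear_map (Hom T V W n) (Hom E (fo V) (fo W) (n + 1)) (%f. ?F V W (n + 1) (Dif T V W n f))"
    by (rule linear_map_comp[OF T.dif_lin lin]) (use Ob in auto)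
   show "linear_map (Hom T V W n) (Hom E (fo V) (fo W) (n + 1)) (%f. Dif E (fo V) (fo W) n (?F V W n f))"
    by (rule linear_map_comp[OF lin E.dif_lin]) (use Ob fo in auto)
   fix p a q b assume ab: "a : hom_set C (pfst V) (pfst W) p" "b : hom_set D (psnd V) (psnd W) q" "p + q = n"
   show "?F V W (n + 1) (Dif T V W n (pt V W p a q b)) = Dif E (fo V) (fo W) n (?F V W n (pt V W p a q b))"
    using dif[OF Ob ab(1,2), unfolded ab(3)] Ob ab lin[OF Ob, of "n + 1"] by (simp add: dif_pt linear_map_def val)
  qed (use Ob fo in auto)
 qed
qed

end

end

subsection \<open>The structural dg functors of the tensor product\<close>

lemma dgc_tensor: "[|dgc C; dgc D|] ==> dgc (tensor_dg C D)"
 by (rule tens.dgc_T[OF tens.intro])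

context
 fixes C C' D D' :: "('a, 'k::field) dg" and F G
 assumes F: "dg_functor C C' F" and G: "dg_functor D D' G"
  and cats: "dgc C" "dgc C'" "dgc D" "dgc D'"
begin

interpretation S: tens C D using cats by (intro tens.intro)
interpretation R: tens C' D' using cats by (intro tens.intro)
interpretation F: dgfunctor C C' F by (intro dgfunctor.intro dgfunctor_axioms.intro cats F)
interpretation G: dgfunctor D D' G by (intro dgfunctor.intro dgfunctor_axioms.intro cats G)

abbreviation (input) "tf_ob == (%V. Pair (fob F (pfst V)) (fob G (psnd V)))"
abbreviation (input) "tf_ar == (%V W (n::int) p f q g. pure_tensor C' D' (tf_ob V) (tf_ob W)
       p (far F (pfst V) (pfst W) p f) q (far G (psnd V) (psnd W) q g))"

lemma tensor_fun_tmap: "tensor_fun C C' D D' F G = S.tmap R.T tf_ob tf_ar"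
 unfolding tensor_fun_def S.tmap_def Let_def R.Hom_T ..

lemma tf_ob: "V : Ob S.T ==> tf_ob V : Ob R.T"
 by simp

lemma tf_bilin: "[|V : Ob S.T; W : Ob S.T|] ==> bilin_into C D V W n (Hom R.T (tf_ob V) (tf_ob W) n) (tf_ar V W n)"
 by (rule S.bilinI) (simp_all add: R.kmod_T R.hv_pt[where V = "Pair _ _" and W = "Pair _ _", simplified])

lemma tensor_fun_ob: "V : Ob S.T ==> fob (tensor_fun C C' D D' F G) V = tf_ob V"
 by (simp add: tensor_fun_def mk_fun_def Let_def)

lemma tensor_fun_pt: "[|V : Ob S.T; W : Ob S.T; f : hom_set C (pfst V) (pfst W) p; g : hom_set D (psnd V) (psnd W) q; n = p + q|] ==>
  far (tensor_fun C C' D D' F G) V W n (pure_tensor C D V W p f q g) = tf_ar V W n p f q g"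
 unfolding tensor_fun_tmap by (rule S.tmap_pt[OF R.T.dgc_axioms tf_ob tf_bilin])

lemma tensor_fun_functor: "dg_functor S.T R.T (tensor_fun C C' D D' F G)"
 unfolding tensor_fun_tmap
proof (rule S.tmap_functor[OF R.T.dgc_axioms tf_ob tf_bilin])
 fix V assume "V : Ob S.T"
 then show "tf_ar V V 0 0 (Id C (pfst V)) 0 (Id D (psnd V)) = Id R.T (tf_ob V)" by (simp add: R.Id_T)
next
 fix U V W p q p' q' g k g' k'
 assume "U : Ob S.T" "V : Ob S.T" "W : Ob S.T"
    "g : hom_set C (pfst V) (pfst W) p" "k : hom_set D (psnd V) (psnd W) q"
    "g' : hom_set C (pfst U) (pfst V) p'" "k' : hom_set D (psnd U) (psnd V) q'"
 then show "Cmp R.T (tf_ob U) (tf_ob V) (tf_ob W) (p + q) (p' + q') (tf_ar V W (p + q) p g q k) (tf_ar U V (p' + q') p' g' q' k')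
     = hscale R.T (tf_ob U) (tf_ob W) (p + q + (p' + q')) (koszul (q * p')) (tf_ar U W (p + q + (p' + q'))
       (p + p') (Cmp C (pfst U) (pfst V) (pfst W) p p' g g')
       (q + q') (Cmp D (psnd U) (psnd V) (psnd W) q q' k k'))"
  by (simp add: R.cmp_pt F.far_cmp G.far_cmp)
next
 fix V W p q f g assume "V : Ob S.T" "W : Ob S.T" "f : hom_set C (pfst V) (pfst W) p" "g : hom_set D (psnd V) (psnd W) q"
 then show "Dif R.T (tf_ob V) (tf_ob W) (p + q) (tf_ar V W (p + q) p f q g)
     = hadd R.T (tf_ob V) (tf_ob W) (p + q + 1) (tf_ar V W (p + q + 1) (p + 1) (Dif C (pfst V) (pfst W) p f) q g)
      (hscale R.T (tf_ob V) (tf_ob W) (p + q + 1) (koszul p) (tf_ar V W (p + q + 1) p f (q + 1) (Dif D (psnd V) (psnd W) q g)))"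
  by (simp add: R.dif_pt F.far_dif G.far_dif)
qed

end

context
 fixes C D E :: "('a, 'k::field) dg"
 assumes cats: "dgc C" "dgc D" "dgc E"
begin

interpretation CD: tens C D using cats by (intro tens.intro)
interpretation DE: tens D E using cats by (intro tens.intro)
interpretation L: tens CD.T E using cats CD.T.dgc_axioms by (intro tens.intro)
interpretation R: tens C DE.T using cats DE.T.dgc_axioms by (intro tens.intro)

abbreviation (input) "as_ob == (%V. Pair (pfst (pfst V)) (Pair (psnd (pfst V)) (psnd V)))"
abbreviation (input) "as_in == (%V W s h p f q g. R.pt (as_ob V) (as_ob W) p f (q + s)
  (DE.pt (psnd (as_ob V)) (psnd (as_ob W)) q g s h))"
abbreviation (input) "as_ar == (%V W n (r::int) a s h. tensor_ext (Hom R.T (as_ob V) (as_ob W) n) (as_in V W s h) a)"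

lemma tensor_assoc_tmap: "tensor_assoc C D E = L.tmap R.T as_ob as_ar"
 unfolding tensor_assoc_def L.tmap_def Let_def R.Hom_T ..

lemma as_ob: "V : Ob L.T ==> as_ob V : Ob R.T"
 by simp

lemma as_in_bilin: "[|V : Ob L.T; W : Ob L.T; h : hom_set E (psnd V) (psnd W) s; n = r + s|] ==>
 bilin_into C D (pfst V) (pfst W) r (Hom R.T (as_ob V) (as_ob W) n) (as_in V W s h)"
 by (rule CD.bilinI) (simp_all add: R.kmod_T R.hv_pt[where V = "Pair _ _" and W = "Pair _ _", simplified]
   DE.pt_add_left[where V = "Pair _ _" and W = "Pair _ _", simplified]
   DE.pt_scale_left[where V = "Pair _ _" and W = "Pair _ _", simplified])

lemma as_ar_lin: "[|V : Ob L.T; W : Ob L.T; h : hom_set E (psnd V) (psnd W) s; n = r + s|] ==>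
 linear_map (Hom CD.T (pfst V) (pfst W) r) (Hom R.T (as_ob V) (as_ob W) n) (%a. as_ar V W n r a s h)"
 by (rule CD.tensor_ext_lin[OF R.kmod_T as_in_bilin]) simp_all

lemma as_ar_pt: "[|V : Ob L.T; W : Ob L.T; h : hom_set E (psnd V) (psnd W) s; n = p + q + s;
  f : hom_set C (pfst (pfst V)) (pfst (pfst W)) p; g : hom_set D (psnd (pfst V)) (psnd (pfst W)) q|] ==>
 as_ar V W n r (CD.pt (pfst V) (pfst W) p f q g) s h = as_in V W s h p f q g"
 by (rule CD.tensor_ext_pt[OF R.kmod_T as_in_bilin, of V W h s n "p + q"]) simp_all

lemma as_bilin:
 assumes VW: "V : Ob L.T" "W : Ob L.T"
 shows "bilin_into CD.T E V W n (Hom R.T (as_ob V) (as_ob W) n) (as_ar V W n)"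
proof -
 have Ob: "pfst V : Ob CD.T" "pfst W : Ob CD.T" "as_ob V : Ob R.T" "as_ob W : Ob R.T" using VW by simp_all
 define e where "e = as_ar V W n"
 have lin: "linear_map (Hom CD.T (pfst V) (pfst W) r) (Hom R.T (as_ob V) (as_ob W) n) (%a. e r a s h)"
  if "h : hom_set E (psnd V) (psnd W) s" "r + s = n" for r s h
  unfolding e_def using as_ar_lin[OF VW that(1), of n r] that by simp
 have val: "e r (CD.pt (pfst V) (pfst W) p f q g) s h = as_in V W s h p f q g"
  if "h : hom_set E (psnd V) (psnd W) s" "n = p + q + s" 
  "f : hom_set C (pfst (pfst V)) (pfst (pfst W)) p" "g : hom_set D (psnd (pfst V)) (psnd (pfst W)) q" for r h s n' p q f g
  unfolding e_def using as_ar_pt[OF VW that] by simp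
 have "bilin_into CD.T E V W n (Hom R.T (as_ob V) (as_ob W) n) e"
  unfolding bilin_into_def
 proof (intro allI impI conjI ballI)
  fix r s a assume rs: "r + s = n" and a: "a : hom_set CD.T (pfst V) (pfst W) r"
  show "linear_map (Hom E (psnd V) (psnd W) s) (Hom R.T (as_ob V) (as_ob W) n) (e r a s)"
   using Ob(1,2) a
  proof (induction rule: CD.tensor_hom_induct)
   case (pure p f q g)
   show ?case
    by (rule linear_mapI) (use VW pure rs in \<open>simp_all add: DE.D.kmod_hom R.kmod_T val R.hv_pt[where V = "Pair _ _" and W = "Pair _ _", simplified, unfolded hv_def]
   DE.pt_add_right[where V = "Pair _ _" and W = "Pair _ _", simplified]
   DE.pt_scale_right[where V = "Pair _ _" and W = "Pair _ _", simplified]\<close>)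
  next
   case (add x y)
   show ?case
    by (rule linear_map_cong[OF linear_map_add[OF _ _ add(3,4)]])
     (use add lin rs VW in "simp_all add: R.kmod_T DE.D.kmod_hom linear_map_def")
  next
   case (scale c x)
   show ?case
    by (rule linear_map_cong[OF linear_map_scale[OF _ _ scale(2)]])
     (use scale lin rs VW in "simp_all add: R.kmod_T DE.D.kmod_hom linear_map_def")
  qed
 qed (use lin in simp)
 then show ?thesis by (simp add: e_def)
qed

lemma tensor_assoc_ob: "V : Ob L.T ==> fob (tensor_assoc C D E) V = as_ob V"
 by (simp add: tensor_assoc_def mk_fun_def Let_def)

lemma tensor_assoc_pt:
 assumes "V : Ob L.T" "W : Ob L.T" "f : hom_set C (pfst (pfst V)) (pfst (pfst W)) p"
  "g : hom_set D (psnd (pfst V)) (psnd (pfst W)) q" "h : hom_set E (psnd V) (psnd W) s" "r = p + q" "n = r + s"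
 shows "far (tensor_assoc C D E) V W n (L.pt V W r (CD.pt (pfst V) (pfst W) p f q g) s h) = as_in V W s h p f q g"
proof -
 have "far (tensor_assoc C D E) V W n (L.pt V W r (CD.pt (pfst V) (pfst W) p f q g) s h) =
  as_ar V W n r (CD.pt (pfst V) (pfst W) p f q g) s h"
  unfolding tensor_assoc_tmap by (rule L.tmap_pt[OF R.T.dgc_axioms as_ob as_bilin]) (use assms in simp_all)
 also have "... = as_in V W s h p f q g" by (rule as_ar_pt) (use assms in simp_all)
 finally show ?thesis .
qed

lemma tensor_assoc_functor: "dg_functor L.T R.T (tensor_assoc C D E)"
 unfolding tensor_assoc_tmap
proof (rule L.tmap_functor[OF R.T.dgc_axioms as_ob as_bilin])
 fix V assume V: "V : Ob L.T"
 then show "as_ar V V 0 0 (Id CD.T (pfst V)) 0 (Id E (psnd V)) = Id R.T (as_ob V)"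
  using as_ar_pt[OF V V, of "Id E (psnd V)" 0 0 0 0] by (simp add: R.Id_T CD.Id_T DE.Id_T)
next
 fix U V W p q p' q' g k g' k'
 assume Ob: "U : Ob L.T" "V : Ob L.T" "W : Ob L.T"
  and g: "g : hom_set CD.T (pfst V) (pfst W) p" and k: "k : hom_set E (psnd V) (psnd W) q"
  and g': "g' : hom_set CD.T (pfst U) (pfst V) p'" and k': "k' : hom_set E (psnd U) (psnd V) q'"
 let ?U = "as_ob U" and ?V = "as_ob V" and ?W = "as_ob W" and ?Up = "pfst U" and ?Vp = "pfst V" and ?Wp = "pfst W" and ?Ue = "psnd U" and ?Ve = "psnd V" and ?We = "psnd W"
 let ?U2 = "psnd ?U" and ?V2 = "psnd ?V" and ?W2 = "psnd ?W" and ?Ua = "pfst ?Up" and ?Va = "pfst ?Vp" and ?Wa = "pfst ?Wp" and ?Ub = "psnd ?Up" and ?Vb = "psnd ?Vp" and ?Wb = "psnd ?Wp"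
 let ?n = "p + q + (p' + q')"
 have Ob1: "pfst U : Ob CD.T" "pfst V : Ob CD.T" "pfst W : Ob CD.T" using Ob by simp_all
 note kR = R.kmod_T[OF as_ob[OF Ob(1)] as_ob[OF Ob(3)]]
 have kk: "Cmp E ?Ue ?Ve ?We q q' k k' : hom_set E ?Ue ?We (q + q')"
  using Ob k k' by simp
 have lin: "linear_map (Hom CD.T ?Vp ?Wp p) (Hom R.T ?V ?W (p + q)) (%a. as_ar V W (p + q) p a q k)"
  by (rule as_ar_lin) (use Ob k in simp_all)
 have lin': "linear_map (Hom CD.T ?Up ?Vp p') (Hom R.T ?U ?V (p' + q')) (%a. as_ar U V (p' + q') p' a q' k')"
  by (rule as_ar_lin) (use Ob k' in simp_all)
 have lin2: "linear_map (Hom CD.T ?Up ?Wp (p + p')) (Hom R.T ?U ?W ?n)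
   (%a. as_ar U W ?n (p + p') a (q + q') (Cmp E ?Ue ?Ve ?We q q' k k'))"
  by (rule as_ar_lin) (use Ob kk in simp_all)
 show "Cmp R.T ?U ?V ?W (p + q) (p' + q') (as_ar V W (p + q) p g q k) (as_ar U V (p' + q') p' g' q' k')
     = hscale R.T ?U ?W ?n (koszul (q * p')) (as_ar U W ?n
       (p + p') (Cmp CD.T ?Up ?Vp ?Wp p p' g g')
       (q + q') (Cmp E ?Ue ?Ve ?We q q' k k'))"
 proof (rule CD.tensor_lin_eq[OF kR Ob1(2,3) _ _ _ g])
  have "as_ar U V (p' + q') p' g' q' k' : hom_set R.T ?U ?V (p' + q')"
   using lin' g' by (simp add: linear_map_def)
  then show "linear_map (Hom CD.T ?Vp ?Wp p) (Hom R.T ?U ?W ?n)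
   (%g. Cmp R.T ?U ?V ?W (p + q) (p' + q') (as_ar V W (p + q) p g q k) (as_ar U V (p' + q') p' g' q' k'))"
   by (intro linear_map_comp[OF lin R.T.cmp_lin_left]) (use as_ob Ob in blast)+
  show "linear_map (Hom CD.T ?Vp ?Wp p) (Hom R.T ?U ?W ?n)
   (%g. hscale R.T ?U ?W ?n (koszul (q * p')) (as_ar U W ?n
       (p + p') (Cmp CD.T ?Up ?Vp ?Wp p p' g g')
       (q + q') (Cmp E ?Ue ?Ve ?We q q' k k')))"
   by (rule linear_map_scale[OF CD.kmod_T[OF Ob1(2,3)] kR linear_map_comp[OF CD.cmpT_lin_left lin2]]) (use Ob1 g' in blast)+
  fix r a s b assume ab: "a : hom_set C ?Va ?Wa r" "b : hom_set D ?Vb ?Wb s" "r + s = p"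
  let ?g = "CD.pt ?Vp ?Wp r a s b"
  have g: "?g : hom_set CD.T ?Vp ?Wp p" using ab Ob by simp
  show "Cmp R.T ?U ?V ?W (p + q) (p' + q') (as_ar V W (p + q) p ?g q k) (as_ar U V (p' + q') p' g' q' k')
     = hscale R.T ?U ?W ?n (koszul (q * p')) (as_ar U W ?n
       (p + p') (Cmp CD.T ?Up ?Vp ?Wp p p' ?g g')
       (q + q') (Cmp E ?Ue ?Ve ?We q q' k k'))"
  proof (rule CD.tensor_lin_eq[OF kR Ob1(1,2) _ _ _ g'])
   have "as_ar V W (p + q) p ?g q k : hom_set R.T ?V ?W (p + q)"
    using lin g by (simp add: linear_map_def)
   then show "linear_map (Hom CD.T ?Up ?Vp p') (Hom R.T ?U ?W ?n)
    (%g'. Cmp R.T ?U ?V ?W (p + q) (p' + q') (as_ar V W (p + q) p ?g q k) (as_ar U V (p' + q') p' g' q' k'))"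
    by (intro linear_map_comp[OF lin' R.T.cmp_lin_right]) (use as_ob Ob in blast)+
   show "linear_map (Hom CD.T ?Up ?Vp p') (Hom R.T ?U ?W ?n)
    (%g'. hscale R.T ?U ?W ?n (koszul (q * p')) (as_ar U W ?n
       (p + p') (Cmp CD.T ?Up ?Vp ?Wp p p' ?g g')
       (q + q') (Cmp E ?Ue ?Ve ?We q q' k k')))"
    by (rule linear_map_scale[OF CD.kmod_T[OF Ob1(1,2)] kR linear_map_comp[OF CD.cmpT_lin_right lin2]]) (use Ob1 g in blast)+
   fix r' a' s' b' assume ab': "a' : hom_set C ?Ua ?Va r'" "b' : hom_set D ?Ub ?Vb s'" "r' + s' = p'"
   let ?g' = "CD.pt ?Up ?Vp r' a' s' b'"
   let ?aa = "Cmp C ?Ua ?Va ?Wa r r' a a'"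
   let ?bb = "Cmp D ?Ub ?Vb ?Wb s s' b b'"
   let ?kk = "Cmp E ?Ue ?Ve ?We q q' k k'"
   let ?x = "R.pt ?U ?W (r + r') ?aa (s + s' + (q + q')) (DE.pt ?U2 ?W2 (s + s') ?bb (q + q') ?kk)"
   have x: "?x : hom_set R.T ?U ?W ?n" using Ob ab ab' k k' by simp
   have aab: "?aa : hom_set C ?Ua ?Wa (r + r')" "?bb : hom_set D ?Ub ?Wb (s + s')"
    using Ob ab ab' by simp_all
   have 1: "as_ar V W (p + q) p ?g q k = as_in V W q k r a s b"
    by (rule as_ar_pt) (use Ob ab k in simp_all)
   have 2: "as_ar U V (p' + q') p' ?g' q' k' = as_in U V q' k' r' a' s' b'"
    by (rule as_ar_pt) (use Ob ab' k' in simp_all)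
   have "as_ar U W ?n (p + p') (CD.pt ?Up ?Wp (r + r') ?aa (s + s') ?bb) (q + q') ?kk = ?x"
    by (rule as_ar_pt) (use Ob ab ab' kk aab in simp_all)
   then have 3: "as_ar U W ?n (p + p') (Cmp CD.T ?Up ?Vp ?Wp p p' ?g ?g') (q + q') ?kk
    = hscale R.T ?U ?W ?n (koszul (s * r')) ?x"
    using lin2 CD.cmp_pt[OF Ob1 ab ab'] Ob1 aab ab(3) ab'(3) by (simp add: linear_map_def)
   have 4: "Cmp DE.T ?U2 ?V2 ?W2 (s + q) (s' + q') (DE.pt ?V2 ?W2 s b q k) (DE.pt ?U2 ?V2 s' b' q' k')
    = hscale DE.T ?U2 ?W2 (s + q + (s' + q')) (koszul (q * s')) (DE.pt ?U2 ?W2 (s + s') ?bb (q + q') ?kk)"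
    using DE.cmp_pt[of ?U2 ?V2 ?W2 b s k q "s + q" b' s' k' q' "s' + q'"] Ob ab ab' k k' by simp
   have 5: "Cmp R.T ?U ?V ?W (p + q) (p' + q') (as_in V W q k r a s b) (as_in U V q' k' r' a' s' b')
    = hscale R.T ?U ?W ?n (koszul ((s + q) * r')) (R.pt ?U ?W (r + r') ?aa (s + q + (s' + q'))
      (hscale DE.T ?U2 ?W2 (s + q + (s' + q')) (koszul (q * s')) (DE.pt ?U2 ?W2 (s + s') ?bb (q + q') ?kk)))"
    using R.cmp_pt[of ?U ?V ?W a r "DE.pt ?V2 ?W2 s b q k" "s + q" "p + q"
       a' r' "DE.pt ?U2 ?V2 s' b' q' k'" "s' + q'" "p' + q'"] Ob ab ab' k k' 4 by simp
   show "Cmp R.T ?U ?V ?W (p + q) (p' + q') (as_ar V W (p + q) p ?g q k) (as_ar U V (p' + q') p' ?g' q' k')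
     = hscale R.T ?U ?W ?n (koszul (q * p')) (as_ar U W ?n
       (p + p') (Cmp CD.T ?Up ?Vp ?Wp p p' ?g ?g')
       (q + q') ?kk)"
    unfolding 1 2 3 5
   proof (rule R.pt_eqI[OF _ as_ob[OF Ob(1)] as_ob[OF Ob(3)]])
    have "q * s' + (s + q) * r' = s * r' + q * p'" unfolding ab'(3)[symmetric] by (simp add: algebra_simps)
    have idx: "s + s' + (q + q') = s + q + (s' + q')" by simp
    from \<open>q * s' + (s + q) * r' = s * r' + q * p'\<close> have e: "sg (q * s' + (s + q) * r') z = sg (s * r' + q * p') z" for z :: "(('a, 'k) univ => 'k) => 'k" by (simp only:)
    have "hv R.T ?U ?W ?n (R.pt ?U ?W (r + r') ?aa (s + q + (s' + q'))
      (hscale DE.T ?U2 ?W2 (s + q + (s' + q')) (koszul (q * s')) (DE.pt ?U2 ?W2 (s + s') ?bb (q + q') ?kk)))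
     = sg (q * s') (hv R.T ?U ?W ?n (R.pt ?U ?W (r + r') ?aa (s + q + (s' + q')) (DE.pt ?U2 ?W2 (s + s') ?bb (q + q') ?kk)))"
     using R.hv_pt(4)[OF as_ob[OF Ob(1)] as_ob[OF Ob(3)], of ?aa "r + r'"
       "DE.pt ?U2 ?W2 (s + s') ?bb (q + q') ?kk" "s + q + (s' + q')" ?n "koszul (q * s')"]
      Ob aab kk ab(3) ab'(3) by simp
    then show "hv R.T ?U ?W ?n (hscale R.T ?U ?W ?n (koszul ((s + q) * r')) (R.pt ?U ?W (r + r') ?aa (s + q + (s' + q'))
      (hscale DE.T ?U2 ?W2 (s + q + (s' + q')) (koszul (q * s')) (DE.pt ?U2 ?W2 (s + s') ?bb (q + q') ?kk))))
     = hv R.T ?U ?W ?n (hscale R.T ?U ?W ?n (koszul (q * p')) (hscale R.T ?U ?W ?n (koszul (s * r')) ?x))"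
     using Ob aab kk x ab(3) ab'(3) by (simp add: e idx)
   qed (use Ob aab kk x ab(3) ab'(3) in simp_all)
  qed
 qed
next
 fix V W p q f g assume Ob: "V : Ob L.T" "W : Ob L.T" and f: "f : hom_set CD.T (pfst V) (pfst W) p" and g: "g : hom_set E (psnd V) (psnd W) q"
 let ?V = "as_ob V" and ?W = "as_ob W" and ?Vp = "pfst V" and ?Wp = "pfst W" and ?Ve = "psnd V" and ?We = "psnd W"
 let ?V2 = "psnd ?V" and ?W2 = "psnd ?W" and ?Va = "pfst ?Vp" and ?Wa = "pfst ?Wp" and ?Vb = "psnd ?Vp" and ?Wb = "psnd ?Wp"
 have Ob1: "pfst V : Ob CD.T" "pfst W : Ob CD.T" using Ob by simp_all
 have Ob2: "as_ob V : Ob R.T" "as_ob W : Ob R.T" using Ob by simp_all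
 note kR = R.kmod_T[OF Ob2]
 have dg: "Dif E ?Ve ?We q g : hom_set E ?Ve ?We (q + 1)" using Ob g by simp
 have lin: "linear_map (Hom CD.T ?Vp ?Wp r) (Hom R.T ?V ?W n) (%a. as_ar V W n r a s k)"
  if "k : hom_set E ?Ve ?We s" "n = r + s" for n r s k
  by (rule as_ar_lin) (use Ob that in simp_all)
 show "Dif R.T ?V ?W (p + q) (as_ar V W (p + q) p f q g)
     = hadd R.T ?V ?W (p + q + 1) (as_ar V W (p + q + 1) (p + 1) (Dif CD.T ?Vp ?Wp p f) q g)
      (hscale R.T ?V ?W (p + q + 1) (koszul p) (as_ar V W (p + q + 1) p f (q + 1) (Dif E ?Ve ?We q g)))"
 proof (rule CD.tensor_lin_eq[OF kR Ob1 _ _ _ f])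
  show "linear_map (Hom CD.T ?Vp ?Wp p) (Hom R.T ?V ?W (p + q + 1)) (%f. Dif R.T ?V ?W (p + q) (as_ar V W (p + q) p f q g))"
   by (rule linear_map_comp[OF lin[OF g] R.T.dif_lin[OF Ob2]]) simp
  show "linear_map (Hom CD.T ?Vp ?Wp p) (Hom R.T ?V ?W (p + q + 1))
    (%f. hadd R.T ?V ?W (p + q + 1) (as_ar V W (p + q + 1) (p + 1) (Dif CD.T ?Vp ?Wp p f) q g)
      (hscale R.T ?V ?W (p + q + 1) (koszul p) (as_ar V W (p + q + 1) p f (q + 1) (Dif E ?Ve ?We q g))))"
   by (intro linear_map_add[OF CD.kmod_T[OF Ob1] kR] linear_map_scale[OF CD.kmod_T[OF Ob1] kR] lin[OF dg]
     linear_map_comp[OF CD.difT_lin[OF Ob1] lin[OF g]]) simp_all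
  fix r a s b assume ab: "a : hom_set C ?Va ?Wa r" "b : hom_set D ?Vb ?Wb s" "r + s = p"
  let ?f = "CD.pt ?Vp ?Wp r a s b"
  let ?da = "Dif C ?Va ?Wa r a" and ?db = "Dif D ?Vb ?Wb s b"
  let ?dg = "Dif E ?Ve ?We q g" and ?n = "p + q + 1"
  have d: "?da : hom_set C ?Va ?Wa (r + 1)" "?db : hom_set D ?Vb ?Wb (s + 1)"
   using ab Ob by simp_all
  have 1: "as_ar V W (p + q) p ?f q g = as_in V W q g r a s b"
   by (rule as_ar_pt) (use Ob ab g in simp_all)
  have 2: "as_ar V W ?n (p + 1) (CD.pt ?Vp ?Wp (r + 1) ?da s b) q g = as_in V W q g (r + 1) ?da s b"
   by (rule as_ar_pt) (use Ob ab d g in simp_all)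
  have 3: "as_ar V W ?n (p + 1) (CD.pt ?Vp ?Wp r a (s + 1) ?db) q g = as_in V W q g r a (s + 1) ?db"
   by (rule as_ar_pt) (use Ob ab d g in simp_all)
  have 4: "as_ar V W ?n p ?f (q + 1) ?dg = as_in V W (q + 1) ?dg r a s b"
   by (rule as_ar_pt) (use Ob ab d dg in simp_all)
  have 5: "as_ar V W ?n (p + 1) (Dif CD.T ?Vp ?Wp p ?f) q g =
   hadd R.T ?V ?W ?n (as_in V W q g (r + 1) ?da s b) (hscale R.T ?V ?W ?n (koszul r) (as_in V W q g r a (s + 1) ?db))"
   using lin[OF g, of "p + q + 1" "p + 1"] CD.dif_pt[OF Ob1 ab] Ob1 ab d 2 3 by (simp add: linear_map_def)
  have 6: "Dif DE.T ?V2 ?W2 (s + q) (DE.pt ?V2 ?W2 s b q g) = hadd DE.T ?V2 ?W2 (s + q + 1)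
   (DE.pt ?V2 ?W2 (s + 1) ?db q g) (hscale DE.T ?V2 ?W2 (s + q + 1) (koszul s) (DE.pt ?V2 ?W2 s b (q + 1) ?dg))"
   using DE.dif_pt[of ?V2 ?W2 b s g q "s + q"] Ob ab g by simp
  have 7: "Dif R.T ?V ?W (p + q) (as_in V W q g r a s b) =
   hadd R.T ?V ?W ?n (as_in V W q g (r + 1) ?da s b) (hscale R.T ?V ?W ?n (koszul r)
    (R.pt ?V ?W r a (s + q + 1) (Dif DE.T ?V2 ?W2 (s + q) (DE.pt ?V2 ?W2 s b q g))))"
   using R.dif_pt[of ?V ?W a r "DE.pt ?V2 ?W2 s b q g" "s + q" "p + q"] Ob ab g by simp
  have m: "as_in V W q g (r + 1) ?da s b : hom_set R.T ?V ?W ?n"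
   "as_in V W q g r a (s + 1) ?db : hom_set R.T ?V ?W ?n"
   "as_in V W (q + 1) ?dg r a s b : hom_set R.T ?V ?W ?n"
   "R.pt ?V ?W r a (s + q + 1) (Dif DE.T ?V2 ?W2 (s + q) (DE.pt ?V2 ?W2 s b q g)) : hom_set R.T ?V ?W ?n"
   using Ob ab d g dg by simp_all
  have dm: "DE.pt ?V2 ?W2 (s + 1) ?db q g : hom_set DE.T ?V2 ?W2 (s + q + 1)" "DE.pt ?V2 ?W2 s b (q + 1) ?dg : hom_set DE.T ?V2 ?W2 (s + q + 1)"
   using Ob ab d g dg by simp_all
  have 8: "hv R.T ?V ?W ?n (R.pt ?V ?W r a (s + q + 1) (Dif DE.T ?V2 ?W2 (s + q) (DE.pt ?V2 ?W2 s b q g)))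
   = hv R.T ?V ?W ?n (as_in V W q g r a (s + 1) ?db) + sg s (hv R.T ?V ?W ?n (as_in V W (q + 1) ?dg r a s b))"
  proof -
   have "hv R.T ?V ?W ?n (R.pt ?V ?W r a (s + q + 1) (hadd DE.T ?V2 ?W2 (s + q + 1)
   (DE.pt ?V2 ?W2 (s + 1) ?db q g) (hscale DE.T ?V2 ?W2 (s + q + 1) (koszul s) (DE.pt ?V2 ?W2 s b (q + 1) ?dg))))
    = hv R.T ?V ?W ?n (R.pt ?V ?W r a (s + q + 1) (DE.pt ?V2 ?W2 (s + 1) ?db q g))
    + fsc (koszul s) (hv R.T ?V ?W ?n (R.pt ?V ?W r a (s + q + 1) (DE.pt ?V2 ?W2 s b (q + 1) ?dg)))"
    using R.hv_pt(2)[OF Ob2, of a r "DE.pt ?V2 ?W2 (s + 1) ?db q g" "s + q + 1" ?n "hscale DE.T ?V2 ?W2 (s + q + 1) (koszul s) (DE.pt ?V2 ?W2 s b (q + 1) ?dg)"]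
     R.hv_pt(4)[OF Ob2, of a r "DE.pt ?V2 ?W2 s b (q + 1) ?dg" "s + q + 1" ?n "koszul s"] Ob ab dm by simp
   then show ?thesis unfolding 6 by (simp add: algebra_simps)
  qed
  show "Dif R.T ?V ?W (p + q) (as_ar V W (p + q) p ?f q g)
     = hadd R.T ?V ?W ?n (as_ar V W ?n (p + 1) (Dif CD.T ?Vp ?Wp p ?f) q g)
      (hscale R.T ?V ?W ?n (koszul p) (as_ar V W ?n p ?f (q + 1) ?dg))"
   unfolding 1 4 5 7
   by (rule R.T.leibniz_regroup[OF Ob2 m 8]) (simp add: ab(3))
 qed
qed

end

subsection \<open>The unit\<close>

lemma dgc_unit: "dgc (unit_dg :: ('a, 'k::field) dg)"
 unfolding dgc_iff dg_category_def
 by (auto simp: unit_dg_def linear_map_def algebra_simps koszul_def split: if_splits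
   intro: module_cx[where b=True, simplified] module_cx[where b=False, simplified])

context
 fixes C :: "('a, 'k::field) dg"
 assumes C: "dgc C"
begin

interpretation L: tens unit_dg C using C dgc_unit by (intro tens.intro)
interpretation R: tens C unit_dg using C dgc_unit by (intro tens.intro)

abbreviation (input) "lu_ar == (%V W n (p::int) a (q::int) f.
  if p = 0 then hscale C (psnd V) (psnd W) n (scal a) f else hzero C (psnd V) (psnd W) n)"
abbreviation (input) "ru_ar == (%V W n (p::int) f (q::int) a.
  if q = 0 then hscale C (pfst V) (pfst W) n (scal a) f else hzero C (pfst V) (pfst W) n)"

lemma tensor_lunit_tmap: "tensor_lunit C = L.tmap C psnd lu_ar"
 unfolding tensor_lunit_def L.tmap_def ..
lemma tensor_runit_tmap: "tensor_runit C = R.tmap C pfst ru_ar"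
 unfolding tensor_runit_def R.tmap_def ..

lemma unit_hom: "hom_set unit_dg X Y n = (if n = 0 then range Scal else {Scal 0})"
 "hadd unit_dg X Y n a b = Scal (scal a + scal b)" "hscale unit_dg X Y n c a = Scal (c * scal a)"
 "Id unit_dg X = Scal 1" "Cmp unit_dg X Y Z m n g f = Scal (scal g * scal f)" "Dif unit_dg X Y n f = Scal 0"
 by (simp_all add: unit_dg_def)

lemma lu_bilin: "[|V : Ob L.T; W : Ob L.T|] ==> bilin_into unit_dg C V W n (Hom C (psnd V) (psnd W) n) (lu_ar V W n)"
 by (rule L.bilinI) (auto simp: unit_hom L.D.kmod_hom mult.commute split: if_splits)
lemma ru_bilin: "[|V : Ob R.T; W : Ob R.T|] ==> bilin_into C unit_dg V W n (Hom C (pfst V) (pfst W) n) (ru_ar V W n)"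
 by (rule R.bilinI) (auto simp: unit_hom L.D.kmod_hom mult.commute split: if_splits)

lemma smult_one [simp]: "[|X : Ob C; Y : Ob C; f : hom_set C X Y n|] ==> hscale C X Y n 1 f = f"
 by (rule kmod.smult_one[OF L.D.kmod_hom])

lemma tensor_lunit_functor: "dg_functor L.T C (tensor_lunit C)"
 unfolding tensor_lunit_tmap
proof (rule L.tmap_functor[OF C _ lu_bilin])
 fix U V W p q p' q' g k g' k'
 assume "U : Ob L.T" "V : Ob L.T" "W : Ob L.T"
    "g : hom_set unit_dg (pfst V) (pfst W) p" "k : hom_set C (psnd V) (psnd W) q"
    "g' : hom_set unit_dg (pfst U) (pfst V) p'" "k' : hom_set C (psnd U) (psnd V) q'"
 then show "Cmp C (psnd U) (psnd V) (psnd W) (p + q) (p' + q') (lu_ar V W (p + q) p g q k) (lu_ar U V (p' + q') p' g' q' k')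
     = hscale C (psnd U) (psnd W) (p + q + (p' + q')) (koszul (q * p')) (lu_ar U W (p + q + (p' + q'))
       (p + p') (Cmp unit_dg (pfst U) (pfst V) (pfst W) p p' g g')
       (q + q') (Cmp C (psnd U) (psnd V) (psnd W) q q' k k'))"
  by (intro L.D.hv_inj[of "psnd U" "psnd W" "p + q + (p' + q')"]) (auto simp: unit_hom mult.commute split: if_splits)
next
 fix V W p q f g assume "V : Ob L.T" "W : Ob L.T" "f : hom_set unit_dg (pfst V) (pfst W) p" "g : hom_set C (psnd V) (psnd W) q"
 then show "Dif C (psnd V) (psnd W) (p + q) (lu_ar V W (p + q) p f q g)
     = hadd C (psnd V) (psnd W) (p + q + 1) (lu_ar V W (p + q + 1) (p + 1) (Dif unit_dg (pfst V) (pfst W) p f) q g)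
      (hscale C (psnd V) (psnd W) (p + q + 1) (koszul p) (lu_ar V W (p + q + 1) p f (q + 1) (Dif C (psnd V) (psnd W) q g)))"
  by (intro L.D.hv_inj[of "psnd V" "psnd W" "p + q + 1"]) (auto simp: unit_hom eq_neg_iff_add_eq_0[symmetric] L.D.hscale_zero split: if_splits)
qed (auto simp: unit_hom)

lemma tensor_runit_functor: "dg_functor R.T C (tensor_runit C)"
 unfolding tensor_runit_tmap
proof (rule R.tmap_functor[OF C _ ru_bilin])
 fix U V W p q p' q' g k g' k'
 assume "U : Ob R.T" "V : Ob R.T" "W : Ob R.T"
    "g : hom_set C (pfst V) (pfst W) p" "k : hom_set unit_dg (psnd V) (psnd W) q"
    "g' : hom_set C (pfst U) (pfst V) p'" "k' : hom_set unit_dg (psnd U) (psnd V) q'"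
 then show "Cmp C (pfst U) (pfst V) (pfst W) (p + q) (p' + q') (ru_ar V W (p + q) p g q k) (ru_ar U V (p' + q') p' g' q' k')
     = hscale C (pfst U) (pfst W) (p + q + (p' + q')) (koszul (q * p')) (ru_ar U W (p + q + (p' + q'))
       (p + p') (Cmp C (pfst U) (pfst V) (pfst W) p p' g g')
       (q + q') (Cmp unit_dg (psnd U) (psnd V) (psnd W) q q' k k'))"
  by (intro L.D.hv_inj[of "pfst U" "pfst W" "p + q + (p' + q')"]) (auto simp: unit_hom mult.commute split: if_splits)
next
 fix V W p q f g assume "V : Ob R.T" "W : Ob R.T" "f : hom_set C (pfst V) (pfst W) p" "g : hom_set unit_dg (psnd V) (psnd W) q"
 then show "Dif C (pfst V) (pfst W) (p + q) (ru_ar V W (p + q) p f q g)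
     = hadd C (pfst V) (pfst W) (p + q + 1) (ru_ar V W (p + q + 1) (p + 1) (Dif C (pfst V) (pfst W) p f) q g)
      (hscale C (pfst V) (pfst W) (p + q + 1) (koszul p) (ru_ar V W (p + q + 1) p f (q + 1) (Dif unit_dg (psnd V) (psnd W) q g)))"
  by (intro L.D.hv_inj[of "pfst V" "pfst W" "p + q + 1"]) (auto simp: unit_hom eq_neg_iff_add_eq_0[symmetric] L.D.hscale_zero split: if_splits)
qed (auto simp: unit_hom)

lemma tensor_lunit_pt: "[|V : Ob L.T; W : Ob L.T; a : hom_set unit_dg (pfst V) (pfst W) p; f : hom_set C (psnd V) (psnd W) q; n = p + q|] ==>
  far (tensor_lunit C) V W n (pure_tensor unit_dg C V W p a q f) = lu_ar V W n p a q f"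
 unfolding tensor_lunit_tmap by (rule L.tmap_pt[OF C _ lu_bilin]) simp_all
lemma tensor_runit_pt: "[|V : Ob R.T; W : Ob R.T; f : hom_set C (pfst V) (pfst W) p; a : hom_set unit_dg (psnd V) (psnd W) q; n = p + q|] ==>
  far (tensor_runit C) V W n (pure_tensor C unit_dg V W p f q a) = ru_ar V W n p f q a"
 unfolding tensor_runit_tmap by (rule R.tmap_pt[OF C _ ru_bilin]) simp_all
lemma tensor_lunit_ob: "V : Ob L.T ==> fob (tensor_lunit C) V = psnd V"
 by (simp add: tensor_lunit_def)
lemma tensor_runit_ob: "V : Ob R.T ==> fob (tensor_runit C) V = pfst V"
 by (simp add: tensor_runit_def)

end

section \<open>The Drinfeld quotient is a dg category\<close>

text \<open>This is \<open>d d = 0\<close> for the Cech differential: omitting position \<open>t\<close> and then \<open>s < t\<close> is the same as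
 omitting \<open>s\<close> and then \<open>t - 1\<close>, and the two terms carry opposite signs.\<close>

lemma double_removal_sum:
 fixes F :: "nat => nat => 'r::ab_group_add"
 assumes F: "!!s t. [|s < t; t < n|] ==> F t s = F s (t - 1)"
 shows "(\<Sum>t<n. \<Sum>s<n - 1. sg (int t + int s) (F t s)) = 0"
proof -
 let ?f = "%(t, s). sg (int t + int s) (F t s)"
 let ?A = "{(t, s). s < t & t < n}" and ?B = "{(t, s). t <= s & s < n - 1}"
 have eq: "{..<n} \<times> {..<n - 1} = ?A \<union> ?B" by auto
 have fin: "finite ?A" "finite ?B"
  by (rule finite_subset[of _ "{..<n} \<times> {..<n}"]; auto)+
 have "(\<Sum>t<n. \<Sum>s<n - 1. sg (int t + int s) (F t s)) = sum ?f (?A \<union> ?B)"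
  unfolding eq[symmetric] by (rule sum.cartesian_product)
 also have "... = sum ?f ?A + sum ?f ?B"
  by (rule sum.union_disjoint[OF fin]) auto
 also have "sum ?f ?A = sum (%x. - ?f x) ?B"
 proof (rule sum.reindex_bij_witness[where i = "%(t, s). (Suc s, t)" and j = "%(t, s). (s, t - 1)"])
  fix x assume x: "x : ?A"
  obtain t s where ts: "x = (t, s)" "s < t" "t < n" using x by auto
  then show "- ?f (case x of (t, s) => (s, t - 1)) = ?f x"
   using F[of s t] by (auto simp: sg_def of_nat_diff)
 qed auto
 finally show ?thesis by (simp add: sum_negf)
qed

definition rm :: "nat => 'b list => 'b list" where
 "rm t I = take t I @ drop (t + 1) I"

lemma length_rm [simp]: "t < length I ==> length (rm t I) = length I - 1"
 by (simp add: rm_def)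

lemma rm_nth: "t < length I ==> i < length I - 1 ==> rm t I ! i = (if i < t then I ! i else I ! Suc i)"
 by (auto simp: rm_def nth_append min_def)

lemma rm_rm: "[|s < t; t < length I|] ==> rm s (rm t I) = rm (t - 1) (rm s I)"
 by (rule nth_equalityI) (auto simp: rm_nth)

lemma set_rm: "set (rm t I) \<subseteq> set I"
 unfolding rm_def using set_take_subset set_drop_subset by fastforce

lemma eps_index_rm: "[|eps_index S X I; t < length I; length I ~= 1|] ==> eps_index S X (rm t I)"
proof -
 assume I: "eps_index S X I" and t: "t < length I" "length I ~= 1"
 have "sorted_wrt (<) (rm t I)"
  using I t by (auto simp: eps_index_def sorted_wrt_iff_nth_less rm_nth)
 moreover have "rm t I ~= []" using t length_rm[of t I] by (auto simp del: length_rm)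
 ultimately show ?thesis using I set_rm[of t I] by (auto simp: eps_index_def)
qed

lemma drinfeld_eq_Ob: "drinfeld_eq C S X Y n t u ==> X : Ob C & Y : Ob C"
 by (induction rule: drinfeld_eq.induct) auto

locale dri = dgc C for C :: "('a, 'k::field) dg" +
 fixes S :: "('a, 'k) univ set list"
begin

abbreviation "Q == drinfeld (C, S)"
abbreviation "DE == drinfeld_eq C S"
abbreviation "ty X Y n t == DE X Y n t t"

lemma Q_simps: "Ob Q = Ob C" "Hom Q X Y n = quot_module (DE X Y n) (Incl (hzero C X Y n))"
 "Id Q X = rep (DE X X 0) (Incl (Id C X))"
 "Cmp Q X Y Z m n t u = rep (DE X Z (m + n)) (Comp Y m n t u)"
 "Dif Q X Y n t = rep (DE X Y (n + 1)) (drinfeld_dif C X Y n t)"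
 by (simp_all add: drinfeld_def)

declare Q_simps(1) [simp]

lemma linper: assumes [simp]: "X : Ob C" "Y : Ob C" shows "linper (DE X Y n) (Incl (hzero C X Y n))"
proof
 show "DE X Y n (Incl (hzero C X Y n)) (FScale 0 (Incl (hzero C X Y n)))"
  using drinfeld_eq.incl_scale[of X C Y "hzero C X Y n" n S 0] by (simp add: hscale_zero)
qed (fact drinfeld_eq.sym drinfeld_eq.trans drinfeld_eq.sum_cong drinfeld_eq.scale_cong drinfeld_eq.sum_assoc
 drinfeld_eq.sum_comm drinfeld_eq.sum_zero drinfeld_eq.scale_sum drinfeld_eq.scale_add drinfeld_eq.scale_mult
 drinfeld_eq.scale_one)+

lemma ty_Ob: "ty X Y n t ==> X : Ob C" "ty X Y n t ==> Y : Ob C"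
 using drinfeld_eq_Ob by blast+

lemma ty_left: "DE X Y n t u ==> ty X Y n t" and ty_right: "DE X Y n t u ==> ty X Y n u"
 using drinfeld_eq.trans[OF _ drinfeld_eq.sym] drinfeld_eq.trans[OF drinfeld_eq.sym] by blast+

lemma linper_ty: "ty X Y n t ==> linper (DE X Y n) (Incl (hzero C X Y n))"
 using linper ty_Ob by blast

abbreviation "cl X Y n t == rep (DE X Y n) t"

lemma kmod_Q: "[|X : Ob C; Y : Ob C|] ==> kmod (Hom Q X Y n)"
 unfolding Q_simps by (rule kmod.intro) (rule linper.quot_module[OF linper])

lemma cl_closed: "ty X Y n t ==> cl X Y n t : hom_set Q X Y n"
 unfolding Q_simps using linper.rep_closed[OF linper_ty] by blast

lemma cl_eq: "DE X Y n t u ==> cl X Y n t = cl X Y n u"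
 using linper.rep_cong[OF linper_ty] ty_left by blast

lemma cl_eqD: "[|cl X Y n t = cl X Y n u; ty X Y n t; ty X Y n u|] ==> DE X Y n t u"
 using linper.rep_eq_iff[OF linper_ty] by blast

lemma cl_rel: "ty X Y n t ==> DE X Y n (cl X Y n t) t"
 using linper.rep_rel(2)[OF linper_ty] by blast

lemma homE: assumes "x : hom_set Q X Y n" "X : Ob C" "Y : Ob C" obtains t where "ty X Y n t" "x = cl X Y n t"
 using linper.carrierE[OF linper[OF assms(2,3)], of x n] assms(1) unfolding Q_simps by blast

lemma cl_sum: "[|ty X Y n t; ty X Y n u|] ==> cl X Y n (FSum t u) = hadd Q X Y n (cl X Y n t) (cl X Y n u)"
 unfolding Q_simps using linper.add_rep[OF linper_ty] by metis
lemma cl_scale: "ty X Y n t ==> cl X Y n (FScale c t) = hscale Q X Y n c (cl X Y n t)"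
 unfolding Q_simps using linper.smult_rep[OF linper_ty] by metis
lemma cl_comp: "[|ty Y Z m t; ty X Y n u|] ==> cl X Z (m + n) (Comp Y m n t u) = Cmp Q X Y Z m n (cl Y Z m t) (cl X Y n u)"
 unfolding Q_simps using cl_eq[OF drinfeld_eq.comp_cong[OF cl_rel cl_rel]] by metis

lemma ty_intros:
 "[|X : Ob C; Y : Ob C; f : hom_set C X Y n|] ==> ty X Y n (Incl f)"
 "[|X : Ob C; eps_index S X I; k = - len I|] ==> ty X X k (Eps X I)"
 "[|ty X Y n t; ty X Y n u|] ==> ty X Y n (FSum t u)"
 "ty X Y n t ==> ty X Y n (FScale c t)"
 "[|ty Y Z m t; ty X Y n u; k = m + n|] ==> ty X Z k (Comp Y m n t u)"
 by (auto intro: drinfeld_eq.intros)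

text \<open>Equivalence of expressions is equality of these values (\<open>ev_eqD\<close>), which are computed by rewriting.\<close>

definition ev :: "('a, 'k) univ => ('a, 'k) univ => int => ('a, 'k) univ => (('a, 'k) univ => 'k) => 'k" where
 "ev X Y n t = hv Q X Y n (cl X Y n t)"

lemma ev_eq: "DE X Y n t u ==> ev X Y n t = ev X Y n u"
 by (simp add: ev_def cl_eq)

lemma ev_eqD: "[|ev X Y n t = ev X Y n u; ty X Y n t; ty X Y n u|] ==> DE X Y n t u"
 unfolding ev_def hv_def using kmod.emb_inj[OF kmod_Q cl_closed cl_closed] cl_eqD ty_Ob by blast

lemma ev_sum: "[|ty X Y n t; ty X Y n u|] ==> ev X Y n (FSum t u) = ev X Y n t + ev X Y n u"
 unfolding ev_def hv_def using kmod.emb_add[OF kmod_Q cl_closed cl_closed] cl_sum ty_Ob by metis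
lemma ev_scale: "ty X Y n t ==> ev X Y n (FScale c t) = fsc c (ev X Y n t)"
 unfolding ev_def hv_def using kmod.emb_smult[OF kmod_Q cl_closed] cl_scale ty_Ob by metis

lemma ev_comp_sum:
 "[|ty Y Z m t; ty Y Z m t'; ty X Y n u; k = m + n|] ==>
  ev X Z k (Comp Y m n (FSum t t') u) = ev X Z k (Comp Y m n t u) + ev X Z k (Comp Y m n t' u)"
 "[|ty Y Z m t; ty X Y n u; ty X Y n u'; k = m + n|] ==>
  ev X Z k (Comp Y m n t (FSum u u')) = ev X Z k (Comp Y m n t u) + ev X Z k (Comp Y m n t u')"
 by (simp_all add: ev_eq[OF drinfeld_eq.comp_sum_left] ev_eq[OF drinfeld_eq.comp_sum_right] ev_sum ty_intros)

lemma ev_comp_scale: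
 "[|ty Y Z m t; ty X Y n u; k = m + n|] ==> ev X Z k (Comp Y m n (FScale c t) u) = fsc c (ev X Z k (Comp Y m n t u))"
 "[|ty Y Z m t; ty X Y n u; k = m + n|] ==> ev X Z k (Comp Y m n t (FScale c u)) = fsc c (ev X Z k (Comp Y m n t u))"
 by (simp_all add: ev_eq[OF drinfeld_eq.comp_scale_left] ev_eq[OF drinfeld_eq.comp_scale_right] ev_scale ty_intros)

lemma ev_comp_assoc:
 "[|ty Y Z l t; ty X Y m u; ty W X n v; k = l + m; k' = l + m + n|] ==>
  ev W Z k' (Comp X k n (Comp Y l m t u) v) = ev W Z k' (Comp Y l (m + n) t (Comp X m n u v))"
 using ev_eq[OF drinfeld_eq.comp_assoc[of C S Y Z l t X m u W n v]] by simp

lemma ev_comp_id: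
 "ty X Y n t ==> ev X Y n (Comp Y 0 n (Incl (Id C Y)) t) = ev X Y n t"
 "ty X Y n t ==> ev X Y n (Comp X n 0 t (Incl (Id C X))) = ev X Y n t"
 by (simp_all add: ev_eq[OF drinfeld_eq.comp_id_left] ev_eq[OF drinfeld_eq.comp_id_right])

lemma ev_incl_add: "[|X : Ob C; Y : Ob C; f : hom_set C X Y n; g : hom_set C X Y n|] ==>
  ev X Y n (Incl (hadd C X Y n f g)) = ev X Y n (Incl f) + ev X Y n (Incl g)"
 by (simp add: ev_eq[OF drinfeld_eq.incl_add] ev_sum ty_intros)
lemma ev_incl_scale: "[|X : Ob C; Y : Ob C; f : hom_set C X Y n|] ==>
  ev X Y n (Incl (hscale C X Y n c f)) = fsc c (ev X Y n (Incl f))"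
 by (simp add: ev_eq[OF drinfeld_eq.incl_scale] ev_scale ty_intros)
lemma ev_incl_zero: "[|X : Ob C; Y : Ob C|] ==> ev X Y n (Incl (hzero C X Y n)) = 0"
 using ev_incl_scale[of X Y "hzero C X Y n" n 0] by (simp add: hscale_zero)
lemma ev_incl_comp: "[|X : Ob C; Y : Ob C; Z : Ob C; g : hom_set C Y Z m; f : hom_set C X Y n; k = m + n|] ==>
  ev X Z k (Comp Y m n (Incl g) (Incl f)) = ev X Z k (Incl (Cmp C X Y Z m n g f))"
 by (simp add: ev_eq[OF drinfeld_eq.incl_comp])

lemma ev_comp_zero:
 "[|ty X Y n t; Z : Ob C; k = m + n|] ==> ev X Z k (Comp Y m n (Incl (hzero C Y Z m)) t) = 0"
 "[|ty Y Z m t; X : Ob C; k = m + n|] ==> ev X Z k (Comp Y m n t (Incl (hzero C X Y n))) = 0"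
proof -
 assume t: "ty X Y n t" "Z : Ob C" "k = m + n"
 have z: "DE Y Z m (Incl (hzero C Y Z m)) (FScale 0 (Incl (hzero C Y Z m)))"
  using linper.zero[OF linper] t ty_Ob by blast
 have "ev X Z k (Comp Y m n (Incl (hzero C Y Z m)) t) = ev X Z k (Comp Y m n (FScale 0 (Incl (hzero C Y Z m))) t)"
  using ev_eq[OF drinfeld_eq.comp_cong[OF z t(1)]] t(3) by simp
 also have "... = 0" using t ty_left[OF z] by (simp add: ev_comp_scale)
 finally show "ev X Z k (Comp Y m n (Incl (hzero C Y Z m)) t) = 0" .
next
 assume t: "ty Y Z m t" "X : Ob C" "k = m + n"
 have z: "DE X Y n (Incl (hzero C X Y n)) (FScale 0 (Incl (hzero C X Y n)))"
  using linper.zero[OF linper] t ty_Ob by blast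
 have "ev X Z k (Comp Y m n t (Incl (hzero C X Y n))) = ev X Z k (Comp Y m n t (FScale 0 (Incl (hzero C X Y n))))"
  using ev_eq[OF drinfeld_eq.comp_cong[OF t(1) z]] t(3) by simp
 also have "... = 0" using t ty_left[OF z] by (simp add: ev_comp_scale)
 finally show "ev X Z k (Comp Y m n t (Incl (hzero C X Y n))) = 0" .
qed

lemmas ev_simps = ev_sum ev_scale ev_comp_sum ev_comp_scale ev_comp_assoc ev_comp_id ev_incl_add ev_incl_scale
 ev_incl_zero ev_incl_comp ev_comp_zero

sublocale Q: gcat Q
proof (rule gcat.intro)
 fix X Y n assume XY: "X : Ob Q" "Y : Ob Q"
 then show "Module.module scalars (Hom Q X Y n)" using kmod_Q[of X Y n] kmod.kmod by simp
next
 fix X assume "X : Ob Q"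
 then show "Id Q X : hom_set Q X X 0" unfolding Q_simps(3) by (intro cl_closed ty_intros) simp_all
next
 fix X Y Z m n f assume "X : Ob Q" "Y : Ob Q" "Z : Ob Q" and f: "f : hom_set Q X Y n"
 then have Ob: "X : Ob C" "Y : Ob C" "Z : Ob C" by simp_all
 obtain u where u: "ty X Y n u" "f = cl X Y n u" using homE[OF f] Ob by blast
 show "linear_map (Hom Q Y Z m) (Hom Q X Z (m + n)) (%g. Cmp Q X Y Z m n g f)"
  unfolding linear_map_def
 proof (intro conjI ballI allI)
  fix a assume "a : hom_set Q Y Z m" then obtain t where t: "ty Y Z m t" "a = cl Y Z m t" using homE Ob by blast
  show "Cmp Q X Y Z m n a f : hom_set Q X Z (m + n)" using t u by (simp add: cl_comp[symmetric] cl_closed ty_intros)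
  show "Cmp Q X Y Z m n (hscale Q Y Z m c a) f = hscale Q X Z (m + n) c (Cmp Q X Y Z m n a f)" for c
   using t u by (simp add: cl_comp[symmetric] cl_scale[symmetric] ty_intros cl_eq[OF drinfeld_eq.comp_scale_left])
  fix b assume "b : hom_set Q Y Z m" then obtain t' where t': "ty Y Z m t'" "b = cl Y Z m t'" using homE Ob by blast
  show "Cmp Q X Y Z m n (hadd Q Y Z m a b) f = hadd Q X Z (m + n) (Cmp Q X Y Z m n a f) (Cmp Q X Y Z m n b f)"
   using t t' u by (simp add: cl_comp[symmetric] cl_sum[symmetric] ty_intros cl_eq[OF drinfeld_eq.comp_sum_left])
 qed
next
 fix X Y Z m n f assume "X : Ob Q" "Y : Ob Q" "Z : Ob Q" and f: "f : hom_set Q Y Z m"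
 then have Ob: "X : Ob C" "Y : Ob C" "Z : Ob C" by simp_all
 obtain u where u: "ty Y Z m u" "f = cl Y Z m u" using homE[OF f] Ob by blast
 show "linear_map (Hom Q X Y n) (Hom Q X Z (m + n)) (%g. Cmp Q X Y Z m n f g)"
  unfolding linear_map_def
 proof (intro conjI ballI allI)
  fix a assume "a : hom_set Q X Y n" then obtain t where t: "ty X Y n t" "a = cl X Y n t" using homE Ob by blast
  show "Cmp Q X Y Z m n f a : hom_set Q X Z (m + n)" using t u by (simp add: cl_comp[symmetric] cl_closed ty_intros)
  show "Cmp Q X Y Z m n f (hscale Q X Y n c a) = hscale Q X Z (m + n) c (Cmp Q X Y Z m n f a)" for c
   using t u by (simp add: cl_comp[symmetric] cl_scale[symmetric] ty_intros cl_eq[OF drinfeld_eq.comp_scale_right])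
  fix b assume "b : hom_set Q X Y n" then obtain t' where t': "ty X Y n t'" "b = cl X Y n t'" using homE Ob by blast
  show "Cmp Q X Y Z m n f (hadd Q X Y n a b) = hadd Q X Z (m + n) (Cmp Q X Y Z m n f a) (Cmp Q X Y Z m n f b)"
   using t t' u by (simp add: cl_comp[symmetric] cl_sum[symmetric] ty_intros cl_eq[OF drinfeld_eq.comp_sum_right])
 qed
next
 fix W X Y Z l m n h g f
 assume "W : Ob Q" "X : Ob Q" "Y : Ob Q" "Z : Ob Q"
  and hgf: "h : hom_set Q Y Z l" "g : hom_set Q X Y m" "f : hom_set Q W X n"
 then have Ob: "W : Ob C" "X : Ob C" "Y : Ob C" "Z : Ob C" by simp_all
 obtain t u v where t: "ty Y Z l t" "h = cl Y Z l t" and u: "ty X Y m u" "g = cl X Y m u" and v: "ty W X n v" "f = cl W X n v"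
  using homE[OF hgf(1) Ob(3,4)] homE[OF hgf(2) Ob(2,3)] homE[OF hgf(3) Ob(1,2)] by metis
 show "Cmp Q W Y Z l (m + n) h (Cmp Q W X Y m n g f) = Cmp Q W X Z (l + m) n (Cmp Q X Y Z l m h g) f"
  using t u v cl_eq[OF drinfeld_eq.comp_assoc[OF t(1) u(1) v(1)]] cl_comp[OF t(1) ty_intros(5)[OF u(1) v(1) refl]]
  by (simp add: cl_comp[symmetric] ty_intros add.assoc[symmetric])
next
 fix X Y n f assume "X : Ob Q" "Y : Ob Q" and f: "f : hom_set Q X Y n"
 then have Ob: "X : Ob C" "Y : Ob C" by simp_all
 obtain t where t: "ty X Y n t" "f = cl X Y n t" using homE[OF f Ob] by metis
 have i: "ty X X 0 (Incl (Id C X))" "ty Y Y 0 (Incl (Id C Y))" using Ob by (simp_all add: ty_intros)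
 show "Cmp Q X Y Y 0 n (Id Q Y) f = f"
  using t cl_eq[OF drinfeld_eq.comp_id_left[OF t(1)]] cl_comp[OF i(2) t(1)] by (simp add: Q_simps(3))
 show "Cmp Q X X Y n 0 f (Id Q X) = f"
  using t cl_eq[OF drinfeld_eq.comp_id_right[OF t(1)]] cl_comp[OF t(1) i(1)] by (simp add: Q_simps(3))
qed

subsection \<open>The differential\<close>

lemma eps_expr_ty: "[|X : Ob C; I = [] | eps_index S X I; k = - len I|] ==> ty X X k (eps_expr C X I)"
 by (auto simp: eps_expr_def intro!: ty_intros)

lemma valid_rm: "[|I = [] | eps_index S X I; t < length I|] ==> rm t I = [] | eps_index S X (rm t I)"
proof (cases "length I = 1")
 assume "t < length I" "length I = 1"
 then have "length (rm t I) = 0" by simp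
 then show ?thesis by blast
next
 assume "I = [] | eps_index S X I" "t < length I" "length I ~= 1"
 then show ?thesis using eps_index_rm[of S X I t] by (metis less_zeroE list.size(3))
qed

lemma foldr_FSum:
 assumes "!!t. t : set ts ==> ty X Y n (f t)" and "ty X Y n z"
 shows "ty X Y n (foldr FSum (map f ts) z) & ev X Y n (foldr FSum (map f ts) z) = (\<Sum>t\<leftarrow>ts. ev X Y n (f t)) + ev X Y n z"
 using assms by (induction ts) (auto simp: ev_sum algebra_simps intro: ty_intros)

lemma dif_Eps:
 assumes X: "X : Ob C" and I: "eps_index S X I" and k: "k = - len I"
 shows "ty X X (k + 1) (drinfeld_dif C X X k (Eps X I))"
  and "ev X X (k + 1) (drinfeld_dif C X X k (Eps X I)) =
   (\<Sum>t<length I. sg (len I - int (t + 1)) (ev X X (k + 1) (eps_expr C X (rm t I))))"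
proof -
 have t: "ty X X (k + 1) (eps_expr C X (rm t I))" if "t < length I" for t
  by (rule eps_expr_ty[OF X valid_rm]) (use that I k in auto)
 have z: "ty X X (k + 1) (Incl (hzero C X X (k + 1)))" using X by (intro ty_intros) auto
 let ?f = "%t. FScale (koszul (len I - int (t + 1))) (eps_expr C X (rm t I))"
 have f: "ty X X (k + 1) (?f t)" if "t : set [0..<length I]" for t
  using t[of t] that by (intro ty_intros) auto
 have d: "drinfeld_dif C X X k (Eps X I) = foldr FSum (map ?f [0..<length I]) (Incl (hzero C X X (k + 1)))"
  by (simp add: rm_def)
 note * = foldr_FSum[of "[0..<length I]" X X "k + 1" ?f, OF f z]
 show "ty X X (k + 1) (drinfeld_dif C X X k (Eps X I))" using * unfolding d by blast
 have "ev X X (k + 1) (drinfeld_dif C X X k (Eps X I)) = (\<Sum>t\<leftarrow>[0..<length I]. ev X X (k + 1) (?f t))"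
  using * X unfolding d by (simp add: ev_incl_zero)
 also have "... = (\<Sum>t<length I. ev X X (k + 1) (?f t))"
  by (simp add: interv_sum_list_conv_sum_set_nat atLeast0LessThan)
 also have "... = (\<Sum>t<length I. sg (len I - int (t + 1)) (ev X X (k + 1) (eps_expr C X (rm t I))))"
  by (rule sum.cong) (auto simp: ev_scale t)
 finally show "ev X X (k + 1) (drinfeld_dif C X X k (Eps X I)) = ..." .
qed

lemma dif_sound: "DE X Y n t u ==> DE X Y (n + 1) (drinfeld_dif C X Y n t) (drinfeld_dif C X Y n u)"
proof (induction rule: drinfeld_eq.induct)
 case (comp_cong Y Z m t t' X n u u')
 have "DE X Z (m + 1 + n) (Comp Y (m + 1) n (drinfeld_dif C Y Z m t) u) (Comp Y (m + 1) n (drinfeld_dif C Y Z m t') u')"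
  using comp_cong by (intro drinfeld_eq.comp_cong)
 moreover have "DE X Z (m + (n + 1)) (Comp Y m (n + 1) t (drinfeld_dif C X Y n u)) (Comp Y m (n + 1) t' (drinfeld_dif C X Y n u'))"
  using comp_cong by (intro drinfeld_eq.comp_cong)
 ultimately show ?case by (auto simp: algebra_simps intro!: drinfeld_eq.sum_cong drinfeld_eq.scale_cong)
next
 case (comp_sum_left Y Z m t t' X n u)
 then show ?case by - (rule ev_eqD, simp_all add: ev_simps ty_intros algebra_simps)
next
 case (comp_sum_right Y Z m t X n u u')
 then show ?case by - (rule ev_eqD, simp_all add: ev_simps ty_intros algebra_simps)
next
 case (comp_scale_left Y Z m t X n u c)
 then show ?case by - (rule ev_eqD, simp_all add: ev_simps ty_intros algebra_simps)
next
 case (comp_scale_right Y Z m t X n u c)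
 then show ?case by - (rule ev_eqD, simp_all add: ev_simps ty_intros algebra_simps)
next
 case (comp_assoc Y Z l t X m u W n v)
 then show ?case by - (rule ev_eqD, simp_all add: ev_simps ty_intros algebra_simps)
next
 case (comp_id_left X Y n t)
 then show ?case by - (rule ev_eqD, simp_all add: ev_simps ty_intros ty_Ob[OF comp_id_left.hyps] algebra_simps koszul_def)
next
 case (comp_id_right X Y n t)
 then show ?case by - (rule ev_eqD, simp_all add: ev_simps ty_intros ty_Ob[OF comp_id_right.hyps] algebra_simps)
next
 case (incl_comp X Y Z g m f n)
 then show ?case by - (rule ev_eqD, simp_all add: ev_simps ty_intros dif_cmp algebra_simps)
next
 case (eps X I)
 then show ?case using dif_Eps(1) by blast
qed (auto intro: drinfeld_eq.intros)

lemma dif_ty: "ty X Y n t ==> ty X Y (n + 1) (drinfeld_dif C X Y n t)"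
 by (rule dif_sound)

lemma cl_dif: "ty X Y n t ==> cl X Y (n + 1) (drinfeld_dif C X Y n t) = Dif Q X Y n (cl X Y n t)"
 unfolding Q_simps using cl_eq[OF dif_sound[OF cl_rel]] by metis

subsection \<open>Generators\<close>

definition inc :: "('a, 'k) univ => ('a, 'k) univ => int => ('a, 'k) univ => ('a, 'k) univ" where
 "inc X Y n f = cl X Y n (Incl f)"

definition eb :: "('a, 'k) univ => nat list => ('a, 'k) univ" where
 "eb X I = cl X X (- len I) (eps_expr C X I)"

definition valid :: "('a, 'k) univ => nat list => bool" where
 "valid X I \<longleftrightarrow> X : Ob C & (I = [] | eps_index S X I)"

lemma valid_Ob: "valid X I ==> X : Ob C"
 by (simp add: valid_def)
lemma valid_Nil [simp]: "valid X [] \<longleftrightarrow> X : Ob C"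
 by (simp add: valid_def)
lemma valid_rm': "[|valid X I; t < length I|] ==> valid X (rm t I)"
 unfolding valid_def using valid_rm by blast

lemma eb_Nil: "eb X [] = Id Q X"
 by (simp add: eb_def eps_expr_def Q_simps)
lemma eb_closed: "[|valid X I; k = - len I|] ==> eb X I : hom_set Q X X k"
 unfolding eb_def valid_def by (simp add: cl_closed eps_expr_ty)
lemma inc_closed: "[|X : Ob C; Y : Ob C; f : hom_set C X Y n|] ==> inc X Y n f : hom_set Q X Y n"
 unfolding inc_def by (intro cl_closed ty_intros)

lemma Q_induct [consumes 3, case_names inc eps cmp add scale]:
 assumes x: "X : Ob C" "Y : Ob C" "x : hom_set Q X Y n"
  and inc: "!!X Y n f. [|X : Ob C; Y : Ob C; f : hom_set C X Y n|] ==> P X Y n (inc X Y n f)"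
  and eps: "!!X I. [|X : Ob C; eps_index S X I|] ==> P X X (- len I) (eb X I)"
  and cmp: "!!X Y Z m n g f. [|X : Ob C; Y : Ob C; Z : Ob C; g : hom_set Q Y Z m; f : hom_set Q X Y n;
    P Y Z m g; P X Y n f|] ==> P X Z (m + n) (Cmp Q X Y Z m n g f)"
  and add: "!!X Y n g f. [|X : Ob C; Y : Ob C; g : hom_set Q X Y n; f : hom_set Q X Y n;
    P X Y n g; P X Y n f|] ==> P X Y n (hadd Q X Y n g f)"
  and scale: "!!X Y n c f. [|X : Ob C; Y : Ob C; f : hom_set Q X Y n;
    P X Y n f|] ==> P X Y n (hscale Q X Y n c f)"
 shows "P X Y n x"
proof -
 have I: "P X Y n (cl X Y n (Incl f))" if "X : Ob C" "Y : Ob C" "f : hom_set C X Y n" for X Y n f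
  using inc[OF that] by (simp add: inc_def)
 have E: "P X X (- len I) (cl X X (- len I) (Eps X I))" if "X : Ob C" "eps_index S X I" for X I
  using eps[OF that] that by (auto simp: eb_def eps_expr_def eps_index_def)
 have A: "P X Y n (cl X Y n (FSum t u))" if "ty X Y n t" "ty X Y n u" "P X Y n (cl X Y n t)" "P X Y n (cl X Y n u)" for X Y n t u
  using add[of X Y "cl X Y n t" n "cl X Y n u"] that ty_Ob[OF that(1)] by (simp add: cl_sum cl_closed)
 have K: "P X Y n (cl X Y n (FScale c t))" if "ty X Y n t" "P X Y n (cl X Y n t)" for X Y n t c
  using scale[of X Y "cl X Y n t" n c] that ty_Ob[OF that(1)] by (simp add: cl_scale cl_closed)
 have M: "P X Z k (cl X Z k (Comp Y m n t u))"
  if "ty Y Z m t" "ty X Y n u" "P Y Z m (cl Y Z m t)" "P X Y n (cl X Y n u)" "k = m + n" for X Y Z m n t u k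
  using cmp[of X Y Z "cl Y Z m t" m "cl X Y n u" n] that ty_Ob[OF that(1)] ty_Ob[OF that(2)] by (simp add: cl_comp cl_closed)
 have *: "P X Y n (cl X Y n t) & P X Y n (cl X Y n u)" if "DE X Y n t u" for X Y n t u
  using that
 proof (induction rule: drinfeld_eq.induct)
  case (sum_cong X Y n t t' u u')
  then show ?case using A ty_left ty_right by blast
 next
  case (scale_cong X Y n t t' c)
  then show ?case using K ty_left ty_right by blast
 next
  case (comp_cong Y Z m t t' X n u u')
  then show ?case using M[OF _ _ _ _ refl] ty_left ty_right by blast
 qed (simp_all add: I E A K M ty_intros drinfeld_eq_Ob)
 obtain t where "ty X Y n t" "x = cl X Y n t" using homE[OF x(3,1,2)] by metis
 then show ?thesis using * by blast
qed

lemma difQ_lin: "[|X : Ob C; Y : Ob C|] ==> linear_map (Hom Q X Y n) (Hom Q X Y (n + 1)) (Dif Q X Y n)"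
 unfolding linear_map_def
proof (intro conjI ballI allI)
 assume Ob: "X : Ob C" "Y : Ob C"
 fix a assume "a : hom_set Q X Y n" then obtain t where t: "ty X Y n t" "a = cl X Y n t" using homE Ob by blast
 show "Dif Q X Y n a : hom_set Q X Y (n + 1)" using t by (simp add: cl_dif[symmetric] cl_closed dif_ty)
 show "Dif Q X Y n (hscale Q X Y n c a) = hscale Q X Y (n + 1) c (Dif Q X Y n a)" for c
  using t by (simp add: cl_dif[symmetric] cl_scale[symmetric] ty_intros dif_ty)
 fix b assume "b : hom_set Q X Y n" then obtain u where u: "ty X Y n u" "b = cl X Y n u" using homE Ob by blast
 show "Dif Q X Y n (hadd Q X Y n a b) = hadd Q X Y (n + 1) (Dif Q X Y n a) (Dif Q X Y n b)"
  using t u by (simp add: cl_dif[symmetric] cl_sum[symmetric] ty_intros dif_ty)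
qed

lemma difQ_inc: "[|X : Ob C; Y : Ob C; f : hom_set C X Y n|] ==> Dif Q X Y n (inc X Y n f) = inc X Y (n + 1) (Dif C X Y n f)"
 by (simp add: inc_def cl_dif[symmetric] ty_intros)

lemma hv_difQ_eb:
 assumes "valid X I"
 shows "hv Q X X (1 - len I) (Dif Q X X (- len I) (eb X I)) =
  (\<Sum>t<length I. sg (len I - int (t + 1)) (hv Q X X (1 - len I) (eb X (rm t I))))"
proof (cases "I = []")
 case True
 then have "Dif Q X X 0 (Id Q X) = cl X X (0 + 1) (drinfeld_dif C X X 0 (Incl (Id C X)))"
  using assms by (subst cl_dif) (auto simp: Q_simps intro: ty_intros)
 also have "... = cl X X 1 (Incl (hzero C X X 1))" using assms True by simp
 finally show ?thesis using True assms ev_incl_zero[of X X 1] by (simp add: eb_Nil ev_def)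
next
 case False
 then have X: "X : Ob C" and I: "eps_index S X I" using assms by (auto simp: valid_def)
 have e: "eb X I = cl X X (- len I) (Eps X I)" using False by (simp add: eb_def eps_expr_def)
 have r: "ev X X (1 - len I) (eps_expr C X (rm t I)) = hv Q X X (1 - len I) (eb X (rm t I))" if "t < length I" for t
 proof -
  have "- len (rm t I) = 1 - len I" using that by simp
  then show ?thesis by (simp only: ev_def eb_def)
 qed
 have "hv Q X X (1 - len I) (Dif Q X X (- len I) (eb X I)) =
  ev X X (- len I + 1) (drinfeld_dif C X X (- len I) (Eps X I))"
  unfolding e using cl_dif[OF ty_intros(2)[OF X I refl]] by (simp add: ev_def del: drinfeld_dif.simps)
 also have "... = (\<Sum>t<length I. sg (len I - int (t + 1)) (ev X X (1 - len I) (eps_expr C X (rm t I))))"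
  using dif_Eps(2)[OF X I refl] by (simp del: drinfeld_dif.simps)
 also have "... = (\<Sum>t<length I. sg (len I - int (t + 1)) (hv Q X X (1 - len I) (eb X (rm t I))))"
  by (rule sum.cong) (auto simp: r)
 finally show ?thesis .
qed

lemma difQ_cmp: "[|X : Ob C; Y : Ob C; Z : Ob C; g : hom_set Q Y Z m; f : hom_set Q X Y n|] ==>
    Dif Q X Z (m + n) (Cmp Q X Y Z m n g f)
     = hadd Q X Z (m + n + 1)
       (Cmp Q X Y Z (m + 1) n (Dif Q Y Z m g) f)
       (hscale Q X Z (m + n + 1) (koszul m) (Cmp Q X Y Z m (n + 1) g (Dif Q X Y n f)))"
proof -
 assume Ob: "X : Ob C" "Y : Ob C" "Z : Ob C" and gf: "g : hom_set Q Y Z m" "f : hom_set Q X Y n"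
 obtain t where t: "ty Y Z m t" "g = cl Y Z m t" using homE[OF gf(1) Ob(2,3)] .
 obtain u where u: "ty X Y n u" "f = cl X Y n u" using homE[OF gf(2) Ob(1,2)] .
 have 1: "Cmp Q X Y Z (m + 1) n (Dif Q Y Z m g) f = cl X Z (m + n + 1) (Comp Y (m + 1) n (drinfeld_dif C Y Z m t) u)"
  unfolding t(2) u(2) cl_dif[OF t(1), symmetric] using cl_comp[OF dif_ty[OF t(1)] u(1)] by (simp add: ac_simps)
 have 2: "Cmp Q X Y Z m (n + 1) g (Dif Q X Y n f) = cl X Z (m + n + 1) (Comp Y m (n + 1) t (drinfeld_dif C X Y n u))"
  unfolding t(2) u(2) cl_dif[OF u(1), symmetric] using cl_comp[OF t(1) dif_ty[OF u(1)]] by (simp add: ac_simps)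
 have ty1: "ty X Z (m + n + 1) (Comp Y (m + 1) n (drinfeld_dif C Y Z m t) u)"
  by (rule ty_intros(5)[OF dif_ty[OF t(1)] u(1)]) simp
 have ty2: "ty X Z (m + n + 1) (Comp Y m (n + 1) t (drinfeld_dif C X Y n u))"
  by (rule ty_intros(5)[OF t(1) dif_ty[OF u(1)]]) simp
 have "Dif Q X Z (m + n) (Cmp Q X Y Z m n g f) = cl X Z (m + n + 1) (drinfeld_dif C X Z (m + n) (Comp Y m n t u))"
  using t u by (simp add: cl_comp[symmetric] cl_dif[symmetric] ty_intros del: drinfeld_dif.simps)
 also have "... = hadd Q X Z (m + n + 1)
       (Cmp Q X Y Z (m + 1) n (Dif Q Y Z m g) f)
       (hscale Q X Z (m + n + 1) (koszul m) (Cmp Q X Y Z m (n + 1) g (Dif Q X Y n f)))"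
  unfolding 1 2 by (simp add: cl_sum[symmetric] cl_scale[symmetric] ty1 ty2 ty_intros)
 finally show ?thesis .
qed

lemma difQ_closed: "[|X : Ob C; Y : Ob C; f : hom_set Q X Y n; k = n + 1|] ==> Dif Q X Y n f : hom_set Q X Y k"
 using difQ_lin[of X Y n] by (auto simp: linear_map_def)

lemma difQ_add: "[|X : Ob C; Y : Ob C; f : hom_set Q X Y n; g : hom_set Q X Y n|] ==>
  Dif Q X Y n (hadd Q X Y n f g) = hadd Q X Y (n + 1) (Dif Q X Y n f) (Dif Q X Y n g)"
 and difQ_scale: "[|X : Ob C; Y : Ob C; f : hom_set Q X Y n|] ==>
  Dif Q X Y n (hscale Q X Y n c f) = hscale Q X Y (n + 1) c (Dif Q X Y n f)"
 using difQ_lin[of X Y n] by (auto simp: linear_map_def)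

lemma hv_difQ_cmp:
 assumes "X : Ob C" "Y : Ob C" "Z : Ob C" "g : hom_set Q Y Z m" "f : hom_set Q X Y n" and k: "k = m + n" and k': "k' = m + n + 1"
 shows "hv Q X Z k' (Dif Q X Z k (Cmp Q X Y Z m n g f)) = hv Q X Z k' (Cmp Q X Y Z (m + 1) n (Dif Q Y Z m g) f)
  + sg m (hv Q X Z k' (Cmp Q X Y Z m (n + 1) g (Dif Q X Y n f)))"
 unfolding k k' using assms by (simp add: difQ_cmp difQ_closed)

text \<open>The differentials of the \<open>\<epsilon>\<close>'s are known only as sums in double duals. A linear map can nevertheless
 be applied term by term, because the partial sums come from morphisms.\<close>

lemma hv_linear_sum:
 fixes N :: nat
 assumes Ob: "X : Ob C" "Y : Ob C" and E: "gcat E" "X' : Ob E" "Y' : Ob E"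
  and lin: "linear_map (Hom Q X Y n) (Hom E X' Y' m) h"
  and x: "x : hom_set Q X Y n" and y: "!!t. t < N ==> y t : hom_set Q X Y n"
  and eq: "hv Q X Y n x = (\<Sum>t<N. sg (s t) (hv Q X Y n (y t)))"
 shows "hv E X' Y' m (h x) = (\<Sum>t<N. sg (s t) (hv E X' Y' m (h (y t))))"
proof -
 interpret E: gcat E by fact
 have *: "EX z:hom_set Q X Y n. hv Q X Y n z = (\<Sum>t<k. sg (s t) (hv Q X Y n (y t))) &
   hv E X' Y' m (h z) = (\<Sum>t<k. sg (s t) (hv E X' Y' m (h (y t))))" if "k <= N" for k
  using that
 proof (induction k)
  case 0
  have "h (hscale Q X Y n 0 (hzero Q X Y n)) = hscale E X' Y' m 0 (h (hzero Q X Y n))" "h (hzero Q X Y n) : hom_set E X' Y' m"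
   using lin Ob by (auto simp: linear_map_def)
  then have "h (hzero Q X Y n) = hzero E X' Y' m" using Ob E by (simp add: Q.hscale_zero E.hscale_zero)
  then show ?case using Ob E by (intro bexI[of _ "hzero Q X Y n"]) simp_all
 next
  case (Suc k)
  then obtain z where z: "z : hom_set Q X Y n" "hv Q X Y n z = (\<Sum>t<k. sg (s t) (hv Q X Y n (y t)))"
    "hv E X' Y' m (h z) = (\<Sum>t<k. sg (s t) (hv E X' Y' m (h (y t))))" by auto
  have yk: "y k : hom_set Q X Y n" using y Suc by simp
  have hc: "h z : hom_set E X' Y' m" "h (y k) : hom_set E X' Y' m" "h (hscale Q X Y n (koszul (s k)) (y k)) = hscale E X' Y' m (koszul (s k)) (h (y k))"
   using lin z yk by (auto simp: linear_map_def)
  have "h (hadd Q X Y n z (hscale Q X Y n (koszul (s k)) (y k))) = hadd E X' Y' m (h z) (h (hscale Q X Y n (koszul (s k)) (y k)))"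
   using lin z yk Ob by (auto simp: linear_map_def)
  then show ?case
   using Ob E z yk hc by (intro bexI[of _ "hadd Q X Y n z (hscale Q X Y n (koszul (s k)) (y k))"]) simp_all
 qed
 obtain z where z: "z : hom_set Q X Y n" "hv Q X Y n z = (\<Sum>t<N. sg (s t) (hv Q X Y n (y t)))"
  "hv E X' Y' m (h z) = (\<Sum>t<N. sg (s t) (hv E X' Y' m (h (y t))))" using *[of N] by auto
 have "x = z" by (rule Q.hv_inj[of X Y n]) (use z x eq Ob in simp_all)
 then show ?thesis using z by simp
qed

lemma difQ_difQ: "[|X : Ob C; Y : Ob C; f : hom_set Q X Y n|] ==>
    Dif Q X Y (n + 1) (Dif Q X Y n f) = hzero Q X Y (n + 1 + 1)"
proof (induction rule: Q_induct)
 case (inc X Y n f)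
 have "inc X Y (n + 1 + 1) (hzero C X Y (n + 1 + 1)) = hzero Q X Y (n + 1 + 1)"
  using inc by (simp add: inc_def Q_simps linper.zero_rep[OF linper])
 then show ?case using inc by (simp add: difQ_inc)
next
 case (eps X I)
 let ?n = "len I"
 have v: "valid X I" using eps by (simp add: valid_def)
 have pos: "length I > 0" using eps by (auto simp: eps_index_def)
 have vr: "valid X (rm t I)" if "t < length I" for t using valid_rm'[OF v that] .
 have len: "- len (rm t I) = - ?n + 1" "1 - len (rm t I) = - ?n + 1 + 1" if "t < length I" for t
  using that by simp_all
 let ?k = "- ?n + 1 + 1"
 have "hv Q X X ?k (Dif Q X X (- ?n + 1) (Dif Q X X (- ?n) (eb X I))) =
   (\<Sum>t<length I. sg (?n - int (t + 1)) (hv Q X X ?k (Dif Q X X (- ?n + 1) (eb X (rm t I)))))"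
 proof (rule hv_linear_sum[OF eps(1,1) Q.gcat_axioms _ _ difQ_lin])
  show "hv Q X X (- ?n + 1) (Dif Q X X (- ?n) (eb X I)) = (\<Sum>t<length I. sg (?n - int (t + 1)) (hv Q X X (- ?n + 1) (eb X (rm t I))))"
   using hv_difQ_eb[OF v] by simp
  show "Dif Q X X (- ?n) (eb X I) : hom_set Q X X (- ?n + 1)"
   by (rule difQ_closed) (use v eps in "simp_all add: eb_closed")
  fix t assume "t < length I"
  then show "eb X (rm t I) : hom_set Q X X (- ?n + 1)" using vr len by (intro eb_closed) simp_all
 qed (use eps in simp_all)
 also have "... = (\<Sum>t<length I. - (\<Sum>s<length I - 1. sg (int t + int s) (hv Q X X ?k (eb X (rm s (rm t I))))))"
 proof (rule sum.cong[OF refl])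
  fix t assume "t : {..<length I}"
  then have t: "t < length I" by simp
  have "hv Q X X ?k (Dif Q X X (- ?n + 1) (eb X (rm t I))) =
   (\<Sum>s<length I - 1. sg (?n - 1 - int (s + 1)) (hv Q X X ?k (eb X (rm s (rm t I)))))"
   using hv_difQ_eb[OF vr[OF t]] t unfolding len[OF t] by (simp add: of_nat_diff)
  then have "sg (?n - int (t + 1)) (hv Q X X ?k (Dif Q X X (- ?n + 1) (eb X (rm t I)))) =
   (\<Sum>s<length I - 1. sg (?n - int (t + 1)) (sg (?n - 1 - int (s + 1)) (hv Q X X ?k (eb X (rm s (rm t I))))))"
   by (simp add: sg_def sum_negf)
  also have "... = (\<Sum>s<length I - 1. - sg (int t + int s) (hv Q X X ?k (eb X (rm s (rm t I)))))"
   by (intro sum.cong refl) (auto simp: sg_def)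
  finally show "sg (?n - int (t + 1)) (hv Q X X ?k (Dif Q X X (- ?n + 1) (eb X (rm t I)))) =
    - (\<Sum>s<length I - 1. sg (int t + int s) (hv Q X X ?k (eb X (rm s (rm t I)))))" by (simp add: sum_negf)
 qed
 also have "... = 0"
  unfolding sum_negf by (subst double_removal_sum) (simp_all add: rm_rm)
 finally show ?case using eps v difQ_closed eb_closed by (intro Q.hv_inj[of X X ?k]) (simp_all add: difQ_closed eb_closed)
next
 case (cmp X Y Z m n g f)
 have "hv Q X Z (m + n + 1 + 1) (Dif Q X Z (m + n + 1) (Dif Q X Z (m + n) (Cmp Q X Y Z m n g f))) = 0"
  unfolding difQ_cmp[OF cmp(1-5)]
  using cmp by (simp add: difQ_add difQ_scale difQ_closed hv_difQ_cmp, simp add: sg_def ac_simps)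
 then show ?case using cmp by (intro Q.hv_inj[of X Z "m + n + 1 + 1"]) (simp_all add: difQ_closed)
next
 case (add X Y n g f)
 then show ?case by (intro Q.hv_inj[of X Y "n + 1 + 1"]) (simp_all add: difQ_add difQ_closed)
next
 case (scale X Y n c f)
 then show ?case by (intro Q.hv_inj[of X Y "n + 1 + 1"]) (simp_all add: difQ_scale difQ_closed)
qed

sublocale Q: dgc Q
 by (rule dgc.intro[OF Q.gcat_axioms dgc_axioms.intro]) (simp_all add: difQ_lin difQ_difQ difQ_cmp)

lemma dgc_Q: "dgc Q"
 by (rule Q.dgc_axioms)

end

section \<open>The universal property of the Drinfeld quotient\<close>

context dri
begin

lemma inc_lin: "[|X : Ob C; Y : Ob C|] ==> linear_map (Hom C X Y n) (Hom Q X Y n) (inc X Y n)"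
 by (rule linear_mapI) (auto simp: kmod_Q kmod_hom inc_closed,
  auto simp: inc_def ev_def[unfolded hv_def, symmetric] ev_incl_add ev_incl_scale)

lemma inc_cmp: "[|X : Ob C; Y : Ob C; Z : Ob C; g : hom_set C Y Z m; f : hom_set C X Y n|] ==>
  inc X Z (m + n) (Cmp C X Y Z m n g f) = Cmp Q X Y Z m n (inc Y Z m g) (inc X Y n f)"
 by (simp add: inc_def cl_comp[symmetric] ty_intros cl_eq[OF drinfeld_eq.incl_comp])

lemma inc_id: "X : Ob C ==> inc X X 0 (Id C X) = Id Q X"
 by (simp add: inc_def Q_simps)

definition incl :: "('a, 'k) dgf" where
 "incl = mk_fun C (%X. X) inc"

lemma incl_functor: "dg_functor C Q incl"
 unfolding incl_def by (rule dg_functor_mk_fun) (simp_all add: dgc_axioms inc_lin inc_cmp inc_id difQ_inc)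

lemma incl_simps [simp]: "X : Ob C ==> fob incl X = X"
 "[|X : Ob C; Y : Ob C; f : hom_set C X Y n|] ==> far incl X Y n f = inc X Y n f"
 by (simp_all add: incl_def)

end

fun lift_term :: "('a, 'k::field) dg => ('a, 'k) dgf => (('a, 'k) univ => nat list => ('a, 'k) univ) =>
  ('a, 'k) univ => ('a, 'k) univ => int => ('a, 'k) univ => ('a, 'k) univ" where
 "lift_term E F e X Z k (Incl f) = far F X Z k f"
| "lift_term E F e X Z k (Eps A I) = e A I"
| "lift_term E F e X Z k (Comp Y m n t u) =
   Cmp E (fob F X) (fob F Y) (fob F Z) m n (lift_term E F e Y Z m t) (lift_term E F e X Y n u)"
| "lift_term E F e X Z k (FSum t u) = hadd E (fob F X) (fob F Z) k (lift_term E F e X Z k t) (lift_term E F e X Z k u)"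
| "lift_term E F e X Z k (FScale c t) = hscale E (fob F X) (fob F Z) k c (lift_term E F e X Z k t)"
| "lift_term E F e X Z k _ = undefined"

text \<open>The data for a dg functor out of the quotient. With the convention \<open>e X [] = Id\<close> the condition on
 differentials has the same form for all numbers of indices.\<close>

locale drilift = dri C S + F: dgfunctor C E F for C E :: "('a, 'k::field) dg" and S F +
 fixes e :: "('a, 'k) univ => nat list => ('a, 'k) univ"
 assumes e_closed': "!!X I. valid X I ==> e X I : hom_set E (fob F X) (fob F X) (- len I)"
  and e_Nil: "!!X. X : Ob C ==> e X [] = Id E (fob F X)"
  and hv_dif_e: "!!X I. [|X : Ob C; eps_index S X I|] ==>
   hv E (fob F X) (fob F X) (1 - len I) (Dif E (fob F X) (fob F X) (- len I) (e X I)) =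
   (\<Sum>t<length I. sg (len I - int (t + 1)) (hv E (fob F X) (fob F X) (1 - len I) (e X (rm t I))))"
begin

abbreviation "L == lift_term E F e"

lemma e_closed: "[|valid X I; k = - len I|] ==> e X I : hom_set E (fob F X) (fob F X) k"
 by (simp add: e_closed')

text \<open>Membership of the end points in \<open>Ob C\<close> is carried along since the rules for vector spaces need it.\<close>

lemma lift_sound': "DE X Y n t u ==> X : Ob C & Y : Ob C & L X Y n t : hom_set E (fob F X) (fob F Y) n &
  L X Y n u : hom_set E (fob F X) (fob F Y) n & L X Y n t = L X Y n u"
proof (induction rule: drinfeld_eq.induct)
 case (eps X I)
 then show ?case by (simp add: e_closed valid_def)
next
 case (comp_assoc Y Z l t X m u W n v)
 then show ?case using F.T.cmp_assoc[of "fob F W" "fob F X" "fob F Y" "fob F Z" "L Y Z l t" l "L X Y m u" m "L W X n v" n] by simp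
next
 case (sum_assoc X Y n t u v)
 have "hadd E (fob F X) (fob F Y) n (hadd E (fob F X) (fob F Y) n (L X Y n t) (L X Y n u)) (L X Y n v)
  = hadd E (fob F X) (fob F Y) n (L X Y n t) (hadd E (fob F X) (fob F Y) n (L X Y n u) (L X Y n v))"
  by (rule F.T.hv_inj[of "fob F X" "fob F Y" n]) (use sum_assoc in "simp_all add: ac_simps")
 then show ?case using sum_assoc.IH by simp
next
 case (sum_comm X Y n t u)
 have "hadd E (fob F X) (fob F Y) n (L X Y n t) (L X Y n u) = hadd E (fob F X) (fob F Y) n (L X Y n u) (L X Y n t)"
  by (rule F.T.hv_inj[of "fob F X" "fob F Y" n]) (use sum_comm in "simp_all add: ac_simps")
 then show ?case using sum_comm.IH by simp
next
 case (sum_zero X Y n t u)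
 have "hadd E (fob F X) (fob F Y) n (L X Y n t) (hscale E (fob F X) (fob F Y) n 0 (L X Y n u)) = L X Y n t"
  by (rule F.T.hv_inj[of "fob F X" "fob F Y" n]) (use sum_zero in "simp_all")
 then show ?case using sum_zero.IH by simp
qed (simp_all add: F.far_cmp kmod.smult_distr[OF F.T.kmod_hom] kmod.smult_add[OF F.T.kmod_hom]
 kmod.smult_smult[OF F.T.kmod_hom] kmod.smult_one[OF F.T.kmod_hom])

lemma lift_sound: "DE X Y n t u ==> L X Y n t : hom_set E (fob F X) (fob F Y) n &
  L X Y n u : hom_set E (fob F X) (fob F Y) n & L X Y n t = L X Y n u"
 using lift_sound' by blast

lemma lift_cl: "ty X Y n t ==> L X Y n (cl X Y n t) = L X Y n t"
 using lift_sound[OF cl_rel] by blast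

lemma lift_ty: "ty X Y n t ==> L X Y n t : hom_set E (fob F X) (fob F Y) n"
 using lift_sound by blast

definition lift :: "('a, 'k) dgf" where
 "lift = mk_fun Q (fob F) L"

lemma L_lin: assumes Ob: "X : Ob C" "Y : Ob C"
 shows "linear_map (Hom Q X Y n) (Hom E (fob F X) (fob F Y) n) (L X Y n)"
 unfolding linear_map_def
proof (intro conjI ballI allI)
 fix a assume "a : hom_set Q X Y n" then obtain t where t: "ty X Y n t" "a = cl X Y n t" using homE Ob by blast
 show "L X Y n a : hom_set E (fob F X) (fob F Y) n" using t by (simp add: lift_cl lift_ty)
 show "L X Y n (hscale Q X Y n c a) = hscale E (fob F X) (fob F Y) n c (L X Y n a)" for c
  using t by (simp add: cl_scale[symmetric] lift_cl ty_intros)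
 fix b assume "b : hom_set Q X Y n" then obtain u where u: "ty X Y n u" "b = cl X Y n u" using homE Ob by blast
 show "L X Y n (hadd Q X Y n a b) = hadd E (fob F X) (fob F Y) n (L X Y n a) (L X Y n b)"
  using t u by (simp add: cl_sum[symmetric] lift_cl ty_intros)
qed

lemma L_closed: "[|X : Ob C; Y : Ob C; f : hom_set Q X Y n|] ==> L X Y n f : hom_set E (fob F X) (fob F Y) n"
 using L_lin[of X Y n] by (simp add: linear_map_def)

lemma L_inc: "[|X : Ob C; Y : Ob C; f : hom_set C X Y n|] ==> L X Y n (inc X Y n f) = far F X Y n f"
 unfolding inc_def by (simp add: lift_cl ty_intros)

lemma L_eb: "valid X I ==> L X X (- len I) (eb X I) = e X I"
 unfolding eb_def valid_def by (auto simp: lift_cl eps_expr_ty) (auto simp: eps_expr_def e_Nil)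

lemma L_cmp: "[|X : Ob C; Y : Ob C; Z : Ob C; g : hom_set Q Y Z m; f : hom_set Q X Y n|] ==>
  L X Z (m + n) (Cmp Q X Y Z m n g f) = Cmp E (fob F X) (fob F Y) (fob F Z) m n (L Y Z m g) (L X Y n f)"
proof -
 assume Ob: "X : Ob C" "Y : Ob C" "Z : Ob C" and gf: "g : hom_set Q Y Z m" "f : hom_set Q X Y n"
 obtain t where t: "ty Y Z m t" "g = cl Y Z m t" using homE[OF gf(1) Ob(2,3)] .
 obtain u where u: "ty X Y n u" "f = cl X Y n u" using homE[OF gf(2) Ob(1,2)] .
 show ?thesis using t u by (simp add: cl_comp[symmetric] lift_cl ty_intros)
qed

lemma L_dif: "[|X : Ob C; Y : Ob C; f : hom_set Q X Y n|] ==>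
  L X Y (n + 1) (Dif Q X Y n f) = Dif E (fob F X) (fob F Y) n (L X Y n f)"
proof (induction rule: Q_induct)
 case (inc X Y n f)
 then show ?case by (simp add: difQ_inc L_inc F.far_dif)
next
 case (eps X I)
 let ?n = "len I"
 have v: "valid X I" using eps by (simp add: valid_def)
 have "hv E (fob F X) (fob F X) (1 - ?n) (L X X (1 - ?n) (Dif Q X X (- ?n) (eb X I))) =
  (\<Sum>t<length I. sg (?n - int (t + 1)) (hv E (fob F X) (fob F X) (1 - ?n) (L X X (1 - ?n) (eb X (rm t I)))))"
 proof (rule hv_linear_sum[OF eps(1,1) F.T.gcat_axioms _ _ L_lin _ _ hv_difQ_eb[OF v]])
  show "Dif Q X X (- ?n) (eb X I) : hom_set Q X X (1 - ?n)"
   using eps v by (simp add: difQ_closed eb_closed)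
  show "eb X (rm t I) : hom_set Q X X (1 - ?n)" if "t < length I" for t
   using that v by (simp add: eb_closed valid_rm')
 qed (use eps in simp_all)
 also have "... = (\<Sum>t<length I. sg (?n - int (t + 1)) (hv E (fob F X) (fob F X) (1 - ?n) (e X (rm t I))))"
 proof (rule sum.cong[OF refl])
  fix t assume "t : {..<length I}"
  then have t: "t < length I" by simp
  have "- len (rm t I) = 1 - ?n" using t by simp
  then show "sg (?n - int (t + 1)) (hv E (fob F X) (fob F X) (1 - ?n) (L X X (1 - ?n) (eb X (rm t I)))) =
    sg (?n - int (t + 1)) (hv E (fob F X) (fob F X) (1 - ?n) (e X (rm t I)))"
   using L_eb[OF valid_rm'[OF v t]] by simp
 qed
 also have "... = hv E (fob F X) (fob F X) (1 - ?n) (Dif E (fob F X) (fob F X) (- ?n) (L X X (- ?n) (eb X I)))"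
  using hv_dif_e[OF eps] L_eb[OF v] by simp
 finally show ?case
  using eps v by (intro F.T.hv_inj[of "fob F X" "fob F X" "1 - ?n"]) (simp_all add: L_closed difQ_closed eb_closed)
next
 case (cmp X Y Z m n g f)
 have 1: "L X Z (m + n + 1) (Cmp Q X Y Z (m + 1) n (Dif Q Y Z m g) f) =
   Cmp E (fob F X) (fob F Y) (fob F Z) (m + 1) n (L Y Z (m + 1) (Dif Q Y Z m g)) (L X Y n f)"
  using L_cmp[of X Y Z "Dif Q Y Z m g" "m + 1" f n] cmp by (simp add: difQ_closed ac_simps)
 have 2: "L X Z (m + n + 1) (Cmp Q X Y Z m (n + 1) g (Dif Q X Y n f)) =
   Cmp E (fob F X) (fob F Y) (fob F Z) m (n + 1) (L Y Z m g) (L X Y (n + 1) (Dif Q X Y n f))"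
  using L_cmp[of X Y Z g m "Dif Q X Y n f" "n + 1"] cmp by (simp add: difQ_closed ac_simps)
 have "L X Z (m + n + 1) (Dif Q X Z (m + n) (Cmp Q X Y Z m n g f)) =
   hadd E (fob F X) (fob F Z) (m + n + 1) (L X Z (m + n + 1) (Cmp Q X Y Z (m + 1) n (Dif Q Y Z m g) f))
   (hscale E (fob F X) (fob F Z) (m + n + 1) (koszul m) (L X Z (m + n + 1) (Cmp Q X Y Z m (n + 1) g (Dif Q X Y n f))))"
  unfolding difQ_cmp[OF cmp(1-5)] using L_lin[of X Z "m + n + 1"] cmp by (simp add: linear_map_def difQ_closed)
 then show ?case unfolding 1 2 using cmp by (simp add: L_cmp F.T.dif_cmp L_closed)
next
 case (add X Y n g f)
 then show ?case using L_lin[of X Y n] L_lin[of X Y "n + 1"] by (simp add: linear_map_def difQ_closed)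
next
 case (scale X Y n c f)
 then show ?case using L_lin[of X Y n] L_lin[of X Y "n + 1"] by (simp add: linear_map_def difQ_closed)
qed

lemma lift_functor: "dg_functor Q E lift"
 unfolding lift_def
proof (rule dg_functor_mk_fun[OF dgc_Q])
 fix X assume "X : Ob Q"
 then show "L X X 0 (Id Q X) = Id E (fob F X)" using L_eb[of X "[]"] by (simp add: eb_Nil e_Nil)
qed (simp_all add: L_lin L_cmp L_dif)

lemma lift_simps:
 "X : Ob C ==> fob lift X = fob F X"
 "[|X : Ob C; Y : Ob C; f : hom_set C X Y n|] ==> far lift X Y n (inc X Y n f) = far F X Y n f"
 "[|valid X I; k = - len I|] ==> far lift X X k (eb X I) = e X I"
 by (simp_all add: lift_def L_inc inc_closed L_eb eb_closed valid_Ob)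

end

context dri
begin

text \<open>Uniqueness in the universal property, through which all naturality and coherence identities are proved.\<close>

lemma Q_functor_eqI:
 assumes F: "dg_functor Q E F" and G: "dg_functor Q E G" and E: "dgc E"
  and ob: "!!X. X : Ob C ==> fob F X = fob G X"
  and inc: "!!X Y n f. [|X : Ob C; Y : Ob C; f : hom_set C X Y n|] ==> far F X Y n (inc X Y n f) = far G X Y n (inc X Y n f)"
  and eps: "!!X I. [|X : Ob C; eps_index S X I|] ==> far F X X (- len I) (eb X I) = far G X X (- len I) (eb X I)"
 shows "F = G"
proof (rule dg_functor_eqI[OF F G])
 interpret F: dgfunctor Q E F by (intro dgfunctor.intro dgfunctor_axioms.intro dgc_Q E F)
 interpret G: dgfunctor Q E G by (intro dgfunctor.intro dgfunctor_axioms.intro dgc_Q E G)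
 fix X Y n f assume "X : Ob Q" "Y : Ob Q" "f : hom_set Q X Y n"
 then have "X : Ob C" "Y : Ob C" "f : hom_set Q X Y n" by simp_all
 then show "far F X Y n f = far G X Y n f"
  by (induction rule: Q_induct) (simp_all add: inc eps F.far_cmp G.far_cmp ob)
qed (simp add: ob)

end

section \<open>Functoriality of the Drinfeld quotient\<close>

lemma comp_fun_simps:
 "X : Ob C ==> fob (comp_fun C G F) X = fob G (fob F X)"
 "[|X : Ob C; Y : Ob C; f : hom_set C X Y n|] ==>
  far (comp_fun C G F) X Y n f = far G (fob F X) (fob F Y) n (far F X Y n f)"
 by (simp_all add: comp_fun_def)

lemma id_fun_simps:
 "X : Ob C ==> fob (id_fun C) X = X"
 "[|X : Ob C; Y : Ob C; f : hom_set C X Y n|] ==> far (id_fun C) X Y n f = f"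
 by (simp_all add: id_fun_def)

text \<open>In a weakly increasing sequence a repetition occurs at neighbouring places; these two places
 produce the cancelling terms in the differential.\<close>

lemma adjacent_equal:
 assumes "sorted xs" "~ distinct xs"
 shows "EX t. Suc t < length xs & xs ! t = xs ! Suc t"
proof (rule ccontr)
 assume a: "~ ?thesis"
 have "xs ! t < xs ! Suc t" if "Suc t < length xs" for t
  using sorted_nth_mono[OF assms(1), of t "Suc t"] that a by (auto simp: order_less_le)
 then have "sorted_wrt (<) xs" using sorted_wrt_iff_nth_Suc_transp[of "(<)" xs] by (simp add: transp_on_less)
 then show False using assms(2) by (simp add: strict_sorted_iff)
qed

lemma rm_map: "rm t (map f I) = map f (rm t I)"
 by (simp add: rm_def take_map drop_map)

lemma distinct_rm: "distinct I ==> distinct (rm t I)"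
 unfolding rm_def using set_take_disj_set_drop_if_distinct[of I t "t + 1"] by simp

lemma not_distinct_rm:
 assumes t: "Suc t < length I" "I ! t = I ! Suc t" and u: "u < length I" "u ~= t" "u ~= Suc t"
 shows "~ distinct (rm u I)"
proof -
 define a where "a = (if t < u then t else t - 1)"
 have "Suc a < length I - 1" "rm u I ! a = rm u I ! Suc a"
  using t u by (auto simp: a_def rm_nth split: if_splits)
 then show ?thesis using length_rm[OF u(1)] by (metis Suc_lessD n_not_Suc_n nth_eq_iff_index_eq)
qed

lemma rm_adjacent:
 assumes t: "Suc t < length I" "I ! t = I ! Suc t"
 shows "rm t I = rm (Suc t) I"
 by (rule nth_equalityI) (use t in "auto simp: rm_nth less_Suc_eq")

text \<open>Equal indices in the image would make \<open>\<epsilon>\<close> ill-formed; such generators go to \<open>0\<close>.\<close>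

definition dr_e :: "('a, 'k::field) pdg => ('a, 'k) dgf => (nat => nat) => ('a, 'k) univ => nat list => ('a, 'k) univ" where
 "dr_e = (%(D, T) F p X I. if distinct (map p I) then dri.eb D T (fob F X) (map p I)
   else hzero (drinfeld (D, T)) (fob F X) (fob F X) (- len I))"

locale drmap = P: dri C S + R: dri D T + F: dgfunctor C D F
 for C :: "('a, 'k::field) dg" and S and D :: "('a, 'k) dg" and T F +
 fixes p :: "nat => nat"
 assumes p_mem: "!!i X. [|1 <= i; i <= length S; X : Ob C; X : S ! (i - 1)|] ==>
   1 <= p i & p i <= length T & fob F X : T ! (p i - 1)"
  and p_mono: "!!i j. [|1 <= i; i <= j; j <= length S|] ==> p i <= p j"
begin

abbreviation "G == comp_fun C R.incl F"
abbreviation "e == dr_e (D, T) F p"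

lemma G_functor: "dg_functor C R.Q G"
 by (rule dg_functor_comp[OF P.dgc_axioms R.dgc_axioms R.dgc_Q F.dg_functor R.incl_functor])

lemma G_simps [simp]: "X : Ob C ==> fob G X = fob F X"
 "[|X : Ob C; Y : Ob C; f : hom_set C X Y n|] ==> far G X Y n f = R.inc (fob F X) (fob F Y) n (far F X Y n f)"
 by (simp_all add: comp_fun_def)

lemma sorted_p: "P.valid X I ==> sorted (map p I)"
 unfolding P.valid_def eps_index_def
 by (auto simp: sorted_wrt_map strict_sorted_iff intro!: p_mono elim!: sorted_wrt_mono_rel[rotated])

lemma valid_p: assumes "P.valid X I" "distinct (map p I)" shows "R.valid (fob F X) (map p I)"
proof (cases "I = []")
 case True then show ?thesis using assms(1) by (simp add: P.valid_Ob)
next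
 case False
 then have X: "X : Ob C" and I: "eps_index S X I" using assms(1) by (auto simp: P.valid_def)
 have "sorted_wrt (<) (map p I)" using sorted_p[OF assms(1)] assms(2) by (simp add: strict_sorted_iff del: distinct_map)
 then show ?thesis using X I p_mem[OF _ _ X] by (auto simp: R.valid_def eps_index_def)
qed

lemma e_closed: "[|P.valid X I; k = - len I|] ==> e X I : hom_set R.Q (fob F X) (fob F X) k"
 using P.valid_Ob[of X I] by (auto simp: dr_e_def R.eb_closed valid_p simp del: distinct_map)

lemma hv_dif_e:
 assumes X: "X : Ob C" and I: "eps_index S X I"
 shows "hv R.Q (fob F X) (fob F X) (1 - len I) (Dif R.Q (fob F X) (fob F X) (- len I) (e X I)) =
   (\<Sum>t<length I. sg (len I - int (t + 1)) (hv R.Q (fob F X) (fob F X) (1 - len I) (e X (rm t I))))"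
  (is "?l = ?r")
proof -
 have v: "P.valid X I" using X I by (simp add: P.valid_def)
 have FX: "fob F X : Ob D" using X by simp
 have len: "- len (rm t I) = 1 - len I" if "t < length I" for t using that by simp
 show ?thesis
 proof (cases "distinct (map p I)")
  case True
  have "?l = (\<Sum>t<length I. sg (len I - int (t + 1)) (hv R.Q (fob F X) (fob F X) (1 - len I) (R.eb (fob F X) (rm t (map p I)))))"
   using R.hv_difQ_eb[OF valid_p[OF v True]] True by (simp add: dr_e_def)
  also have "... = ?r"
  proof (rule sum.cong[OF refl])
   fix t assume "t : {..<length I}"
   have "distinct (map p (rm t I))" using distinct_rm[OF True] by (simp add: rm_map del: distinct_map)
   then show "sg (len I - int (t + 1)) (hv R.Q (fob F X) (fob F X) (1 - len I) (R.eb (fob F X) (rm t (map p I))))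
     = sg (len I - int (t + 1)) (hv R.Q (fob F X) (fob F X) (1 - len I) (e X (rm t I)))"
    by (simp add: dr_e_def rm_map del: distinct_map)
  qed
  finally show ?thesis .
 next
  case False
  have l0: "?l = 0" using False FX by (simp add: dr_e_def del: distinct_map)
  obtain t where t: "Suc t < length I" "map p I ! t = map p I ! Suc t"
   using adjacent_equal[OF sorted_p[OF v] False] by auto
  let ?f = "%t. sg (len I - int (t + 1)) (hv R.Q (fob F X) (fob F X) (1 - len I) (e X (rm t I)))"
  have "?r = sum ?f {t, Suc t}"
  proof (rule sum.mono_neutral_right)
   show "ALL u:{..<length I} - {t, Suc t}. ?f u = 0"
   proof
    fix u assume "u : {..<length I} - {t, Suc t}"
    then have u: "u < length I" "u ~= t" "u ~= Suc t" by auto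
    have "~ distinct (map p (rm u I))" using not_distinct_rm[of t "map p I" u] t u by (simp add: rm_map del: distinct_map)
    then show "?f u = 0" using FX len[OF u(1)] by (simp add: dr_e_def del: distinct_map length_rm)
   qed
  qed (use t in auto)
  also have "... = 0"
  proof -
   have "map p (rm t I) = map p (rm (Suc t) I)" using rm_adjacent[of t "map p I"] t by (simp add: rm_map)
   moreover have "length (rm t I) = length (rm (Suc t) I)" using t by simp
   ultimately have "e X (rm t I) = e X (rm (Suc t) I)" by (simp only: dr_e_def prod.case)
   then show ?thesis by (simp add: sg_def)
  qed
  finally show ?thesis using l0 by simp
 qed
qed

sublocale U: drilift C R.Q S G e
proof -
 interpret G: dgfunctor C R.Q G
  by (intro dgfunctor.intro dgfunctor_axioms.intro P.dgc_axioms R.dgc_Q G_functor)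
 show "drilift C R.Q S G e"
 proof (intro drilift.intro drilift_axioms.intro P.dri_axioms G.dgfunctor_axioms)
  fix X I assume v: "P.valid X I"
  then show "e X I : hom_set R.Q (fob G X) (fob G X) (- len I)"
   using e_closed P.valid_Ob by simp
 next
  fix X assume "X : Ob C"
  then show "e X [] = Id R.Q (fob G X)" by (simp add: dr_e_def R.eb_Nil)
 next
  fix X I assume "X : Ob C" "eps_index S X I"
  then show "hv R.Q (fob G X) (fob G X) (1 - len I) (Dif R.Q (fob G X) (fob G X) (- len I) (e X I)) =
   (\<Sum>t<length I. sg (len I - int (t + 1)) (hv R.Q (fob G X) (fob G X) (1 - len I) (e X (rm t I))))"
   using hv_dif_e by simp
 qed
qed

lemma dr_simps:
 "X : Ob C ==> fob U.lift X = fob F X"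
 "[|X : Ob C; Y : Ob C; f : hom_set C X Y n|] ==> far U.lift X Y n (P.inc X Y n f) = R.inc (fob F X) (fob F Y) n (far F X Y n f)"
 "[|P.valid X I; k = - len I|] ==> far U.lift X X k (P.eb X I) = e X I"
 by (simp_all add: U.lift_simps)

end

text \<open>The number of the block \<open>\<sigma> (j - 1) < i \<le> \<sigma> j\<close> that contains \<open>i\<close>.\<close>

definition idx :: "(nat => nat) => nat => nat" where
 "idx \<sigma> i = (LEAST j. i <= \<sigma> j)"

definition dr_arr :: "('a, 'k::field) pdg => ('a, 'k) pdg => ('a, 'k) pdgf => ('a, 'k) dgf" where
 "dr_arr P R f = drilift.lift (fst P) (drinfeld R) (snd P)
   (comp_fun (fst P) (dri.incl (fst R) (snd R)) (snd f)) (dr_e R (snd f) (idx (fst f)))"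

text \<open>The Grothendieck construction over all small dg categories.\<close>

definition pobj :: "('a, 'k::field) pdg set" where
 "pobj = {(C, S). dgc C & (ALL A:set S. A \<subseteq> Ob C)}"

definition parr :: "('a, 'k::field) pdg => ('a, 'k) pdg => ('a, 'k) pdgf set" where
 "parr = (%(C, S) (D, T).
    {(\<sigma>, F). \<sigma> : Delta_f (length T) (length S) & dg_functor C D F &
      (ALL j:{1..length T}. ALL i. \<sigma> (j - 1) < i & i <= \<sigma> j -->
       fob F ` (S ! (i - 1)) \<subseteq> T ! (j - 1))})"

lemma Delta_fD:
 assumes "\<sigma> : Delta_f m n"
 shows "\<sigma> 0 = 0" "\<sigma> m = n" "!!i j. [|i <= j; j <= m|] ==> \<sigma> i <= \<sigma> j"
 using assms by (auto simp: Delta_f_def mono_on_def)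

lemma idx:
 assumes s: "\<sigma> : Delta_f m n" and i: "1 <= i" "i <= n"
 shows "i <= \<sigma> (idx \<sigma> i)" "1 <= idx \<sigma> i" "idx \<sigma> i <= m" "\<sigma> (idx \<sigma> i - 1) < i"
  and "!!j. j <= m ==> i <= \<sigma> j \<longleftrightarrow> idx \<sigma> i <= j"
proof -
 have m: "i <= \<sigma> m" using Delta_fD(2)[OF s] i by simp
 show 1: "i <= \<sigma> (idx \<sigma> i)" unfolding idx_def by (rule LeastI[of "%j. i <= \<sigma> j", OF m])
 show 3: "idx \<sigma> i <= m" unfolding idx_def by (rule Least_le[of "%j. i <= \<sigma> j", OF m])
 show 2: "1 <= idx \<sigma> i" using 1 Delta_fD(1)[OF s] i by (cases "idx \<sigma> i") auto
 show "\<sigma> (idx \<sigma> i - 1) < i"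
  using not_less_Least[of "idx \<sigma> i - 1" "%j. i <= \<sigma> j"] 2 unfolding idx_def[symmetric] by simp
 show "i <= \<sigma> j \<longleftrightarrow> idx \<sigma> i <= j" if "j <= m" for j
 proof
  assume "i <= \<sigma> j" then show "idx \<sigma> i <= j" unfolding idx_def by (rule Least_le)
 next
  assume "idx \<sigma> i <= j" then show "i <= \<sigma> j" using 1 Delta_fD(3)[OF s _ that, of "idx \<sigma> i"] by linarith
 qed
qed

lemma idx_eqI:
 assumes "i <= \<sigma> j" "!!j'. j' < j ==> \<sigma> j' < i"
 shows "idx \<sigma> i = j"
 unfolding idx_def by (rule Least_equality) (use assms not_le in "blast+")

lemma idx_Delta_id: "[|1 <= i; i <= n|] ==> idx (Delta_id n) i = i"
 by (rule idx_eqI) (auto simp: Delta_id_def)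

lemma drmap_parr:
 assumes P: "(C, S) : pobj" and R: "(D, T) : pobj" and f: "(\<sigma>, F) : parr (C, S) (D, T)"
 shows "drmap C S D T F (idx \<sigma>)"
proof -
 have s: "\<sigma> : Delta_f (length T) (length S)" and F: "dg_functor C D F"
  and sub: "!!i j. [|1 <= j; j <= length T; \<sigma> (j - 1) < i; i <= \<sigma> j|] ==> fob F ` (S ! (i - 1)) \<subseteq> T ! (j - 1)"
  using f by (auto simp: parr_def)
 have C: "dgc C" and D: "dgc D" using P R by (auto simp: pobj_def)
 show ?thesis
 proof (intro drmap.intro dri.intro C D dgfunctor.intro dgfunctor_axioms.intro F drmap_axioms.intro)
  fix i X assume i: "1 <= i" "i <= length S" and X: "X : S ! (i - 1)"
  show "1 <= idx \<sigma> i & idx \<sigma> i <= length T & fob F X : T ! (idx \<sigma> i - 1)"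
   using idx(2,3)[OF s i] sub[OF idx(2,3,4,1)[OF s i]] X by auto
 next
  fix i j assume ij: "1 <= i" "i <= j" "j <= length S"
  have "i <= \<sigma> (idx \<sigma> j)" using idx(1)[OF s, of j] ij by simp
  then show "idx \<sigma> i <= idx \<sigma> j" using idx(5)[OF s, of i "idx \<sigma> j"] idx(3)[OF s, of j] ij by simp
 qed
qed

lemma dr_arr_functor:
 assumes "P : pobj" "R : pobj" "f : parr P R"
 shows "dg_functor (drinfeld P) (drinfeld R) (dr_arr P R f)"
proof -
 obtain C S D T \<sigma> F where e: "P = (C, S)" "R = (D, T)" "f = (\<sigma>, F)" by (metis surj_pair)
 interpret drmap C S D T F "idx \<sigma>" using drmap_parr assms e by blast
 show ?thesis using U.lift_functor by (simp add: dr_arr_def e)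
qed

lemma dr_arr_simps:
 assumes "(C, S) : pobj" "(D, T) : pobj" "(\<sigma>, F) : parr (C, S) (D, T)"
 shows "X : Ob C ==> fob (dr_arr (C, S) (D, T) (\<sigma>, F)) X = fob F X"
  and "[|X : Ob C; Y : Ob C; f : hom_set C X Y n|] ==>
   far (dr_arr (C, S) (D, T) (\<sigma>, F)) X Y n (dri.inc C S X Y n f) = dri.inc D T (fob F X) (fob F Y) n (far F X Y n f)"
  and "[|dri.valid C S X I; k = - len I|] ==>
   far (dr_arr (C, S) (D, T) (\<sigma>, F)) X X k (dri.eb C S X I) = dr_e (D, T) F (idx \<sigma>) X I"
proof -
 interpret drmap C S D T F "idx \<sigma>" using drmap_parr assms by blast
 show "X : Ob C ==> fob (dr_arr (C, S) (D, T) (\<sigma>, F)) X = fob F X"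
  "[|X : Ob C; Y : Ob C; f : hom_set C X Y n|] ==>
   far (dr_arr (C, S) (D, T) (\<sigma>, F)) X Y n (dri.inc C S X Y n f) = dri.inc D T (fob F X) (fob F Y) n (far F X Y n f)"
  "[|dri.valid C S X I; k = - len I|] ==>
   far (dr_arr (C, S) (D, T) (\<sigma>, F)) X X k (dri.eb C S X I) = dr_e (D, T) F (idx \<sigma>) X I"
  using dr_simps by (simp_all add: dr_arr_def)
qed

lemma valid_idx_id: "dri C ==> dri.valid C S X I ==> map (idx (Delta_id (length S))) I = I"
 by (rule map_idI) (auto simp: dri.valid_def eps_index_def idx_Delta_id)

lemma dri_valid_distinct: "dri C ==> dri.valid C S X I ==> distinct I"
 by (auto simp: dri.valid_def eps_index_def strict_sorted_iff)

lemma dr_arr_id: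
 assumes P: "(C, S) : pobj" and f: "(Delta_id (length S), id_fun C) : parr (C, S) (C, S)"
 shows "dr_arr (C, S) (C, S) (Delta_id (length S), id_fun C) = id_fun (drinfeld (C, S))"
proof -
 interpret dri C S using P by (auto simp: pobj_def intro: dri.intro)
 show ?thesis
 proof (rule Q_functor_eqI[OF dr_arr_functor[OF P P f] dg_functor_id[OF dgc_Q] dgc_Q])
  fix X I assume XI: "X : Ob C" "eps_index S X I"
  then have v: "valid X I" by (simp add: valid_def)
  then show "far (dr_arr (C, S) (C, S) (Delta_id (length S), id_fun C)) X X (- len I) (eb X I)
    = far (id_fun Q) X X (- len I) (eb X I)"
   using XI valid_idx_id[OF dri_axioms v] dri_valid_distinct[OF dri_axioms v] unfolding dr_arr_simps(3)[OF P P f v refl]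
   by (simp add: id_fun_def dr_e_def eb_closed)
 qed (simp_all add: dr_arr_simps[OF P P f], simp_all add: id_fun_def inc_closed)
qed

lemma dr_arr_comp:
 assumes P: "(C, S) : pobj" and R: "(D, T) : pobj" and Z: "(E, U) : pobj"
  and f: "(\<sigma>, F) : parr (C, S) (D, T)" and g: "(\<tau>, G) : parr (D, T) (E, U)"
  and h: "(restrict (%j. \<sigma> (\<tau> j)) {0..length U}, comp_fun C G F) : parr (C, S) (E, U)"
 shows "dr_arr (C, S) (E, U) (restrict (%j. \<sigma> (\<tau> j)) {0..length U}, comp_fun C G F) =
  comp_fun (drinfeld (C, S)) (dr_arr (D, T) (E, U) (\<tau>, G)) (dr_arr (C, S) (D, T) (\<sigma>, F))"
proof -
 interpret F: drmap C S D T F "idx \<sigma>" using drmap_parr[OF P R f] .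
 interpret G: drmap D T E U G "idx \<tau>" using drmap_parr[OF R Z g] .
 let ?h = "dr_arr (C, S) (E, U) (restrict (%j. \<sigma> (\<tau> j)) {0..length U}, comp_fun C G F)"
 let ?f = "dr_arr (C, S) (D, T) (\<sigma>, F)" and ?g = "dr_arr (D, T) (E, U) (\<tau>, G)"
 note F_f = dr_arr_functor[OF P R f] and F_g = dr_arr_functor[OF R Z g] and F_h = dr_arr_functor[OF P Z h]
 interpret f: dgfunctor F.P.Q F.R.Q ?f by (intro dgfunctor.intro dgfunctor_axioms.intro F.P.dgc_Q F.R.dgc_Q F_f)
 interpret g: dgfunctor F.R.Q G.R.Q ?g by (intro dgfunctor.intro dgfunctor_axioms.intro G.R.dgc_Q F.R.dgc_Q F_g)
 have s: "\<sigma> : Delta_f (length T) (length S)" and t: "\<tau> : Delta_f (length U) (length T)"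
  using f g by (auto simp: parr_def)
 have ix: "idx (restrict (%j. \<sigma> (\<tau> j)) {0..length U}) i = idx \<tau> (idx \<sigma> i)" if i: "1 <= i" "i <= length S" for i
 proof (rule idx_eqI)
  note a = idx[OF s i] and b = idx[OF t idx(2,3)[OF s i]]
  have le: "\<tau> j <= length T" if "j <= length U" for j using Delta_fD(3)[OF t that order_refl] Delta_fD(2)[OF t] by simp
  have eq: "i <= \<sigma> (\<tau> j) \<longleftrightarrow> idx \<tau> (idx \<sigma> i) <= j" if "j <= length U" for j
   using a(5)[OF le[OF that]] b(5)[OF that] by simp
  show "i <= restrict (%j. \<sigma> (\<tau> j)) {0..length U} (idx \<tau> (idx \<sigma> i))" using eq[OF b(3)] b(3) by simp
  show "restrict (%j. \<sigma> (\<tau> j)) {0..length U} j < i" if "j < idx \<tau> (idx \<sigma> i)" for j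
   using eq[of j] that b(3) by auto
 qed
 show ?thesis
 proof (rule F.P.Q_functor_eqI[OF F_h dg_functor_comp[OF F.P.dgc_Q F.R.dgc_Q G.R.dgc_Q F_f F_g] G.R.dgc_Q])
  fix X I assume XI: "X : Ob C" "eps_index S X I"
  then have v: "F.P.valid X I" by (simp add: F.P.valid_def)
  let ?n = "- len I"
  have m: "map (idx (restrict (%j. \<sigma> (\<tau> j)) {0..length U})) I = map (idx \<tau>) (map (idx \<sigma>) I)"
   using XI by (auto simp: ix eps_index_def)
  have l: "far ?h X X ?n (F.P.eb X I) = dr_e (E, U) (comp_fun C G F) (idx (restrict (%j. \<sigma> (\<tau> j)) {0..length U})) X I"
   by (rule dr_arr_simps(3)[OF P Z h v refl])
  have r: "far (comp_fun F.P.Q ?g ?f) X X ?n (F.P.eb X I) = far ?g (fob F X) (fob F X) ?n (dr_e (D, T) F (idx \<sigma>) X I)"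
   using XI v by (simp add: comp_fun_def F.P.eb_closed dr_arr_simps[OF P R f])
  show "far ?h X X ?n (F.P.eb X I) = far (comp_fun F.P.Q ?g ?f) X X ?n (F.P.eb X I)"
  proof (cases "distinct (map (idx \<sigma>) I)")
   case True
   have v': "F.R.valid (fob F X) (map (idx \<sigma>) I)" using F.valid_p[OF v True] .
   show ?thesis unfolding l r using True XI dr_arr_simps(3)[OF R Z g v', of ?n]
    by (simp add: dr_e_def m comp_fun_def del: distinct_map map_map)
  next
   case False
   then have "~ distinct (map (idx \<tau>) (map (idx \<sigma>) I))" by (metis distinct_map)
   then show ?thesis unfolding l r using False XI g.far_zero[of "fob F X" "fob F X" ?n]
    by (simp add: dr_e_def m comp_fun_def dr_arr_simps[OF R Z g] del: distinct_map map_map)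
  qed
 qed (simp_all add: dr_arr_simps[OF P R f] dr_arr_simps[OF R Z g] dr_arr_simps[OF P Z h] comp_fun_simps F.P.inc_closed)
qed

subsection \<open>The restriction to the fibres\<close>

context drmap
begin

lemma drinfeld_map_sound:
 assumes id: "!!i. 1 <= i ==> i <= length S ==> p i = i" and t: "P.ty X Y n t"
 shows "U.L X Y n t = R.cl (fob F X) (fob F Y) n (drinfeld_map F X Y n t)"
proof -
 define J where "J X Y n t \<longleftrightarrow> X : Ob C & Y : Ob C & R.ty (fob F X) (fob F Y) n (drinfeld_map F X Y n t) &
  U.L X Y n t = R.cl (fob F X) (fob F Y) n (drinfeld_map F X Y n t)" for X Y n t
 have I: "J X Y n (Incl f)" if "X : Ob C" "Y : Ob C" "f : hom_set C X Y n" for X Y n f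
  using that by (simp add: J_def R.inc_def R.ty_intros)
 have E: "J X X (- len I) (Eps X I)" if XI: "X : Ob C" "eps_index S X I" for X I
 proof -
  have v: "P.valid X I" using XI by (simp add: P.valid_def)
  have m: "map p I = I" using XI id by (auto simp: eps_index_def intro: map_idI)
  have d: "distinct I" using XI by (auto simp: eps_index_def strict_sorted_iff)
  have v': "R.valid (fob F X) I" using valid_p[OF v] m d by simp
  have ne: "I ~= []" using XI by (simp add: eps_index_def)
  show ?thesis using XI(1) v' ne m d by (auto simp: J_def R.valid_def dr_e_def R.eb_def eps_expr_def R.ty_intros)
 qed
 have A: "J X Y n (FSum t u)" if "J X Y n t" "J X Y n u" for X Y n t u
  using that by (simp add: J_def R.cl_sum R.ty_intros)
 have K: "J X Y n (FScale c t)" if "J X Y n t" for X Y n t c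
  using that by (simp add: J_def R.cl_scale R.ty_intros)
 have M: "J X Z k (Comp Y m n t u)" if "J Y Z m t" "J X Y n u" "k = m + n" for X Y Z m n t u k
  using that by (simp add: J_def R.cl_comp R.ty_intros)
 have "J X Y n t & J X Y n u" if "P.DE X Y n t u" for X Y n t u
  using that
 proof (induction rule: drinfeld_eq.induct)
  case (comp_id_left X Y n t)
  then have "Y : Ob C" by (simp add: J_def)
  then show ?case using comp_id_left by (simp add: I M)
 next
  case (comp_id_right X Y n t)
  then have "X : Ob C" by (simp add: J_def)
  then show ?case using comp_id_right by (simp add: I M)
 qed (simp_all add: I E A K M)
 then show ?thesis using t by (simp add: J_def)
qed

lemma lift_eq_drinfeld_fun:
 assumes id: "!!i. 1 <= i ==> i <= length S ==> p i = i"
 shows "U.lift = drinfeld_fun (C, S) (D, T) F"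
 unfolding U.lift_def drinfeld_fun_def
proof (rule mk_fun_cong)
 fix X Y n f assume "X : Ob P.Q" "Y : Ob P.Q" and f: "f : hom_set P.Q X Y n"
 then have Ob: "X : Ob C" "Y : Ob C" by simp_all
 obtain t where t: "P.ty X Y n t" "f = P.cl X Y n t" using P.homE[OF f Ob] .
 have "P.ty X Y n f" using t P.cl_rel[OF t(1)] P.ty_left by simp
 from drinfeld_map_sound[OF id this]
 show "U.L X Y n f = rep (drinfeld_eq (fst (D, T)) (snd (D, T)) (fob F X) (fob F Y) n) (drinfeld_map F X Y n f)"
  by simp
qed simp

end

section \<open>The comparison functor\<close>

context tens
begin

lemma pt_lin_left: "[|V : Ob T; W : Ob T; g : hom_set D (psnd V) (psnd W) q; k = p + q|] ==>
  linear_map (Hom C (pfst V) (pfst W) p) (Hom T V W k) (%f. pt V W p f q g)"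
 by (rule linear_mapI[OF kmod_T C.kmod_hom]) (simp_all flip: hv_def)
lemma pt_lin_right: "[|V : Ob T; W : Ob T; f : hom_set C (pfst V) (pfst W) p; k = p + q|] ==>
  linear_map (Hom D (psnd V) (psnd W) q) (Hom T V W k) (%g. pt V W p f q g)"
 by (rule linear_mapI[OF kmod_T D.kmod_hom]) (simp_all flip: hv_def)

end

text \<open>The parts of an index list for a tensor product that belong to the two factors.\<close>

definition lo :: "nat => nat list => nat list" where
 "lo n K = filter (%k. k <= n) K"
definition hi :: "nat => nat list => nat list" where
 "hi n K = map (%k. k - n) (filter (%k. n < k) K)"

lemma lo_hi: "sorted K ==> K = lo n K @ map ((+) n) (hi n K)"
proof (induction K)
 case (Cons k K)
 show ?case
 proof (cases "k <= n")
  case True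
  then have "lo n (k # K) = k # lo n K" "hi n (k # K) = hi n K" by (simp_all add: lo_def hi_def)
  then show ?thesis using Cons by simp
 next
  case False
  have "ALL j:set K. n < j" using Cons.prems False by auto
  then have "lo n (k # K) = []" "filter (%k. n < k) K = K" using False by (auto simp: lo_def filter_empty_conv)
  moreover have "map ((+) n) (hi n (k # K)) = k # K"
   using False \<open>ALL j:set K. n < j\<close> by (simp add: hi_def) (rule map_idI, auto)
  ultimately show ?thesis by simp
 qed
qed (simp add: lo_def hi_def)

lemma lo_hi_append:
 assumes "!!a. a : set A ==> a <= n" "!!b. b : set B ==> 1 <= b"
 shows "lo n (A @ map ((+) n) B) = A" "hi n (A @ map ((+) n) B) = B"
proof -
 have A: "filter (%k. k <= n) A = A" "filter (%k. n < k) A = []"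
  using assms(1) by (auto simp: filter_id_conv filter_empty_conv not_less)
 have "filter (%k. k <= n) (map ((+) n) B) = []" "filter (%k. n < k) (map ((+) n) B) = map ((+) n) B"
  using assms(2) by (auto simp: filter_id_conv filter_empty_conv dest!: assms(2))
 then show "lo n (A @ map ((+) n) B) = A" "hi n (A @ map ((+) n) B) = B"
  using A by (simp_all add: lo_def hi_def comp_def)
qed

lemma rm_append: "rm t (A @ B) = (if t < length A then rm t A @ B else A @ rm (t - length A) B)"
 by (auto simp: rm_def Suc_diff_le)

definition tS :: "('a, 'k::field) pdg => ('a, 'k) pdg => ('a, 'k) univ set list" where
 "tS = (%(C, S) (D, T). map (%A. {Pair X Y |X Y. X : A & Y : Ob D}) S @
     map (%B. {Pair X Y |X Y. X : Ob C & Y : B}) T)"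

text \<open>The sign comes from the Cech rule, which counts positions from the end: omitting an index of \<open>I\<close> acquires
 the extra sign \<open>(-1)^|J|\<close>, whereas the differential of a tensor product puts the sign \<open>(-1)^|I|\<close> on the
 second factor. Multiplying by \<open>(-1)^(|I||J|)\<close> turns one rule into the other.\<close>

definition beta_e :: "('a, 'k::field) pdg => ('a, 'k) pdg => ('a, 'k) univ => nat list => ('a, 'k) univ" where
 "beta_e P R V K = (let I = lo (length (snd P)) K; J = hi (length (snd P)) K in
   hscale (tensor_dg (drinfeld P) (drinfeld R)) V V (- len K) (koszul (len I * len J))
    (pure_tensor (drinfeld P) (drinfeld R) V V
     (- len I) (dri.eb (fst P) (snd P) (pfst V) I) (- len J) (dri.eb (fst R) (snd R) (psnd V) J)))"

definition beta :: "('a, 'k::field) pdg => ('a, 'k) pdg => ('a, 'k) dgf" where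
 "beta P R = drilift.lift (tensor_dg (fst P) (fst R)) (tensor_dg (drinfeld P) (drinfeld R)) (tS P R)
   (tensor_fun (fst P) (drinfeld P) (fst R) (drinfeld R) (dri.incl (fst P) (snd P)) (dri.incl (fst R) (snd R))) (beta_e P R)"

lemma sum_split: "(\<Sum>u<s + (t::nat). f u) = (\<Sum>u<s. f u) + (\<Sum>u<t. f (s + u) :: 'r::ab_group_add)"
 by (induction t) (simp_all add: add.assoc)

locale dripair = P: dri C S + R: dri D T for C :: "('a, 'k::field) dg" and S and D :: "('a, 'k) dg" and T
begin

sublocale A: tens C D by (rule tens.intro[OF P.dgc_axioms R.dgc_axioms])
sublocale E: tens P.Q R.Q by (rule tens.intro[OF P.dgc_Q R.dgc_Q])

abbreviation "ST == tS (C, S) (D, T)"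

sublocale M: dri "tensor_dg C D" ST by (rule dri.intro[OF A.dgc_T])

abbreviation "N == length S"
abbreviation "be == beta_e (C, S) (D, T)"
abbreviation "ii == tensor_fun C P.Q D R.Q P.incl R.incl"

lemma Ob_E [simp]: "Ob E.T = Ob A.T"
 by (simp add: tensor_dg_def)

lemma ii_functor: "dg_functor A.T E.T ii"
 by (rule tensor_fun_functor[OF P.incl_functor R.incl_functor P.dgc_axioms P.dgc_Q R.dgc_axioms R.dgc_Q])

lemma ii_ob: "V : Ob A.T ==> fob ii V = V"
 by (simp add: tensor_fun_ob[OF P.incl_functor R.incl_functor P.dgc_axioms P.dgc_Q R.dgc_axioms R.dgc_Q])

lemma ii_pt: "[|V : Ob A.T; W : Ob A.T; f : hom_set C (pfst V) (pfst W) p; g : hom_set D (psnd V) (psnd W) q; n = p + q|] ==>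
  far ii V W n (A.pt V W p f q g) = E.pt V W p (P.inc (pfst V) (pfst W) p f) q (R.inc (psnd V) (psnd W) q g)"
 by (simp add: tensor_fun_pt[OF P.incl_functor R.incl_functor P.dgc_axioms P.dgc_Q R.dgc_axioms R.dgc_Q])

lemma mem_ST:
 assumes V: "V : Ob A.T" and i: "1 <= i" "i <= length ST"
 shows "V : ST ! (i - 1) \<longleftrightarrow> (if i <= N then pfst V : S ! (i - 1) else psnd V : T ! (i - N - 1))"
proof -
 obtain X Y where "V = Pair X Y" "X : Ob C" "Y : Ob D" using V by (auto simp: A.Ob_T)
 moreover have "i - 1 - N = i - N - 1" by simp
 ultimately show ?thesis using i by (auto simp: tS_def nth_append)
qed

lemma length_ST: "length ST = N + length T"
 by (simp add: tS_def)

lemma split_valid: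
 assumes v: "M.valid V K"
 shows "P.valid (pfst V) (lo N K)" "R.valid (psnd V) (hi N K)" "K = lo N K @ map ((+) N) (hi N K)"
  "length K = length (lo N K) + length (hi N K)"
proof -
 have V: "V : Ob A.T" by (rule M.valid_Ob[OF v])
 have K: "sorted_wrt (<) K" "!!k. k : set K ==> 1 <= k & k <= length ST & V : ST ! (k - 1)"
  using v by (auto simp: M.valid_def eps_index_def)
 show eq: "K = lo N K @ map ((+) N) (hi N K)" using K(1) by (intro lo_hi) (simp add: strict_sorted_iff)
 then show "length K = length (lo N K) + length (hi N K)" by (metis length_append length_map)
 have s1: "sorted_wrt (<) (lo N K)" unfolding lo_def using K(1) by (rule sorted_wrt_filter)
 have "sorted_wrt (<) (map ((+) N) (hi N K))" using K(1) eq by (metis sorted_wrt_append)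
 then have s2: "sorted_wrt (<) (hi N K)" by (simp add: sorted_wrt_map)
 have m1: "1 <= i & i <= N & pfst V : S ! (i - 1)" if "i : set (lo N K)" for i
  using K(2)[of i] that mem_ST[OF V, of i] by (auto simp: lo_def)
 have m2: "1 <= i & i <= length T & psnd V : T ! (i - 1)" if i: "i : set (hi N K)" for i
 proof -
  obtain k where k: "k : set K" "N < k" "i = k - N" using i by (auto simp: hi_def)
  then show ?thesis using K(2)[of k] mem_ST[OF V, of k] by (auto simp: length_ST)
 qed
 show "P.valid (pfst V) (lo N K)" using V s1 m1 by (auto simp: P.valid_def eps_index_def)
 show "R.valid (psnd V) (hi N K)" using V s2 m2 by (auto simp: R.valid_def eps_index_def)
qed

lemma lo_hi_rm:
 assumes v: "M.valid V K"
 shows "u < length (lo N K) ==> lo N (rm u K) = rm u (lo N K) & hi N (rm u K) = hi N K"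
  and "u < length (hi N K) ==> lo N (rm (length (lo N K) + u) K) = lo N K & hi N (rm (length (lo N K) + u) K) = rm u (hi N K)"
proof -
 note eq = split_valid(3)[OF v]
 have a: "!!a. a : set (lo N K) ==> a <= N" by (simp add: lo_def)
 have b: "!!b. b : set (hi N K) ==> 1 <= b" by (auto simp: hi_def)
 show "lo N (rm u K) = rm u (lo N K) & hi N (rm u K) = hi N K" if "u < length (lo N K)"
 proof -
  have "rm u K = rm u (lo N K) @ map ((+) N) (hi N K)" using that by (subst eq) (simp add: rm_append)
  then show ?thesis using lo_hi_append[of "rm u (lo N K)" N "hi N K"] set_rm[of u "lo N K"] a b by auto
 qed
 show "lo N (rm (length (lo N K) + u) K) = lo N K & hi N (rm (length (lo N K) + u) K) = rm u (hi N K)" if "u < length (hi N K)"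
 proof -
  have "rm (length (lo N K) + u) K = lo N K @ map ((+) N) (rm u (hi N K))"
   using that by (subst eq) (simp add: rm_append rm_map)
  then show ?thesis using lo_hi_append[of "lo N K" N "rm u (hi N K)"] set_rm[of u "hi N K"] a b by auto
 qed
qed

abbreviation "pe V I J == E.pt V V (- len I) (P.eb (pfst V) I) (- len J) (R.eb (psnd V) J)"

lemma pe_closed: "[|V : Ob A.T; P.valid (pfst V) I; R.valid (psnd V) J; k = - len I - len J|] ==>
 pe V I J : hom_set E.T V V k"
 by (simp add: P.eb_closed R.eb_closed)

lemma be_closed: "[|M.valid V K; k = - len K|] ==> be V K : hom_set E.T V V k"
 using split_valid[of V K] M.valid_Ob[of V K] by (simp add: beta_e_def Let_def pe_closed)

lemma hv_be: "M.valid V K ==> k = - len K ==> hv E.T V V k (be V K) =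
 sg (len (lo N K) * len (hi N K)) (hv E.T V V k (pe V (lo N K) (hi N K)))"
 using split_valid[of V K] M.valid_Ob[of V K] by (simp add: beta_e_def Let_def pe_closed)

lemma hv_dif_pe:
 assumes V: "V : Ob A.T" and vI: "P.valid (pfst V) I" and vJ: "R.valid (psnd V) J"
  and k: "k = - len I - len J"
 shows "hv E.T V V (k + 1) (Dif E.T V V k (pe V I J)) =
   (\<Sum>u<length I. sg (len I - int (u + 1)) (hv E.T V V (k + 1) (pe V (rm u I) J)))
   + sg (len I) (\<Sum>u<length J. sg (len J - int (u + 1)) (hv E.T V V (k + 1) (pe V I (rm u J))))"
proof -
 let ?s = "len I" and ?t = "len J"
 let ?x = "P.eb (pfst V) I" and ?y = "R.eb (psnd V) J"
 have Ob: "pfst V : Ob C" "psnd V : Ob D" using V by simp_all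
 have x: "?x : hom_set P.Q (pfst V) (pfst V) (- ?s)" and y: "?y : hom_set R.Q (psnd V) (psnd V) (- ?t)"
  using vI vJ by (simp_all add: P.eb_closed R.eb_closed)
 have dx: "Dif P.Q (pfst V) (pfst V) (- ?s) ?x : hom_set P.Q (pfst V) (pfst V) (1 - ?s)"
  and dy: "Dif R.Q (psnd V) (psnd V) (- ?t) ?y : hom_set R.Q (psnd V) (psnd V) (1 - ?t)"
  using x y Ob by (simp_all add: P.difQ_closed R.difQ_closed)
 have d: "Dif E.T V V k (pe V I J) = hadd E.T V V (k + 1)
   (E.pt V V (1 - ?s) (Dif P.Q (pfst V) (pfst V) (- ?s) ?x) (- ?t) ?y)
   (hscale E.T V V (k + 1) (koszul (- ?s)) (E.pt V V (- ?s) ?x (1 - ?t) (Dif R.Q (psnd V) (psnd V) (- ?t) ?y)))"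
  using E.dif_pt[of V V ?x "- ?s" ?y "- ?t" k] V x y k by simp
 have lenI: "- len (rm u I) = 1 - ?s" if "u < length I" for u using that by simp
 have lenJ: "- len (rm u J) = 1 - ?t" if "u < length J" for u using that by simp
 have 1: "hv E.T V V (k + 1) (E.pt V V (1 - ?s) (Dif P.Q (pfst V) (pfst V) (- ?s) ?x) (- ?t) ?y)
   = (\<Sum>u<length I. sg (?s - int (u + 1)) (hv E.T V V (k + 1) (E.pt V V (1 - ?s) (P.eb (pfst V) (rm u I)) (- ?t) ?y)))"
 proof (rule P.hv_linear_sum[OF Ob(1,1) E.T.gcat_axioms _ _ E.pt_lin_left dx _ P.hv_difQ_eb[OF vI]])
  fix u assume u: "u < length I"
  then show "P.eb (pfst V) (rm u I) : hom_set P.Q (pfst V) (pfst V) (1 - ?s)"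
   using lenI[OF u] P.valid_rm'[OF vI u] by (simp add: P.eb_closed)
 qed (use V y k in simp_all)
 have 2: "hv E.T V V (k + 1) (E.pt V V (- ?s) ?x (1 - ?t) (Dif R.Q (psnd V) (psnd V) (- ?t) ?y))
   = (\<Sum>u<length J. sg (?t - int (u + 1)) (hv E.T V V (k + 1) (E.pt V V (- ?s) ?x (1 - ?t) (R.eb (psnd V) (rm u J)))))"
 proof (rule R.hv_linear_sum[OF Ob(2,2) E.T.gcat_axioms _ _ E.pt_lin_right dy _ R.hv_difQ_eb[OF vJ]])
  fix u assume u: "u < length J"
  then show "R.eb (psnd V) (rm u J) : hom_set R.Q (psnd V) (psnd V) (1 - ?t)"
   using lenJ[OF u] R.valid_rm'[OF vJ u] by (simp add: R.eb_closed)
 qed (use V x k in simp_all)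
 have "hv E.T V V (k + 1) (Dif E.T V V k (pe V I J)) =
  hv E.T V V (k + 1) (E.pt V V (1 - ?s) (Dif P.Q (pfst V) (pfst V) (- ?s) ?x) (- ?t) ?y)
  + sg (- ?s) (hv E.T V V (k + 1) (E.pt V V (- ?s) ?x (1 - ?t) (Dif R.Q (psnd V) (psnd V) (- ?t) ?y)))"
  unfolding d using V x y dx dy k by simp
 also have "... = (\<Sum>u<length I. sg (?s - int (u + 1)) (hv E.T V V (k + 1) (pe V (rm u I) J)))
   + sg ?s (\<Sum>u<length J. sg (?t - int (u + 1)) (hv E.T V V (k + 1) (pe V I (rm u J))))"
  unfolding 1 2 using lenI lenJ by (simp add: sg_def[of "- ?s"] sg_def[of ?s] cong: sum.cong_simp)
 finally show ?thesis .
qed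

lemma sg_sum: "sg m (sum f A) = (\<Sum>x\<in>A. sg m (f x))"
 by (simp add: sg_def sum_negf)

lemma sg_cong: "even (m - n) ==> sg m r = sg n r"
 by (simp add: sg_def)

lemma hv_dif_be:
 assumes v: "M.valid V K"
 shows "hv E.T V V (1 - len K) (Dif E.T V V (- len K) (be V K)) =
   (\<Sum>u<length K. sg (len K - int (u + 1)) (hv E.T V V (1 - len K) (be V (rm u K))))"
proof -
 define I J where IJ: "I = lo N K" "J = hi N K"
 note sv = split_valid[OF v, folded IJ]
 let ?s = "len I" and ?t = "len J" and ?k = "- len K"
 have V: "V : Ob A.T" by (rule M.valid_Ob[OF v])
 have k: "?k = - ?s - ?t" "?k + 1 = 1 - len K" using sv(4) by simp_all
 have d: "Dif E.T V V ?k (be V K) = hscale E.T V V (?k + 1) (koszul (?s * ?t)) (Dif E.T V V ?k (pe V I J))"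
  using V sv(1,2,4) pe_closed[OF V sv(1,2) k(1)] by (simp add: beta_e_def Let_def IJ[symmetric])
 have split: "(\<Sum>u<length K. f u) = (\<Sum>u<length I. f u) + (\<Sum>u<length J. f (length I + u))"
  for f :: "nat => (('a, 'k) univ => 'k) => 'k"
  unfolding sv(4) by (rule sum_split)
 have "hv E.T V V (?k + 1) (Dif E.T V V ?k (be V K)) = sg (?s * ?t)
  ((\<Sum>u<length I. sg (?s - int (u + 1)) (hv E.T V V (?k + 1) (pe V (rm u I) J)))
   + sg ?s (\<Sum>u<length J. sg (?t - int (u + 1)) (hv E.T V V (?k + 1) (pe V I (rm u J)))))"
  unfolding d using hv_dif_pe[OF V sv(1,2) k(1)] V pe_closed[OF V sv(1,2) k(1)] by (simp, simp add: add.commute)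
 also have "... = (\<Sum>u<length I. sg (?s * ?t + (?s - int (u + 1))) (hv E.T V V (?k + 1) (pe V (rm u I) J)))
   + (\<Sum>u<length J. sg (?s * ?t + ?s + (?t - int (u + 1))) (hv E.T V V (?k + 1) (pe V I (rm u J))))"
  by (simp add: sg_sum add.assoc)
 also have "(\<Sum>u<length I. sg (?s * ?t + (?s - int (u + 1))) (hv E.T V V (?k + 1) (pe V (rm u I) J))) =
   (\<Sum>u<length I. sg (len K - int (u + 1)) (hv E.T V V (?k + 1) (be V (rm u K))))"
 proof (rule sum.cong[OF refl])
  fix u assume "u : {..<length I}"
  then have u: "u < length I" "u < length K" using sv(4) by auto
  have b: "hv E.T V V (?k + 1) (be V (rm u K)) = sg (int (length I - 1) * ?t) (hv E.T V V (?k + 1) (pe V (rm u I) J))"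
   using hv_be[OF M.valid_rm'[OF v u(2)], of "?k + 1"] lo_hi_rm(1)[OF v, folded IJ, OF u(1)] u by simp
  show "sg (?s * ?t + (?s - int (u + 1))) (hv E.T V V (?k + 1) (pe V (rm u I) J)) =
    sg (len K - int (u + 1)) (hv E.T V V (?k + 1) (be V (rm u K)))"
   unfolding b sg_simps by (rule sg_cong) (use u sv(4) in "simp add: of_nat_diff algebra_simps")
 qed
 also have "(\<Sum>u<length J. sg (?s * ?t + ?s + (?t - int (u + 1))) (hv E.T V V (?k + 1) (pe V I (rm u J)))) =
   (\<Sum>u<length J. sg (len K - int (length I + u + 1)) (hv E.T V V (?k + 1) (be V (rm (length I + u) K))))"
 proof (rule sum.cong[OF refl])
  fix u assume "u : {..<length J}"
  then have u: "u < length J" "length I + u < length K" using sv(4) by auto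
  have b: "hv E.T V V (?k + 1) (be V (rm (length I + u) K)) = sg (?s * int (length J - 1)) (hv E.T V V (?k + 1) (pe V I (rm u J)))"
   using hv_be[OF M.valid_rm'[OF v u(2)], of "?k + 1"] lo_hi_rm(2)[OF v, folded IJ, OF u(1)] u by simp
  show "sg (?s * ?t + ?s + (?t - int (u + 1))) (hv E.T V V (?k + 1) (pe V I (rm u J))) =
    sg (len K - int (length I + u + 1)) (hv E.T V V (?k + 1) (be V (rm (length I + u) K)))"
   unfolding b sg_simps by (rule sg_cong) (use u sv(4) in "simp add: of_nat_diff algebra_simps")
 qed
 finally show ?thesis unfolding k(2) split .
qed

sublocale B: drilift "tensor_dg C D" E.T ST ii be
proof -
 interpret i: dgfunctor A.T E.T ii
  by (intro dgfunctor.intro dgfunctor_axioms.intro A.dgc_T E.dgc_T ii_functor)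
 show "drilift (tensor_dg C D) E.T ST ii be"
 proof (intro drilift.intro drilift_axioms.intro M.dri_axioms i.dgfunctor_axioms)
  fix V K assume v: "M.valid V K"
  then show "be V K : hom_set E.T (fob ii V) (fob ii V) (- len K)"
   using be_closed M.valid_Ob by (simp add: ii_ob)
 next
  fix V assume V: "V : Ob A.T"
  have "be V [] = hscale E.T V V 0 1 (Id E.T V)"
   by (simp add: beta_e_def lo_def hi_def P.eb_Nil R.eb_Nil E.Id_T koszul_def)
  then show "be V [] = Id E.T (fob ii V)"
   using V by (simp add: ii_ob kmod.smult_one[OF E.T.kmod_hom])
 next
  fix V K assume V: "V : Ob A.T" and K: "eps_index ST V K"
  then have "M.valid V K" by (simp add: M.valid_def)
  from hv_dif_be[OF this]
  show "hv E.T (fob ii V) (fob ii V) (1 - len K) (Dif E.T (fob ii V) (fob ii V) (- len K) (be V K)) =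
   (\<Sum>t<length K. sg (len K - int (t + 1)) (hv E.T (fob ii V) (fob ii V) (1 - len K) (be V (rm t K))))"
   using V by (simp add: ii_ob)
 qed
qed

lemma beta_functor: "dg_functor M.Q E.T (beta (C, S) (D, T))"
 using B.lift_functor by (simp add: beta_def)

lemma beta_simps:
 "V : Ob A.T ==> fob (beta (C, S) (D, T)) V = V"
 "[|V : Ob A.T; W : Ob A.T; x : hom_set A.T V W n|] ==> far (beta (C, S) (D, T)) V W n (M.inc V W n x) = far ii V W n x"
 "[|M.valid V K; k = - len K|] ==> far (beta (C, S) (D, T)) V V k (M.eb V K) = be V K"
 using B.lift_simps by (simp_all add: beta_def ii_ob)

end

section \<open>Coherence of the comparison functor\<close>

lemma dgfunctorI: "[|dgc C; dgc D; dg_functor C D F|] ==> dgfunctor C D F"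
 by (intro dgfunctor.intro dgfunctor_axioms.intro)

lemma (in dri) inc_add: "[|X : Ob C; Y : Ob C; f : hom_set C X Y n; g : hom_set C X Y n|] ==>
  inc X Y n (hadd C X Y n f g) = hadd Q X Y n (inc X Y n f) (inc X Y n g)"
 and inc_scale: "[|X : Ob C; Y : Ob C; f : hom_set C X Y n|] ==>
  inc X Y n (hscale C X Y n c f) = hscale Q X Y n c (inc X Y n f)"
 using inc_lin[of X Y n] by (simp_all add: linear_map_def)

definition ptensor :: "('a, 'k::field) pdg => ('a, 'k) pdg => ('a, 'k) pdg" where
 "ptensor P R = (tensor_dg (fst P) (fst R), tS P R)"

lemma ptensor_pobj: "[|P : pobj; R : pobj|] ==> ptensor P R : pobj"
 by (auto simp: pobj_def ptensor_def tS_def dgc_tensor, auto simp: tensor_dg_def)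

lemma pobj_dri: "(C, S) : pobj ==> dri C"
 by (auto simp: pobj_def intro: dri.intro)

subsection \<open>Naturality\<close>

definition tsum :: "nat => nat => nat => (nat => nat) => (nat => nat) => nat => nat" where
 "tsum n m' n' \<sigma> \<tau> = restrict (%j. if j <= m' then \<sigma> j else n + \<tau> (j - m')) {0..m' + n'}"

lemma tsum_Delta:
 assumes s: "\<sigma> : Delta_f m' n" and t: "\<tau> : Delta_f n' k"
 shows "tsum n m' n' \<sigma> \<tau> : Delta_f (m' + n') (n + k)"
proof -
 note S = Delta_fD[OF s] and T = Delta_fD[OF t]
 have le: "\<sigma> j <= n" if "j <= m'" for j using S(3)[OF that order_refl] S(2) by simp
 have le': "\<tau> j <= k" if "j <= n'" for j using T(3)[OF that order_refl] T(2) by simp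
 have "mono_on {0..m' + n'} (tsum n m' n' \<sigma> \<tau>)"
 proof (rule mono_onI)
  fix i j assume "i : {0..m' + n'}" "j : {0..m' + n'}" "i <= j"
  then show "tsum n m' n' \<sigma> \<tau> i <= tsum n m' n' \<sigma> \<tau> j"
   using S(3)[of i j] T(3)[of "i - m'" "j - m'"] le[of i] by (auto simp: tsum_def)
 qed
 moreover have "tsum n m' n' \<sigma> \<tau> : {0..m' + n'} \<rightarrow>\<^sub>E {0..n + k}"
  using le le' by (auto simp: tsum_def intro!: le_trans[OF le] add_left_mono)
 moreover have "tsum n m' n' \<sigma> \<tau> (m' + n') = n + k"
  using S T by (auto simp: tsum_def)
 ultimately show ?thesis using S by (simp add: Delta_f_def tsum_def)
qed

lemma idx_tsum:
 assumes s: "\<sigma> : Delta_f m' n" and t: "\<tau> : Delta_f n' k"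
 shows "[|1 <= i; i <= n|] ==> idx (tsum n m' n' \<sigma> \<tau>) i = idx \<sigma> i"
  and "[|1 <= i; i <= k|] ==> idx (tsum n m' n' \<sigma> \<tau>) (n + i) = m' + idx \<tau> i"
proof -
 note S = Delta_fD[OF s] and T = Delta_fD[OF t]
 have le: "\<sigma> j <= n" if "j <= m'" for j using S(3)[OF that order_refl] S(2) by simp
 show "idx (tsum n m' n' \<sigma> \<tau>) i = idx \<sigma> i" if i: "1 <= i" "i <= n"
 proof (rule idx_eqI)
  note a = idx[OF s i]
  show "i <= tsum n m' n' \<sigma> \<tau> (idx \<sigma> i)" using a by (simp add: tsum_def)
  show "tsum n m' n' \<sigma> \<tau> j < i" if "j < idx \<sigma> i" for j
   using a(3) a(5)[of j] that by (simp add: tsum_def)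
 qed
 show "idx (tsum n m' n' \<sigma> \<tau>) (n + i) = m' + idx \<tau> i" if i: "1 <= i" "i <= k"
 proof (rule idx_eqI)
  note a = idx[OF t i]
  show "n + i <= tsum n m' n' \<sigma> \<tau> (m' + idx \<tau> i)" using a by (simp add: tsum_def)
  show "tsum n m' n' \<sigma> \<tau> j < n + i" if "j < m' + idx \<tau> i" for j
  proof -
   have "j - m' < idx \<tau> i" using that a(2) by linarith
   then have "\<tau> (j - m') < i" using a(3) a(5)[of "j - m'"] by (simp add: not_le[symmetric])
   then show ?thesis using that le[of j] i a(3) by (auto simp: tsum_def)
  qed
 qed
qed

locale drinat = F: drmap C S C' S' F "idx \<sigma>" + G: drmap D T D' T' G "idx \<tau>"
 for C :: "('a, 'k::field) dg" and S and C' :: "('a, 'k) dg" and S' F \<sigma>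
  and D :: "('a, 'k) dg" and T and D' :: "('a, 'k) dg" and T' G \<tau> +
 assumes P: "(C, S) : pobj" and P': "(C', S') : pobj" and R: "(D, T) : pobj" and R': "(D', T') : pobj"
  and f: "(\<sigma>, F) : parr (C, S) (C', S')" and g: "(\<tau>, G) : parr (D, T) (D', T')"
begin

sublocale p: dripair C S D T
 by (rule dripair.intro[OF F.P.dri_axioms G.P.dri_axioms])
sublocale p': dripair C' S' D' T'
 by (rule dripair.intro[OF F.R.dri_axioms G.R.dri_axioms])

abbreviation "\<rho> == tsum (length S) (length S') (length T') \<sigma> \<tau>"
abbreviation "H == tensor_fun C C' D D' F G"
abbreviation "PT == ptensor (C, S) (D, T)"
abbreviation "PT' == ptensor (C', S') (D', T')"

lemma s: "\<sigma> : Delta_f (length S') (length S)" and t: "\<tau> : Delta_f (length T') (length T)"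
 using f g by (auto simp: parr_def)

lemma PT_eq: "PT = (p.A.T, p.ST)" "PT' = (p'.A.T, p'.ST)"
 by (simp_all add: ptensor_def)

lemmas H_functor = tensor_fun_functor[OF F.F.dg_functor G.F.dg_functor F.P.dgc_axioms F.R.dgc_axioms G.P.dgc_axioms G.R.dgc_axioms]
lemmas H_ob = tensor_fun_ob[OF F.F.dg_functor G.F.dg_functor F.P.dgc_axioms F.R.dgc_axioms G.P.dgc_axioms G.R.dgc_axioms]
lemmas H_pt = tensor_fun_pt[OF F.F.dg_functor G.F.dg_functor F.P.dgc_axioms F.R.dgc_axioms G.P.dgc_axioms G.R.dgc_axioms]

lemma h: "(\<rho>, H) : parr PT PT'"
proof -
 have sub: "fob F ` (S ! (i - 1)) \<subseteq> S' ! (j - 1)" if "1 <= j" "j <= length S'" "\<sigma> (j - 1) < i" "i <= \<sigma> j" for i j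
  using f that by (auto simp: parr_def)
 have sub': "fob G ` (T ! (i - 1)) \<subseteq> T' ! (j - 1)" if "1 <= j" "j <= length T'" "\<tau> (j - 1) < i" "i <= \<tau> j" for i j
  using g that by (auto simp: parr_def)
 have SO: "A \<subseteq> Ob C" if "A : set S" for A using P that by (auto simp: pobj_def)
 have TO: "A \<subseteq> Ob D" if "A : set T" for A using R that by (auto simp: pobj_def)
 have "fob H ` (p.ST ! (i - 1)) \<subseteq> p'.ST ! (j - 1)"
  if j: "1 <= j" "j <= length p'.ST" and i: "\<rho> (j - 1) < i" "i <= \<rho> j" for i j
 proof (cases "j <= length S'")
  case True
  then have "j - 1 <= length S'" by simp
  then have i': "\<sigma> (j - 1) < i" "i <= \<sigma> j" using i True by (simp_all add: tsum_def)
  then have n: "i <= length S" "1 <= i" using Delta_fD(3)[OF s True order_refl] Delta_fD(2)[OF s] by simp_all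
  have "S ! (i - 1) \<subseteq> Ob C" using n by (intro SO) simp
  then have "fob H (Pair X Y) = Pair (fob F X) (fob G Y)" if "X : S ! (i - 1)" "Y : Ob D" for X Y
   using that H_ob[of "Pair X Y"] by auto
  moreover have "p.ST ! (i - 1) = {Pair X Y |X Y. X : S ! (i - 1) & Y : Ob D}"
  proof -
   have "i - 1 < length S" using n by linarith
   then show ?thesis by (simp add: tS_def nth_append)
  qed
  moreover have "p'.ST ! (j - 1) = {Pair X Y |X Y. X : S' ! (j - 1) & Y : Ob D'}"
  proof -
   have "j - 1 < length S'" using True j by linarith
   then show ?thesis by (simp add: tS_def nth_append)
  qed
  ultimately show ?thesis using sub[OF j(1) True i'] by fastforce
 next
  case False
  then have j': "1 <= j - length S'" "j - length S' <= length T'" using j by (simp_all add: tS_def)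
  have "\<rho> (j - 1) = length S + \<tau> (j - length S' - 1)"
  proof (cases "j - 1 <= length S'")
   case True
   then have "j - 1 = length S'" using False by simp
   then show ?thesis using Delta_fD(2)[OF s] Delta_fD(1)[OF t] j' by (simp add: tsum_def)
  next
   case False
   moreover have "j - 1 <= length S' + length T'" using j' by linarith
   ultimately show ?thesis using j' by (simp add: tsum_def diff_commute)
  qed
  moreover have "\<rho> j = length S + \<tau> (j - length S')"
  proof -
   have "j <= length S' + length T'" using j' by linarith
   then show ?thesis using False by (simp add: tsum_def)
  qed
  ultimately have i': "\<tau> (j - length S' - 1) < i - length S" "i - length S <= \<tau> (j - length S')" "length S < i" using i by simp_all
  then have n: "i - length S <= length T" "1 <= i - length S"
   using Delta_fD(3)[OF t j'(2) order_refl] Delta_fD(2)[OF t] by simp_all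
  have "T ! (i - length S - 1) \<subseteq> Ob D" using n by (intro TO) simp
  then have "fob H (Pair X Y) = Pair (fob F X) (fob G Y)" if "Y : T ! (i - length S - 1)" "X : Ob C" for X Y
   using that H_ob[of "Pair X Y"] by auto
  moreover have "p.ST ! (i - 1) = {Pair X Y |X Y. X : Ob C & Y : T ! (i - length S - 1)}"
  proof -
   have "~ i - 1 < length S" "i - 1 - length S = i - length S - 1" "i - length S - 1 < length T" using n i'(3) by linarith+
   then show ?thesis by (simp add: tS_def nth_append)
  qed
  moreover have "p'.ST ! (j - 1) = {Pair X Y |X Y. X : Ob C' & Y : T' ! (j - length S' - 1)}"
  proof -
   have "~ j - 1 < length S'" "j - 1 - length S' = j - length S' - 1" "j - length S' - 1 < length T'" using j' False by linarith+
   then show ?thesis by (simp add: tS_def nth_append)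
  qed
  ultimately show ?thesis using sub'[OF j' i'(1,2)] by fastforce
 qed
 then show ?thesis
  using tsum_Delta[OF s t] H_functor unfolding PT_eq parr_def by (auto simp: tS_def)
qed

abbreviation "dF == dr_arr (C, S) (C', S') (\<sigma>, F)"
abbreviation "dG == dr_arr (D, T) (D', T') (\<tau>, G)"
abbreviation "dH == dr_arr PT PT' (\<rho>, H)"
abbreviation "dFG == tensor_fun F.P.Q F.R.Q G.P.Q G.R.Q dF dG"

lemmas dF_functor = dr_arr_functor[OF P P' f]
lemmas dG_functor = dr_arr_functor[OF R R' g]
lemmas dH_functor = dr_arr_functor[OF ptensor_pobj[OF P R] ptensor_pobj[OF P' R'] h, unfolded PT_eq]
lemmas dH_simps = dr_arr_simps[OF ptensor_pobj[OF P R, unfolded PT_eq] ptensor_pobj[OF P' R', unfolded PT_eq] h[unfolded PT_eq]]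
lemmas dFG_functor = tensor_fun_functor[OF dF_functor dG_functor F.P.dgc_Q F.R.dgc_Q G.P.dgc_Q G.R.dgc_Q]
lemmas dFG_ob = tensor_fun_ob[OF dF_functor dG_functor F.P.dgc_Q F.R.dgc_Q G.P.dgc_Q G.R.dgc_Q]
lemmas dFG_pt = tensor_fun_pt[OF dF_functor dG_functor F.P.dgc_Q F.R.dgc_Q G.P.dgc_Q G.R.dgc_Q]

text \<open>On generators both sides send \<open>I, J\<close> to the renumbered lists, or to \<open>0\<close> if either of these has a repetition;
 there is no repetition between the two parts because they land in different blocks.\<close>

lemma beta_natural:
 "comp_fun p.M.Q (beta (C', S') (D', T')) dH = comp_fun p.M.Q dFG (beta (C, S) (D, T))"
proof -
 let ?b = "beta (C, S) (D, T)" and ?b' = "beta (C', S') (D', T')"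
 interpret b: dgfunctor p.M.Q p.E.T ?b by (rule dgfunctorI[OF p.M.dgc_Q p.E.dgc_T p.beta_functor])
 interpret b': dgfunctor p'.M.Q p'.E.T ?b' by (rule dgfunctorI[OF p'.M.dgc_Q p'.E.dgc_T p'.beta_functor])
 have dHf: "dg_functor p.M.Q p'.M.Q dH" using dH_functor unfolding PT_eq .
 interpret h: dgfunctor p.M.Q p'.M.Q dH by (rule dgfunctorI[OF p.M.dgc_Q p'.M.dgc_Q dHf])
 interpret fg: dgfunctor p.E.T p'.E.T dFG by (rule dgfunctorI[OF p.E.dgc_T p'.E.dgc_T dFG_functor])
 interpret H: dgfunctor p.A.T p'.A.T H by (rule dgfunctorI[OF p.A.dgc_T p'.A.dgc_T H_functor])
 show ?thesis
 proof (rule p.M.Q_functor_eqI[OF dg_functor_comp[OF p.M.dgc_Q p'.M.dgc_Q p'.E.dgc_T dHf p'.beta_functor]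
    dg_functor_comp[OF p.M.dgc_Q p.E.dgc_T p'.E.dgc_T p.beta_functor dFG_functor] p'.E.dgc_T])
  fix V assume V: "V : Ob p.A.T"
  then have "fob H V : Ob p'.A.T" by simp
  then show "fob (comp_fun p.M.Q ?b' dH) V = fob (comp_fun p.M.Q dFG ?b) V"
   using V by (simp add: comp_fun_simps dH_simps[folded PT_eq] p'.beta_simps p.beta_simps dFG_ob H_ob
    dr_arr_simps[OF P P' f] dr_arr_simps[OF R R' g])
 next
  fix V W n x assume V: "V : Ob p.A.T" and W: "W : Ob p.A.T" and x: "x : hom_set p.A.T V W n"
  have dob: "fob dFG V = fob H V" if "V : Ob p.A.T" for V
   using that by (simp add: H_ob dFG_ob dr_arr_simps[OF P P' f] dr_arr_simps[OF R R' g])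
  have e: "far p'.ii (fob H V) (fob H W) n (far H V W n x) = far dFG V W n (far p.ii V W n x)"
   using V W x
  proof (induction rule: p.A.tensor_hom_induct)
   case (pure p f q g)
   then show ?case using V W
    by (simp add: H_pt H_ob p'.ii_pt p.ii_pt dFG_pt F.P.inc_closed G.P.inc_closed dr_arr_simps[OF P P' f] dr_arr_simps[OF R R' g])
  next
   case (add x y)
   then show ?case using V W p.B.F.far_add[OF V W add(1,2)] p.B.F.far_closed[OF V W] fg.far_add[of V W "far p.ii V W n x" n "far p.ii V W n y"]
    by (simp add: p.ii_ob p'.ii_ob dob)
  next
   case (scale c x)
   then show ?case using V W p.B.F.far_scale[OF V W scale(1)] p.B.F.far_closed[OF V W] fg.far_scale[of V W "far p.ii V W n x" n c]
    by (simp add: p.ii_ob p'.ii_ob dob)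
  qed
  have Hx: "fob H V : Ob p'.A.T" "fob H W : Ob p'.A.T" "far H V W n x : hom_set p'.A.T (fob H V) (fob H W) n"
   using V W x by simp_all
  show "far (comp_fun p.M.Q ?b' dH) V W n (p.M.inc V W n x) = far (comp_fun p.M.Q dFG ?b) V W n (p.M.inc V W n x)"
   using V W x e Hx by (simp add: comp_fun_simps p.M.inc_closed dH_simps[folded PT_eq] p'.beta_simps p.beta_simps)
 next
  fix V K assume V: "V : Ob p.A.T" and K: "eps_index p.ST V K"
  then have v: "p.M.valid V K" by (simp add: p.M.valid_def)
  define I J where IJ: "I = lo (length S) K" "J = hi (length S) K"
  note sv = p.split_valid[OF v, folded IJ]
  let ?k = "- len K" and ?p = "map (idx \<sigma>) I" and ?q = "map (idx \<tau>) J"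
  have I: "1 <= i & i <= length S" if "i : set I" for i
   using sv(1) that by (auto simp: F.P.valid_def eps_index_def)
  have J: "1 <= i & i <= length T" if "i : set J" for i
   using sv(2) that by (auto simp: G.P.valid_def eps_index_def)
  have m: "map (idx \<rho>) K = ?p @ map ((+) (length S')) ?q"
   using I J idx_tsum[OF s t] by (subst sv(3)) simp
  have pq: "!!a. a : set ?p ==> a <= length S'" "!!b. b : set ?q ==> 1 <= b"
   using I J idx(2,3)[OF s] idx(2,3)[OF t] by auto
  have d: "distinct (map (idx \<rho>) K) \<longleftrightarrow> distinct ?p & distinct ?q"
  proof -
   have "set ?p \<inter> set (map ((+) (length S')) ?q) = {}" using pq by (force simp del: map_map)
   moreover have "distinct (map ((+) (length S')) ?q) \<longleftrightarrow> distinct ?q" unfolding distinct_map[of "(+) (length S')"] by simp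
   ultimately show ?thesis unfolding m distinct_append by blast
  qed
  have lh: "lo (length S') (?p @ map ((+) (length S')) ?q) = ?p" "hi (length S') (?p @ map ((+) (length S')) ?q) = ?q"
   by (rule lo_hi_append(1)[OF pq], assumption+) (rule lo_hi_append(2)[OF pq], assumption+)
  have FO: "fob F (pfst V) : Ob C'" "fob G (psnd V) : Ob D'" "fob H V : Ob p'.A.T" using V by simp_all
  have HV: "fob H V = Pair (fob F (pfst V)) (fob G (psnd V))" using V by (simp add: H_ob)
  have VW: "fob dFG V = fob H V" using V by (simp add: HV dFG_ob dr_arr_simps[OF P P' f] dr_arr_simps[OF R R' g])
  let ?E = "hv p'.E.T (fob H V) (fob H V) ?k"
  let ?ei = "dr_e (C', S') F (idx \<sigma>) (pfst V) I" and ?ej = "dr_e (D', T') G (idx \<tau>) (psnd V) J"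
  have eij: "?ei : hom_set F.R.Q (fob F (pfst V)) (fob F (pfst V)) (- len I)"
   "?ej : hom_set G.R.Q (fob G (psnd V)) (fob G (psnd V)) (- len J)"
   using F.e_closed[OF sv(1) refl] G.e_closed[OF sv(2) refl] by simp_all
  have k: "?k = - len I + - len J" using sv(4) by simp
  have be: "p.be V K : hom_set p.E.T V V ?k" using p.be_closed[OF v refl] .
  have r0: "far dFG V V ?k (p.pe V I J) = p'.E.pt (fob H V) (fob H V) (- len I) ?ei (- len J) ?ej"
   using V dFG_pt[of V V "F.P.eb (pfst V) I" "- len I" "G.P.eb (psnd V) J" "- len J" ?k]
    F.P.eb_closed[OF sv(1) refl] G.P.eb_closed[OF sv(2) refl] k
   by (simp add: HV dr_arr_simps[OF P P' f] dr_arr_simps[OF R R' g] sv(1,2))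
  have pec: "p.pe V I J : hom_set p.E.T V V ?k"
   using p.pe_closed[OF V sv(1,2)] k by simp
  have r: "?E (far dFG V V ?k (p.be V K)) = sg (len I * len J)
    (?E (p'.E.pt (fob H V) (fob H V) (- len I) ?ei (- len J) ?ej))"
   unfolding r0[symmetric] using V fg.far_scale[of V V "p.pe V I J" ?k "koszul (len I * len J)"] pec fg.far_closed[of V V "p.pe V I J" ?k] FO
   by (simp add: beta_e_def Let_def IJ[symmetric] VW)
  have l: "far (comp_fun p.M.Q ?b' dH) V V ?k (p.M.eb V K) = far ?b' (fob H V) (fob H V) ?k (dr_e PT' H (idx \<rho>) V K)"
   using V v by (simp add: comp_fun_simps p.M.eb_closed dH_simps[folded PT_eq])
  have r': "far (comp_fun p.M.Q dFG ?b) V V ?k (p.M.eb V K) = far dFG V V ?k (p.be V K)"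
   using V v by (simp add: comp_fun_simps p.M.eb_closed p.beta_simps)
  have "?E (far ?b' (fob H V) (fob H V) ?k (dr_e PT' H (idx \<rho>) V K)) = ?E (far dFG V V ?k (p.be V K))"
  proof (cases "distinct ?p & distinct ?q")
   case True
   interpret hh: drmap p.A.T p.ST p'.A.T p'.ST H "idx \<rho>"
    using drmap_parr[OF ptensor_pobj[OF P R, unfolded PT_eq] ptensor_pobj[OF P' R', unfolded PT_eq] h[unfolded PT_eq]] .
   have v': "p'.M.valid (fob H V) (map (idx \<rho>) K)" using hh.valid_p[OF v] d True by blast
   have "far ?b' (fob H V) (fob H V) ?k (dr_e PT' H (idx \<rho>) V K) = p'.be (fob H V) (map (idx \<rho>) K)"
    using p'.beta_simps(3)[OF v', of ?k] d True unfolding PT_eq by (simp add: dr_e_def del: distinct_map)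
   have lk: "?k = - int (length (map (idx \<rho>) K))" by simp
   have "?ei = F.R.eb (fob F (pfst V)) ?p" "?ej = G.R.eb (fob G (psnd V)) ?q"
    using True by (simp_all add: dr_e_def del: distinct_map)
   then show ?thesis unfolding r \<open>far ?b' _ _ _ _ = _\<close>
    using p'.hv_be[OF v' lk, unfolded m lh] by (simp add: HV m del: map_map)
  next
   case False
   then have "~ distinct (map (idx \<rho>) K)" using d by blast
   then have "far ?b' (fob H V) (fob H V) ?k (dr_e PT' H (idx \<rho>) V K) = hzero p'.E.T (fob H V) (fob H V) ?k"
    using b'.far_zero[of "fob H V" "fob H V" ?k] FO unfolding PT_eq by (simp add: dr_e_def p'.beta_simps del: distinct_map)
   then have "?E (far ?b' (fob H V) (fob H V) ?k (dr_e PT' H (idx \<rho>) V K)) = 0" using FO by simp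
   moreover have "?E (p'.E.pt (fob H V) (fob H V) (- len I) ?ei (- len J) ?ej) = 0"
   proof (cases "distinct ?p")
    case True
    then have "?ej = hzero G.R.Q (fob G (psnd V)) (fob G (psnd V)) (- len J)" using False by (simp add: dr_e_def del: distinct_map)
    then show ?thesis using p'.E.hv_pt_zero(2)[of "fob H V" "fob H V" ?k "- len I" "- len J" ?ei] FO eij k by (simp add: HV)
   next
    case False
    then have "?ei = hzero F.R.Q (fob F (pfst V)) (fob F (pfst V)) (- len I)" by (simp add: dr_e_def del: distinct_map)
    then show ?thesis using p'.E.hv_pt_zero(1)[of "fob H V" "fob H V" ?k "- len I" "- len J" ?ej] FO eij k by (simp add: HV)
   qed
   ultimately show ?thesis unfolding r by simp
  qed
  moreover have "far dFG V V ?k (p.be V K) : hom_set p'.E.T (fob H V) (fob H V) ?k"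
   using fg.far_closed[of V V "p.be V K" ?k] V be VW by simp
  moreover have "far ?b' (fob H V) (fob H V) ?k (dr_e PT' H (idx \<rho>) V K) : hom_set p'.E.T (fob H V) (fob H V) ?k"
  proof -
   have "far dH V V ?k (p.M.eb V K) : hom_set p'.M.Q (fob H V) (fob H V) ?k"
    using h.far_closed[of V V "p.M.eb V K" ?k] V v by (simp add: p.M.eb_closed dH_simps[folded PT_eq])
   then show ?thesis using b'.far_closed[of "fob H V" "fob H V" "dr_e PT' H (idx \<rho>) V K" ?k] FO V v
    by (simp add: dH_simps[folded PT_eq] p'.beta_simps)
  qed
  ultimately show "far (comp_fun p.M.Q ?b' dH) V V ?k (p.M.eb V K) = far (comp_fun p.M.Q dFG ?b) V V ?k (p.M.eb V K)"
   unfolding l r' using FO by (intro p'.E.hvT_inj[of "fob H V" "fob H V" ?k]) simp_all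
 qed
qed

end

subsection \<open>Coassociativity\<close>

lemma lo_hi_lo: "lo s (lo (s + t) K) = lo s K" "hi s (lo (s + t) K) = lo t (hi s K)" "hi t (hi s K) = hi (s + t) K"
proof -
 show "lo s (lo (s + t) K) = lo s K" by (simp add: lo_def) (rule filter_cong, auto)
 have "filter (%k. s < k & k <= s + t) K = filter (%k. s < k & k - s <= t) K" by (rule filter_cong) auto
 then show "hi s (lo (s + t) K) = lo t (hi s K)" by (simp add: lo_def hi_def filter_map comp_def conj_commute)
 have "filter (%k. s < k & t < k - s) K = filter (%k. s + t < k) K" by (rule filter_cong) auto
 then show "hi t (hi s K) = hi (s + t) K" by (simp add: hi_def filter_map comp_def conj_commute)
qed

lemma Delta_id_mem: "Delta_id n : Delta_f n n"
 by (auto simp: Delta_f_def Delta_id_def mono_on_def)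

lemma parr_Delta_id:
 assumes "dg_functor C D F" "length S = n" "length T = n"
  and "!!j. [|1 <= j; j <= n|] ==> fob F ` (S ! (j - 1)) \<subseteq> T ! (j - 1)"
 shows "(Delta_id n, F) : parr (C, S) (D, T)"
proof -
 have "fob F ` (S ! (i - 1)) \<subseteq> T ! (j - 1)" if "j : {1..n}" "Delta_id n (j - 1) < i & i <= Delta_id n j" for i j
 proof -
  have "i = j" using that by (auto simp: Delta_id_def split: if_splits)
  then show ?thesis using assms(4)[of j] that by simp
 qed
 then have "ALL j:{1..n}. ALL i. Delta_id n (j - 1) < i & i <= Delta_id n j --> fob F ` (S ! (i - 1)) \<subseteq> T ! (j - 1)"
  by blast
 then show ?thesis unfolding parr_def prod.case mem_Collect_eq using assms(1-3) Delta_id_mem[of n] by simp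
qed

lemma dr_e_Delta_id:
 assumes "dri C" "dri.valid C S X I" "length S = n"
 shows "dr_e (D, T) F (idx (Delta_id n)) X I = dri.eb D T (fob F X) I"
 using valid_idx_id[OF assms(1,2)] dri_valid_distinct[OF assms(1,2)] assms(3) by (simp add: dr_e_def)

lemma pobj_nth: "[|(C, S) : pobj; j < length S|] ==> S ! j \<subseteq> Ob C"
 by (auto simp: pobj_def)

locale dritriple = P: dri C S + R: dri D T + Z: dri B U
 for C :: "('a, 'k::field) dg" and S and D :: "('a, 'k) dg" and T and B :: "('a, 'k) dg" and U +
 assumes CS: "(C, S) : pobj" and DT: "(D, T) : pobj" and BU: "(B, U) : pobj"
begin

sublocale x: dripair C S D T by (rule dripair.intro[OF P.dri_axioms R.dri_axioms])
sublocale z: dripair D T B U by (rule dripair.intro[OF R.dri_axioms Z.dri_axioms])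
sublocale y: dripair x.A.T x.ST B U by (rule dripair.intro[OF x.M.dri_axioms Z.dri_axioms])
sublocale w: dripair C S z.A.T z.ST by (rule dripair.intro[OF P.dri_axioms z.M.dri_axioms])
sublocale g: tens P.Q z.E.T by (rule tens.intro[OF P.dgc_Q z.E.dgc_T])
sublocale h: tens x.E.T Z.Q by (rule tens.intro[OF x.E.dgc_T Z.dgc_Q])

lemma Ob_gh [simp]: "Ob g.T = Ob w.A.T" "Ob h.T = Ob y.A.T"
 by (simp_all add: tensor_dg_def)

abbreviation "n == length S + length T + length U"
abbreviation "as0 == tensor_assoc C D B"
abbreviation "as1 == tensor_assoc P.Q R.Q Z.Q"
abbreviation "da == dr_arr (y.A.T, y.ST) (w.A.T, w.ST) (Delta_id n, as0)"
abbreviation "bxy == beta (C, S) (D, T)"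
abbreviation "byz == beta (D, T) (B, U)"
abbreviation "bl == beta (x.A.T, x.ST) (B, U)"
abbreviation "br == beta (C, S) (z.A.T, z.ST)"
abbreviation "bxy1 == tensor_fun x.M.Q x.E.T Z.Q Z.Q bxy (id_fun Z.Q)"
abbreviation "b1yz == tensor_fun P.Q P.Q z.M.Q z.E.T (id_fun P.Q) byz"

lemmas as0_functor = tensor_assoc_functor[OF P.dgc_axioms R.dgc_axioms Z.dgc_axioms]
lemmas as0_ob = tensor_assoc_ob[OF P.dgc_axioms R.dgc_axioms Z.dgc_axioms]
lemmas as0_pt = tensor_assoc_pt[OF P.dgc_axioms R.dgc_axioms Z.dgc_axioms]
lemmas as1_functor = tensor_assoc_functor[OF P.dgc_Q R.dgc_Q Z.dgc_Q]
lemmas as1_ob = tensor_assoc_ob[OF P.dgc_Q R.dgc_Q Z.dgc_Q]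
lemmas as1_pt = tensor_assoc_pt[OF P.dgc_Q R.dgc_Q Z.dgc_Q]
lemmas id3 = dg_functor_id[OF Z.dgc_Q]
lemmas id1 = dg_functor_id[OF P.dgc_Q]
lemmas bxy1_functor = tensor_fun_functor[OF x.beta_functor id3 x.M.dgc_Q x.E.dgc_T Z.dgc_Q Z.dgc_Q]
lemmas bxy1_ob = tensor_fun_ob[OF x.beta_functor id3 x.M.dgc_Q x.E.dgc_T Z.dgc_Q Z.dgc_Q]
lemmas bxy1_pt = tensor_fun_pt[OF x.beta_functor id3 x.M.dgc_Q x.E.dgc_T Z.dgc_Q Z.dgc_Q]
lemmas b1yz_functor = tensor_fun_functor[OF id1 z.beta_functor P.dgc_Q P.dgc_Q z.M.dgc_Q z.E.dgc_T]
lemmas b1yz_ob = tensor_fun_ob[OF id1 z.beta_functor P.dgc_Q P.dgc_Q z.M.dgc_Q z.E.dgc_T]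
lemmas b1yz_pt = tensor_fun_pt[OF id1 z.beta_functor P.dgc_Q P.dgc_Q z.M.dgc_Q z.E.dgc_T]

lemma pobjs: "(y.A.T, y.ST) : pobj" "(w.A.T, w.ST) : pobj"
 using ptensor_pobj[OF ptensor_pobj[OF CS DT] BU] ptensor_pobj[OF CS ptensor_pobj[OF DT BU]]
 by (simp_all add: ptensor_def)

lemma lengths: "length x.ST = length S + length T" "length y.ST = n" "length z.ST = length T + length U" "length w.ST = n"
 by (simp_all add: x.length_ST y.length_ST z.length_ST w.length_ST)

lemma as0_parr: "(Delta_id n, as0) : parr (y.A.T, y.ST) (w.A.T, w.ST)"
proof (rule parr_Delta_id[OF as0_functor lengths(2,4)])
 fix j assume j: "1 <= j" "j <= n"
 show "fob as0 ` (y.ST ! (j - 1)) \<subseteq> w.ST ! (j - 1)"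
 proof
  fix v assume "v : fob as0 ` (y.ST ! (j - 1))"
  then obtain V where V: "V : y.ST ! (j - 1)" "v = fob as0 V" by auto
  have "j - 1 < length y.ST" using j lengths by linarith
  then have VO: "V : Ob y.A.T" using V pobj_nth[OF pobjs(1), of "j - 1"] by auto
  have vO: "v : Ob w.A.T" "pfst v = pfst (pfst V)" "psnd v = Pair (psnd (pfst V)) (psnd V)" using VO V(2) by (simp_all add: as0_ob)
  have y1: "if j <= length S + length T then pfst V : x.ST ! (j - 1) else psnd V : U ! (j - (length S + length T) - 1)"
  proof -
   have "j <= length y.ST" using j lengths by simp
   from iffD1[OF y.mem_ST[OF VO j(1) this] V(1)] show ?thesis unfolding lengths(1) .
  qed
  show "v : w.ST ! (j - 1)"
  proof (cases "j <= length S")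
   case True
   then have "pfst (pfst V) : S ! (j - 1)" using y1 x.mem_ST[of "pfst V" j] VO j lengths by simp
   then show ?thesis using w.mem_ST[OF vO(1) j(1)] True vO j lengths by simp
  next
   case False
   then have z: "1 <= j - length S" "j - length S <= length z.ST" using j lengths by simp_all
   have "psnd v : z.ST ! (j - length S - 1)"
   proof (cases "j <= length S + length T")
    case True
    then have "psnd (pfst V) : T ! (j - length S - 1)" using y1 x.mem_ST[of "pfst V" j] False VO j lengths by simp
    moreover have "j - length S <= length T" using True by linarith
    ultimately show ?thesis using z.mem_ST[OF _ z] VO vO by simp
   next
    case False
    have "psnd V : U ! (j - (length S + length T) - 1)" using y1 False by simp
    moreover have "~ j - length S <= length T" "j - length S - length T - 1 = j - (length S + length T) - 1" using False by simp_all
    ultimately show ?thesis using z.mem_ST[OF _ z, of "psnd v"] VO vO by simp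
   qed
   then show ?thesis using w.mem_ST[OF vO(1) j(1)] False vO j lengths by simp
  qed
 qed
qed

lemmas da_functor = dr_arr_functor[OF pobjs as0_parr]
lemmas da_simps = dr_arr_simps[OF pobjs as0_parr]

lemma bl_pt_inc:
 assumes "V : Ob y.A.T" "W : Ob y.A.T" "f : hom_set C (pfst (pfst V)) (pfst (pfst W)) p"
  "k : hom_set D (psnd (pfst V)) (psnd (pfst W)) q" "l : hom_set B (psnd V) (psnd W) s"
 shows "far as1 V W (p + q + s) (far bxy1 V W (p + q + s) (far y.ii V W (p + q + s) (y.A.pt V W (p + q) (x.A.pt (pfst V) (pfst W) p f q k) s l)))
  = far b1yz (fob as0 V) (fob as0 W) (p + q + s) (far w.ii (fob as0 V) (fob as0 W) (p + q + s)
    (far as0 V W (p + q + s) (y.A.pt V W (p + q) (x.A.pt (pfst V) (pfst W) p f q k) s l)))"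
proof -
 let ?V = "fob as0 V" and ?W = "fob as0 W"
 have V: "pfst ?V = pfst (pfst V)" "psnd ?V = Pair (psnd (pfst V)) (psnd V)" "?V : Ob w.A.T"
  and W: "pfst ?W = pfst (pfst W)" "psnd ?W = Pair (psnd (pfst W)) (psnd W)" "?W : Ob w.A.T"
  using assms by (simp_all add: as0_ob)
 have V': "?V = Pair (pfst (pfst V)) (Pair (psnd (pfst V)) (psnd V))" "?W = Pair (pfst (pfst W)) (Pair (psnd (pfst W)) (psnd W))"
  using assms by (simp_all add: as0_ob)
 have fk: "x.A.pt (pfst V) (pfst W) p f q k : hom_set x.A.T (pfst V) (pfst W) (p + q)" using assms by simp
 have kl: "z.A.pt (psnd ?V) (psnd ?W) q k s l : hom_set z.A.T (psnd ?V) (psnd ?W) (q + s)" using assms by (simp add: V W)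
 have 1: "far bxy1 V W (p + q + s) (far y.ii V W (p + q + s) (y.A.pt V W (p + q) (x.A.pt (pfst V) (pfst W) p f q k) s l))
  = h.pt V W (p + q) (x.E.pt (pfst V) (pfst W) p (P.inc (pfst (pfst V)) (pfst (pfst W)) p f) q (R.inc (psnd (pfst V)) (psnd (pfst W)) q k))
    s (Z.inc (psnd V) (psnd W) s l)"
  using assms fk by (simp add: y.ii_pt bxy1_pt x.M.inc_closed Z.inc_closed x.beta_simps x.ii_pt id_fun_simps)
 have 2: "far as0 V W (p + q + s) (y.A.pt V W (p + q) (x.A.pt (pfst V) (pfst W) p f q k) s l) =
   w.A.pt ?V ?W p f (q + s) (z.A.pt (psnd ?V) (psnd ?W) q k s l)"
  using assms by (simp add: as0_pt as0_ob)
 have 3: "far b1yz ?V ?W (p + q + s) (far w.ii ?V ?W (p + q + s) (w.A.pt ?V ?W p f (q + s) (z.A.pt (psnd ?V) (psnd ?W) q k s l)))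
  = g.pt ?V ?W p (P.inc (pfst (pfst V)) (pfst (pfst W)) p f) (q + s)
    (z.E.pt (psnd ?V) (psnd ?W) q (R.inc (psnd (pfst V)) (psnd (pfst W)) q k) s (Z.inc (psnd V) (psnd W) s l))"
 proof -
  have "far w.ii ?V ?W (p + q + s) (w.A.pt ?V ?W p f (q + s) (z.A.pt (psnd ?V) (psnd ?W) q k s l))
   = w.E.pt ?V ?W p (P.inc (pfst (pfst V)) (pfst (pfst W)) p f) (q + s) (z.M.inc (psnd ?V) (psnd ?W) (q + s) (z.A.pt (psnd ?V) (psnd ?W) q k s l))"
   using assms kl V W by (subst w.ii_pt) simp_all
  moreover have "far b1yz ?V ?W (p + q + s) (w.E.pt ?V ?W p (P.inc (pfst (pfst V)) (pfst (pfst W)) p f) (q + s) (z.M.inc (psnd ?V) (psnd ?W) (q + s) (z.A.pt (psnd ?V) (psnd ?W) q k s l)))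
   = g.pt ?V ?W p (P.inc (pfst (pfst V)) (pfst (pfst W)) p f) (q + s)
    (z.E.pt (psnd ?V) (psnd ?W) q (R.inc (psnd (pfst V)) (psnd (pfst W)) q k) s (Z.inc (psnd V) (psnd W) s l))"
   using assms kl V(3) W(3) unfolding V' 
   by (subst b1yz_pt) (simp_all add: P.inc_closed z.M.inc_closed id_fun_simps z.beta_simps z.ii_pt)
  ultimately show ?thesis by simp
 qed
 have 4: "far as1 V W (p + q + s) (h.pt V W (p + q) (x.E.pt (pfst V) (pfst W) p (P.inc (pfst (pfst V)) (pfst (pfst W)) p f) q (R.inc (psnd (pfst V)) (psnd (pfst W)) q k))
    s (Z.inc (psnd V) (psnd W) s l)) = g.pt ?V ?W p (P.inc (pfst (pfst V)) (pfst (pfst W)) p f) (q + s)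
    (z.E.pt (psnd ?V) (psnd ?W) q (R.inc (psnd (pfst V)) (psnd (pfst W)) q k) s (Z.inc (psnd V) (psnd W) s l))"
  using assms unfolding V' by (subst as1_pt) (simp_all add: P.inc_closed R.inc_closed Z.inc_closed)
 show ?thesis unfolding 1 2 3 4 ..
qed

lemma lhs_eb:
 assumes v: "y.M.valid V K"
 defines "I == lo (length S) K" and "J == lo (length T) (hi (length S) K)" and "L == hi (length T) (hi (length S) K)"
 defines "k == - len K" and "W == fob as0 V"
 defines "X == g.pt W W (- len I) (P.eb (pfst W) I) (- len J + - len L)
   (z.E.pt (psnd W) (psnd W) (- len J) (R.eb (pfst (psnd W)) J) (- len L) (Z.eb (psnd (psnd W)) L))"
 shows "far as1 V V k (far bxy1 V V k (y.be V K)) = hscale g.T W W k (koszul (int (length I + length J) * len L))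
   (hscale g.T W W k (koszul (len I * len J)) X)"
  and "X : hom_set g.T W W k" and "W : Ob w.A.T"
  and "P.valid (pfst W) I" "R.valid (pfst (psnd W)) J" "Z.valid (psnd (psnd W)) L" "length K = length I + length J + length L"
proof -
 have VO: "V : Ob y.A.T" by (rule y.M.valid_Ob[OF v])
 define K1 where "K1 = lo (length S + length T) K"
 have sv: "x.M.valid (pfst V) K1" "Z.valid (psnd V) L" "length K = length K1 + length L"
  using y.split_valid[OF v] by (simp_all add: K1_def L_def x.length_ST lo_hi_lo)
 have IJ: "I = lo (length S) K1" "J = hi (length S) K1" by (simp_all add: I_def J_def K1_def lo_hi_lo)
 have sv1: "P.valid (pfst (pfst V)) I" "R.valid (psnd (pfst V)) J" "length K1 = length I + length J"
  using x.split_valid[OF sv(1)] by (simp_all add: IJ)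
 have W: "pfst W = pfst (pfst V)" "psnd W = Pair (psnd (pfst V)) (psnd V)"
  "W = Pair (pfst (pfst V)) (Pair (psnd (pfst V)) (psnd V))"
  using VO by (simp_all add: as0_ob W_def)
 show WO: "W : Ob w.A.T" using VO by (simp add: W)
 show vs: "P.valid (pfst W) I" "R.valid (pfst (psnd W)) J" "Z.valid (psnd (psnd W)) L" using sv1 sv by (simp_all add: W)
 show len: "length K = length I + length J + length L" using sv sv1 by simp
 have k: "k = - len I + (- len J + - len L)" "k = - len K1 + - len L"
  "- len K1 = - len I + - len J"
  using sv sv1 by (simp_all add: k_def)
 show X: "X : hom_set g.T W W k"
  unfolding X_def using WO vs k(1) VO W by (simp add: P.eb_closed R.eb_closed Z.eb_closed)
 interpret b: dgfunctor y.E.T h.T bxy1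
  by (rule dgfunctorI[OF y.E.dgc_T h.dgc_T bxy1_functor])
 interpret a: dgfunctor h.T g.T as1
  by (rule dgfunctorI[OF h.dgc_T g.dgc_T as1_functor])
 have aV: "fob as1 V = W" using VO by (simp add: as1_ob W)
 have bV: "fob bxy1 V = V" using VO by (simp add: bxy1_ob x.beta_simps id_fun_simps)
 have VE: "V : Ob y.E.T" "V : Ob h.T" using VO by simp_all
 have ypec: "y.pe V K1 L : hom_set y.E.T V V k" using y.pe_closed[OF VO sv(1,2)] k(2) by simp
 have xpec: "x.pe (pfst V) I J : hom_set x.E.T (pfst V) (pfst V) (- len K1)"
  using x.pe_closed[OF _ sv1(1,2)] VO k(3) by simp
 have Lc: "Z.eb (psnd V) L : hom_set Z.Q (psnd V) (psnd V) (- len L)" using sv by (simp add: Z.eb_closed)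
 have K1c: "x.M.eb (pfst V) K1 : hom_set x.M.Q (pfst V) (pfst V) (- len K1)" using sv by (simp add: x.M.eb_closed)
 let ?Y = "h.pt V V (- len K1) (x.pe (pfst V) I J) (- len L) (Z.eb (psnd V) L)"
 have Yc: "?Y : hom_set h.T V V k" using VE xpec Lc k(2) by simp
 have "far bxy1 V V k (y.pe V K1 L) = h.pt V V (- len K1) (x.be (pfst V) K1) (- len L) (Z.eb (psnd V) L)"
  using VO sv K1c Lc k(2) by (subst bxy1_pt) (simp_all add: x.beta_simps id_fun_simps)
 also have "x.be (pfst V) K1 = hscale x.E.T (pfst V) (pfst V) (- len K1) (koszul (len I * len J)) (x.pe (pfst V) I J)"
  by (simp add: beta_e_def Let_def IJ[symmetric])
 also have "h.pt V V (- len K1) ... (- len L) (Z.eb (psnd V) L) = hscale h.T V V k (koszul (len I * len J)) ?Y"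
  using h.pt_scale_left[OF VE(2,2) xpec Lc] k(2) by simp
 finally have 1: "far bxy1 V V k (y.pe V K1 L) = ..." .
 have 2: "far as1 V V k ?Y = X"
  unfolding X_def W
  by (subst as1_pt[OF VE(2,2) _ _ _ k(3,2)]) (use sv1 sv in "simp_all add: P.eb_closed R.eb_closed Z.eb_closed")
 have be: "y.be V K = hscale y.E.T V V k (koszul (len K1 * len L)) (y.pe V K1 L)"
  by (simp add: beta_e_def Let_def k_def K1_def L_def x.length_ST lo_hi_lo)
 have "far bxy1 V V k (y.be V K) = hscale h.T V V k (koszul (len K1 * len L)) (hscale h.T V V k (koszul (len I * len J)) ?Y)"
  unfolding be using b.far_scale[OF VE(1,1) ypec] by (simp add: bV 1)
 then have "far as1 V V k (far bxy1 V V k (y.be V K)) = hscale g.T W W k (koszul (len K1 * len L))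
   (hscale g.T W W k (koszul (len I * len J)) (far as1 V V k ?Y))"
  using Yc VE by (simp add: a.far_scale aV)
 then show "far as1 V V k (far bxy1 V V k (y.be V K)) = hscale g.T W W k (koszul (int (length I + length J) * len L))
   (hscale g.T W W k (koszul (len I * len J)) X)"
  unfolding 2 unfolding sv1(3) .
qed

text \<open>Both sides split an index list into three parts of lengths \<open>a, b, c\<close> and produce the sign
 \<open>(-1)^(ab + ac + bc)\<close>.\<close>

lemma coassoc:
 "comp_fun y.M.Q as1 (comp_fun y.M.Q bxy1 bl) = comp_fun y.M.Q (comp_fun w.M.Q b1yz br) da"
proof -
 have F1: "dg_functor y.M.Q h.T (comp_fun y.M.Q bxy1 bl)"
  by (rule dg_functor_comp[OF y.M.dgc_Q y.E.dgc_T h.dgc_T y.beta_functor bxy1_functor])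
 have F: "dg_functor y.M.Q g.T (comp_fun y.M.Q as1 (comp_fun y.M.Q bxy1 bl))"
  by (rule dg_functor_comp[OF y.M.dgc_Q h.dgc_T g.dgc_T F1 as1_functor])
 have G1: "dg_functor w.M.Q g.T (comp_fun w.M.Q b1yz br)"
  by (rule dg_functor_comp[OF w.M.dgc_Q w.E.dgc_T g.dgc_T w.beta_functor b1yz_functor])
 have G: "dg_functor y.M.Q g.T (comp_fun y.M.Q (comp_fun w.M.Q b1yz br) da)"
  by (rule dg_functor_comp[OF y.M.dgc_Q w.M.dgc_Q g.dgc_T da_functor G1])
 interpret f: dgfunctor y.M.Q g.T "comp_fun y.M.Q as1 (comp_fun y.M.Q bxy1 bl)"
  by (rule dgfunctorI[OF y.M.dgc_Q g.dgc_T F])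
 interpret g': dgfunctor y.M.Q g.T "comp_fun y.M.Q (comp_fun w.M.Q b1yz br) da"
  by (rule dgfunctorI[OF y.M.dgc_Q g.dgc_T G])
 interpret as0: dgfunctor y.A.T w.A.T as0
  by (rule dgfunctorI[OF y.A.dgc_T w.A.dgc_T as0_functor])
 have ob: "fob (comp_fun y.M.Q as1 (comp_fun y.M.Q bxy1 bl)) V = fob as0 V"
   "fob (comp_fun y.M.Q (comp_fun w.M.Q b1yz br) da) V = fob as0 V" if V: "V : Ob y.A.T" for V
 proof -
  have "fob as0 V : Ob w.A.T" using V by simp
  then show "fob (comp_fun y.M.Q as1 (comp_fun y.M.Q bxy1 bl)) V = fob as0 V"
   "fob (comp_fun y.M.Q (comp_fun w.M.Q b1yz br) da) V = fob as0 V"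
   using V by (simp_all add: comp_fun_simps da_simps y.beta_simps w.beta_simps bxy1_ob b1yz_ob x.beta_simps z.beta_simps
    id_fun_simps as1_ob as0_ob)
 qed
 show ?thesis
 proof (rule y.M.Q_functor_eqI[OF F G g.dgc_T])
  fix V assume "V : Ob y.A.T"
  then show "fob (comp_fun y.M.Q as1 (comp_fun y.M.Q bxy1 bl)) V = fob (comp_fun y.M.Q (comp_fun w.M.Q b1yz br) da) V"
   by (simp add: ob)
 next
  fix V W m t assume V: "V : Ob y.A.T" and W: "W : Ob y.A.T" and t: "t : hom_set y.A.T V W m"
  show "far (comp_fun y.M.Q as1 (comp_fun y.M.Q bxy1 bl)) V W m (y.M.inc V W m t) =
    far (comp_fun y.M.Q (comp_fun w.M.Q b1yz br) da) V W m (y.M.inc V W m t)"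
   using V W t
  proof (induction rule: y.A.tensor_hom_induct)
   case (pure r u s l)
   have "pfst V : Ob x.A.T" "pfst W : Ob x.A.T" using V W by simp_all
   from this pure(1) show ?case
   proof (induction rule: x.A.tensor_hom_induct)
    case (pure p f q k)
    let ?t = "y.A.pt V W (p + q) (x.A.pt (pfst V) (pfst W) p f q k) s l"
    have tt: "?t : hom_set y.A.T V W m" using V W pure \<open>l : _\<close> \<open>r + s = m\<close> by simp
    have VW': "fob as0 V : Ob w.A.T" "fob as0 W : Ob w.A.T" "far as0 V W m ?t : hom_set w.A.T (fob as0 V) (fob as0 W) m"
     using V W tt by simp_all
    have "m = p + q + s" using pure(3) \<open>r + s = m\<close> by simp
    then have "far as1 V W m (far bxy1 V W m (far y.ii V W m ?t))
     = far b1yz (fob as0 V) (fob as0 W) m (far w.ii (fob as0 V) (fob as0 W) m (far as0 V W m ?t))"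
     using bl_pt_inc[OF V W pure(1,2) \<open>l : _\<close>] by simp
    moreover have "fob bxy1 V = V" "fob bxy1 W = W" using V W by (simp_all add: bxy1_ob x.beta_simps id_fun_simps)
    ultimately show ?case
     using V W tt VW' pure(3)
     by (simp add: comp_fun_simps y.M.inc_closed y.beta_simps da_simps w.M.inc_closed w.beta_simps)
   next
    case (add u u')
    then show ?case using V W \<open>l : _\<close> \<open>r + s = m\<close> y.A.pt_add_left[OF V W add(1,2) \<open>l : _\<close>]
     by (simp add: y.M.inc_add y.M.inc_closed ob)
   next
    case (scale c u)
    then show ?case using V W \<open>l : _\<close> \<open>r + s = m\<close> y.A.pt_scale_left[OF V W scale(1) \<open>l : _\<close>]
     by (simp add: y.M.inc_scale y.M.inc_closed ob)
   qed
  next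
   case (add u u')
   then show ?case using V W by (simp add: y.M.inc_add y.M.inc_closed ob)
  next
   case (scale c u)
   then show ?case using V W by (simp add: y.M.inc_scale y.M.inc_closed ob)
  qed
 next
  fix V K assume V: "V : Ob y.A.T" and K: "eps_index y.ST V K"
  then have v: "y.M.valid V K" by (simp add: y.M.valid_def)
  define I J L where IJL: "I = lo (length S) K" "J = lo (length T) (hi (length S) K)" "L = hi (length T) (hi (length S) K)"
  define k where "k = - len K"
  define W where "W = fob as0 V"
  define X where "X = g.pt W W (- len I) (P.eb (pfst W) I) (- len J + - len L)
   (z.E.pt (psnd W) (psnd W) (- len J) (R.eb (pfst (psnd W)) J) (- len L) (Z.eb (psnd (psnd W)) L))"
  note l = lhs_eb[OF v, folded IJL k_def W_def, folded X_def]
  interpret d: drmap y.A.T y.ST w.A.T w.ST as0 "idx (Delta_id n)"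
   by (rule drmap_parr[OF pobjs as0_parr])
  have e: "dr_e (w.A.T, w.ST) as0 (idx (Delta_id n)) V K = w.M.eb W K"
   using dr_e_Delta_id[OF y.M.dri_axioms v lengths(2)] by (simp add: W_def)
  have "distinct (map (idx (Delta_id n)) K)" "map (idx (Delta_id n)) K = K"
   using valid_idx_id[OF y.M.dri_axioms v] dri_valid_distinct[OF y.M.dri_axioms v] lengths(2) by simp_all
  then have vW: "w.M.valid W K" using d.valid_p[OF v] by (simp add: W_def del: distinct_map)
  let ?K2 = "hi (length S) K"
  note svw = w.split_valid[OF vW, folded IJL(1)]
  note svz = z.split_valid[OF svw(2), folded IJL(2,3)]
  interpret b: dgfunctor w.E.T g.T b1yz
   by (rule dgfunctorI[OF w.E.dgc_T g.dgc_T b1yz_functor])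
  have WO: "W : Ob w.A.T" "W : Ob w.E.T" "W : Ob g.T" using l(3) by simp_all
  have WW: "Pair (pfst W) (psnd W) = W" using WO by simp
  have bW: "fob b1yz W = W" using WO by (simp add: b1yz_ob z.beta_simps id_fun_simps)
  have k: "k = - len I + - int (length ?K2)" "- int (length ?K2) = - len J + - len L"
   using svw(4) svz(4) by (simp_all add: k_def)
  have Ic: "P.eb (pfst W) I : hom_set P.Q (pfst W) (pfst W) (- len I)" using svw(1) by (simp add: P.eb_closed)
  have K2c: "z.M.eb (psnd W) ?K2 : hom_set z.M.Q (psnd W) (psnd W) (- int (length ?K2))" using svw(2) by (simp add: z.M.eb_closed)
  have zpec: "z.pe (psnd W) J L : hom_set z.E.T (psnd W) (psnd W) (- int (length ?K2))"
   using z.pe_closed[OF _ svz(1,2)] WO k(2) by simp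
  have "far b1yz W W k (w.pe W I ?K2) = g.pt W W (- len I) (P.eb (pfst W) I) (- int (length ?K2)) (z.be (psnd W) ?K2)"
   using WO Ic K2c k(1) svw(2) by (subst b1yz_pt) (simp_all add: z.beta_simps id_fun_simps)
  also have "z.be (psnd W) ?K2 = hscale z.E.T (psnd W) (psnd W) (- int (length ?K2)) (koszul (len J * len L)) (z.pe (psnd W) J L)"
   by (simp add: beta_e_def Let_def IJL)
  also have "g.pt W W (- len I) (P.eb (pfst W) I) (- int (length ?K2)) ... = hscale g.T W W k (koszul (len J * len L)) X"
   using g.pt_scale_right[OF WO(3,3) Ic zpec] k by (simp add: X_def)
  finally have 1: "far b1yz W W k (w.pe W I ?K2) = ..." .
  have be: "w.be W K = hscale w.E.T W W k (koszul (len I * int (length ?K2))) (w.pe W I ?K2)"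
   by (simp add: beta_e_def Let_def k_def IJL)
  have wpec: "w.pe W I ?K2 : hom_set w.E.T W W k" using w.pe_closed[OF WO(1) svw(1,2)] k(1) by simp
  have r: "far b1yz W W k (w.be W K) = hscale g.T W W k (koszul (len I * int (length J + length L))) (hscale g.T W W k (koszul (len J * len L)) X)"
   unfolding be unfolding b.far_scale[OF WO(2,2) wpec] bW 1 unfolding svz(4) ..
  have "far as1 V V k (far bxy1 V V k (y.be V K)) = far b1yz W W k (w.be W K)"
   unfolding l(1) r by (rule g.hvT_inj[of W W k]) (use WO l(2) in "simp_all add: algebra_simps")
  moreover have "fob bxy1 V = V" using V by (simp add: bxy1_ob x.beta_simps id_fun_simps)
  ultimately show "far (comp_fun y.M.Q as1 (comp_fun y.M.Q bxy1 bl)) V V (- len K) (y.M.eb V K) =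
    far (comp_fun y.M.Q (comp_fun w.M.Q b1yz br) da) V V (- len K) (y.M.eb V K)"
   using V v vW WO
   by (simp add: comp_fun_simps y.M.eb_closed y.beta_simps da_simps e w.M.eb_closed w.beta_simps k_def W_def[symmetric])
 qed
qed

end

subsection \<open>Counitality\<close>

lemma unit_pobj: "(unit_dg, []) : pobj"
 by (simp add: pobj_def dgc_unit)

text \<open>The quotient of the unit by the empty tuple is the unit again, as there are no generators.\<close>

definition eta :: "('a, 'k::field) dgf" where
 "eta = drilift.lift unit_dg unit_dg [] (id_fun unit_dg) (%X I. Id unit_dg X)"

locale driunit = P: dri C S for C :: "('a, 'k::field) dg" and S +
 assumes CS: "(C, S) : pobj"
begin

abbreviation "I1 == unit_dg :: ('a, 'k) dg"

sublocale u: dri I1 "[]" by (rule dri.intro[OF dgc_unit])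
sublocale l: dripair I1 "[]" C S by (rule dripair.intro[OF u.dri_axioms P.dri_axioms])
sublocale r: dripair C S I1 "[]" by (rule dripair.intro[OF P.dri_axioms u.dri_axioms])
sublocale lq: tens I1 P.Q by (rule tens.intro[OF dgc_unit P.dgc_Q])
sublocale rq: tens P.Q I1 by (rule tens.intro[OF P.dgc_Q dgc_unit])

lemma not_eps_index_Nil: "~ eps_index [] X I"
 by (cases I) (auto simp: eps_index_def)

lemma u_valid: "u.valid X I \<longleftrightarrow> X : Ob I1 & I = []"
 by (auto simp: u.valid_def not_eps_index_Nil)

interpretation e: drilift I1 I1 "[]" "id_fun I1" "%X I. Id I1 X"
proof -
 interpret i: dgfunctor I1 I1 "id_fun I1"
  by (rule dgfunctorI[OF dgc_unit dgc_unit dg_functor_id[OF dgc_unit]])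
 show "drilift I1 I1 [] (id_fun I1) (%X I. Id I1 X)"
  by (intro drilift.intro drilift_axioms.intro u.dri_axioms i.dgfunctor_axioms)
   (auto simp: u_valid id_fun_simps not_eps_index_Nil)
qed

lemma eta_functor: "dg_functor u.Q I1 eta"
 unfolding eta_def by (rule e.lift_functor)
lemma eta_ob: "X : Ob I1 ==> fob eta X = X"
 unfolding eta_def by (simp add: e.lift_simps id_fun_simps)
lemma eta_inc: "[|X : Ob I1; Y : Ob I1; f : hom_set I1 X Y n|] ==> far eta X Y n (u.inc X Y n f) = f"
 unfolding eta_def by (simp add: e.lift_simps id_fun_simps)

lemma Ob_q [simp]: "Ob lq.T = Ob l.A.T" "Ob rq.T = Ob r.A.T"
 by (simp_all add: tensor_dg_def)

abbreviation "etal == tensor_fun u.Q I1 P.Q P.Q eta (id_fun P.Q)"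
abbreviation "etar == tensor_fun P.Q P.Q u.Q I1 (id_fun P.Q) eta"

lemmas id1 = dg_functor_id[OF P.dgc_Q]
lemmas etal_functor = tensor_fun_functor[OF eta_functor id1 u.dgc_Q dgc_unit P.dgc_Q P.dgc_Q]
lemmas etal_ob = tensor_fun_ob[OF eta_functor id1 u.dgc_Q dgc_unit P.dgc_Q P.dgc_Q]
lemmas etal_pt = tensor_fun_pt[OF eta_functor id1 u.dgc_Q dgc_unit P.dgc_Q P.dgc_Q]
lemmas etar_functor = tensor_fun_functor[OF id1 eta_functor P.dgc_Q P.dgc_Q u.dgc_Q dgc_unit]
lemmas etar_ob = tensor_fun_ob[OF id1 eta_functor P.dgc_Q P.dgc_Q u.dgc_Q dgc_unit]
lemmas etar_pt = tensor_fun_pt[OF id1 eta_functor P.dgc_Q P.dgc_Q u.dgc_Q dgc_unit]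

abbreviation "dl == dr_arr (l.A.T, l.ST) (C, S) (Delta_id (length S), tensor_lunit C)"
abbreviation "dr == dr_arr (r.A.T, r.ST) (C, S) (Delta_id (length S), tensor_runit C)"

lemma pobjs: "(l.A.T, l.ST) : pobj" "(r.A.T, r.ST) : pobj"
 using ptensor_pobj[OF unit_pobj CS] ptensor_pobj[OF CS unit_pobj] by (simp_all add: ptensor_def)

lemma lunit_parr: "(Delta_id (length S), tensor_lunit C) : parr (l.A.T, l.ST) (C, S)"
proof (rule parr_Delta_id[OF tensor_lunit_functor[OF P.dgc_axioms]])
 fix j assume j: "1 <= j" "j <= length S"
 then have j': "j <= length l.ST" by (simp add: tS_def)
 have sub: "l.ST ! (j - 1) \<subseteq> Ob l.A.T" using pobj_nth[OF pobjs(1), of "j - 1"] j j' by linarith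
 show "fob (tensor_lunit C) ` (l.ST ! (j - 1)) \<subseteq> S ! (j - 1)"
 proof
  fix v assume "v : fob (tensor_lunit C) ` (l.ST ! (j - 1))"
  then obtain V where V: "V : l.ST ! (j - 1)" "V : Ob l.A.T" "v = fob (tensor_lunit C) V" using sub by auto
  then show "v : S ! (j - 1)" using l.mem_ST[OF V(2) j(1) j'] j by (simp add: tensor_lunit_ob[OF P.dgc_axioms])
 qed
qed (simp_all add: tS_def)

lemma runit_parr: "(Delta_id (length S), tensor_runit C) : parr (r.A.T, r.ST) (C, S)"
proof (rule parr_Delta_id[OF tensor_runit_functor[OF P.dgc_axioms]])
 fix j assume j: "1 <= j" "j <= length S"
 then have j': "j <= length r.ST" by (simp add: tS_def)
 have sub: "r.ST ! (j - 1) \<subseteq> Ob r.A.T" using pobj_nth[OF pobjs(2), of "j - 1"] j j' by linarith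
 show "fob (tensor_runit C) ` (r.ST ! (j - 1)) \<subseteq> S ! (j - 1)"
 proof
  fix v assume "v : fob (tensor_runit C) ` (r.ST ! (j - 1))"
  then obtain V where V: "V : r.ST ! (j - 1)" "V : Ob r.A.T" "v = fob (tensor_runit C) V" using sub by auto
  then show "v : S ! (j - 1)" using r.mem_ST[OF V(2) j(1) j'] j by (simp add: tensor_runit_ob[OF P.dgc_axioms])
 qed
qed (simp_all add: tS_def)

lemma hscale_one: "[|X : Ob C; Y : Ob C; f : hom_set P.Q X Y n|] ==> hscale P.Q X Y n 1 f = f"
 by (rule kmod.smult_one[OF P.kmod_Q])

lemma left_counit:
 "comp_fun l.M.Q (tensor_lunit P.Q) (comp_fun l.M.Q etal (beta (I1, []) (C, S))) = dl"
proof -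
 note dls = dr_arr_simps[OF pobjs(1) CS lunit_parr] and dlf = dr_arr_functor[OF pobjs(1) CS lunit_parr]
 have F1: "dg_functor l.M.Q lq.T (comp_fun l.M.Q etal (beta (I1, []) (C, S)))"
  by (rule dg_functor_comp[OF l.M.dgc_Q l.E.dgc_T lq.dgc_T l.beta_functor etal_functor])
 have F: "dg_functor l.M.Q P.Q (comp_fun l.M.Q (tensor_lunit P.Q) (comp_fun l.M.Q etal (beta (I1, []) (C, S))))"
  by (rule dg_functor_comp[OF l.M.dgc_Q lq.dgc_T P.dgc_Q F1 tensor_lunit_functor[OF P.dgc_Q]])
 let ?F = "comp_fun l.M.Q (tensor_lunit P.Q) (comp_fun l.M.Q etal (beta (I1, []) (C, S)))"
 interpret f: dgfunctor l.M.Q P.Q ?F by (rule dgfunctorI[OF l.M.dgc_Q P.dgc_Q F])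
 interpret d: dgfunctor l.M.Q P.Q dl by (rule dgfunctorI[OF l.M.dgc_Q P.dgc_Q dlf])
 have etal_V: "fob etal V = V" if "V : Ob l.A.T" for V using that by (simp add: etal_ob eta_ob id_fun_simps)
 have ob: "fob ?F V = psnd V" "fob dl V = psnd V" if "V : Ob l.A.T" for V
  using that by (simp_all add: comp_fun_simps l.beta_simps etal_V tensor_lunit_ob[OF P.dgc_Q] dls tensor_lunit_ob[OF P.dgc_axioms])
 show ?thesis
 proof (rule l.M.Q_functor_eqI[OF F dlf P.dgc_Q])
  fix V assume "V : Ob l.A.T" then show "fob ?F V = fob dl V" by (simp add: ob)
 next
  fix V W n x assume V: "V : Ob l.A.T" and W: "W : Ob l.A.T" and x: "x : hom_set l.A.T V W n"
  show "far ?F V W n (l.M.inc V W n x) = far dl V W n (l.M.inc V W n x)"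
   using V W x
  proof (induction rule: l.A.tensor_hom_induct)
   case (pure p a q f)
   have t: "l.A.pt V W p a q f : hom_set l.A.T V W n" using V W pure by simp
   have "far etal V W n (l.E.pt V W p (u.inc (pfst V) (pfst W) p a) q (P.inc (psnd V) (psnd W) q f)) =
     lq.pt V W p a q (P.inc (psnd V) (psnd W) q f)"
    using V W pure by (subst etal_pt) (simp_all add: u.inc_closed P.inc_closed eta_inc eta_ob id_fun_simps)
   then have "far ?F V W n (l.M.inc V W n (l.A.pt V W p a q f)) =
    far (tensor_lunit P.Q) V W n (lq.pt V W p a q (P.inc (psnd V) (psnd W) q f))"
    using V W pure t by (simp add: comp_fun_simps l.M.inc_closed l.beta_simps l.ii_pt etal_V)
   also have "... = (if p = 0 then hscale P.Q (psnd V) (psnd W) n (scal a) (P.inc (psnd V) (psnd W) q f) else hzero P.Q (psnd V) (psnd W) n)"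
    by (rule tensor_lunit_pt[OF P.dgc_Q]) (use V W pure in "simp_all add: P.inc_closed")
   also have "... = P.inc (psnd V) (psnd W) n (if p = 0 then hscale C (psnd V) (psnd W) n (scal a) f else hzero C (psnd V) (psnd W) n)"
   proof (cases "p = 0")
    case True
    then show ?thesis using V W pure by (simp add: P.inc_scale)
   next
    case False
    have "P.inc (psnd V) (psnd W) n (hscale C (psnd V) (psnd W) n 0 (hzero C (psnd V) (psnd W) n)) =
     hscale P.Q (psnd V) (psnd W) n 0 (P.inc (psnd V) (psnd W) n (hzero C (psnd V) (psnd W) n))"
     using V W by (intro P.inc_scale) simp_all
    then show ?thesis using False V W by (simp add: P.hscale_zero P.Q.hscale_zero P.inc_closed)
   qed
   also have "... = far dl V W n (l.M.inc V W n (l.A.pt V W p a q f))"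
    using V W pure t by (simp add: dls tensor_lunit_pt[OF P.dgc_axioms] tensor_lunit_ob[OF P.dgc_axioms])
   finally show ?case .
  next
   case (add x y)
   then show ?case using V W by (simp add: l.M.inc_add l.M.inc_closed ob)
  next
   case (scale c x)
   then show ?case using V W by (simp add: l.M.inc_scale l.M.inc_closed ob)
  qed
 next
  fix V K assume V: "V : Ob l.A.T" and K: "eps_index l.ST V K"
  then have v: "l.M.valid V K" by (simp add: l.M.valid_def)
  have "lo 0 K = []" "hi 0 K = K"
   using K by (auto simp: lo_def hi_def eps_index_def filter_empty_conv filter_id_conv)
  then have sv: "P.valid (psnd V) K" and be: "l.be V K = hscale l.E.T V V (- len K) 1 (l.pe V [] K)"
   using l.split_valid[OF v] by (simp_all add: beta_e_def Let_def koszul_def)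
  have pec: "l.pe V [] K : hom_set l.E.T V V (- len K)" using l.pe_closed[OF V _ sv, of "[]"] V by simp
  have be': "l.be V K = l.pe V [] K" unfolding be by (rule kmod.smult_one[OF l.E.kmod_T]) (use V pec in simp_all)
  have Kc: "P.eb (psnd V) K : hom_set P.Q (psnd V) (psnd V) (- len K)" using sv by (simp add: P.eb_closed)
  have "far etal V V (- len K) (l.pe V [] K) = lq.pt V V 0 (Id I1 (pfst V)) (- len K) (P.eb (psnd V) K)"
   using V Kc eta_inc[of "pfst V" "pfst V" "Id I1 (pfst V)" 0] by (subst etal_pt) (simp_all add: u.eb_Nil u.inc_id id_fun_simps eta_ob)
  then have "far ?F V V (- len K) (l.M.eb V K) = far (tensor_lunit P.Q) V V (- len K) (lq.pt V V 0 (Id I1 (pfst V)) (- len K) (P.eb (psnd V) K))"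
   using V v by (simp add: comp_fun_simps l.M.eb_closed l.beta_simps etal_V be')
  also have "... = hscale P.Q (psnd V) (psnd V) (- len K) (scal (Id I1 (pfst V))) (P.eb (psnd V) K)"
   using V Kc by (subst tensor_lunit_pt[OF P.dgc_Q]) simp_all
  also have "... = P.eb (psnd V) K" using V Kc by (simp add: unit_dg_def hscale_one)
  also have "... = far dl V V (- len K) (l.M.eb V K)"
   using V v dr_e_Delta_id[OF l.M.dri_axioms v, of "length S"] by (simp add: dls tensor_lunit_ob[OF P.dgc_axioms] l.length_ST)
  finally show "far ?F V V (- len K) (l.M.eb V K) = far dl V V (- len K) (l.M.eb V K)" .
 qed
qed

lemma right_counit:
 "comp_fun r.M.Q (tensor_runit P.Q) (comp_fun r.M.Q etar (beta (C, S) (I1, []))) = dr"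
proof -
 note drs = dr_arr_simps[OF pobjs(2) CS runit_parr] and drf = dr_arr_functor[OF pobjs(2) CS runit_parr]
 have F1: "dg_functor r.M.Q rq.T (comp_fun r.M.Q etar (beta (C, S) (I1, [])))"
  by (rule dg_functor_comp[OF r.M.dgc_Q r.E.dgc_T rq.dgc_T r.beta_functor etar_functor])
 have F: "dg_functor r.M.Q P.Q (comp_fun r.M.Q (tensor_runit P.Q) (comp_fun r.M.Q etar (beta (C, S) (I1, []))))"
  by (rule dg_functor_comp[OF r.M.dgc_Q rq.dgc_T P.dgc_Q F1 tensor_runit_functor[OF P.dgc_Q]])
 let ?F = "comp_fun r.M.Q (tensor_runit P.Q) (comp_fun r.M.Q etar (beta (C, S) (I1, [])))"
 interpret f: dgfunctor r.M.Q P.Q ?F by (rule dgfunctorI[OF r.M.dgc_Q P.dgc_Q F])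
 interpret d: dgfunctor r.M.Q P.Q dr by (rule dgfunctorI[OF r.M.dgc_Q P.dgc_Q drf])
 have etar_V: "fob etar V = V" if "V : Ob r.A.T" for V using that by (simp add: etar_ob eta_ob id_fun_simps)
 have ob: "fob ?F V = pfst V" "fob dr V = pfst V" if "V : Ob r.A.T" for V
  using that by (simp_all add: comp_fun_simps r.beta_simps etar_V tensor_runit_ob[OF P.dgc_Q] drs tensor_runit_ob[OF P.dgc_axioms])
 show ?thesis
 proof (rule r.M.Q_functor_eqI[OF F drf P.dgc_Q])
  fix V assume "V : Ob r.A.T" then show "fob ?F V = fob dr V" by (simp add: ob)
 next
  fix V W n x assume V: "V : Ob r.A.T" and W: "W : Ob r.A.T" and x: "x : hom_set r.A.T V W n"
  show "far ?F V W n (r.M.inc V W n x) = far dr V W n (r.M.inc V W n x)"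
   using V W x
  proof (induction rule: r.A.tensor_hom_induct)
   case (pure p f q a)
   have t: "r.A.pt V W p f q a : hom_set r.A.T V W n" using V W pure by simp
   have "far etar V W n (r.E.pt V W p (P.inc (pfst V) (pfst W) p f) q (u.inc (psnd V) (psnd W) q a)) =
     rq.pt V W p (P.inc (pfst V) (pfst W) p f) q a"
    using V W pure by (subst etar_pt) (simp_all add: u.inc_closed P.inc_closed eta_inc eta_ob id_fun_simps)
   then have "far ?F V W n (r.M.inc V W n (r.A.pt V W p f q a)) =
    far (tensor_runit P.Q) V W n (rq.pt V W p (P.inc (pfst V) (pfst W) p f) q a)"
    using V W pure t by (simp add: comp_fun_simps r.M.inc_closed r.beta_simps r.ii_pt etar_V)
   also have "... = (if q = 0 then hscale P.Q (pfst V) (pfst W) n (scal a) (P.inc (pfst V) (pfst W) p f) else hzero P.Q (pfst V) (pfst W) n)"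
    by (rule tensor_runit_pt[OF P.dgc_Q]) (use V W pure in "simp_all add: P.inc_closed")
   also have "... = P.inc (pfst V) (pfst W) n (if q = 0 then hscale C (pfst V) (pfst W) n (scal a) f else hzero C (pfst V) (pfst W) n)"
   proof (cases "q = 0")
    case True
    then show ?thesis using V W pure by (simp add: P.inc_scale)
   next
    case False
    have "P.inc (pfst V) (pfst W) n (hscale C (pfst V) (pfst W) n 0 (hzero C (pfst V) (pfst W) n)) =
     hscale P.Q (pfst V) (pfst W) n 0 (P.inc (pfst V) (pfst W) n (hzero C (pfst V) (pfst W) n))"
     using V W by (intro P.inc_scale) simp_all
    then show ?thesis using False V W by (simp add: P.hscale_zero P.Q.hscale_zero P.inc_closed)
   qed
   also have "... = far dr V W n (r.M.inc V W n (r.A.pt V W p f q a))"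
    using V W pure t by (simp add: drs tensor_runit_pt[OF P.dgc_axioms] tensor_runit_ob[OF P.dgc_axioms])
   finally show ?case .
  next
   case (add x y)
   then show ?case using V W by (simp add: r.M.inc_add r.M.inc_closed ob)
  next
   case (scale c x)
   then show ?case using V W by (simp add: r.M.inc_scale r.M.inc_closed ob)
  qed
 next
  fix V K assume V: "V : Ob r.A.T" and K: "eps_index r.ST V K"
  then have v: "r.M.valid V K" by (simp add: r.M.valid_def)
  have "ALL k:set K. k <= length S" using K by (auto simp: eps_index_def tS_def)
  then have "lo (length S) K = K" "hi (length S) K = []"
   by (auto simp: lo_def hi_def filter_id_conv filter_empty_conv not_less)
  then have sv: "P.valid (pfst V) K" and be: "r.be V K = hscale r.E.T V V (- len K) 1 (r.pe V K [])"
   using r.split_valid[OF v] by (simp_all add: beta_e_def Let_def koszul_def)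
  have pec: "r.pe V K [] : hom_set r.E.T V V (- len K)" using r.pe_closed[OF V sv, of "[]"] V by simp
  have be': "r.be V K = r.pe V K []" unfolding be by (rule kmod.smult_one[OF r.E.kmod_T]) (use V pec in simp_all)
  have Kc: "P.eb (pfst V) K : hom_set P.Q (pfst V) (pfst V) (- len K)" using sv by (simp add: P.eb_closed)
  have "far etar V V (- len K) (r.pe V K []) = rq.pt V V (- len K) (P.eb (pfst V) K) 0 (Id I1 (psnd V))"
   using V Kc eta_inc[of "psnd V" "psnd V" "Id I1 (psnd V)" 0] by (subst etar_pt) (simp_all add: u.eb_Nil u.inc_id id_fun_simps eta_ob)
  then have "far ?F V V (- len K) (r.M.eb V K) = far (tensor_runit P.Q) V V (- len K) (rq.pt V V (- len K) (P.eb (pfst V) K) 0 (Id I1 (psnd V)))"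
   using V v by (simp add: comp_fun_simps r.M.eb_closed r.beta_simps etar_V be')
  also have "... = hscale P.Q (pfst V) (pfst V) (- len K) (scal (Id I1 (psnd V))) (P.eb (pfst V) K)"
   using V Kc by (subst tensor_runit_pt[OF P.dgc_Q]) simp_all
  also have "... = P.eb (pfst V) K" using V Kc by (simp add: unit_dg_def hscale_one)
  also have "... = far dr V V (- len K) (r.M.eb V K)"
   using V v dr_e_Delta_id[OF r.M.dri_axioms v, of "length S"] by (simp add: drs tensor_runit_ob[OF P.dgc_axioms] r.length_ST)
  finally show "far ?F V V (- len K) (r.M.eb V K) = far dr V V (- len K) (r.M.eb V K)" .
 qed
qed

end

section \<open>Maps from a Drinfeld quotient into contractible modules\<close>

text \<open>Left dg modules over \<open>C\<close>, given by subspaces \<open>R X n\<close> of one vector space.\<close>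

locale lmod = C: dgc C + V: vector_space sc
 for C :: "('k::field, 'u) dgcat" and sc :: "'k => 'r::ab_group_add => 'r" +
 fixes R :: "'u => int => 'r set"
  and act :: "'u => 'u => int => int => 'u => 'r => 'r"
  and dl :: "'u => int => 'r => 'r"
 assumes R_zero [simp]: "X : Ob C ==> 0 : R X n"
  and R_add [simp]: "[|X : Ob C; r : R X n; s : R X n|] ==> r + s : R X n"
  and R_scale [simp]: "[|X : Ob C; r : R X n|] ==> sc c r : R X n"
  and act_closed [simp]: "[|X : Ob C; Y : Ob C; a : hom_set C X Y m; r : R X n; k = m + n|] ==> act X Y m n a r : R Y k"
  and act_add_left: "[|X : Ob C; Y : Ob C; a : hom_set C X Y m; b : hom_set C X Y m; r : R X n|] ==>
   act X Y m n (hadd C X Y m a b) r = act X Y m n a r + act X Y m n b r"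
  and act_scale_left: "[|X : Ob C; Y : Ob C; a : hom_set C X Y m; r : R X n|] ==>
   act X Y m n (hscale C X Y m c a) r = sc c (act X Y m n a r)"
  and act_add: "[|X : Ob C; Y : Ob C; a : hom_set C X Y m; r : R X n; s : R X n|] ==>
   act X Y m n a (r + s) = act X Y m n a r + act X Y m n a s"
  and act_scale: "[|X : Ob C; Y : Ob C; a : hom_set C X Y m; r : R X n|] ==>
   act X Y m n a (sc c r) = sc c (act X Y m n a r)"
  and act_id: "[|X : Ob C; r : R X n|] ==> act X X 0 n (Id C X) r = r"
  and act_cmp: "[|X : Ob C; Y : Ob C; Z : Ob C; b : hom_set C Y Z l; a : hom_set C X Y m; r : R X n; k = l + m; k' = m + n|] ==>
   act X Z k n (Cmp C X Y Z l m b a) r = act Y Z l k' b (act X Y m n a r)"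
  and dl_closed [simp]: "[|X : Ob C; r : R X n; k = n + 1|] ==> dl X n r : R X k"
  and dl_add: "[|X : Ob C; r : R X n; s : R X n|] ==> dl X n (r + s) = dl X n r + dl X n s"
  and dl_scale: "[|X : Ob C; r : R X n|] ==> dl X n (sc c r) = sc c (dl X n r)"
  and dl_act: "[|X : Ob C; Y : Ob C; a : hom_set C X Y m; r : R X n; k = m + n; m' = m + 1; n' = n + 1|] ==>
   dl Y k (act X Y m n a r) = act X Y m' n (Dif C X Y m a) r + sg m (act X Y m n' a (dl X n r))"
begin

lemma sc_koszul: "sc (koszul m) r = sg m r"
 by (simp add: koszul_def sg_def)

lemma R_sg [simp]: "[|X : Ob C; r : R X n|] ==> sg m r : R X n"
 using R_scale[of X r n "koszul m"] by (simp add: sc_koszul)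
lemma R_minus [simp]: "[|X : Ob C; r : R X n|] ==> - r : R X n"
 using R_sg[of X r n 1] by (simp add: sg_def)
lemma R_diff [simp]: "[|X : Ob C; r : R X n; s : R X n|] ==> r - s : R X n"
 using R_add[of X r n "- s"] by simp
lemma R_sum: "[|X : Ob C; !!t. t : A ==> f t : R X n|] ==> sum f A : R X n"
 by (induction A rule: infinite_finite_induct) simp_all

lemma sc_sg: "sc c (sg m r) = sg m (sc c r)"
 by (simp add: sg_def)

lemma act_sg: "[|X : Ob C; Y : Ob C; a : hom_set C X Y m; r : R X n|] ==>
  act X Y m n a (sg k r) = sg k (act X Y m n a r)"
 using act_scale[of X Y a m r n "koszul k"] by (simp add: sc_koszul)
lemma act_zero [simp]: "[|X : Ob C; Y : Ob C; a : hom_set C X Y m|] ==> act X Y m n a 0 = 0"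
 using act_scale[of X Y a m 0 n 0] by simp
lemma act_minus: "[|X : Ob C; Y : Ob C; a : hom_set C X Y m; r : R X n|] ==>
  act X Y m n a (- r) = - act X Y m n a r"
 using act_sg[of X Y a m r n 1] by (simp add: sg_def)
lemma act_diff: "[|X : Ob C; Y : Ob C; a : hom_set C X Y m; r : R X n; s : R X n|] ==>
  act X Y m n a (r - s) = act X Y m n a r - act X Y m n a s"
 using act_add[of X Y a m r n "- s"] by (simp add: act_minus)
lemma dl_sg: "[|X : Ob C; r : R X n|] ==> dl X n (sg k r) = sg k (dl X n r)"
 using dl_scale[of X r n "koszul k"] by (simp add: sc_koszul)
lemma dl_zero [simp]: "X : Ob C ==> dl X n 0 = 0"
 using dl_scale[of X 0 n 0] by simp
end

text \<open>A module with a contraction \<open>kap\<close> over each object of the subcategories, linear over the field only.\<close>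

locale ctr = D: dri C S + lmod C sc R act dl
 for C :: "('a, 'k::field) dg" and S and sc :: "'k => 'r::ab_group_add => 'r" and R act dl +
 fixes Y0 :: "('a, 'k) univ" and kap :: "('a, 'k) univ => int => 'r => 'r"
 assumes Y0 [simp]: "Y0 : Ob C"
  and kap_closed [simp]: "[|X : Ob C; X : \<Union>(set S); r : R X n; k = n - 1|] ==> kap X n r : R X k"
  and kap_add: "[|X : Ob C; X : \<Union>(set S); r : R X n; s : R X n|] ==> kap X n (r + s) = kap X n r + kap X n s"
  and kap_scale: "[|X : Ob C; X : \<Union>(set S); r : R X n|] ==> kap X n (sc c r) = sc c (kap X n r)"
  and kap_htpy: "[|X : Ob C; X : \<Union>(set S); r : R X n; k = n - 1; k' = n + 1|] ==>
   dl X k (kap X n r) + kap X k' (dl X n r) = r"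
begin

abbreviation "Q == D.Q"
abbreviation "hq X j == hom_set Q Y0 X j"
abbreviation "qc X Y m j a q == Cmp Q Y0 X Y m j a q"

text \<open>The \<open>C\<close>-linear maps of degree \<open>n\<close> from \<open>Q(Y0, -)\<close> to \<open>R\<close>. They vanish outside their domain, so that
 they form a vector space and equality of maps is equality in HOL.\<close>

definition chom :: "int => (('a, 'k) univ => int => ('a, 'k) univ => 'r) => bool" where
 "chom n g \<longleftrightarrow>
   (ALL X j q. X : Ob C --> q : hq X j --> g X j q : R X (j + n)) &
   (ALL X j q q'. X : Ob C --> q : hq X j --> q' : hq X j --> g X j (hadd Q Y0 X j q q') = g X j q + g X j q') &
   (ALL X j q c. X : Ob C --> q : hq X j --> g X j (hscale Q Y0 X j c q) = sc c (g X j q)) &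
   (ALL X Y m j a q. X : Ob C --> Y : Ob C --> a : hom_set C X Y m --> q : hq X j -->
    g Y (m + j) (qc X Y m j (D.inc X Y m a) q) = sg (n * m) (act X Y m (j + n) a (g X j q))) &
   (ALL X j q. X ~: Ob C | q ~: hq X j --> g X j q = 0)"

lemma chomI:
 assumes "!!X j q. [|X : Ob C; q : hq X j|] ==> g X j q : R X (j + n)"
  and "!!X j q q'. [|X : Ob C; q : hq X j; q' : hq X j|] ==> g X j (hadd Q Y0 X j q q') = g X j q + g X j q'"
  and "!!X j q c. [|X : Ob C; q : hq X j|] ==> g X j (hscale Q Y0 X j c q) = sc c (g X j q)"
  and "!!X Y m j a q. [|X : Ob C; Y : Ob C; a : hom_set C X Y m; q : hq X j|] ==>
    g Y (m + j) (qc X Y m j (D.inc X Y m a) q) = sg (n * m) (act X Y m (j + n) a (g X j q))"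
  and "!!X j q. X ~: Ob C | q ~: hq X j ==> g X j q = 0"
 shows "chom n g"
 unfolding chom_def using assms by blast

lemma chomD:
 assumes "chom n g"
 shows chom_closed: "[|X : Ob C; q : hq X j; k = j + n|] ==> g X j q : R X k"
  and chom_add: "[|X : Ob C; q : hq X j; q' : hq X j|] ==> g X j (hadd Q Y0 X j q q') = g X j q + g X j q'"
  and chom_scale: "[|X : Ob C; q : hq X j|] ==> g X j (hscale Q Y0 X j c q) = sc c (g X j q)"
  and chom_act: "[|X : Ob C; Y : Ob C; a : hom_set C X Y m; q : hq X j; k = m + j; k' = j + n|] ==>
    g Y k (qc X Y m j (D.inc X Y m a) q) = sg (n * m) (act X Y m k' a (g X j q))"
  and chom_out: "X ~: Ob C | q ~: hq X j ==> g X j q = 0"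
 using assms unfolding chom_def by blast+

lemma chom_zero_arg: "[|chom n g; X : Ob C|] ==> g X j (hzero Q Y0 X j) = 0"
 using chom_scale[of n g X "hzero Q Y0 X j" j 0] by (simp add: D.Q.hscale_zero)

lemma chom_sum:
 fixes N :: nat
 assumes g: "chom n g" and X: "X : Ob C" and x: "x : hq X j" and y: "!!t. t < N ==> y t : hq X j"
  and eq: "hv Q Y0 X j x = (\<Sum>t<N. sg (s t) (hv Q Y0 X j (y t)))"
 shows "g X j x = (\<Sum>t<N. sg (s t) (g X j (y t)))"
proof -
 have *: "EX z:hq X j. hv Q Y0 X j z = (\<Sum>t<k. sg (s t) (hv Q Y0 X j (y t))) &
   g X j z = (\<Sum>t<k. sg (s t) (g X j (y t)))" if "k <= N" for k
  using that
 proof (induction k)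
  case 0
  then show ?case using g X by (intro bexI[of _ "hzero Q Y0 X j"]) (simp_all add: chom_zero_arg)
 next
  case (Suc k)
  then obtain z where z: "z : hq X j" "hv Q Y0 X j z = (\<Sum>t<k. sg (s t) (hv Q Y0 X j (y t)))"
    "g X j z = (\<Sum>t<k. sg (s t) (g X j (y t)))" by auto
  have yk: "y k : hq X j" using y Suc by simp
  then show ?case
   using X z g by (intro bexI[of _ "hadd Q Y0 X j z (hscale Q Y0 X j (koszul (s k)) (y k))"])
    (simp_all add: chom_add chom_scale sc_koszul)
 qed
 obtain z where z: "z : hq X j" "hv Q Y0 X j z = (\<Sum>t<N. sg (s t) (hv Q Y0 X j (y t)))"
  "g X j z = (\<Sum>t<N. sg (s t) (g X j (y t)))" using *[of N] by auto
 have "x = z" by (rule D.Q.hv_inj[of Y0 X j]) (use z x eq X in simp_all)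
 then show ?thesis using z by simp
qed

lemma Id_Q0: "Id Q Y0 : hq Y0 0"
 using D.Q.id_closed[of Y0] by simp

lemma Q_left_induct [consumes 2, case_names one inc eps add scale]:
 assumes x: "X : Ob C" "x : hq X j"
  and one: "P Y0 0 (Id Q Y0)"
  and inc: "!!X Y m j a q. [|X : Ob C; Y : Ob C; a : hom_set C X Y m; q : hq X j; P X j q|] ==>
   P Y (m + j) (qc X Y m j (D.inc X Y m a) q)"
  and eps: "!!X I j q. [|X : Ob C; eps_index S X I; q : hq X j; P X j q|] ==>
   P X (- len I + j) (qc X X (- len I) j (D.eb X I) q)"
  and add: "!!X j q q'. [|X : Ob C; q : hq X j; q' : hq X j; P X j q; P X j q'|] ==> P X j (hadd Q Y0 X j q q')"
  and scale: "!!X j c q. [|X : Ob C; q : hq X j; P X j q|] ==> P X j (hscale Q Y0 X j c q)"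
 shows "P X j x"
proof -
 have *: "ALL q l. q : hq X l --> P X l q --> P Y (m + l) (qc X Y m l y q)" if "X : Ob C" "Y : Ob C" "y : hom_set Q X Y m" for X Y m y
  using that
 proof (induction rule: D.Q_induct)
  case (inc X Y n f)
  then show ?case by (simp add: assms(4))
 next
  case (eps X I)
  then show ?case using assms(5) by blast
 next
  case (cmp X Y Z m n g f)
  show ?case
  proof (intro allI impI)
   fix q l assume q: "q : hq X l" "P X l q"
   have "P Z (m + (n + l)) (qc Y Z m (n + l) g (qc X Y n l f q))" using cmp q by simp
   then show "P Z (m + n + l) (qc X Z (m + n) l (Cmp Q X Y Z m n g f) q)"
    using D.Q.cmp_assoc[of Y0 X Y Z g m f n q l] cmp q by (simp add: add.assoc)
  qed
 next
  case (add X Y n g f)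
  then show ?case by (simp add: assms(6))
 next
  case (scale X Y n c f)
  then show ?case by (simp add: assms(7))
 qed
 have "P X (j + 0) (qc Y0 X j 0 x (Id Q Y0))" using *[OF Y0 x, rule_format, of "Id Q Y0" 0] one D.Q.id_closed[of Y0] by simp
 then show ?thesis using x D.Q.cmp_id_right[of Y0 X x j] by simp
qed

text \<open>The construction of \<open>G(g, r)\<close>: an expression \<open>t\<close> acts on pairs \<open>(q, h(q))\<close> and yields \<open>h(t q)\<close>. Since
 \<open>d\<epsilon>\<close> consists of \<open>\<epsilon>\<close>'s with fewer indices, \<open>HI\<close> computes \<open>h(\<epsilon> q)\<close> by recursion on their number.\<close>

primrec HI where
 "HI n g X 0 = (%I j q r. r)"
| "HI n g X (Suc k) = (%I j q r. kap X (j - len I + n + 1)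
   (g X (- len I + j) (qc X X (- len I) j (D.eb X I) q) +
   sg n (\<Sum>t<length I. sg (len I - int (t + 1)) (HI n g X k (rm t I) j q r))))"

fun Hf where
 "Hf n g X Z k (Incl f) j q r = sg (n * k) (act X Z k (j + n) f r)"
| "Hf n g X Z k (Eps A I) j q r = HI n g X (length I) I j q r"
| "Hf n g X Z k (Comp Y m l t u) j q r = Hf n g Y Z m t (l + j) (qc X Y l j (D.cl X Y l u) q) (Hf n g X Y l u j q r)"
| "Hf n g X Z k (FSum t u) j q r = Hf n g X Z k t j q r + Hf n g X Z k u j q r"
| "Hf n g X Z k (FScale c t) j q r = sc c (Hf n g X Z k t j q r)"
| "Hf n g X Z k _ j q r = 0"

definition jlin :: "int => _ => _ => int => (int => _ => 'r => 'r) => bool" where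
 "jlin n X Y m \<phi> \<longleftrightarrow> (ALL j q r. q : hq X j --> r : R X (j + n) --> \<phi> j q r : R Y (m + j + n) &
   (ALL q' r'. q' : hq X j --> r' : R X (j + n) --> \<phi> j (hadd Q Y0 X j q q') (r + r') = \<phi> j q r + \<phi> j q' r') &
   (ALL c. \<phi> j (hscale Q Y0 X j c q) (sc c r) = sc c (\<phi> j q r)))"

lemma jlinD:
 assumes "jlin n X Y m \<phi>" "q : hq X j" "r : R X k" "k = j + n"
 shows "k' = m + j + n ==> \<phi> j q r : R Y k'"
  and "q' : hq X j ==> r' : R X k ==> \<phi> j (hadd Q Y0 X j q q') (r + r') = \<phi> j q r + \<phi> j q' r'"
  and "\<phi> j (hscale Q Y0 X j c q) (sc c r) = sc c (\<phi> j q r)"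
 using assms unfolding jlin_def by blast+

lemma jlinI:
 assumes "!!j q r. [|q : hq X j; r : R X (j + n)|] ==> \<phi> j q r : R Y (m + j + n)"
  and "!!j q r q' r'. [|q : hq X j; r : R X (j + n); q' : hq X j; r' : R X (j + n)|] ==>
    \<phi> j (hadd Q Y0 X j q q') (r + r') = \<phi> j q r + \<phi> j q' r'"
  and "!!j q r c. [|q : hq X j; r : R X (j + n)|] ==> \<phi> j (hscale Q Y0 X j c q) (sc c r) = sc c (\<phi> j q r)"
 shows "jlin n X Y m \<phi>"
 unfolding jlin_def using assms by blast

lemma jlin_sum: "[|jlin n X Y m \<phi>; jlin n X Y m \<psi>; Y : Ob C|] ==> jlin n X Y m (%j q r. \<phi> j q r + \<psi> j q r)"
 by (rule jlinI) (simp_all add: jlinD V.scale_right_distrib ac_simps)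

lemma jlin_scale: "[|jlin n X Y m \<phi>; Y : Ob C|] ==> jlin n X Y m (%j q r. sc c (\<phi> j q r))"
 by (rule jlinI) (simp_all add: jlinD V.scale_right_distrib ac_simps)

lemma jlin_comp: "[|jlin n Y Z m \<phi>; jlin n X Y l \<psi>; u : hom_set Q X Y l; X : Ob C; Y : Ob C; k = m + l|] ==>
  jlin n X Z k (%j q r. \<phi> (l + j) (qc X Y l j u q) (\<psi> j q r))"
proof -
 assume a: "jlin n Y Z m \<phi>" "jlin n X Y l \<psi>" "u : hom_set Q X Y l" "X : Ob C" "Y : Ob C" "k = m + l"
 have c: "qc X Y l j u q : hq Y (l + j)" "\<psi> j q r : R Y (l + j + n)" if "q : hq X j" "r : R X (j + n)" for j q r
  using a that jlinD(1)[OF a(2) that] by simp_all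
 show ?thesis
 proof (rule jlinI)
  fix j q r assume q: "q : hq X j" "r : R X (j + n)"
  note p = jlinD[OF a(1) c[OF q] refl] and p' = jlinD[OF a(2) q refl]
  show "\<phi> (l + j) (qc X Y l j u q) (\<psi> j q r) : R Z (k + j + n)" by (rule p(1)) (simp add: a(6))
  show "\<phi> (l + j) (qc X Y l j u (hscale Q Y0 X j b q)) (\<psi> j (hscale Q Y0 X j b q) (sc b r)) =
   sc b (\<phi> (l + j) (qc X Y l j u q) (\<psi> j q r))" for b using a q p(3) p'(3) by simp
  fix q' r' assume q': "q' : hq X j" "r' : R X (j + n)"
  show "\<phi> (l + j) (qc X Y l j u (hadd Q Y0 X j q q')) (\<psi> j (hadd Q Y0 X j q q') (r + r')) =
   \<phi> (l + j) (qc X Y l j u q) (\<psi> j q r) + \<phi> (l + j) (qc X Y l j u q') (\<psi> j q' r')"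
   using a q p(2)[OF c[OF q']] p'(2)[OF q'] q' by simp
 qed
qed

lemma eps_index_mem: "eps_index S X I ==> X : \<Union>(set S)"
proof -
 assume "eps_index S X I"
 then obtain i where "1 <= i" "i <= length S" "X : S ! (i - 1)" by (auto simp: eps_index_def neq_Nil_conv)
 then show ?thesis by (intro UnionI[of "S ! (i - 1)"] nth_mem) auto
qed

lemma sg_add: "sg m (x + y) = sg m x + sg m y"
 by (simp add: sg_def)

lemma HI_jlin:
 assumes g: "chom (n + 1) g"
 shows "D.valid X I ==> length I = k ==> jlin n X X (- len I) (HI n g X k I)"
proof (induction k arbitrary: I)
 case 0
 then show ?case by (intro jlinI) simp_all
next
 case (Suc k)
 have X: "X : Ob C" and K: "X : \<Union>(set S)" using Suc.prems eps_index_mem by (auto simp: D.valid_def)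
 let ?l = "len I"
 have IH: "jlin n X X (- ?l + 1) (HI n g X k (rm t I))" if "t < length I" for t
  using Suc.IH[of "rm t I"] D.valid_rm'[OF Suc.prems(1) that] Suc.prems(2) that by (simp add: add.commute)
 have e: "D.eb X I : hom_set Q X X (- ?l)" by (rule D.eb_closed[OF Suc.prems(1)]) simp
 have G: "g X (- ?l + j) (qc X X (- ?l) j (D.eb X I) q) : R X (j - ?l + n + 1)" if "q : hq X j" for j q
  using X e that by (intro chom_closed[OF g]) (simp_all add: algebra_simps)
 let ?Z = "%j q r. g X (- ?l + j) (qc X X (- ?l) j (D.eb X I) q) +
   sg n (\<Sum>t<length I. sg (?l - int (t + 1)) (HI n g X k (rm t I) j q r))"
 have Zc: "?Z j q r : R X (j - ?l + n + 1)" if "q : hq X j" "r : R X (j + n)" for j q r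
 proof -
  have "HI n g X k (rm t I) j q r : R X (j - ?l + n + 1)" if "t < length I" for t
   by (rule jlinD(1)[OF IH[OF that] \<open>q : hq X j\<close> \<open>r : R X (j + n)\<close>]) simp_all
  then show ?thesis by (intro R_add X G that R_sg R_sum) simp_all
 qed
 have Za: "?Z j (hadd Q Y0 X j q q') (r + r') = ?Z j q r + ?Z j q' r'"
  if "q : hq X j" "r : R X (j + n)" "q' : hq X j" "r' : R X (j + n)" for j q r q' r'
  using X e that by (simp add: chom_add[OF g] jlinD(2)[OF IH] sg_add sum.distrib cong: sum.cong_simp)
 have Zs: "?Z j (hscale Q Y0 X j c q) (sc c r) = sc c (?Z j q r)"
  if "q : hq X j" "r : R X (j + n)" for j q r c
  using X e that by (simp add: chom_scale[OF g] jlinD(3)[OF IH] sc_sg V.scale_right_distrib V.scale_sum_right cong: sum.cong_simp)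
 show ?case
 proof (rule jlinI)
  fix j q r assume qr: "q : hq X j" "r : R X (j + n)"
  show "HI n g X (Suc k) I j q r : R X (- len I + j + n)"
   unfolding HI.simps by (rule kap_closed[OF X K Zc[OF qr]]) simp
  show "HI n g X (Suc k) I j (hscale Q Y0 X j c q) (sc c r) = sc c (HI n g X (Suc k) I j q r)" for c
   unfolding HI.simps Zs[OF qr] by (rule kap_scale[OF X K Zc[OF qr]])
  fix q' r' assume qr': "q' : hq X j" "r' : R X (j + n)"
  show "HI n g X (Suc k) I j (hadd Q Y0 X j q q') (r + r') = HI n g X (Suc k) I j q r + HI n g X (Suc k) I j q' r'"
   unfolding HI.simps Za[OF qr qr'] by (rule kap_add[OF X K Zc[OF qr] Zc[OF qr']])
 qed
qed

lemma ty_ObD: "D.DE X Y n t u ==> X : Ob C & Y : Ob C"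
 by (rule drinfeld_eq_Ob)

text \<open>The action of expressions respects all relations of the quotient, because it is jointly linear in
 the two components of a pair.\<close>

context
 fixes n g assumes g: "chom (n + 1) g"
begin

abbreviation "hf == Hf n g"
abbreviation "jl == %X Y m t. jlin n X Y m (hf X Y m t)"

lemma jl_sum: "[|jl X Y m t; jl X Y m u; Y : Ob C|] ==> jl X Y m (FSum t u)"
 using jlin_sum[of n X Y m "hf X Y m t" "hf X Y m u"] by (simp add: jlin_def)
lemma jl_scale: "[|jl X Y m t; Y : Ob C|] ==> jl X Y m (FScale c t)"
 using jlin_scale[of n X Y m "hf X Y m t" c] by (simp add: jlin_def)
lemma jl_comp: "[|jl Y Z m t; jl X Y l u; D.ty X Y l u; Y : Ob C; X : Ob C; k = m + l|] ==> jl X Z k (Comp Y m l t u)"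
 using jlin_comp[of n Y Z m "hf Y Z m t" X l "hf X Y l u" "D.cl X Y l u" k] D.cl_closed[of X Y l u]
 by (simp add: jlin_def)
lemma jl_incl: "[|X : Ob C; Y : Ob C; f : hom_set C X Y m|] ==> jl X Y m (Incl f)"
 unfolding jlin_def by (simp add: act_add act_scale sg_add sc_sg)
lemma jl_eps: "[|X : Ob C; eps_index S X I|] ==> jl X X (- len I) (Eps X I)"
 using HI_jlin[OF g, of X I "length I"] by (simp add: D.valid_def jlin_def)

lemmas jl = jl_sum jl_scale jl_comp jl_incl

lemma Hf_sound: "D.DE X Y m t u ==> jl X Y m t & jl X Y m u &
  (ALL j q r. q : hq X j --> r : R X (j + n) --> hf X Y m t j q r = hf X Y m u j q r)"
proof (induction rule: drinfeld_eq.induct)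
 case (incl X Y f m)
 then show ?case using jl_incl[of X Y f m] by blast
next
 case (eps X I)
 then show ?case using jl_eps[of X I] by blast
next
 case (sym X Y n t u)
 then show ?case by simp
next
 case (trans X Y n t u v)
 then show ?case by simp
next
 case (sum_cong X Y m t t' u u')
 note Ob = sum_cong.hyps[THEN ty_ObD]
 show ?case using sum_cong.IH Ob by (intro conjI jl) (simp_all add: D.ty_intros)
next
 case (scale_cong X Y m t t' c)
 note Ob = scale_cong.hyps[THEN ty_ObD]
 show ?case using scale_cong.IH Ob by (intro conjI jl) (simp_all add: D.ty_intros)
next
 case (comp_cong Y Z m t t' X l u u')
 note Ob = comp_cong.hyps[THEN ty_ObD]
 have c: "D.cl X Y l u : hom_set Q X Y l" "D.cl X Y l u' = D.cl X Y l u" "D.ty X Y l u" "D.ty X Y l u'"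
  using D.cl_closed D.cl_eq[OF comp_cong.hyps(2)] D.ty_left[OF comp_cong.hyps(2)] D.ty_right[OF comp_cong.hyps(2)] by simp_all
 have "hf Y Z m t (l + j) (qc X Y l j (D.cl X Y l u) q) (hf X Y l u j q r) = hf Y Z m t' (l + j) (qc X Y l j (D.cl X Y l u) q) (hf X Y l u j q r)"
  if "q : hq X j" "r : R X (j + n)" for j q r
  using comp_cong.IH(1) c Ob that jlinD(1)[OF conjunct1[OF comp_cong.IH(2)] that] by simp
 then show ?case using comp_cong.IH Ob c by (intro conjI jl) (simp_all add: D.ty_intros)
next
 case (sum_assoc X Y m t u v)
 note Ob = sum_assoc.hyps[THEN ty_ObD]
 show ?case using sum_assoc.IH Ob by (intro conjI jl) (simp_all add: ac_simps)
next
 case (sum_comm X Y m t u)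
 note Ob = sum_comm.hyps[THEN ty_ObD]
 show ?case using sum_comm.IH Ob by (intro conjI jl) (simp_all add: ac_simps)
next
 case (sum_zero X Y m t u)
 note Ob = sum_zero.hyps[THEN ty_ObD]
 show ?case using sum_zero.IH Ob by (intro conjI jl) (simp_all add: D.ty_intros)
next
 case (scale_sum X Y m t u c)
 note Ob = scale_sum.hyps[THEN ty_ObD]
 show ?case using scale_sum.IH Ob by (intro conjI jl) (simp_all add: V.scale_right_distrib)
next
 case (scale_add X Y m t c c')
 note Ob = scale_add.hyps[THEN ty_ObD]
 show ?case using scale_add.IH Ob by (intro conjI jl) (simp_all add: V.scale_left_distrib)
next
 case (scale_mult X Y m t c c')
 note Ob = scale_mult.hyps[THEN ty_ObD]
 show ?case using scale_mult.IH Ob by (intro conjI jl) (simp_all add: D.ty_intros)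
next
 case (scale_one X Y m t)
 note Ob = scale_one.hyps[THEN ty_ObD]
 show ?case using scale_one.IH Ob by (intro conjI jl) (simp_all add: D.ty_intros)
next
 case (comp_sum_left Y Z m t t' X l u)
 note Ob = comp_sum_left.hyps[THEN ty_ObD]
 show ?case using comp_sum_left.IH comp_sum_left.hyps Ob by (intro conjI jl) (simp_all add: D.ty_intros)
next
 case (comp_sum_right Y Z m t X l u u')
 note Ob = comp_sum_right.hyps[THEN ty_ObD] and h = comp_sum_right.hyps and IH = comp_sum_right.IH
 have c: "D.cl X Y l u : hom_set Q X Y l" "D.cl X Y l u' : hom_set Q X Y l" "D.cl X Y l (FSum u u') = hadd Q X Y l (D.cl X Y l u) (D.cl X Y l u')"
  using h by (simp_all add: D.cl_closed D.cl_sum)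
 have "hf X Z (m + l) (Comp Y m l t (FSum u u')) j q r = hf X Z (m + l) (FSum (Comp Y m l t u) (Comp Y m l t u')) j q r"
  if "q : hq X j" "r : R X (j + n)" for j q r
 proof -
  have "hf X Y l u j q r : R Y (l + j + n)" "hf X Y l u' j q r : R Y (l + j + n)"
   using jlinD(1)[OF _ that refl refl] IH by simp_all
  then show ?thesis using c Ob that by (simp add: jlinD(2)[OF conjunct1[OF IH(1)]])
 qed
 then show ?case using IH h Ob by (intro conjI jl) (simp_all add: D.ty_intros del: Hf.simps)
next
 case (comp_scale_left Y Z m t X l u c)
 note Ob = comp_scale_left.hyps[THEN ty_ObD]
 show ?case using comp_scale_left.IH comp_scale_left.hyps Ob by (intro conjI jl) (simp_all add: D.ty_intros)
next
 case (comp_scale_right Y Z m t X l u c)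
 note Ob = comp_scale_right.hyps[THEN ty_ObD] and h = comp_scale_right.hyps and IH = comp_scale_right.IH
 have c: "D.cl X Y l u : hom_set Q X Y l" "D.cl X Y l (FScale c u) = hscale Q X Y l c (D.cl X Y l u)"
  using h by (simp_all add: D.cl_closed D.cl_scale)
 have "hf X Z (m + l) (Comp Y m l t (FScale c u)) j q r = hf X Z (m + l) (FScale c (Comp Y m l t u)) j q r"
  if "q : hq X j" "r : R X (j + n)" for j q r
 proof -
  have "hf X Y l u j q r : R Y (l + j + n)" using jlinD(1)[OF _ that refl refl] IH by simp
  then show ?thesis using c Ob that by (simp add: jlinD(3)[OF conjunct1[OF IH(1)]])
 qed
 then show ?case using IH h Ob by (intro conjI jl) (simp_all add: D.ty_intros del: Hf.simps)
next
 case (comp_assoc Y Z l t X m u W k v)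
 note Ob = comp_assoc.hyps[THEN ty_ObD] and h = comp_assoc.hyps and IH = comp_assoc.IH
 have c: "D.cl X Y m u : hom_set Q X Y m" "D.cl W X k v : hom_set Q W X k"
  "D.cl W Y (m + k) (Comp X m k u v) = Cmp Q W X Y m k (D.cl X Y m u) (D.cl W X k v)"
  using h by (simp_all add: D.cl_closed D.cl_comp)
 have "hf W Z (l + m + k) (Comp Y l (m + k) t (Comp X m k u v)) j q r = hf W Z (l + m + k) (Comp X (l + m) k (Comp Y l m t u) v) j q r"
  if "q : hq W j" for j q r
  using c Ob that D.Q.cmp_assoc[of Y0 W X Y "D.cl X Y m u" m "D.cl W X k v" k q j] by (simp add: add.assoc)
 moreover have "jl W Z (l + m + k) (Comp Y l (m + k) t (Comp X m k u v))"
  using IH h Ob by (intro jl_comp) (simp_all add: jl D.ty_intros add.assoc)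
 moreover have "jl W Z (l + m + k) (Comp X (l + m) k (Comp Y l m t u) v)"
  using IH h Ob by (intro jl_comp) (simp_all add: jl D.ty_intros add.assoc)
 ultimately show ?case by blast
next
 case (comp_id_left X Y m t)
 note Ob = comp_id_left.hyps[THEN ty_ObD] and h = comp_id_left.hyps and IH = comp_id_left.IH
 have "hf X Y m (Comp Y 0 m (Incl (Id C Y)) t) j q r = hf X Y m t j q r"
  if "q : hq X j" "r : R X (j + n)" for j q r
 proof -
  have "hf X Y m t j q r : R Y (m + j + n)" using jlinD(1)[OF _ that refl refl] IH by simp
  then show ?thesis using Ob by (simp add: act_id)
 qed
 then show ?case using IH h Ob by (intro conjI jl) (simp_all add: D.ty_intros del: Hf.simps)
next
 case (comp_id_right X Y m t)
 note Ob = comp_id_right.hyps[THEN ty_ObD] and h = comp_id_right.hyps and IH = comp_id_right.IH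
 have c: "D.cl X X 0 (Incl (Id C X)) = Id Q X" using D.inc_id[of X] Ob by (simp add: D.inc_def)
 have "hf X Y m (Comp X m 0 t (Incl (Id C X))) j q r = hf X Y m t j q r"
  if "q : hq X j" "r : R X (j + n)" for j q r
  using Ob that D.Q.cmp_id_left[of Y0 X q j] by (simp add: act_id c)
 then show ?case using IH h Ob by (intro conjI jl) (simp_all add: D.ty_intros del: Hf.simps)
next
 case (incl_add X Y f m f')
 have "hf X Y m (Incl (hadd C X Y m f f')) j q r = hf X Y m (FSum (Incl f) (Incl f')) j q r" if "r : R X (j + n)" for j q r
  using incl_add that by (simp add: act_add_left sg_add)
 then show ?case using incl_add by (intro conjI jl) (simp_all del: Hf.simps)
next
 case (incl_scale X Y f m c)
 have "hf X Y m (Incl (hscale C X Y m c f)) j q r = hf X Y m (FScale c (Incl f)) j q r" if "r : R X (j + n)" for j q r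
  using incl_scale that by (simp add: act_scale_left sc_sg)
 then show ?case using incl_scale by (intro conjI jl) (simp_all del: Hf.simps)
next
 case (incl_comp X Y Z f' m f l)
 have "hf X Z (m + l) (Comp Y m l (Incl f') (Incl f)) j q r = hf X Z (m + l) (Incl (Cmp C X Y Z m l f' f)) j q r"
  if "r : R X (j + n)" for j q r
  using incl_comp that by (simp add: act_sg act_cmp[where k' = "l + (j + n)"] add.assoc) (simp add: sg_def algebra_simps)
 then show ?case using incl_comp by (intro conjI jl) (simp_all add: D.ty_intros del: Hf.simps)
qed

lemma cl_hom: "[|x : hom_set Q X Y m; X : Ob C; Y : Ob C|] ==> D.ty X Y m x & D.cl X Y m x = x"
 by (metis D.homE D.cl_rel D.cl_eq D.ty_left)

text \<open>As a morphism of the quotient is represented by an expression, it can act on the pair \<open>(1, r)\<close>.\<close>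

definition G where
 "G r0 = (%X j q. if X : Ob C & q : hq X j then hf Y0 X j q 0 (Id Q Y0) r0 else 0)"

context
 fixes r0 assumes r0: "r0 : R Y0 n"
begin

lemma G_cl:
 assumes X: "X : Ob C" and t: "D.ty Y0 X j t"
 shows "G r0 X j (D.cl Y0 X j t) = hf Y0 X j t 0 (Id Q Y0) r0"
 using Hf_sound[OF D.cl_rel[OF t]] Id_Q0 r0 X D.cl_closed[OF t] by (simp add: G_def)

lemma G_closed: "[|X : Ob C; q : hq X j; k = j + n|] ==> G r0 X j q : R X k"
proof -
 assume a: "X : Ob C" "q : hq X j" "k = j + n"
 have "jl Y0 X j q" using Hf_sound[of Y0 X j q q] cl_hom[OF a(2)] a by simp
 then show ?thesis using jlinD(1)[OF _ Id_Q0, of n X j "hf Y0 X j q" r0 n k] r0 a by (simp add: G_def)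
qed

lemma G_one: "G r0 Y0 0 (Id Q Y0) = r0"
 using G_cl[of Y0 0 "Incl (Id C Y0)"] r0 D.inc_id[of Y0] by (simp add: D.inc_def D.ty_intros act_id)

lemma G_comp:
 assumes X: "X : Ob C" "Y : Ob C" and t: "D.ty X Y m t" and q: "q : hq X j"
 shows "G r0 Y (m + j) (qc X Y m j (D.cl X Y m t) q) = hf X Y m t j q (G r0 X j q)"
proof -
 have q': "D.ty Y0 X j q" "D.cl Y0 X j q = q" using cl_hom[OF q] X by simp_all
 have "qc X Y m j (D.cl X Y m t) q = D.cl Y0 Y (m + j) (Comp X m j t q)"
  using D.cl_comp[OF t q'(1)] q'(2) by simp
 then have "G r0 Y (m + j) (qc X Y m j (D.cl X Y m t) q) = hf Y0 Y (m + j) (Comp X m j t q) 0 (Id Q Y0) r0"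
  using G_cl[of Y "m + j" "Comp X m j t q"] X t q' by (simp add: D.ty_intros del: Hf.simps)
 also have "... = hf X Y m t j q (G r0 X j q)"
  using X q q'(2) D.Q.cmp_id_right[of Y0 X q j] by (simp add: G_def)
 finally show ?thesis .
qed

lemma G_chom: "chom n (G r0)"
proof (rule chomI)
 fix X j q q' c assume X: "X : Ob C" and q: "q : hq X j"
 have q': "D.ty Y0 X j q" "D.cl Y0 X j q = q" using cl_hom[OF q] X by simp_all
 show "G r0 X j q : R X (j + n)" by (rule G_closed[OF X q refl])
 show "G r0 X j (hscale Q Y0 X j c q) = sc c (G r0 X j q)"
  using G_cl[OF X D.ty_intros(4)[OF q'(1)], of c] G_cl[OF X q'(1)] q' by (simp add: D.cl_scale)
 assume w: "q' : hq X j"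
 have w': "D.ty Y0 X j q'" "D.cl Y0 X j q' = q'" using cl_hom[OF w] X by simp_all
 show "G r0 X j (hadd Q Y0 X j q q') = G r0 X j q + G r0 X j q'"
  using G_cl[OF X D.ty_intros(3)[OF q'(1) w'(1)]] G_cl[OF X q'(1)] G_cl[OF X w'(1)] q' w' by (simp add: D.cl_sum)
next
 fix X Y m j a q assume a: "X : Ob C" "Y : Ob C" "a : hom_set C X Y m" "q : hq X j"
 then show "G r0 Y (m + j) (qc X Y m j (D.inc X Y m a) q) = sg (n * m) (act X Y m (j + n) a (G r0 X j q))"
  using G_comp[of X Y m "Incl a" q j] by (simp add: D.inc_def D.ty_intros)
qed (auto simp: G_def)

lemma G_HI:
 assumes X: "X : Ob C" and I: "D.valid X I" and q: "q : hq X j"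
 shows "G r0 X (- len I + j) (qc X X (- len I) j (D.eb X I) q) = HI n g X (length I) I j q (G r0 X j q)"
proof (cases "I = []")
 case True
 then show ?thesis using X q D.Q.cmp_id_left[of Y0 X q j] by (simp add: D.eb_Nil)
next
 case False
 then have e: "eps_index S X I" "D.eb X I = D.cl X X (- len I) (Eps X I)"
  using I by (simp_all add: D.valid_def D.eb_def eps_expr_def)
 then show ?thesis using G_comp[of X X "- len I" "Eps X I" q j] X q by (simp add: D.ty_intros)
qed

lemma G_eps:
 assumes X: "X : Ob C" and I: "eps_index S X I" and q: "q : hq X j"
  and k: "k = - len I + j" "k' = j - len I + n + 1" "k'' = - len I + 1 + j"
 shows "G r0 X k (qc X X (- len I) j (D.eb X I) q) =
  kap X k' (g X k (qc X X (- len I) j (D.eb X I) q) +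
   sg n (G r0 X k'' (qc X X (- len I + 1) j (Dif Q X X (- len I) (D.eb X I)) q)))"
proof -
 let ?l = "len I"
 have v: "D.valid X I" using X I by (simp add: D.valid_def)
 have pos: "length I > 0" using I by (auto simp: eps_index_def)
 then obtain k0 where k0: "length I = Suc k0" using gr0_conv_Suc by blast
 have vr: "D.valid X (rm t I)" if "t < length I" for t using D.valid_rm'[OF v that] .
 have lr: "- len (rm t I) = - ?l + 1" "length (rm t I) = k0" if "t < length I" for t using that pos k0 by simp_all
 have e: "D.eb X (rm t I) : hom_set Q X X (- ?l + 1)" if "t < length I" for t
  using vr[OF that] lr[OF that] by (intro D.eb_closed) simp_all
 have d: "Dif Q X X (- ?l) (D.eb X I) : hom_set Q X X (- ?l + 1)"
  using D.difQ_closed[OF X X D.eb_closed[OF v refl]] by simp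
 have hl: "hv Q Y0 X (- ?l + 1 + j) (qc X X (- ?l + 1) j (Dif Q X X (- ?l) (D.eb X I)) q) =
   (\<Sum>t<length I. sg (?l - int (t + 1)) (hv Q Y0 X (- ?l + 1 + j) (qc X X (- ?l + 1) j (D.eb X (rm t I)) q)))"
  by (rule D.hv_linear_sum[OF X X D.Q.gcat_axioms _ _ D.Q.cmp_lin_left])
   (use X q d e D.hv_difQ_eb[OF v] in simp_all)
 have "G r0 X k'' (qc X X (- ?l + 1) j (Dif Q X X (- ?l) (D.eb X I)) q) =
  (\<Sum>t<length I. sg (?l - int (t + 1)) (G r0 X k'' (qc X X (- ?l + 1) j (D.eb X (rm t I)) q)))"
  unfolding k by (rule chom_sum[OF G_chom X _ _ hl]) (use X q d e in simp_all)
 also have "... = (\<Sum>t<length I. sg (?l - int (t + 1)) (HI n g X k0 (rm t I) j q (G r0 X j q)))"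
 proof (intro sum.cong refl)
  fix t assume "t : {..<length I}"
  then have t: "t < length I" by simp
  show "sg (?l - int (t + 1)) (G r0 X k'' (qc X X (- ?l + 1) j (D.eb X (rm t I)) q)) =
    sg (?l - int (t + 1)) (HI n g X k0 (rm t I) j q (G r0 X j q))"
   using G_HI[OF X vr[OF t] q] unfolding lr(1)[OF t] unfolding lr(2)[OF t] k by simp
 qed
 finally have S: "G r0 X k'' (qc X X (- ?l + 1) j (Dif Q X X (- ?l) (D.eb X I)) q) = ..." .
 have "HI n g X (length I) I j q (G r0 X j q) = HI n g X (Suc k0) I j q (G r0 X j q)" by (simp only: k0)
 then show ?thesis using G_HI[OF X v q] S unfolding k by simp
qed

end

end

text \<open>In the induction step for \<open>\<epsilon> q\<close> one may also use the statement for \<open>d\<epsilon> q\<close>: this is a sum of terms \<open>\<epsilon> q\<close>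
 with fewer indices.\<close>

lemma Q_left_induct' [consumes 2, case_names one inc eps add scale]:
 assumes x: "X : Ob C" "x : hq X j"
  and one: "P Y0 0 (Id Q Y0)"
  and inc: "!!X Y m j a q. [|X : Ob C; Y : Ob C; a : hom_set C X Y m; q : hq X j; P X j q|] ==>
   P Y (m + j) (qc X Y m j (D.inc X Y m a) q)"
  and eps: "!!X I j q. [|X : Ob C; eps_index S X I; q : hq X j; P X j q;
    P X (- len I + 1 + j) (qc X X (- len I + 1) j (Dif Q X X (- len I) (D.eb X I)) q)|] ==>
   P X (- len I + j) (qc X X (- len I) j (D.eb X I) q)"
  and add: "!!X j q q'. [|X : Ob C; q : hq X j; q' : hq X j; P X j q; P X j q'|] ==> P X j (hadd Q Y0 X j q q')"
  and scale: "!!X j c q. [|X : Ob C; q : hq X j; P X j q|] ==> P X j (hscale Q Y0 X j c q)"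
 shows "P X j x"
 using x
proof (induction rule: Q_left_induct)
 case (eps X I j q)
 have "P X (- len J + j) (qc X X (- len J) j (D.eb X J) q)" if "D.valid X J" for J
  using that
 proof (induction "length J" arbitrary: J rule: less_induct)
  case less
  let ?l = "len J"
  show ?case
  proof (cases "J = []")
   case True
   then show ?thesis using eps D.Q.cmp_id_left[of Y0 X q j] by (simp add: D.eb_Nil)
  next
   case False
   then have J: "eps_index S X J" and pos: "0 < length J" using less.prems by (simp_all add: D.valid_def)
   have e: "D.eb X (rm t J) : hom_set Q X X (- ?l + 1)" if "t < length J" for t
    using D.valid_rm'[OF less.prems that] that by (intro D.eb_closed) simp_all
   have d: "Dif Q X X (- ?l) (D.eb X J) : hom_set Q X X (- ?l + 1)"
    using D.difQ_closed[OF _ _ D.eb_closed[OF less.prems refl]] eps by simp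
   have P: "P X (- ?l + 1 + j) (qc X X (- ?l + 1) j (D.eb X (rm t J)) q)" if "t < length J" for t
    using less.hyps[of "rm t J"] D.valid_rm'[OF less.prems that] that by simp
   have z0: "qc X X (- ?l + 1) j (D.eb X (rm 0 J)) q : hq X (- ?l + 1 + j)" using e[OF pos] eps by simp
   have "EX z:hom_set Q X X (- ?l + 1). hv Q X X (- ?l + 1) z = (\<Sum>t<k. sg (?l - int (t + 1)) (hv Q X X (- ?l + 1) (D.eb X (rm t J))))
     & P X (- ?l + 1 + j) (qc X X (- ?l + 1) j z q)" if "k <= length J" for k
    using that
   proof (induction k)
    case 0
    have "P X (- ?l + 1 + j) (qc X X (- ?l + 1) j (hscale Q X X (- ?l + 1) 0 (D.eb X (rm 0 J))) q)"
     using assms(7)[OF _ z0 P[OF pos], of 0] eps e[OF pos] by simp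
    then show ?case using eps e[OF pos] by (intro bexI[of _ "hscale Q X X (- ?l + 1) 0 (D.eb X (rm 0 J))"]) simp_all
   next
    case (Suc k)
    then obtain z where z: "z : hom_set Q X X (- ?l + 1)" "P X (- ?l + 1 + j) (qc X X (- ?l + 1) j z q)"
     "hv Q X X (- ?l + 1) z = (\<Sum>t<k. sg (?l - int (t + 1)) (hv Q X X (- ?l + 1) (D.eb X (rm t J))))" by auto
    have k: "k < length J" using Suc by simp
    show ?case
     using z eps e[OF k] assms(6) assms(7) P[OF k]
     by (intro bexI[of _ "hadd Q X X (- ?l + 1) z (hscale Q X X (- ?l + 1) (koszul (?l - int (k + 1))) (D.eb X (rm k J)))"]) simp_all
   qed
   then obtain z where z: "z : hom_set Q X X (- ?l + 1)" "P X (- ?l + 1 + j) (qc X X (- ?l + 1) j z q)"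
    "hv Q X X (- ?l + 1) z = (\<Sum>t<length J. sg (?l - int (t + 1)) (hv Q X X (- ?l + 1) (D.eb X (rm t J))))" by blast
   have "Dif Q X X (- ?l) (D.eb X J) = z"
    by (rule D.Q.hv_inj[of X X "- ?l + 1"]) (use z eps d D.hv_difQ_eb[OF less.prems] in simp_all)
   then show ?thesis using assms(5)[of X J q j] J z eps by simp
  qed
 qed
 then show ?case using eps by (simp add: D.valid_def)
qed (use assms in simp_all)

definition epsf where
 "epsf n g h \<longleftrightarrow> (ALL X I j q. X : Ob C --> eps_index S X I --> q : hq X j -->
   h X (- len I + j) (qc X X (- len I) j (D.eb X I) q) =
  kap X (j - len I + n + 1) (g X (- len I + j) (qc X X (- len I) j (D.eb X I) q) +
   sg n (h X (- len I + 1 + j) (qc X X (- len I + 1) j (Dif Q X X (- len I) (D.eb X I)) q))))"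

text \<open>Uniqueness of \<open>G(g, r)\<close>; it also yields linearity of \<open>G\<close>.\<close>

lemma chom_eqI:
 assumes h: "chom n h" "epsf n g h" and h': "chom n h'" "epsf n g h'" and one: "h Y0 0 (Id Q Y0) = h' Y0 0 (Id Q Y0)"
 shows "h = h'"
proof (intro ext)
 fix X j q
 show "h X j q = h' X j q"
 proof (cases "X : Ob C & q : hq X j")
  case True
  then have "X : Ob C" "q : hq X j" by simp_all
  then show ?thesis
  proof (induction rule: Q_left_induct')
   case (eps X I j q)
   then show ?case using h(2) h'(2) by (simp add: epsf_def)
  qed (simp_all add: one chom_act[OF h(1)] chom_act[OF h'(1)] chom_add[OF h(1)] chom_add[OF h'(1)] chom_scale[OF h(1)] chom_scale[OF h'(1)])
 qed (use chom_out[OF h(1)] chom_out[OF h'(1)] in auto)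
qed

lemma G_epsf: "[|chom (n + 1) g; r0 : R Y0 n|] ==> epsf n g (G n g r0)"
 unfolding epsf_def using G_eps by blast

lemma chom_plus: "[|chom n g; chom n h|] ==> chom n (g + h)"
 by (rule chomI) (simp_all add: fun_app chomD act_add sg_add V.scale_right_distrib ac_simps)

lemma chom_sc: "chom n g ==> chom n (%X j q. sc c (g X j q))"
 by (rule chomI) (simp_all add: chomD act_scale V.scale_right_distrib sc_sg ac_simps)

lemma G_arg:
 assumes g: "chom (n + 1) g" and r: "r0 : R Y0 n" and X: "X : Ob C" and I: "eps_index S X I" and q: "q : hq X j"
 shows "g X (- len I + j) (qc X X (- len I) j (D.eb X I) q) : R X (j - len I + n + 1)"
  "G n g r0 X (- len I + 1 + j) (qc X X (- len I + 1) j (Dif Q X X (- len I) (D.eb X I)) q) : R X (j - len I + n + 1)"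
proof -
 have "D.valid X I" using X I by (simp add: D.valid_def)
 then have e: "D.eb X I : hom_set Q X X (- len I)" by (simp add: D.eb_closed)
 have d: "Dif Q X X (- len I) (D.eb X I) : hom_set Q X X (- len I + 1)"
  by (rule D.difQ_closed[OF X X e refl])
 show "g X (- len I + j) (qc X X (- len I) j (D.eb X I) q) : R X (j - len I + n + 1)"
  by (rule chom_closed[OF g X]) (use X e q in simp_all)
 show "G n g r0 X (- len I + 1 + j) (qc X X (- len I + 1) j (Dif Q X X (- len I) (D.eb X I)) q) : R X (j - len I + n + 1)"
  by (rule chom_closed[OF G_chom[OF g r] X]) (use X d q in simp_all)
qed

lemma G_plus:
 assumes g: "chom (n + 1) g" "chom (n + 1) g'" and r: "r : R Y0 n" "r' : R Y0 n"
 shows "G n (g + g') (r + r') = G n g r + G n g' r'"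
proof (rule chom_eqI[where n = n and g = "g + g'"])
 have gg: "chom (n + 1) (g + g')" "r + r' : R Y0 n" using chom_plus g r by simp_all
 show "chom n (G n (g + g') (r + r'))" "epsf n (g + g') (G n (g + g') (r + r'))"
  by (rule G_chom[OF gg], rule G_epsf[OF gg])
 show "chom n (G n g r + G n g' r')" by (rule chom_plus[OF G_chom[OF g(1) r(1)] G_chom[OF g(2) r(2)]])
 show "G n (g + g') (r + r') Y0 0 (Id Q Y0) = (G n g r + G n g' r') Y0 0 (Id Q Y0)"
  by (simp add: fun_app G_one[OF gg] G_one[OF g(1) r(1)] G_one[OF g(2) r(2)])
 show "epsf n (g + g') (G n g r + G n g' r')"
  unfolding epsf_def
 proof (intro allI impI)
  fix X I j q assume a: "X : Ob C" "eps_index S X I" "q : hq X j"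
  note c = G_arg[OF g(1) r(1) a] G_arg[OF g(2) r(2) a]
  show "(G n g r + G n g' r') X (- len I + j) (qc X X (- len I) j (D.eb X I) q) =
   kap X (j - len I + n + 1) ((g + g') X (- len I + j) (qc X X (- len I) j (D.eb X I) q) +
   sg n ((G n g r + G n g' r') X (- len I + 1 + j) (qc X X (- len I + 1) j (Dif Q X X (- len I) (D.eb X I)) q)))"
   using c a eps_index_mem[OF a(2)] unfolding fun_app G_eps[OF g(1) r(1) a refl refl refl] G_eps[OF g(2) r(2) a refl refl refl]
   by (subst kap_add[symmetric]) (simp_all add: sg_add ac_simps)
 qed
qed

lemma G_sc:
 assumes g: "chom (n + 1) g" and r: "r : R Y0 n"
 shows "G n (%X j q. sc c (g X j q)) (sc c r) = (%X j q. sc c (G n g r X j q))"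
proof (rule chom_eqI[where n = n and g = "%X j q. sc c (g X j q)"])
 have gg: "chom (n + 1) (%X j q. sc c (g X j q))" "sc c r : R Y0 n" using chom_sc g r by simp_all
 show "chom n (G n (%X j q. sc c (g X j q)) (sc c r))" "epsf n (%X j q. sc c (g X j q)) (G n (%X j q. sc c (g X j q)) (sc c r))"
  by (rule G_chom[OF gg], rule G_epsf[OF gg])
 show "chom n (%X j q. sc c (G n g r X j q))" by (rule chom_sc[OF G_chom[OF g r]])
 show "G n (%X j q. sc c (g X j q)) (sc c r) Y0 0 (Id Q Y0) = sc c (G n g r Y0 0 (Id Q Y0))"
  by (simp add: G_one[OF gg] G_one[OF g r])
 show "epsf n (%X j q. sc c (g X j q)) (%X j q. sc c (G n g r X j q))"
  unfolding epsf_def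
 proof (intro allI impI)
  fix X I j q assume a: "X : Ob C" "eps_index S X I" "q : hq X j"
  note c = G_arg[OF g r a]
  show "sc c (G n g r X (- len I + j) (qc X X (- len I) j (D.eb X I) q)) =
   kap X (j - len I + n + 1) (sc c (g X (- len I + j) (qc X X (- len I) j (D.eb X I) q)) +
   sg n (sc c (G n g r X (- len I + 1 + j) (qc X X (- len I + 1) j (Dif Q X X (- len I) (D.eb X I)) q))))"
   using c a eps_index_mem[OF a(2)] unfolding G_eps[OF g r a refl refl refl]
   by (subst kap_scale[symmetric]) (simp_all add: V.scale_right_distrib sc_sg)
 qed
qed

text \<open>The differential of a graded map \<open>h\<close> of degree \<open>n\<close> is \<open>d h - (-1)^n h d\<close>.\<close>

definition dH where
 "dH n h = (%X j q. if X : Ob C & q : hq X j then dl X (j + n) (h X j q) - sg n (h X (j + 1) (Dif Q Y0 X j q)) else 0)"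

lemma dH_chom:
 assumes h: "chom n h" shows "chom (n + 1) (dH n h)"
proof (rule chomI)
 fix X j q assume a: "X : Ob C" "q : hq X j"
 have d: "Dif Q Y0 X j q : hq X (j + 1)" using a by simp
 show "dH n h X j q : R X (j + (n + 1))"
  using a d chom_closed[OF h a refl] chom_closed[OF h a(1) d, of "j + (n + 1)"] by (simp add: dH_def)
 show "dH n h X j (hscale Q Y0 X j c q) = sc c (dH n h X j q)" for c
  using a d chom_closed[OF h a refl] by (simp add: dH_def chom_scale[OF h] dl_scale sc_sg V.scale_right_diff_distrib)
 fix q' assume b: "q' : hq X j"
 show "dH n h X j (hadd Q Y0 X j q q') = dH n h X j q + dH n h X j q'"
  using a b d chom_closed[OF h a refl] chom_closed[OF h a(1) b refl] by (simp add: dH_def chom_add[OF h] dl_add sg_add)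
next
 fix X Y m j a q assume a: "X : Ob C" "Y : Ob C" "a : hom_set C X Y m" "q : hq X j"
 have d: "Dif Q Y0 X j q : hq X (j + 1)" using a by simp
 note hq = chom_closed[OF h a(1,4) refl] and hd = chom_closed[OF h a(1) d refl]
 have i: "D.inc X Y m a : hom_set Q X Y m" "D.inc X Y (m + 1) (Dif C X Y m a) : hom_set Q X Y (m + 1)" using a by (simp_all add: D.inc_closed)
 have "h Y (m + j + 1) (Dif Q Y0 Y (m + j) (qc X Y m j (D.inc X Y m a) q)) =
  h Y (m + j + 1) (qc X Y (m + 1) j (D.inc X Y (m + 1) (Dif C X Y m a)) q) +
   sg m (h Y (m + j + 1) (qc X Y m (j + 1) (D.inc X Y m a) (Dif Q Y0 X j q)))"
  using a i d by (simp add: D.Q.dif_cmp D.difQ_inc chom_add[OF h] chom_scale[OF h] sc_koszul)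
 also have "... = sg (n * (m + 1)) (act X Y (m + 1) (j + n) (Dif C X Y m a) (h X j q)) +
   sg m (sg (n * m) (act X Y m (j + 1 + n) a (h X (j + 1) (Dif Q Y0 X j q))))"
  using a i d by (simp add: chom_act[OF h])
 finally have 1: "h Y (m + j + 1) (Dif Q Y0 Y (m + j) (qc X Y m j (D.inc X Y m a) q)) = ..." .
 have 2: "dl Y (m + j + n) (h Y (m + j) (qc X Y m j (D.inc X Y m a) q)) = sg (n * m) (act X Y (m + 1) (j + n) (Dif C X Y m a) (h X j q)
   + sg m (act X Y m (j + n + 1) a (dl X (j + n) (h X j q))))"
  using a hq by (simp add: chom_act[OF h] dl_sg dl_act add.assoc)
 have 3: "act X Y m (j + (n + 1)) a (dl X (j + n) (h X j q) - sg n (h X (j + 1) (Dif Q Y0 X j q))) =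
   act X Y m (j + n + 1) a (dl X (j + n) (h X j q)) - sg n (act X Y m (j + 1 + n) a (h X (j + 1) (Dif Q Y0 X j q)))"
  using a hq hd act_diff[of X Y a m "dl X (j + n) (h X j q)" "j + n + 1" "sg n (h X (j + 1) (Dif Q Y0 X j q))"]
  by (simp add: act_sg ac_simps)
 show "dH n h Y (m + j) (qc X Y m j (D.inc X Y m a) q) = sg ((n + 1) * m) (act X Y m (j + (n + 1)) a (dH n h X j q))"
  using a i by (simp add: dH_def 1 2 3) (simp add: sg_def algebra_simps)
qed (auto simp: dH_def)

lemma kap_sg: "[|X : Ob C; X : \<Union>(set S); r : R X n|] ==> kap X n (sg m r) = sg m (kap X n r)"
 using kap_scale[of X r n "koszul m"] by (simp add: sc_koszul)

text \<open>The computation at \<open>\<epsilon> q\<close> in the next theorem, where \<open>a, b, u, v, w, y\<close> are the values of \<open>g\<close> at \<open>\<epsilon> q\<close>, of \<open>h\<close> at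
 \<open>d\<epsilon> q\<close>, of \<open>g\<close> at \<open>\<epsilon> dq\<close>, of \<open>h\<close> at \<open>d\<epsilon> dq\<close>, of \<open>h'\<close> at \<open>d\<epsilon> q\<close> and of \<open>g\<close> at \<open>d\<epsilon> q\<close>; the last hypothesis is the
 theorem at \<open>d\<epsilon> q\<close>.\<close>

lemma kap_step:
 assumes X: "X : Ob C" "X : \<Union>(set S)"
  and m: "a : R X K" "b : R X K" "u : R X (K + 1)" "v : R X (K + 1)" "w : R X (K + 1)" "y : R X (K + 1)"
  and b: "dl X K b = sg n (sg (l + 1) v) + y - w"
 shows "dl X (K - 1) (kap X K (a + sg n b)) = a + sg n b
  - kap X (K + 1) ((dl X K a - sg (n + 1) (y + sg l u)) + sg (n + 1) w) - sg (n + l + 1) (kap X (K + 1) (u + sg n v))"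
proof -
 let ?Z = "a + sg n b" and ?Z2 = "u + sg n v" and ?Z3 = "(dl X K a - sg (n + 1) (y + sg l u)) + sg (n + 1) w"
 have Z: "?Z : R X K" "?Z2 : R X (K + 1)" "?Z3 : R X (K + 1)" using X m by simp_all
 have "dl X K ?Z = ?Z3 + sg (n + l + 1) ?Z2"
  using X m by (simp add: dl_add dl_sg b) (auto simp: sg_def)
 then have "kap X (K + 1) (dl X K ?Z) = kap X (K + 1) ?Z3 + sg (n + l + 1) (kap X (K + 1) ?Z2)"
  using X Z by (simp only: kap_add R_sg kap_sg)
 then show ?thesis using kap_htpy[OF X Z(1), of "K - 1" "K + 1"] by (simp add: algebra_simps)
qed

text \<open>At the identity and under the action of \<open>C\<close> both sides agree because both are \<open>C\<close>-linear. At \<open>\<epsilon> q\<close> one uses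
 \<open>d \<kappa> = 1 - \<kappa> d\<close> and the identity at \<open>d\<epsilon> q\<close>; the terms with \<open>g(d\<epsilon> q)\<close> cancel.\<close>

theorem dH_G:
 assumes g: "chom (n + 1) g" and r0: "r0 : R Y0 n"
 shows "dH n (G n g r0) = g - G (n + 1) (dH (n + 1) g) (g Y0 0 (Id Q Y0) - dl Y0 n r0)"
proof (intro ext)
 let ?r = "g Y0 0 (Id Q Y0) - dl Y0 n r0"
 let ?h = "G n g r0"
 have r: "?r : R Y0 (n + 1)" using chom_closed[OF g Y0 Id_Q0, of "n + 1"] r0 by simp
 have g': "chom (n + 1 + 1) (dH (n + 1) g)" by (rule dH_chom[OF g])
 define h' where "h' = G (n + 1) (dH (n + 1) g) ?r"
 note h = G_chom[OF g r0] and h' = G_chom[OF g' r, folded h'_def]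
 fix X j q
 have "dH n ?h X j q = (g - h') X j q"
 proof (cases "X : Ob C & q : hq X j")
  case False
  then have o: "X ~: Ob C | q ~: hq X j" by blast
  have "dH n ?h X j q = 0" unfolding dH_def using o by auto
  then show ?thesis using chom_out[OF g o] chom_out[OF h' o] by (simp add: fun_app)
 next
  case True
  then have a: "X : Ob C" "q : hq X j" by simp_all
  note d = dH_chom[OF h]
  show ?thesis using a
  proof (induction rule: Q_left_induct')
   case one
   then show ?case by (simp add: fun_app dH_def Id_Q0 G_one[OF g r0] G_one[OF g' r, folded h'_def] chom_zero_arg[OF h])
  next
   case (inc X Y m j a q)
   then show ?case
    using chom_closed[OF g, of X q j] chom_closed[OF h', of X q j]
    by (simp add: fun_app chom_act[OF d] chom_act[OF g] chom_act[OF h'] act_diff sg_def)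
  next
   case (add X j q q')
   then show ?case by (simp add: fun_app chom_add[OF d] chom_add[OF g] chom_add[OF h'])
  next
   case (scale X j c q)
   then show ?case by (simp add: fun_app chom_scale[OF d] chom_scale[OF g] chom_scale[OF h'] V.scale_right_diff_distrib)
  next
   case (eps X I j q)
   define l where "l = len I"
   define e where "e = D.eb X I"
   define de where "de = Dif Q X X (- l) e"
   define dq where "dq = Dif Q Y0 X j q"
   define K where "K = j - l + n + 1"
   have X: "X : Ob C" and I: "eps_index S X I" and q: "q : hq X j" using eps by simp_all
   note U = eps_index_mem[OF I]
   have "D.valid X I" using X I by (simp add: D.valid_def)
   then have e: "e : hom_set Q X X (- l)" by (simp add: D.eb_closed e_def l_def)
   have de: "de : hom_set Q X X (- l + 1)" unfolding de_def by (rule D.difQ_closed[OF X X e refl])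
   have dq: "dq : hq X (j + 1)" using X q by (simp add: dq_def)
   let ?eq = "qc X X (- l) j e q" and ?deq = "qc X X (- l + 1) j de q"
   let ?edq = "qc X X (- l) (j + 1) e dq" and ?dedq = "qc X X (- l + 1) (j + 1) de dq"
   have c: "?eq : hq X (- l + j)" "?deq : hq X (- l + 1 + j)" "?edq : hq X (- l + j + 1)" "?dedq : hq X (- l + 1 + j + 1)"
    using X e de q dq by simp_all
   have F1: "Dif Q Y0 X (- l + j) ?eq = hadd Q Y0 X (- l + j + 1) ?deq (hscale Q Y0 X (- l + j + 1) (koszul (- l)) ?edq)"
    unfolding de_def dq_def by (rule D.Q.dif_cmp) (use X e q in simp_all)
   have F2: "Dif Q Y0 X (- l + 1 + j) ?deq = hscale Q Y0 X (- l + 1 + j + 1) (koszul (- l + 1)) ?dedq"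
   proof (rule D.Q.hv_inj[of Y0 X "- l + 1 + j + 1"])
    have "Dif Q X X (- l + 1) de = hzero Q X X (- l + 1 + 1)"
     unfolding de_def by (rule D.Q.dif_dif) (use X e in simp_all)
    moreover have "- l + 1 + 1 + j = - l + 1 + j + 1" by simp
    moreover have "qc X X (- l + 1 + 1) j (hzero Q X X (- l + 1 + 1)) q = hzero Q Y0 X (- l + 1 + 1 + j)"
     by (rule D.Q.cmp_zero_left) (use X q in simp_all)
    ultimately have "qc X X (- l + 1 + 1) j (Dif Q X X (- l + 1) de) q = hzero Q Y0 X (- l + 1 + j + 1)"
     by (simp only:)
    moreover have "Dif Q Y0 X (- l + 1 + j) ?deq = hadd Q Y0 X (- l + 1 + j + 1) (qc X X (- l + 1 + 1) j (Dif Q X X (- l + 1) de) q)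
      (hscale Q Y0 X (- l + 1 + j + 1) (koszul (- l + 1)) ?dedq)"
     unfolding dq_def by (rule D.Q.dif_cmp) (use X de q in simp_all)
    ultimately have F: "Dif Q Y0 X (- l + 1 + j) ?deq = hadd Q Y0 X (- l + 1 + j + 1) (hzero Q Y0 X (- l + 1 + j + 1))
      (hscale Q Y0 X (- l + 1 + j + 1) (koszul (- l + 1)) ?dedq)" by (simp only:)
    have "hscale Q Y0 X (- l + 1 + j + 1) (koszul (- l + 1)) ?dedq : hq X (- l + 1 + j + 1)" using X c by simp
    then show "hv Q Y0 X (- l + 1 + j + 1) (Dif Q Y0 X (- l + 1 + j) ?deq) =
     hv Q Y0 X (- l + 1 + j + 1) (hscale Q Y0 X (- l + 1 + j + 1) (koszul (- l + 1)) ?dedq)"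
     unfolding F using X by (subst D.Q.hv_add) simp_all
   qed (use X c in simp_all)
   have D: "f X (- l + j + 1) (Dif Q Y0 X (- l + j) ?eq) = f X (- l + 1 + j) ?deq + sg l (f X (- l + j + 1) ?edq)"
    "f X (- l + 1 + j + 1) (Dif Q Y0 X (- l + 1 + j) ?deq) = sg (l + 1) (f X (- l + 1 + j + 1) ?dedq)" if "chom m f" for f m
   proof -
    define p where "p = - l + j + 1"
    have p: "- l + j + 1 = p" "- l + 1 + j = p" by (simp_all add: p_def)
    have k: "koszul (- l) = (koszul l :: 'k)" by (simp add: koszul_def)
    show "f X (- l + j + 1) (Dif Q Y0 X (- l + j) ?eq) = f X (- l + 1 + j) ?deq + sg l (f X (- l + j + 1) ?edq)"
     unfolding F1 k unfolding p using X c[unfolded p] by (simp add: chom_add[OF that] chom_scale[OF that] sc_koszul)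
    show "f X (- l + 1 + j + 1) (Dif Q Y0 X (- l + 1 + j) ?deq) = sg (l + 1) (f X (- l + 1 + j + 1) ?dedq)"
     unfolding F2 unfolding p using X c[unfolded p] by (simp add: chom_scale[OF that] sc_koszul sg_def)
   qed
   have P1: "dl X K (?h X (- l + 1 + j) ?deq) = sg n (sg (l + 1) (?h X (- l + 1 + j + 1) ?dedq)) + g X (- l + 1 + j) ?deq - h' X (- l + 1 + j) ?deq"
    using eps(5) X c D(2)[OF h] unfolding l_def[symmetric] e_def[symmetric] de_def[symmetric]
    by (simp add: dH_def fun_app K_def algebra_simps)
   let ?Z = "g X (- l + j) ?eq + sg n (?h X (- l + 1 + j) ?deq)"
   let ?Z2 = "g X (- l + j + 1) ?edq + sg n (?h X (- l + 1 + j + 1) ?dedq)"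
   let ?Z3 = "dH (n + 1) g X (- l + j) ?eq + sg (n + 1) (h' X (- l + 1 + j) ?deq)"
   have G1: "?h X (- l + j) ?eq = kap X K ?Z"
    using G_eps[OF g r0 X I q, of "- l + j" K "- l + 1 + j"] unfolding l_def e_def de_def K_def by simp
   have G2: "?h X (- l + j + 1) ?edq = kap X (K + 1) ?Z2"
    using G_eps[OF g r0 X I dq, of "- l + j + 1" "K + 1" "- l + 1 + j + 1"] unfolding l_def e_def de_def K_def by simp
   have G3: "h' X (- l + j) ?eq = kap X (K + 1) ?Z3"
    using G_eps[OF g' r X I q, folded h'_def, of "- l + j" "K + 1" "- l + 1 + j"] unfolding l_def e_def de_def K_def by simp
   have m: "g X (- l + j) ?eq : R X K" "?h X (- l + 1 + j) ?deq : R X K" "g X (- l + j + 1) ?edq : R X (K + 1)"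
    "?h X (- l + 1 + j + 1) ?dedq : R X (K + 1)" "h' X (- l + 1 + j) ?deq : R X (K + 1)" "dH (n + 1) g X (- l + j) ?eq : R X (K + 1)"
    "g X (- l + 1 + j) ?deq : R X (K + 1)"
    by (rule chom_closed[OF g X c(1)] chom_closed[OF h X c(2)] chom_closed[OF g X c(3)] chom_closed[OF h X c(4)]
     chom_closed[OF h' X c(2)] chom_closed[OF g' X c(1)] chom_closed[OF g X c(2)]; simp add: K_def)+
   have "dH (n + 1) g X (- l + j) ?eq = dl X K (g X (- l + j) ?eq) - sg (n + 1) (g X (- l + 1 + j) ?deq + sg l (g X (- l + j + 1) ?edq))"
    using X c D(1)[OF g] by (simp add: dH_def K_def algebra_simps)
   then have "dl X (K - 1) (?h X (- l + j) ?eq) = ?Z - h' X (- l + j) ?eq - sg (n + l + 1) (?h X (- l + j + 1) ?edq)"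
    using kap_step[OF X U m(1,2,3,4,5,7) P1] unfolding G1 G2 G3 by (simp only:)
   moreover have "- l + j + n = K - 1" by (simp add: K_def)
   ultimately have "dl X (- l + j + n) (?h X (- l + j) ?eq) - sg n (?h X (- l + j + 1) (Dif Q Y0 X (- l + j) ?eq)) = g X (- l + j) ?eq - h' X (- l + j) ?eq"
    unfolding D(1)[OF h] by (simp only: sg_add) (simp add: sg_def)
   then show ?case using X c unfolding l_def[symmetric] e_def[symmetric] by (simp add: dH_def fun_app)
  qed
 qed
 then show "dH n ?h X j q = (g - G (n + 1) (dH (n + 1) g) ?r) X j q" by (simp add: h'_def)
qed

end

section \<open>Modules over a tensor product\<close>

context tens
begin

lemma cmp_pt_left:
 "[|X : Ob C; X' : Ob C; X'' : Ob C; Y : Ob D; a' : hom_set C X' X'' m; a : hom_set C X X' n|] ==>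
  Cmp T (Pair X Y) (Pair X' Y) (Pair X'' Y) m n (pt (Pair X' Y) (Pair X'' Y) m a' 0 (Id D Y)) (pt (Pair X Y) (Pair X' Y) n a 0 (Id D Y))
  = pt (Pair X Y) (Pair X'' Y) (m + n) (Cmp C X X' X'' m n a' a) 0 (Id D Y)"
 by (subst cmp_pt) (simp_all add: koszul_def kmod.smult_one[OF kmod_T])

lemma cmp_pt_right:
 "[|X : Ob C; Y : Ob D; Y' : Ob D; Y'' : Ob D; b' : hom_set D Y' Y'' m; b : hom_set D Y Y' n|] ==>
  Cmp T (Pair X Y) (Pair X Y') (Pair X Y'') m n (pt (Pair X Y') (Pair X Y'') 0 (Id C X) m b') (pt (Pair X Y) (Pair X Y') 0 (Id C X) n b)
  = pt (Pair X Y) (Pair X Y'') 0 (Id C X) (m + n) (Cmp D Y Y' Y'' m n b' b)"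
 by (subst cmp_pt) (simp_all add: koszul_def kmod.smult_one[OF kmod_T])

lemma cmp_pt_comm:
 assumes "X : Ob C" "X' : Ob C" "Y : Ob D" "Y' : Ob D" "a : hom_set C X X' m" "b : hom_set D Y Y' n"
 shows "Cmp T (Pair X Y) (Pair X' Y) (Pair X' Y') n m (pt (Pair X' Y) (Pair X' Y') 0 (Id C X') n b) (pt (Pair X Y) (Pair X' Y) m a 0 (Id D Y))
  = hscale T (Pair X Y) (Pair X' Y') (n + m) (koszul (n * m)) (pt (Pair X Y) (Pair X' Y') m a n b)"
  and "Cmp T (Pair X Y) (Pair X Y') (Pair X' Y') m n (pt (Pair X Y') (Pair X' Y') m a 0 (Id D Y')) (pt (Pair X Y) (Pair X Y') 0 (Id C X) n b)
  = pt (Pair X Y) (Pair X' Y') m a n b"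
 using assms by (subst cmp_pt; simp_all add: koszul_def kmod.smult_one[OF kmod_T])+

lemma dif_pt_left: "[|X : Ob C; X' : Ob C; Y : Ob D; a : hom_set C X X' m|] ==>
  Dif T (Pair X Y) (Pair X' Y) m (pt (Pair X Y) (Pair X' Y) m a 0 (Id D Y)) = pt (Pair X Y) (Pair X' Y) (m + 1) (Dif C X X' m a) 0 (Id D Y)"
 by (rule T.hv_inj[of "Pair X Y" "Pair X' Y" "m + 1"])
  (simp_all add: dif_pt hv_pt_zero[of "Pair X Y" "Pair X' Y", simplified])

lemma dif_pt_right: "[|X : Ob C; Y : Ob D; Y' : Ob D; b : hom_set D Y Y' m|] ==>
  Dif T (Pair X Y) (Pair X Y') m (pt (Pair X Y) (Pair X Y') 0 (Id C X) m b) = pt (Pair X Y) (Pair X Y') 0 (Id C X) (m + 1) (Dif D Y Y' m b)"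
 by (rule T.hv_inj[of "Pair X Y" "Pair X Y'" "m + 1"]) (simp_all add: dif_pt koszul_def kmod.smult_one[OF kmod_T] hv_pt_zero[of "Pair X Y" "Pair X Y'", simplified])

end

text \<open>A module over \<open>C \<otimes> D\<close> contractible over all \<open>X \<otimes> Y\<close> with \<open>X\<close> in some \<open>Ci\<close> or \<open>Y\<close> in some \<open>Dj\<close>. For fixed
 \<open>X\<close> it is a contractible \<open>D\<close>-module.\<close>

locale bictr = dripair C S D T + K: ctr "tensor_dg C D" "tS (C, S) (D, T)" sc R act dl V0 kap
 for C :: "('a, 'k::field) dg" and S and D :: "('a, 'k) dg" and T and sc :: "'k => 'r::ab_group_add => 'r" and R act dl V0 kap
begin

abbreviation "x0 == pfst V0"
abbreviation "y0 == psnd V0"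

lemma base [simp]: "x0 : Ob C" "y0 : Ob D"
 using K.Y0 by simp_all

abbreviation "aC X X' Y m n a r == act (Pair X Y) (Pair X' Y) m n (A.pt (Pair X Y) (Pair X' Y) m a 0 (Id D Y)) r"
abbreviation "RX X == %Y n. R (Pair X Y) n"
abbreviation "aX X == %Y Y' m n b r. act (Pair X Y) (Pair X Y') m n (A.pt (Pair X Y) (Pair X Y') 0 (Id C X) m b) r"
abbreviation "dX X == %Y. dl (Pair X Y)"
abbreviation "kX X == %Y. kap (Pair X Y)"

lemma aC_aD:
 assumes "X : Ob C" "X' : Ob C" "Y : Ob D" "Y' : Ob D" "a : hom_set C X X' m" "b : hom_set D Y Y' l" "r : R (Pair X Y) n" "k = l + n" "k' = m + n"
 shows "aC X X' Y' m k a (aX X Y Y' l n b r) = sg (m * l) (aX X' Y Y' l k' b (aC X X' Y m n a r))"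
proof -
 let ?p = "A.pt (Pair X Y) (Pair X' Y') m a l b"
 have p: "?p : hom_set A.T (Pair X Y) (Pair X' Y') (l + m)" using assms by simp
 have 1: "aC X X' Y' m k a (aX X Y Y' l n b r) = act (Pair X Y) (Pair X' Y') (l + m) n ?p r"
  using assms by (simp add: K.act_cmp[symmetric, where k = "l + m"] A.cmp_pt_comm)
 have "aX X' Y Y' l k' b (aC X X' Y m n a r) = act (Pair X Y) (Pair X' Y') (l + m) n (hscale A.T (Pair X Y) (Pair X' Y') (l + m) (koszul (l * m)) ?p) r"
  using assms by (simp add: K.act_cmp[symmetric, where k = "l + m"] A.cmp_pt_comm)
 also have "... = sg (l * m) (act (Pair X Y) (Pair X' Y') (l + m) n ?p r)"
  using assms p by (simp add: K.act_scale_left K.sc_koszul)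
 finally show ?thesis using 1 by (simp add: sg_def)
qed

lemma ST_mem: "[|X : \<Union>(set S); Y : Ob D|] ==> Pair X Y : \<Union>(set ST)"
 "[|X : Ob C; Y : \<Union>(set T)|] ==> Pair X Y : \<Union>(set ST)"
 by (auto simp: tS_def)

lemma ctrD: "X : Ob C ==> ctr D T sc (RX X) (aX X) (dX X) y0 (kX X)"
proof -
 assume X: "X : Ob C"
 note pc = A.pt_closed
 show ?thesis
 proof (unfold_locales, goal_cases)
  case (4 Y Y' a m r n k) then show ?case using X by simp
 next
  case (5 Y Y' a m b r n) then show ?case using X A.pt_add_right[of "Pair X Y" "Pair X Y'", simplified] by (simp add: K.act_add_left)
 next
  case (6 Y Y' a m r n c) then show ?case using X A.pt_scale_right[of "Pair X Y" "Pair X Y'", simplified] by (simp add: K.act_scale_left)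
 next
  case (9 Y r n) then show ?case using X A.Id_T[of "Pair X Y"] K.act_id[of "Pair X Y" r n] by simp
 qed (use X ST_mem in "simp_all add: K.act_add K.act_scale K.dl_add K.dl_scale K.dl_act A.dif_pt_right K.kap_add K.kap_scale K.kap_htpy A.cmp_pt_right[symmetric] K.act_cmp")
qed

abbreviation "hchom X == ctr.chom D T sc (RX X) (aX X) y0"
abbreviation "hdH X == ctr.dH D T (dX X) y0"
abbreviation "hG X == ctr.G D T sc (aX X) y0 (kX X)"
abbreviation "hD Y j == hom_set R.Q y0 Y j"

definition "scH c F = (%Y j q. sc c (F Y j q))"
definition "RH X n = {F. hchom X n F}"
definition "actH X X' m n a F = (%Y j q. if Y : Ob D & q : hD Y j then aC X X' Y m (j + n) a (F Y j q) else 0)"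
definition "dlH X n F = hdH X n F"
text \<open>This contracts the complex of \<open>D\<close>-linear maps by \<open>ctr.dH_G\<close> alone, and so it works where \<open>R(X, y0)\<close> is contractible,
 although the contraction of \<open>R(X, -)\<close> is not \<open>D\<close>-linear.\<close>

definition "kapH X n F = hG X (n - 1) F (kap (Pair X y0) n (F y0 0 (Id R.Q y0)))"

lemma actH_chom:
 assumes X: "X : Ob C" "X' : Ob C" and a: "a : hom_set C X X' m" and F: "hchom X n F" and k: "k = m + n"
 shows "hchom X' k (actH X X' m n a F)"
proof -
 interpret d: ctr D T sc "RX X" "aX X" "dX X" y0 "kX X" by (rule ctrD[OF X(1)])
 interpret e: ctr D T sc "RX X'" "aX X'" "dX X'" y0 "kX X'" by (rule ctrD[OF X(2)])
 note c = d.chom_closed[OF F _ _ refl]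
 show ?thesis
 proof (rule e.chomI)
  fix Y j q assume y: "Y : Ob D" "q : hD Y j"
  show "actH X X' m n a F Y j q : R (Pair X' Y) (j + k)" using X a y c[OF y] k by (simp add: actH_def)
  show "actH X X' m n a F Y j (hscale R.Q y0 Y j s q) = sc s (actH X X' m n a F Y j q)" for s
   using X a y c[OF y] by (simp add: actH_def d.chom_scale[OF F] K.act_scale)
  fix q' assume y': "q' : hD Y j"
  show "actH X X' m n a F Y j (hadd R.Q y0 Y j q q') = actH X X' m n a F Y j q + actH X X' m n a F Y j q'"
   using X a y y' c[OF y] c[OF y(1) y'] by (simp add: actH_def d.chom_add[OF F] K.act_add)
 next
  fix Y Y' l j b q assume y: "Y : Ob D" "Y' : Ob D" "b : hom_set D Y Y' l" "q : hD Y j"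
  have i: "R.inc Y Y' l b : hom_set R.Q Y Y' l" using y by (simp add: R.inc_closed)
  have r: "aX X Y Y' l (j + n) b (F Y j q) : R (Pair X Y') (l + j + n)" "F Y j q : R (Pair X Y) (j + n)" using X y c[OF y(1,4)] by simp_all
  have "actH X X' m n a F Y' (l + j) (Cmp R.Q y0 Y Y' l j (R.inc Y Y' l b) q) = aC X X' Y' m (l + j + n) a (sg (n * l) (aX X Y Y' l (j + n) b (F Y j q)))"
   using X y i by (simp add: actH_def d.chom_act[OF F])
  also have "... = sg (n * l) (sg (m * l) (aX X' Y Y' l (m + (j + n)) b (aC X X' Y m (j + n) a (F Y j q))))"
   using X y a r by (simp add: K.act_sg aC_aD add.assoc)
  also have "... = sg (k * l) (aX X' Y Y' l (j + k) b (actH X X' m n a F Y j q))"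
   using y k by (simp add: actH_def algebra_simps sg_def)
  finally show "actH X X' m n a F Y' (l + j) (Cmp R.Q y0 Y Y' l j (R.inc Y Y' l b) q) = ..." .
 qed (auto simp: actH_def)
qed

lemma kapH_chom:
 assumes X: "X : Ob C" "X : \<Union>(set S)" and F: "hchom X n F" and k: "k = n - 1"
 shows "hchom X k (kapH X n F)" "kap (Pair X y0) n (F y0 0 (Id R.Q y0)) : R (Pair X y0) k" "F y0 0 (Id R.Q y0) : R (Pair X y0) n"
proof -
 interpret d: ctr D T sc "RX X" "aX X" "dX X" y0 "kX X" by (rule ctrD[OF X(1)])
 show 1: "F y0 0 (Id R.Q y0) : R (Pair X y0) n" by (rule d.chom_closed[OF F base(2) d.Id_Q0]) simp
 then show 2: "kap (Pair X y0) n (F y0 0 (Id R.Q y0)) : R (Pair X y0) k" using X ST_mem(1)[OF X(2) base(2)] k by simp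
 show "hchom X k (kapH X n F)" unfolding kapH_def k by (rule d.G_chom) (use F 2 k in simp_all)
qed

lemma kapH_htpy:
 assumes X: "X : Ob C" "X : \<Union>(set S)" and F: "hchom X n F"
 shows "dlH X (n - 1) (kapH X n F) + kapH X (n + 1) (dlH X n F) = F"
proof -
 interpret d: ctr D T sc "RX X" "aX X" "dX X" y0 "kX X" by (rule ctrD[OF X(1)])
 let ?f = "F y0 0 (Id R.Q y0)"
 note U = ST_mem(1)[OF X(2) base(2)]
 note kc = kapH_chom[OF X F refl]
 have F': "hchom X (n - 1 + 1) F" using F by simp
 have 1: "dlH X (n - 1) (kapH X n F) = F - hG X n (hdH X n F) (?f - dl (Pair X y0) (n - 1) (kap (Pair X y0) n ?f))"
  unfolding dlH_def kapH_def using d.dH_G[OF F' kc(2)] by simp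
 have "dlH X n F y0 0 (Id R.Q y0) = dl (Pair X y0) n ?f"
  unfolding dlH_def d.dH_def using d.Id_Q0 d.chom_zero_arg[OF F base(2)] by simp
 then have "kapH X (n + 1) (dlH X n F) = hG X n (hdH X n F) (kap (Pair X y0) (n + 1) (dl (Pair X y0) n ?f))"
  by (simp add: kapH_def dlH_def)
 moreover have "?f - dl (Pair X y0) (n - 1) (kap (Pair X y0) n ?f) = kap (Pair X y0) (n + 1) (dl (Pair X y0) n ?f)"
  using K.kap_htpy[of "Pair X y0" ?f n "n - 1" "n + 1"] X U kc(3) by (simp add: algebra_simps)
 ultimately show ?thesis using 1 by simp
qed

lemma RH_I [simp]: "F : RH X n \<longleftrightarrow> hchom X n F"
 by (simp add: RH_def)

lemma dlH_actH:
 assumes X: "X : Ob C" "X' : Ob C" and a: "a : hom_set C X X' m" and F: "hchom X n F"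
 shows "dlH X' (m + n) (actH X X' m n a F) = actH X X' (m + 1) n (Dif C X X' m a) F + sg m (actH X X' m (n + 1) a (dlH X n F))"
proof (intro ext)
 interpret d: ctr D T sc "RX X" "aX X" "dX X" y0 "kX X" by (rule ctrD[OF X(1)])
 interpret e: ctr D T sc "RX X'" "aX X'" "dX X'" y0 "kX X'" by (rule ctrD[OF X(2)])
 note F' = d.dH_chom[OF F]
 fix Y j q
 show "dlH X' (m + n) (actH X X' m n a F) Y j q = (actH X X' (m + 1) n (Dif C X X' m a) F + sg m (actH X X' m (n + 1) a (dlH X n F))) Y j q"
 proof (cases "Y : Ob D & q : hD Y j")
  case False
  have o: "sg m f Y j q = sg m (f Y j q)" for f :: "('a, 'k) univ => int => ('a, 'k) univ => 'r" by (simp add: sg_def fun_app)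
  show ?thesis unfolding dlH_def d.dH_def e.dH_def fun_app o actH_def if_not_P[OF False] by (simp add: sg_def)
 next
  case True
  then have y: "Y : Ob D" "q : hD Y j" by simp_all
  have o: "sg m f Y j q = sg m (f Y j q)" for f :: "('a, 'k) univ => int => ('a, 'k) univ => 'r" by (simp add: sg_def fun_app)
  have dq: "Dif R.Q y0 Y j q : hD Y (j + 1)" using y by simp
  note c = d.chom_closed[OF F y refl] d.chom_closed[OF F y(1) dq refl]
  have 1: "dl (Pair X' Y) (j + (m + n)) (aC X X' Y m (j + n) a (F Y j q)) =
   aC X X' Y (m + 1) (j + n) (Dif C X X' m a) (F Y j q) + sg m (aC X X' Y m (j + n + 1) a (dl (Pair X Y) (j + n) (F Y j q)))"
   using X a y c by (simp add: K.dl_act A.dif_pt_left)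
  have 2: "aC X X' Y m (j + (n + 1)) a (dl (Pair X Y) (j + n) (F Y j q) - sg n (F Y (j + 1) (Dif R.Q y0 Y j q)))
    = aC X X' Y m (j + n + 1) a (dl (Pair X Y) (j + n) (F Y j q)) - sg n (aC X X' Y m (j + 1 + n) a (F Y (j + 1) (Dif R.Q y0 Y j q)))"
   using X a y c K.act_diff[of "Pair X Y" "Pair X' Y" "A.pt (Pair X Y) (Pair X' Y) m a 0 (Id D Y)" m "dl (Pair X Y) (j + n) (F Y j q)" "j + n + 1" "sg n (F Y (j + 1) (Dif R.Q y0 Y j q))"]
   by (simp add: K.act_sg ac_simps)
  show ?thesis unfolding dlH_def d.dH_def e.dH_def fun_app o actH_def
   using y dq by (simp add: 1 2)
 qed
qed

lemma dlH_add: 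
 assumes X: "X : Ob C" and F: "hchom X n F" "hchom X n G"
 shows "dlH X n (F + G) = dlH X n F + dlH X n G" "dlH X n (scH c F) = scH c (dlH X n F)"
proof -
 interpret d: ctr D T sc "RX X" "aX X" "dX X" y0 "kX X" by (rule ctrD[OF X])
 show "dlH X n (F + G) = dlH X n F + dlH X n G"
  unfolding dlH_def d.dH_def
  by (intro ext) (simp add: fun_app K.dl_add X d.chom_closed[OF F(1)] d.chom_closed[OF F(2)] K.sg_add)
 show "dlH X n (scH c F) = scH c (dlH X n F)"
  unfolding dlH_def d.dH_def scH_def
  by (intro ext) (simp add: fun_app K.dl_scale X d.chom_closed[OF F(1)] K.sc_sg K.V.scale_right_diff_distrib)
qed

lemma kapH_add:
 assumes X: "X : Ob C" "X : \<Union>(set S)" and F: "hchom X n F" "hchom X n G"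
 shows "kapH X n (F + G) = kapH X n F + kapH X n G" "kapH X n (scH c F) = scH c (kapH X n F)"
proof -
 interpret d: ctr D T sc "RX X" "aX X" "dX X" y0 "kX X" by (rule ctrD[OF X(1)])
 note U = ST_mem(1)[OF X(2) base(2)] and k1 = kapH_chom[OF X F(1) refl] and k2 = kapH_chom[OF X F(2) refl]
 have F': "hchom X (n - 1 + 1) F" "hchom X (n - 1 + 1) G" using F by simp_all
 have "kap (Pair X y0) n ((F + G) y0 0 (Id R.Q y0)) = kap (Pair X y0) n (F y0 0 (Id R.Q y0)) + kap (Pair X y0) n (G y0 0 (Id R.Q y0))"
  using X U k1 k2 by (simp add: fun_app K.kap_add)
 then show "kapH X n (F + G) = kapH X n F + kapH X n G"
  unfolding kapH_def using d.G_plus[OF F' k1(2) k2(2)] by simp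
 have "kap (Pair X y0) n (scH c F y0 0 (Id R.Q y0)) = sc c (kap (Pair X y0) n (F y0 0 (Id R.Q y0)))"
  using X U k1 by (simp add: scH_def K.kap_scale)
 then show "kapH X n (scH c F) = scH c (kapH X n F)"
  unfolding kapH_def using d.G_sc[OF F'(1) k1(2), of c] by (simp add: scH_def)
qed

sublocale H: ctr C S scH RH actH dlH x0 kapH
proof (unfold_locales, goal_cases)
 case (1 a x y) then show ?case by (simp add: scH_def fun_eq_iff fun_app K.V.scale_right_distrib)
next
 case (2 a b x) then show ?case by (simp add: scH_def fun_eq_iff fun_app K.V.scale_left_distrib)
next
 case (3 a b x) then show ?case by (simp add: scH_def)
next
 case (4 x) then show ?case by (simp add: scH_def)
next
 case (5 X n)
 interpret d: ctr D T sc "RX X" "aX X" "dX X" y0 "kX X" by (rule ctrD[OF 5])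
 show ?case unfolding RH_I by (rule d.chomI) (use 5 in "simp_all add: fun_app")
next
 case (6 X r n s)
 interpret d: ctr D T sc "RX X" "aX X" "dX X" y0 "kX X" by (rule ctrD[OF 6(1)])
 show ?case using 6 d.chom_plus by simp
next
 case (7 X r n c)
 interpret d: ctr D T sc "RX X" "aX X" "dX X" y0 "kX X" by (rule ctrD[OF 7(1)])
 show ?case using 7 d.chom_sc[of n r c] by (simp add: scH_def)
next
 case (8 X Y a m r n k) then show ?case using actH_chom by simp
next
 case (9 X X' a m b F n)
 interpret d: ctr D T sc "RX X" "aX X" "dX X" y0 "kX X" by (rule ctrD[OF 9(1)])
 note c = d.chom_closed[OF 9(5)[unfolded RH_I] _ _ refl]
 show ?case
  using 9 c by (intro ext) (simp add: actH_def fun_app A.pt_add_left[of "Pair X _" "Pair X' _", simplified] K.act_add_left)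
next
 case (10 X X' a m F n c)
 interpret d: ctr D T sc "RX X" "aX X" "dX X" y0 "kX X" by (rule ctrD[OF 10(1)])
 note c = d.chom_closed[OF 10(4)[unfolded RH_I] _ _ refl]
 show ?case
  using 10 c by (intro ext) (simp add: actH_def scH_def A.pt_scale_left[of "Pair X _" "Pair X' _", simplified] K.act_scale_left)
next
 case (11 X X' a m F n G)
 interpret d: ctr D T sc "RX X" "aX X" "dX X" y0 "kX X" by (rule ctrD[OF 11(1)])
 note c = d.chom_closed[OF 11(4)[unfolded RH_I] _ _ refl] d.chom_closed[OF 11(5)[unfolded RH_I] _ _ refl]
 show ?case using 11 c by (intro ext) (simp add: actH_def fun_app K.act_add)
next
 case (12 X X' a m F n c)
 interpret d: ctr D T sc "RX X" "aX X" "dX X" y0 "kX X" by (rule ctrD[OF 12(1)])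
 note c = d.chom_closed[OF 12(4)[unfolded RH_I] _ _ refl]
 show ?case using 12 c by (intro ext) (simp add: actH_def scH_def K.act_scale)
next
 case (13 X F n)
 interpret d: ctr D T sc "RX X" "aX X" "dX X" y0 "kX X" by (rule ctrD[OF 13(1)])
 note c = d.chom_closed[OF 13(2)[unfolded RH_I] _ _ refl] and o = d.chom_out[OF 13(2)[unfolded RH_I]]
 have "act (Pair X Y) (Pair X Y) 0 k (A.pt (Pair X Y) (Pair X Y) 0 (Id C X) 0 (Id D Y)) r = r" if "Y : Ob D" "r : R (Pair X Y) k" for Y k r
  using A.Id_T[of "Pair X Y"] K.act_id[of "Pair X Y" r k] 13 that by simp
 then show ?case using c o by (intro ext) (auto simp: actH_def)
next
 case (14 X X' X'' b l a m F n k k')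
 interpret d: ctr D T sc "RX X" "aX X" "dX X" y0 "kX X" by (rule ctrD[OF 14(1)])
 note c = d.chom_closed[OF 14(6)[unfolded RH_I] _ _ refl]
 show ?case using 14 c by (intro ext) (simp add: actH_def A.cmp_pt_left[symmetric] K.act_cmp ac_simps)
next
 case (15 X F n k)
 interpret d: ctr D T sc "RX X" "aX X" "dX X" y0 "kX X" by (rule ctrD[OF 15(1)])
 show ?case using d.dH_chom[of n F] 15 by (simp add: dlH_def)
next
 case (16 X F n G) then show ?case using dlH_add(1)[of X n F G] by simp
next
 case (17 X F n c) then show ?case using dlH_add(2)[of X n F F c] by simp
next
 case (18 X Y a m r n k m' n') then show ?case using dlH_actH by simp
next
 case 19 show ?case by simp
next
 case (20 X F n k) then show ?case using kapH_chom(1) by simp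
next
 case (21 X F n G) then show ?case using kapH_add(1) by simp
next
 case (22 X F n c) then show ?case using kapH_add(2)[of X n F F c] by simp
next
 case (23 X F n k k') then show ?case using kapH_htpy by simp
qed

end

section \<open>Representable modules\<close>

lemma sg_cancel: "r = r - sg (p + z) s - sg z t + sg z (t + sg p s)"
 by (simp add: sg_def)

lemma linear_mapD:
 assumes "linear_map M N h" "a : carrier M"
 shows "h a : carrier N" "b : carrier M ==> h (a \<oplus>\<^bsub>M\<^esub> b) = h a \<oplus>\<^bsub>N\<^esub> h b" "h (s \<odot>\<^bsub>M\<^esub> a) = s \<odot>\<^bsub>N\<^esub> h a"
 using assms by (simp_all add: linear_map_def)

context ctr
begin

lemma zero_chom: "chom n 0"
 by (rule chomI) (simp_all add: fun_app)

lemma G_zero: "G n 0 0 = 0"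
proof -
 have z: "(%X j q. 0) = (0 :: ('a, 'k) univ => int => ('a, 'k) univ => 'r)" by (simp add: fun_eq_iff fun_app)
 show ?thesis using G_sc[OF zero_chom, of 0 n 0] by (simp add: fun_app z)
qed

end

context bictr
begin

lemma act_pt:
 assumes "X : Ob C" "X' : Ob C" "Y : Ob D" "Y' : Ob D" "a : hom_set C X X' m" "b : hom_set D Y Y' l" "r : R (Pair X Y) n" "k = l + n" "k' = m + l"
 shows "aC X X' Y' m k a (aX X Y Y' l n b r) = act (Pair X Y) (Pair X' Y') k' n (A.pt (Pair X Y) (Pair X' Y') m a l b) r"
 using assms by (simp add: K.act_cmp[symmetric, where k = "m + l"] A.cmp_pt_comm)

end

text \<open>The module \<open>E'(V0, -)\<close> over \<open>C \<otimes> D\<close>, contracted by composition with elements \<open>c\<close> such that \<open>d c = 1\<close>. Its elements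
 are kept in double duals.\<close>

locale repr = dripair C S D T + Fn: dgfunctor "tensor_dg C D" E' Fn
 for C :: "('a, 'k::field) dg" and S and D :: "('a, 'k) dg" and T and E' Fn +
 fixes V0 :: "('a, 'k) univ" and c :: "('a, 'k) univ => ('a, 'k) univ"
 assumes Fob [simp]: "!!V. V : Ob (tensor_dg C D) ==> fob Fn V = V"
  and V0 [simp]: "V0 : Ob (tensor_dg C D)"
  and c_closed: "!!W. W : Ob (tensor_dg C D) ==> W : \<Union>(set (tS (C, S) (D, T))) ==> c W : hom_set E' W W (- 1)"
  and dif_c: "!!W. W : Ob (tensor_dg C D) ==> W : \<Union>(set (tS (C, S) (D, T))) ==> Dif E' W W (- 1) (c W) = Id E' W"
begin

lemma Ob_E' [simp]: "W : Ob A.T ==> W : Ob E'"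
 using Fn.fob_closed[of W] by simp

abbreviation "hE W n == hom_set E' V0 W n"
abbreviation "hvE W n == hv E' V0 W n"
definition "un W n = inv_into (hE W n) (hvE W n)"
definition "RE W n = hvE W n ` hE W n"
definition "actE W W' m n a r = hvE W' (m + n) (Cmp E' V0 W W' m n (far Fn W W' m a) (un W n r))"
definition "dlE W n r = hvE W (n + 1) (Dif E' V0 W n (un W n r))"
definition "kapE W n r = hvE W (n - 1) (Cmp E' V0 W W (- 1) n (c W) (un W n r))"

lemma un_hv [simp]: "[|W : Ob A.T; x : hE W n|] ==> un W n (hvE W n x) = x"
 unfolding un_def by (rule inv_into_f_f) (auto intro!: inj_onI intro: Fn.T.hv_inj)

lemma RE_I [simp]: "x : hE W n ==> hvE W n x : RE W n"
 by (simp add: RE_def)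

lemma RE_E: assumes "r : RE W n" obtains x where "x : hE W n" "r = hvE W n x"
 using assms by (auto simp: RE_def)

lemma hv_un: "[|W : Ob A.T; r : RE W n|] ==> hvE W n (un W n r) = r & un W n r : hE W n"
 by (erule RE_E) simp

lemma farFn [simp]: "[|W : Ob A.T; W' : Ob A.T; a : hom_set A.T W W' m|] ==> far Fn W W' m a : hom_set E' W W' m"
 using Fn.far_closed[of W W' a m] by simp

lemma un_lin:
 assumes W: "W : Ob A.T" and r: "r : RE W n" "s : RE W n"
 shows "un W n (r + s) = hadd E' V0 W n (un W n r) (un W n s)" "un W n (fsc b r) = hscale E' V0 W n b (un W n r)"
  "r + s : RE W n" "fsc b r : RE W n"
proof -
 note u = hv_un[OF W r(1)] hv_un[OF W r(2)]
 have 1: "hvE W n (hadd E' V0 W n (un W n r) (un W n s)) = r + s" "hvE W n (hscale E' V0 W n b (un W n r)) = fsc b r"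
  using W u by simp_all
 have c: "hadd E' V0 W n (un W n r) (un W n s) : hE W n" "hscale E' V0 W n b (un W n r) : hE W n" using W u by simp_all
 show "un W n (r + s) = hadd E' V0 W n (un W n r) (un W n s)" "un W n (fsc b r) = hscale E' V0 W n b (un W n r)"
  unfolding 1[symmetric] using W c by simp_all
 show "r + s : RE W n" "fsc b r : RE W n" unfolding 1[symmetric] using c by simp_all
qed

lemma actE_hv: "[|W : Ob A.T; x : hE W n|] ==> actE W W' m n a (hvE W n x) = hvE W' (m + n) (Cmp E' V0 W W' m n (far Fn W W' m a) x)"
 by (simp add: actE_def)
lemma dlE_hv: "[|W : Ob A.T; x : hE W n|] ==> dlE W n (hvE W n x) = hvE W (n + 1) (Dif E' V0 W n x)"
 by (simp add: dlE_def)

sublocale bictr C S D T fsc RE actE dlE V0 kapE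
proof (unfold_locales, goal_cases)
 case (1 a x y) then show ?case by simp
next
 case (2 a b x) then show ?case by simp
next
 case (3 a b x) then show ?case by simp
next
 case (4 x) then show ?case by simp
next
 case (5 W n) then show ?case using RE_I[of "hzero E' V0 W n" W n] by simp
next
 case (6 W r n s) then show ?case by (rule un_lin(3))
next
 case (7 W r n b) then show ?case using un_lin(4)[of W r n r b] by simp
next
 case (8 W W' a m r n k) then show ?case using hv_un[of W r n] by (simp add: actE_def)
next
 case (9 W W' a m b r n) then show ?case using hv_un[of W r n] by (simp add: actE_def)
next
 case (10 W W' a m r n b) then show ?case using hv_un[of W r n] by (simp add: actE_def)
next
 case (11 W W' a m r n s) then show ?case using hv_un[of W r n] hv_un[of W s n] by (simp add: actE_def un_lin)
next
 case (12 W W' a m r n b) then show ?case using hv_un[of W r n] un_lin(2)[of W r n r b] by (simp add: actE_def)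
next
 case (13 W r n) then show ?case using hv_un[of W r n] Fn.far_id[of W] by (simp add: actE_def Fn.T.cmp_id_left)
next
 case (14 W W' W'' b l a m r n k k')
 note u = hv_un[OF 14(1,6)]
 have "far Fn W W'' (l + m) (Cmp A.T W W' W'' l m b a) = Cmp E' W W' W'' l m (far Fn W' W'' l b) (far Fn W W' m a)"
  using Fn.far_cmp[of W W' W'' b l a m] 14 by simp
 moreover have "Cmp E' V0 W W'' (l + m) n (Cmp E' W W' W'' l m (far Fn W' W'' l b) (far Fn W W' m a)) (un W n r)
  = Cmp E' V0 W' W'' l (m + n) (far Fn W' W'' l b) (Cmp E' V0 W W' m n (far Fn W W' m a) (un W n r))"
  by (rule Fn.T.cmp_assoc[symmetric]) (use 14 u in simp_all)
 ultimately show ?case using 14 u by (simp add: actE_def add.assoc)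
next
 case (15 W r n k) then show ?case using hv_un[of W r n] by (simp add: dlE_def)
next
 case (16 W r n s) then show ?case using hv_un[of W r n] hv_un[of W s n] by (simp add: dlE_def un_lin)
next
 case (17 W r n b) then show ?case using hv_un[of W r n] un_lin(2)[of W r n r b] by (simp add: dlE_def)
next
 case (18 W W' a m r n k m' n')
 note u = hv_un[OF 18(1,4)]
 have d: "far Fn W W' (m + 1) (Dif A.T W W' m a) = Dif E' W W' m (far Fn W W' m a)" using Fn.far_dif[of W W' a m] 18 by simp
 have e: "m + (n + 1) = m + n + 1" "m + 1 + n = m + n + 1" by simp_all
 show ?case using 18 u d by (simp add: actE_def dlE_def Fn.T.dif_cmp e)
next
 case 19 show ?case by simp
next
 case (20 W r n k) then show ?case using hv_un[of W r n] c_closed[of W] by (simp add: kapE_def)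
next
 case (21 W r n s) then show ?case using hv_un[of W r n] hv_un[of W s n] c_closed[of W] by (simp add: kapE_def un_lin)
next
 case (22 W r n b) then show ?case using hv_un[of W r n] un_lin(2)[of W r n r b] c_closed[of W] by (simp add: kapE_def)
next
 case (23 W r n k k')
 note u = hv_un[OF 23(1,3)] and c = c_closed[OF 23(1,2)] and dc = dif_c[OF 23(1,2)]
 let ?x = "un W n r"
 have x: "?x : hE W n" "hvE W n ?x = r" "Dif E' V0 W n ?x : hE W (n + 1)" using u 23 by simp_all
 have d: "Dif E' V0 W (n - 1) (Cmp E' V0 W W (- 1) n (c W) ?x) =
   hadd E' V0 W n (Cmp E' V0 W W 0 n (Id E' W) ?x) (hscale E' V0 W n (koszul (- 1)) (Cmp E' V0 W W (- 1) (n + 1) (c W) (Dif E' V0 W n ?x)))"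
  using Fn.T.dif_cmp[of V0 W W "c W" "- 1" ?x n] c dc x 23 by simp
 have "hvE W n (Dif E' V0 W (n - 1) (Cmp E' V0 W W (- 1) n (c W) ?x)) = r - hvE W n (Cmp E' V0 W W (- 1) (n + 1) (c W) (Dif E' V0 W n ?x))"
  unfolding d using c x 23 by (simp add: Fn.T.cmp_id_left) (simp add: sg_def)
 then show ?case using 23 c x by (simp add: kapE_def dlE_def)
qed

text \<open>The homotopy is \<open>G(f, 0)\<close>: since \<open>df = 0\<close> and \<open>f(1) = 0\<close>, its differential is \<open>f\<close>.\<close>

lemma Q_null:
 assumes lin: "!!W n. W : Ob A.T ==> linear_map (Hom M.Q V0 W n) (Hom E' V0 W n) (f W n)"
  and f_act: "!!W W' m n a q. [|W : Ob A.T; W' : Ob A.T; a : hom_set A.T W W' m; q : hom_set M.Q V0 W n|] ==>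
   f W' (m + n) (Cmp M.Q V0 W W' m n (M.inc W W' m a) q) = Cmp E' V0 W W' m n (far Fn W W' m a) (f W n q)"
  and f_dif: "!!W n q. [|W : Ob A.T; q : hom_set M.Q V0 W n|] ==> f W (n + 1) (Dif M.Q V0 W n q) = Dif E' V0 W n (f W n q)"
  and f_one: "f V0 0 (Id M.Q V0) = hzero E' V0 V0 0"
  and q: "W : Ob A.T" "q : hom_set M.Q V0 W n" "Dif M.Q V0 W n q = hzero M.Q V0 W (n + 1)"
 shows "EX y:hE W (n - 1). f W n q = Dif E' V0 W (n - 1) y"
proof -
 define g where "g = (%W n q. if W : Ob A.T & q : hom_set M.Q V0 W n then hvE W n (f W n q) else 0)"
 have fc: "f W n q : hE W n" if "W : Ob A.T" "q : hom_set M.Q V0 W n" for W n q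
  using lin[OF that(1)] that(2) by (simp add: linear_map_def)
 have fa: "f W n (hadd M.Q V0 W n q q') = hadd E' V0 W n (f W n q) (f W n q')"
  if "W : Ob A.T" "q : hom_set M.Q V0 W n" "q' : hom_set M.Q V0 W n" for W n q q'
  using lin[OF that(1)] that(2,3) by (simp add: linear_map_def)
 have fs: "f W n (hscale M.Q V0 W n b q) = hscale E' V0 W n b (f W n q)" if "W : Ob A.T" "q : hom_set M.Q V0 W n" for W n q b
  using lin[OF that(1)] that(2) by (simp add: linear_map_def)
 have g: "K.chom 0 g"
  by (rule K.chomI) (auto simp: g_def fc fa fs f_act actE_hv M.inc_closed sg_def)
 have dg: "K.dH 0 g = 0"
  unfolding K.dH_def by (intro ext) (simp add: g_def fc dlE_hv f_dif fun_app sg_def)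
 have g1: "g V0 0 (Id M.Q V0) = 0" using M.Q.id_closed[of V0] by (simp add: g_def f_one)
 let ?G = "K.G (- 1) g 0"
 have g': "K.chom (- 1 + 1) g" using g by simp
 have G: "K.chom (- 1) ?G" by (rule K.G_chom[OF g']) simp
 have dG: "K.dH (- 1) ?G = g" using K.dH_G[OF g', of 0] g1 dg K.G_zero[of 0] by simp
 have "?G W n q : RE W (n - 1)" by (rule K.chom_closed[OF G q(1,2)]) simp
 then obtain y where y: "y : hE W (n - 1)" "?G W n q = hvE W (n - 1) y" by (rule RE_E)
 have "hvE W n (f W n q) = K.dH (- 1) ?G W n q" unfolding dG using q by (simp add: g_def)
 also have "... = dlE W (n - 1) (?G W n q)" using q K.chom_zero_arg[OF G q(1), of "n + 1"] by (simp add: K.dH_def)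
 also have "... = hvE W n (Dif E' V0 W (n - 1) y)" using y q by (simp add: dlE_hv)
 finally have "f W n q = Dif E' V0 W (n - 1) y"
  by (rule Fn.T.hv_inj) (use q y fc in simp_all)
 then show ?thesis using y by blast
qed

text \<open>A map \<open>\<Theta>\<close> of two variables, linear over both categories, induces a linear map on the tensor
 product; its values are moved back from double duals to morphisms.\<close>

definition hx where
 "hx z \<Theta> W n = tensor_ext (Hom E' V0 W (n + z)) (%p a q b. un W (n + z) (\<Theta> (pfst W) p a (psnd W) q b))"

context
 fixes z \<Theta> assumes T: "H.chom z \<Theta>"
begin

lemma Theta_hchom: "[|X : Ob C; a : hom_set P.Q x0 X p; k = p + z|] ==> hchom X k (\<Theta> X p a)"
 using H.chom_closed[OF T, of X a p k] by simp

lemma Theta_R: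
 assumes "X : Ob C" "a : hom_set P.Q x0 X p" "Y : Ob D" "b : hom_set R.Q y0 Y q" "k = p + q + z"
 shows "\<Theta> X p a Y q b : RE (Pair X Y) k"
proof -
 interpret d: ctr D T fsc "RX X" "aX X" "dX X" y0 "kX X" by (rule ctrD[OF assms(1)])
 show ?thesis by (rule d.chom_closed[OF Theta_hchom[OF assms(1,2) refl] assms(3,4)]) (simp add: assms(5))
qed

lemma Theta_add:
 assumes "X : Ob C" "a : hom_set P.Q x0 X p" "Y : Ob D" "b : hom_set R.Q y0 Y q"
 shows "a' : hom_set P.Q x0 X p ==> \<Theta> X p (hadd P.Q x0 X p a a') Y q b = \<Theta> X p a Y q b + \<Theta> X p a' Y q b"
  and "\<Theta> X p (hscale P.Q x0 X p s a) Y q b = fsc s (\<Theta> X p a Y q b)"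
  and "b' : hom_set R.Q y0 Y q ==> \<Theta> X p a Y q (hadd R.Q y0 Y q b b') = \<Theta> X p a Y q b + \<Theta> X p a Y q b'"
  and "\<Theta> X p a Y q (hscale R.Q y0 Y q s b) = fsc s (\<Theta> X p a Y q b)"
proof -
 interpret d: ctr D T fsc "RX X" "aX X" "dX X" y0 "kX X" by (rule ctrD[OF assms(1)])
 note h = Theta_hchom[OF assms(1,2) refl]
 show "a' : hom_set P.Q x0 X p ==> \<Theta> X p (hadd P.Q x0 X p a a') Y q b = \<Theta> X p a Y q b + \<Theta> X p a' Y q b"
  using H.chom_add[OF T assms(1,2)] by (simp add: fun_app)
 show "\<Theta> X p (hscale P.Q x0 X p s a) Y q b = fsc s (\<Theta> X p a Y q b)"
  using H.chom_scale[OF T assms(1,2)] by (simp add: scH_def)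
 show "b' : hom_set R.Q y0 Y q ==> \<Theta> X p a Y q (hadd R.Q y0 Y q b b') = \<Theta> X p a Y q b + \<Theta> X p a Y q b'"
  by (rule d.chom_add[OF h assms(3,4)])
 show "\<Theta> X p a Y q (hscale R.Q y0 Y q s b) = fsc s (\<Theta> X p a Y q b)"
  by (rule d.chom_scale[OF h assms(3,4)])
qed

lemma hx_props:
 assumes W: "W : Ob A.T"
 shows hx_lin: "linear_map (Hom E.T V0 W n) (Hom E' V0 W (n + z)) (hx z \<Theta> W n)"
  and hv_hx: "[|a : hom_set P.Q x0 (pfst W) p; b : hom_set R.Q y0 (psnd W) q; p + q = n; k = n + z|] ==>
   hvE W k (hx z \<Theta> W n (E.pt V0 W p a q b)) = \<Theta> (pfst W) p a (psnd W) q b"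
proof -
 have ob: "V0 : Ob E.T" "W : Ob E.T" using W V0 by simp_all
 have W': "pfst W : Ob C" "psnd W : Ob D" using W by simp_all
 have u: "hvE W (n + z) (un W (n + z) (\<Theta> (pfst W) p a (psnd W) q b)) = \<Theta> (pfst W) p a (psnd W) q b
   & un W (n + z) (\<Theta> (pfst W) p a (psnd W) q b) : hE W (n + z)"
  if "a : hom_set P.Q x0 (pfst W) p" "b : hom_set R.Q y0 (psnd W) q" "p + q = n" for p a q b
  using hv_un[OF W] Theta_R[OF W'(1) that(1) W'(2) that(2), of "n + z"] W that(3) by simp
 have rw: "\<Theta> (pfst W) p a (psnd W) q b : RE W (n + z)"
  if "a : hom_set P.Q x0 (pfst W) p" "b : hom_set R.Q y0 (psnd W) q" "p + q = n" for p a q b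
  using Theta_R[OF W'(1) that(1) W'(2) that(2), of "n + z"] W that(3) by simp
 have us: "hvE W (n + z) (un W (n + z) (r + s)) = r + s" "hvE W (n + z) (un W (n + z) (fsc d r)) = fsc d r"
  if "r : RE W (n + z)" "s : RE W (n + z)" for r s d
  using hv_un[OF W un_lin(3)[OF W that]] hv_un[OF W un_lin(4)[OF W that]] by simp_all
 have km: "kmod (Hom E' V0 W (n + z))" by (rule Fn.T.kmod_hom) (use W in simp_all)
 have bil: "bilin_into P.Q R.Q V0 W n (Hom E' V0 W (n + z)) (%p a q b. un W (n + z) (\<Theta> (pfst W) p a (psnd W) q b))"
  by (rule E.bilinI[OF ob km]) (use W' in "simp_all add: u Theta_add us rw us(2)[OF rw rw]")
 show "linear_map (Hom E.T V0 W n) (Hom E' V0 W (n + z)) (hx z \<Theta> W n)"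
  unfolding hx_def by (rule E.tensor_ext_lin[OF km bil ob])
 show "[|a : hom_set P.Q x0 (pfst W) p; b : hom_set R.Q y0 (psnd W) q; p + q = n; k = n + z|] ==>
   hvE W k (hx z \<Theta> W n (E.pt V0 W p a q b)) = \<Theta> (pfst W) p a (psnd W) q b"
  unfolding hx_def using E.tensor_ext_pt[OF km bil ob] u by simp
qed

end

lemma hx_eqI:
 assumes W: "W : Ob A.T" and f: "linear_map (Hom E.T V0 W n) (Hom E' V0 W m) f" and g: "linear_map (Hom E.T V0 W n) (Hom E' V0 W m) g"
  and eq: "!!p a q b. [|a : hom_set P.Q x0 (pfst W) p; b : hom_set R.Q y0 (psnd W) q; p + q = n|] ==>
   hvE W m (f (E.pt V0 W p a q b)) = hvE W m (g (E.pt V0 W p a q b))"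
  and x: "x : hom_set E.T V0 W n"
 shows "f x = g x"
proof (rule E.tensor_lin_eq[OF _ _ _ f g _ x])
 show "kmod (Hom E' V0 W m)" by (rule Fn.T.kmod_hom) (use W in simp_all)
 fix p a q b assume h: "a : hom_set P.Q x0 (pfst W) p" "b : hom_set R.Q y0 (psnd W) q" "p + q = n"
 have "E.pt V0 W p a q b : hom_set E.T V0 W n" using h W V0 by simp
 then show "f (E.pt V0 W p a q b) = g (E.pt V0 W p a q b)"
  using eq[OF h] f g W by (intro Fn.T.hv_inj[of V0 W m]) (simp_all add: linear_map_def)
qed (use W V0 in simp_all)

lemma dH_Theta:
 assumes T: "H.chom z \<Theta>" and h: "X : Ob C" "a : hom_set P.Q x0 X p" "Y : Ob D" "b : hom_set R.Q y0 Y q"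
 shows "H.dH z \<Theta> X p a Y q b = dlE (Pair X Y) (p + q + z) (\<Theta> X p a Y q b)
  - sg (p + z) (\<Theta> X p a Y (q + 1) (Dif R.Q y0 Y q b)) - sg z (\<Theta> X (p + 1) (Dif P.Q x0 X p a) Y q b)"
proof -
 interpret d: ctr D T fsc "RX X" "aX X" "dX X" y0 "kX X" by (rule ctrD[OF h(1)])
 have o: "sg m f Y q b = sg m (f Y q b)" for m and f :: "('a, 'k) univ => int => ('a, 'k) univ => (('a, 'k) univ => 'k) => 'k"
  by (simp add: sg_def fun_app)
 have e: "q + (p + z) = p + q + z" by simp
 show ?thesis using h unfolding H.dH_def dlH_def d.dH_def by (simp add: e fun_app o)
qed

lemma E_cocycle_step:
 assumes T: "H.chom z \<Theta>" and W: "W : Ob A.T" and x: "x : hom_set E.T V0 W n"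
  and z: "H.dH z \<Theta> = \<Phi>" and P: "H.chom (z + 1) \<Phi>"
 shows "hvE W (n + z + 1) (Dif E' V0 W (n + z) (hx z \<Theta> W n x)) =
  hvE W (n + z + 1) (hx (z + 1) \<Phi> W n x) + sg z (hvE W (n + z + 1) (hx z \<Theta> W (n + 1) (Dif E.T V0 W n x)))"
proof -
 have W': "pfst W : Ob C" "psnd W : Ob D" "V0 : Ob E.T" "W : Ob E.T" using W V0 by simp_all
 note l = hx_lin[OF T W, of n] hx_lin[OF T W, of "n + 1"] hx_lin[OF P W, of n]
 have lc: "hx z \<Theta> W n x : hE W (n + z)" "hx (z + 1) \<Phi> W n x : hE W (n + z + 1)" if "x : hom_set E.T V0 W n" for x
  using l that by (simp_all add: linear_map_def add.assoc)
 have lc': "hx z \<Theta> W (n + 1) y : hE W (n + z + 1)" if "y : hom_set E.T V0 W (n + 1)" for y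
  using l(2) that by (simp add: linear_map_def ac_simps)
 note la = linear_mapD[OF l(1)] linear_mapD[OF l(2)] linear_mapD[OF l(3)]
 have e: "n + 1 + z = n + z + 1" "n + (z + 1) = n + z + 1" by simp_all
 note la' = la[unfolded e]
 show ?thesis using W'(3,4) x
 proof (induction rule: E.tensor_hom_induct)
  case (pure p a q b)
  let ?t = "E.pt V0 W p a q b"
  have t: "?t : hom_set E.T V0 W n" using pure W' by simp
  have dab: "Dif P.Q x0 (pfst W) p a : hom_set P.Q x0 (pfst W) (p + 1)" "Dif R.Q y0 (psnd W) q b : hom_set R.Q y0 (psnd W) (q + 1)"
   using pure W' by simp_all
  let ?t1 = "E.pt V0 W (p + 1) (Dif P.Q x0 (pfst W) p a) q b" and ?t2 = "E.pt V0 W p a (q + 1) (Dif R.Q y0 (psnd W) q b)"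
  have tc: "?t1 : hom_set E.T V0 W (n + 1)" "?t2 : hom_set E.T V0 W (n + 1)" using pure W' dab by simp_all
  have dt: "Dif E.T V0 W n ?t = hadd E.T V0 W (n + 1) ?t1 (hscale E.T V0 W (n + 1) (koszul p) ?t2)"
   using pure W' by (simp add: E.dif_pt)
  have 1: "hvE W (n + z + 1) (hx z \<Theta> W (n + 1) (Dif E.T V0 W n ?t)) =
   \<Theta> (pfst W) (p + 1) (Dif P.Q x0 (pfst W) p a) (psnd W) q b + sg p (\<Theta> (pfst W) p a (psnd W) (q + 1) (Dif R.Q y0 (psnd W) q b))"
   unfolding dt using tc W lc' pure dab hv_hx[OF T W dab(1) pure(2), of "n + 1" "n + z + 1"] hv_hx[OF T W pure(1) dab(2), of "n + 1" "n + z + 1"]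
   by (simp add: la')
  have 2: "hvE W (n + z + 1) (Dif E' V0 W (n + z) (hx z \<Theta> W n ?t)) = dlE W (n + z) (\<Theta> (pfst W) p a (psnd W) q b)"
   using hv_hx[OF T W pure refl] dlE_hv[OF W lc(1)[OF t]] by simp
  have 3: "hvE W (n + z + 1) (hx (z + 1) \<Phi> W n ?t) = \<Phi> (pfst W) p a (psnd W) q b"
   using hv_hx[OF P W pure, of "n + z + 1"] by simp
  have dd: "\<Phi> (pfst W) p a (psnd W) q b = dlE W (n + z) (\<Theta> (pfst W) p a (psnd W) q b)
   - sg (p + z) (\<Theta> (pfst W) p a (psnd W) (q + 1) (Dif R.Q y0 (psnd W) q b)) - sg z (\<Theta> (pfst W) (p + 1) (Dif P.Q x0 (pfst W) p a) (psnd W) q b)"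
   using dH_Theta[OF T W'(1) pure(1) W'(2) pure(2), unfolded z] pure(3) W by simp
  show ?case unfolding 1 2 3 dd by (rule sg_cancel)
 next
  case (add x y)
  have d: "Dif E.T V0 W n x : hom_set E.T V0 W (n + 1)" "Dif E.T V0 W n y : hom_set E.T V0 W (n + 1)" using add W' by simp_all
  show ?case using add d W W' lc lc' by (simp add: la' sg_def)
 next
  case (scale s x)
  have d: "Dif E.T V0 W n x : hom_set E.T V0 W (n + 1)" using scale W' by simp
  show ?case using scale d W W' lc lc' by (simp add: la' fsc_sg)
 qed
qed

text \<open>Write \<open>\<Phi>\<close> for \<open>f\<close> as a map of two variables. As \<open>\<Phi>(1)\<close> is closed and vanishes at the identity, it is the
 differential of some \<open>k\<close>; then \<open>G(\<Phi>, k)\<close> has differential \<open>\<Phi>\<close>, since \<open>d\<Phi> = 0\<close> and \<open>\<Phi>(1) - dk = 0\<close>.\<close>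

lemma E_null:
 assumes lin: "!!W n. W : Ob A.T ==> linear_map (Hom E.T V0 W n) (Hom E' V0 W n) (f W n)"
  and f_act: "!!W W' m n a x. [|W : Ob A.T; W' : Ob A.T; a : hom_set A.T W W' m; x : hom_set E.T V0 W n|] ==>
   f W' (m + n) (Cmp E.T V0 W W' m n (far ii W W' m a) x) = Cmp E' V0 W W' m n (far Fn W W' m a) (f W n x)"
  and f_dif: "!!W n x. [|W : Ob A.T; x : hom_set E.T V0 W n|] ==> f W (n + 1) (Dif E.T V0 W n x) = Dif E' V0 W n (f W n x)"
  and f_one: "f V0 0 (Id E.T V0) = hzero E' V0 V0 0"
  and x: "W : Ob A.T" "x : hom_set E.T V0 W n" "Dif E.T V0 W n x = hzero E.T V0 W (n + 1)"
 shows "EX y:hE W (n - 1). f W n x = Dif E' V0 W (n - 1) y"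
proof -
 let ?B = "%X Y p q a b. E.pt V0 (Pair X Y) p a q b"
 define \<Phi> where "\<Phi> = (%X p a Y q b. if X : Ob C & a : hom_set P.Q x0 X p & Y : Ob D & b : hom_set R.Q y0 Y q
  then hvE (Pair X Y) (p + q) (f (Pair X Y) (p + q) (?B X Y p q a b)) else 0)"
 have V0': "V0 : Ob E.T" using V0 by simp
 have B: "?B X Y p q a b : hom_set E.T V0 (Pair X Y) (p + q)"
  if "X : Ob C" "a : hom_set P.Q x0 X p" "Y : Ob D" "b : hom_set R.Q y0 Y q" for X Y p q a b using that V0' by simp
 have fB: "f (Pair X Y) (p + q) (?B X Y p q a b) : hE (Pair X Y) (p + q)"
  if "X : Ob C" "a : hom_set P.Q x0 X p" "Y : Ob D" "b : hom_set R.Q y0 Y q" for X Y p q a b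
  using linear_mapD(1)[OF lin B[OF that]] that by simp
 have Badd: "?B X Y p q (hadd P.Q x0 X p a a') b = hadd E.T V0 (Pair X Y) (p + q) (?B X Y p q a b) (?B X Y p q a' b)"
  "?B X Y p q (hscale P.Q x0 X p s a) b = hscale E.T V0 (Pair X Y) (p + q) s (?B X Y p q a b)"
  "?B X Y p q a (hadd R.Q y0 Y q b b') = hadd E.T V0 (Pair X Y) (p + q) (?B X Y p q a b) (?B X Y p q a b')"
  "?B X Y p q a (hscale R.Q y0 Y q s b) = hscale E.T V0 (Pair X Y) (p + q) s (?B X Y p q a b)"
  if "X : Ob C" "a : hom_set P.Q x0 X p" "a' : hom_set P.Q x0 X p" "Y : Ob D" "b : hom_set R.Q y0 Y q" "b' : hom_set R.Q y0 Y q" for X Y p q a b a' b' s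
  using that V0' E.pt_add_left[of V0 "Pair X Y", simplified] E.pt_add_right[of V0 "Pair X Y", simplified]
   E.pt_scale_left[of V0 "Pair X Y", simplified] E.pt_scale_right[of V0 "Pair X Y", simplified] by simp_all
 have Padd: "\<Phi> X p (hadd P.Q x0 X p a a') Y q b = \<Phi> X p a Y q b + \<Phi> X p a' Y q b"
  "\<Phi> X p (hscale P.Q x0 X p s a) Y q b = fsc s (\<Phi> X p a Y q b)"
  "\<Phi> X p a Y q (hadd R.Q y0 Y q b b') = \<Phi> X p a Y q b + \<Phi> X p a Y q b'"
  "\<Phi> X p a Y q (hscale R.Q y0 Y q s b) = fsc s (\<Phi> X p a Y q b)"
  if "X : Ob C" "a : hom_set P.Q x0 X p" "a' : hom_set P.Q x0 X p" "Y : Ob D" "b : hom_set R.Q y0 Y q" "b' : hom_set R.Q y0 Y q" for X Y p q a b a' b' s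
  using that V0' fB B by (simp_all add: \<Phi>_def Badd[OF that] linear_mapD(2,3)[OF lin])
 have out: "\<Phi> X p a Y q b = 0" if "~ (X : Ob C & a : hom_set P.Q x0 X p & Y : Ob D & b : hom_set R.Q y0 Y q)" for X p a Y q b
  unfolding \<Phi>_def using that by auto
 have PR: "\<Phi> X p a Y q b : RE (Pair X Y) k" if "X : Ob C" "a : hom_set P.Q x0 X p" "Y : Ob D" "b : hom_set R.Q y0 Y q" "k = p + q" for X p a Y q b k
  using that fB by (simp add: \<Phi>_def)
 have hP: "hchom X p (\<Phi> X p a)" if X: "X : Ob C" and a: "a : hom_set P.Q x0 X p" for X p a
 proof -
  interpret d: ctr D T fsc "RX X" "aX X" "dX X" y0 "kX X" by (rule ctrD[OF X])
  show ?thesis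
  proof (rule d.chomI)
   fix Y Y' l q b u assume h: "Y : Ob D" "Y' : Ob D" "b : hom_set D Y Y' l" "u : hom_set R.Q y0 Y q"
   let ?i = "R.inc Y Y' l b"
   have i: "?i : hom_set R.Q Y Y' l" using h by (simp add: R.inc_closed)
   have iu: "Cmp R.Q y0 Y Y' l q ?i u : hom_set R.Q y0 Y' (l + q)" using h i by simp
   let ?t = "A.pt (Pair X Y) (Pair X Y') 0 (Id C X) l b"
   have t: "?t : hom_set A.T (Pair X Y) (Pair X Y') l" using X h by simp
   have "far ii (Pair X Y) (Pair X Y') l ?t = E.pt (Pair X Y) (Pair X Y') 0 (Id P.Q X) l ?i"
    using X h by (simp add: ii_pt P.inc_id)
   then have "Cmp E.T V0 (Pair X Y) (Pair X Y') l (p + q) (far ii (Pair X Y) (Pair X Y') l ?t) (?B X Y p q a u) =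
    hscale E.T V0 (Pair X Y') (l + (p + q)) (koszul (l * p)) (?B X Y' p (l + q) a (Cmp R.Q y0 Y Y' l q ?i u))"
    using X a h i V0' P.Q.cmp_id_left[of x0 X a p] P.Q.id_closed[of X] by (simp add: E.cmp_pt)
   then have 1: "f (Pair X Y') (l + (p + q)) (hscale E.T V0 (Pair X Y') (l + (p + q)) (koszul (l * p)) (?B X Y' p (l + q) a (Cmp R.Q y0 Y Y' l q ?i u)))
    = Cmp E' V0 (Pair X Y) (Pair X Y') l (p + q) (far Fn (Pair X Y) (Pair X Y') l ?t) (f (Pair X Y) (p + q) (?B X Y p q a u))"
    using f_act[OF _ _ t B[OF X a h(1,4)]] X h by simp
   have e: "p + (l + q) = l + (p + q)" "q + p = p + q" by simp_all
   note fb = fB[OF X a h(2) iu, unfolded e] and b' = B[OF X a h(2) iu, unfolded e] and fb' = fB[OF X a h(1,4)]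
   have "aX X Y Y' l (q + p) b (\<Phi> X p a Y q u) = hvE (Pair X Y') (l + (p + q)) (Cmp E' V0 (Pair X Y) (Pair X Y') l (p + q) (far Fn (Pair X Y) (Pair X Y') l ?t) (f (Pair X Y) (p + q) (?B X Y p q a u)))"
    using X a h fb' by (simp add: \<Phi>_def actE_hv e)
   also have "... = sg (l * p) (\<Phi> X p a Y' (l + q) (Cmp R.Q y0 Y Y' l q ?i u))"
    unfolding 1[symmetric] using X a h iu fb b' by (simp add: \<Phi>_def e linear_mapD(3)[OF lin])
   finally show "\<Phi> X p a Y' (l + q) (Cmp R.Q y0 Y Y' l q ?i u) = sg (p * l) (aX X Y Y' l (q + p) b (\<Phi> X p a Y q u))"
    by (simp add: sg_def ac_simps)
  next
   fix Y q b assume "Y : Ob D" "b : hom_set R.Q y0 Y q"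
   then show "\<Phi> X p a Y q b : RE (Pair X Y) (q + p)" by (intro PR[OF X a]) simp_all
  qed (use X a Padd out in "auto")
 qed
 have Phi: "H.chom 0 \<Phi>"
 proof (rule H.chomI)
  fix X p a assume X: "X : Ob C" and a: "a : hom_set P.Q x0 X p"
  show "\<Phi> X p a : RH X (p + 0)" using hP[OF X a] by simp
  show "\<Phi> X p (hscale P.Q x0 X p s a) = scH s (\<Phi> X p a)" for s
  proof (intro ext, goal_cases)
   case (1 Y q b v)
   then show ?case using Padd(2)[OF X a a, of Y b q b s] out[of X "hscale P.Q x0 X p s a" p Y b q] out[of X a p Y b q] X a
    by (cases "Y : Ob D & b : hom_set R.Q y0 Y q") (auto simp: scH_def fsc_def fun_app)
  qed
  fix a' assume a': "a' : hom_set P.Q x0 X p"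
  show "\<Phi> X p (hadd P.Q x0 X p a a') = \<Phi> X p a + \<Phi> X p a'"
  proof (intro ext, goal_cases)
   case (1 Y q b v)
   then show ?case using Padd(1)[OF X a a', of Y b q b] out[of X "hadd P.Q x0 X p a a'" p Y b q] out[of X a p Y b q] out[of X a' p Y b q] X a a'
    by (cases "Y : Ob D & b : hom_set R.Q y0 Y q") (auto simp: fun_app)
  qed
 next
  fix X X' m p a u assume h: "X : Ob C" "X' : Ob C" "a : hom_set C X X' m" "u : hom_set P.Q x0 X p"
  let ?i = "P.inc X X' m a"
  have i: "?i : hom_set P.Q X X' m" using h by (simp add: P.inc_closed)
  have iu: "Cmp P.Q x0 X X' m p ?i u : hom_set P.Q x0 X' (m + p)" using h i by simp
  have "\<Phi> X' (m + p) (Cmp P.Q x0 X X' m p ?i u) Y q b = actH X X' m p a (\<Phi> X p u) Y q b" for Y q b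
  proof (cases "Y : Ob D & b : hom_set R.Q y0 Y q")
   case False
   then show ?thesis using out by (auto simp: actH_def)
  next
   case True
   then have y: "Y : Ob D" "b : hom_set R.Q y0 Y q" by simp_all
   let ?t = "A.pt (Pair X Y) (Pair X' Y) m a 0 (Id D Y)"
   have t: "?t : hom_set A.T (Pair X Y) (Pair X' Y) m" using h y by simp
   have "far ii (Pair X Y) (Pair X' Y) m ?t = E.pt (Pair X Y) (Pair X' Y) m ?i 0 (Id R.Q Y)"
    using h y by (simp add: ii_pt R.inc_id)
   then have "Cmp E.T V0 (Pair X Y) (Pair X' Y) m (p + q) (far ii (Pair X Y) (Pair X' Y) m ?t) (?B X Y p q u b) =
    ?B X' Y (m + p) q (Cmp P.Q x0 X X' m p ?i u) b"
    using h y i V0' R.Q.cmp_id_left[of y0 Y b q] R.Q.id_closed[of Y]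
    by (simp add: E.cmp_pt koszul_def kmod.smult_one[OF E.kmod_T])
   then have 1: "f (Pair X' Y) (m + (p + q)) (?B X' Y (m + p) q (Cmp P.Q x0 X X' m p ?i u) b)
    = Cmp E' V0 (Pair X Y) (Pair X' Y) m (p + q) (far Fn (Pair X Y) (Pair X' Y) m ?t) (f (Pair X Y) (p + q) (?B X Y p q u b))"
    using f_act[OF _ _ t B[OF h(1,4) y]] h y by simp
   have e: "q + p = p + q" by simp
   have "\<Phi> X' (m + p) (Cmp P.Q x0 X X' m p ?i u) Y q b = hvE (Pair X' Y) (m + (p + q)) (f (Pair X' Y) (m + (p + q)) (?B X' Y (m + p) q (Cmp P.Q x0 X X' m p ?i u) b))"
    using h y iu by (simp add: \<Phi>_def add.assoc)
   also have "... = actH X X' m p a (\<Phi> X p u) Y q b"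
    unfolding 1 using h y fB[OF h(1,4) y] by (simp add: actH_def \<Phi>_def e actE_hv)
   finally show ?thesis .
  qed
  then show "\<Phi> X' (m + p) (Cmp P.Q x0 X X' m p ?i u) = sg (0 * m) (actH X X' m (p + 0) a (\<Phi> X p u))"
   by (simp add: sg_def fun_eq_iff)
 next
  fix X p a assume "X ~: Ob C | a ~: hom_set P.Q x0 X p"
  then show "\<Phi> X p a = 0" using out by (auto simp: fun_eq_iff fun_app)
 qed
 have dPhi: "H.dH 0 \<Phi> = 0"
 proof (intro ext, goal_cases)
  case (1 X p a Y q b v)
  note dP = H.dH_chom[OF Phi]
  show ?case
  proof (cases "X : Ob C & a : hom_set P.Q x0 X p & Y : Ob D & b : hom_set R.Q y0 Y q")
   case True
   then have h: "X : Ob C" "a : hom_set P.Q x0 X p" "Y : Ob D" "b : hom_set R.Q y0 Y q" by simp_all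
   have dab: "Dif P.Q x0 X p a : hom_set P.Q x0 X (p + 1)" "Dif R.Q y0 Y q b : hom_set R.Q y0 Y (q + 1)" using h by simp_all
   have e: "p + 1 + q = p + q + 1" "p + (q + 1) = p + q + 1" by simp_all
   note b1 = B[OF h(1) dab(1) h(3,4), unfolded e] and b2 = B[OF h(1,2,3) dab(2), unfolded e]
   note f1 = fB[OF h(1) dab(1) h(3,4), unfolded e] and f2 = fB[OF h(1,2,3) dab(2), unfolded e]
   have dB: "Dif E.T V0 (Pair X Y) (p + q) (?B X Y p q a b) = hadd E.T V0 (Pair X Y) (p + q + 1) (?B X Y (p + 1) q (Dif P.Q x0 X p a) b)
     (hscale E.T V0 (Pair X Y) (p + q + 1) (koszul p) (?B X Y p (q + 1) a (Dif R.Q y0 Y q b)))"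
    using h V0' by (simp add: E.dif_pt)
   have fd: "f (Pair X Y) (p + q + 1) (Dif E.T V0 (Pair X Y) (p + q) (?B X Y p q a b)) = Dif E' V0 (Pair X Y) (p + q) (f (Pair X Y) (p + q) (?B X Y p q a b))"
    by (rule f_dif[OF _ B[OF h]]) (use h in simp)
   have "hvE (Pair X Y) (p + q + 1) (Dif E' V0 (Pair X Y) (p + q) (f (Pair X Y) (p + q) (?B X Y p q a b))) =
    \<Phi> X (p + 1) (Dif P.Q x0 X p a) Y q b + sg p (\<Phi> X p a Y (q + 1) (Dif R.Q y0 Y q b))"
    unfolding fd[symmetric] dB
    using h dab b1 b2 f1 f2 by (simp add: \<Phi>_def e linear_mapD(2,3)[OF lin] linear_mapD(1)[OF lin])
   moreover have "dlE (Pair X Y) (p + q) (\<Phi> X p a Y q b) = hvE (Pair X Y) (p + q + 1) (Dif E' V0 (Pair X Y) (p + q) (f (Pair X Y) (p + q) (?B X Y p q a b)))"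
   proof -
    have "\<Phi> X p a Y q b = hvE (Pair X Y) (p + q) (f (Pair X Y) (p + q) (?B X Y p q a b))" using h by (simp add: \<Phi>_def)
    then show ?thesis using dlE_hv[OF _ fB[OF h]] h by simp
   qed
   ultimately have dle: "dlE (Pair X Y) (p + q) (\<Phi> X p a Y q b) = \<Phi> X (p + 1) (Dif P.Q x0 X p a) Y q b + sg p (\<Phi> X p a Y (q + 1) (Dif R.Q y0 Y q b))"
    by (simp only:)
   have "H.dH 0 \<Phi> X p a Y q b = 0"
    unfolding dH_Theta[OF Phi h] add_0_right dle by (simp add: sg_def)
   then show ?thesis by (simp add: fun_app)
  next
   case False
   show ?thesis
   proof (cases "X : Ob C & a : hom_set P.Q x0 X p")
    case True
    then have X: "X : Ob C" and a: "a : hom_set P.Q x0 X p" by simp_all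
    interpret d: ctr D T fsc "RX X" "aX X" "dX X" y0 "kX X" by (rule ctrD[OF X])
    have "hchom X (p + (0 + 1)) (H.dH 0 \<Phi> X p a)" using H.chom_closed[OF dP X a refl] by simp
    then have "H.dH 0 \<Phi> X p a Y q b = 0" by (rule d.chom_out) (use False X a in blast)
    then show ?thesis by (simp add: fun_app)
   next
    case False
    then have "X ~: Ob C | a ~: hom_set P.Q x0 X p" by blast
    then have "H.dH 0 \<Phi> X p a = 0" by (rule H.chom_out[OF dP])
    then show ?thesis by (simp add: fun_app)
   qed
  qed
 qed
 interpret d: ctr D T fsc "RX x0" "aX x0" "dX x0" y0 "kX x0" by (rule ctrD) simp
 let ?F = "\<Phi> x0 0 (Id P.Q x0)"
 have i: "Id P.Q x0 : hom_set P.Q x0 x0 0" by (rule H.Id_Q0)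
 have F: "hchom x0 0 ?F" by (rule hP) (use i in simp_all)
 have V: "Pair x0 y0 = V0" using V0 by simp
 have F1: "?F y0 0 (Id R.Q y0) = 0"
  using E.Id_T[of V0] f_one i d.Id_Q0 V0 by (simp add: \<Phi>_def V)
 have "dlH x0 0 ?F - sg 0 (\<Phi> x0 (0 + 1) (Dif P.Q x0 x0 0 (Id P.Q x0))) = 0"
  using fun_cong[OF fun_cong[OF fun_cong[OF dPhi, of x0], of 0], of "Id P.Q x0"] i by (simp add: H.dH_def fun_app)
 moreover have "\<Phi> x0 1 (hzero P.Q x0 x0 1) = 0" by (rule H.chom_zero_arg[OF Phi]) simp
 ultimately have dF: "hdH x0 0 ?F = 0" by (simp add: dlH_def sg_def)
 define k where "k = hG x0 (- 1) ?F 0"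
 have F': "hchom x0 (- 1 + 1) ?F" using F by simp
 have k: "hchom x0 (- 1) k" unfolding k_def by (rule d.G_chom[OF F']) simp
 have dk: "dlH x0 (- 1) k = ?F" unfolding k_def dlH_def using d.dH_G[OF F', of 0] F1 dF d.G_zero[of 0] by simp
 define \<Psi> where "\<Psi> = H.G (- 1) \<Phi> k"
 have P': "H.chom (- 1 + 1) \<Phi>" using Phi by simp
 have kR: "k : RH x0 (- 1)" using k by simp
 have Psi: "H.chom (- 1) \<Psi>" unfolding \<Psi>_def by (rule H.G_chom[OF P' kR])
 have dPsi: "H.dH (- 1) \<Psi> = \<Phi>" unfolding \<Psi>_def using H.dH_G[OF P' kR] dk dPhi H.G_zero[of 0] by simp
 have Vo: "V0 : Ob E.T" using V0 by simp
 have W': "pfst W : Ob C" "psnd W : Ob D" using x(1) by simp_all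
 have fx: "hx 0 \<Phi> W n x = f W n x"
 proof (rule hx_eqI[OF x(1) _ lin[OF x(1)] _ x(2)])
  show "linear_map (Hom E.T V0 W n) (Hom E' V0 W n) (hx 0 \<Phi> W n)" using hx_lin[OF Phi x(1), of n] by simp
  fix p a q b assume h: "a : hom_set P.Q x0 (pfst W) p" "b : hom_set R.Q y0 (psnd W) q" "p + q = n"
  show "hvE W n (hx 0 \<Phi> W n (E.pt V0 W p a q b)) = hvE W n (f W n (E.pt V0 W p a q b))"
   using hv_hx[OF Phi x(1) h, of n] h W' x(1) by (simp add: \<Phi>_def)
 qed
 let ?y = "hx (- 1) \<Psi> W n x"
 have y: "?y : hE W (n - 1)" using linear_mapD(1)[OF hx_lin[OF Psi x(1)] x(2)] by simp
 have z: "hx (- 1) \<Psi> W (n + 1) (hzero E.T V0 W (n + 1)) = hzero E' V0 W n"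
 proof -
  have "hx (- 1) \<Psi> W (n + 1) (hscale E.T V0 W (n + 1) 0 (hzero E.T V0 W (n + 1))) = hscale E' V0 W n 0 (hx (- 1) \<Psi> W (n + 1) (hzero E.T V0 W (n + 1)))"
   "hx (- 1) \<Psi> W (n + 1) (hzero E.T V0 W (n + 1)) : hE W n"
   using linear_mapD(1,3)[OF hx_lin[OF Psi x(1), of "n + 1"], of "hzero E.T V0 W (n + 1)"] x(1) Vo by simp_all
  then show ?thesis using x(1) Vo by (simp add: E.T.hscale_zero Fn.T.hscale_zero)
 qed
 have "hvE W n (Dif E' V0 W (n - 1) ?y) = hvE W n (f W n x)"
  using E_cocycle_step[OF Psi x(1,2) dPsi P'] x(1,3) fx z by simp
 moreover have "f W n x : hE W n" using linear_mapD(1)[OF lin[OF x(1)] x(2)] .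
 ultimately have "f W n x = Dif E' V0 W (n - 1) ?y" using y x(1) by (intro Fn.T.hv_inj[of V0 W n]) simp_all
 then show ?thesis using y by blast
qed

text \<open>The identity of \<open>V0\<close> is extended to \<open>Q'(y0, -)\<close> by \<open>k = G(0, 1)\<close>, and \<open>k\<close> to both variables by \<open>G(0, k)\<close>.\<close>

lemma E_lift:
 "EX \<gamma>. (ALL W n. W : Ob A.T --> linear_map (Hom E.T V0 W n) (Hom E' V0 W n) (\<gamma> W n)) &
  (ALL W W' m n a x. W : Ob A.T --> W' : Ob A.T --> a : hom_set A.T W W' m --> x : hom_set E.T V0 W n -->
   \<gamma> W' (m + n) (Cmp E.T V0 W W' m n (far ii W W' m a) x) = Cmp E' V0 W W' m n (far Fn W W' m a) (\<gamma> W n x)) &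
  (ALL W n x. W : Ob A.T --> x : hom_set E.T V0 W n --> \<gamma> W (n + 1) (Dif E.T V0 W n x) = Dif E' V0 W n (\<gamma> W n x)) &
  \<gamma> V0 0 (Id E.T V0) = Id E' V0"
proof -
 interpret d: ctr D T fsc "RX x0" "aX x0" "dX x0" y0 "kX x0" by (rule ctrD) simp
 have V: "Pair x0 y0 = V0" using V0 by simp
 have Vo: "V0 : Ob E.T" using V0 by simp
 have idE: "Id E' V0 : hE V0 0" by (rule Fn.T.id_closed) simp
 define r0 where "r0 = hvE V0 0 (Id E' V0)"
 have r0: "r0 : RX x0 y0 0" unfolding V r0_def using idE by simp
 have dr: "dX x0 y0 0 r0 = 0" unfolding V r0_def using idE by (simp add: dlE_hv)
 define k where "k = hG x0 0 0 r0"
 have k: "hchom x0 0 k" unfolding k_def by (rule d.G_chom[OF d.zero_chom r0])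
 have dH0: "hdH x0 1 0 = 0" unfolding d.dH_def by (intro ext) (simp add: fun_app sg_def)
 have dk: "dlH x0 0 k = 0"
  unfolding k_def dlH_def using d.dH_G[OF d.zero_chom r0] dr dH0 d.G_zero[of 1] by (simp add: fun_app)
 have k1: "k y0 0 (Id R.Q y0) = r0" unfolding k_def by (rule d.G_one[OF d.zero_chom r0])
 define \<Psi> where "\<Psi> = H.G 0 0 k"
 have kR: "k : RH x0 0" using k by simp
 have Psi: "H.chom 0 \<Psi>" unfolding \<Psi>_def by (rule H.G_chom[OF H.zero_chom kR])
 have hd: "H.dH 1 0 = 0" unfolding H.dH_def by (intro ext) (simp add: fun_app sg_def)
 have dPsi: "H.dH 0 \<Psi> = 0" unfolding \<Psi>_def using H.dH_G[OF H.zero_chom kR] dk hd H.G_zero[of 1] by (simp add: fun_app)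
 have Psi1: "\<Psi> x0 0 (Id P.Q x0) = k" unfolding \<Psi>_def by (rule H.G_one[OF H.zero_chom kR])
 let ?g = "hx 0 \<Psi>"
 have lin: "linear_map (Hom E.T V0 W n) (Hom E' V0 W n) (?g W n)" if "W : Ob A.T" for W n
  using hx_lin[OF Psi that, of n] by simp
 have hg: "hvE W n (?g W n (E.pt V0 W p a q b)) = \<Psi> (pfst W) p a (psnd W) q b"
  if "W : Ob A.T" "a : hom_set P.Q x0 (pfst W) p" "b : hom_set R.Q y0 (psnd W) q" "p + q = n" for W n p a q b
  using hv_hx[OF Psi that, of n] by simp
 have gc: "?g W n x : hE W n" if "W : Ob A.T" "x : hom_set E.T V0 W n" for W n x
  using linear_mapD(1)[OF lin[OF that(1)] that(2)] .
 have one: "?g V0 0 (Id E.T V0) = Id E' V0"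
 proof (rule Fn.T.hv_inj[of V0 V0 0])
  show "hvE V0 0 (?g V0 0 (Id E.T V0)) = hvE V0 0 (Id E' V0)"
   using hg[of V0 "Id P.Q x0" 0 "Id R.Q y0" 0 0] E.Id_T[of V0] H.Id_Q0 d.Id_Q0 Psi1 k1 by (simp add: r0_def)
  show "?g V0 0 (Id E.T V0) : hE V0 0" by (rule gc) (use E.T.id_closed[OF Vo] in simp_all)
 qed (use idE in simp_all)
 have hx0: "hx (0 + 1) 0 W n x = hzero E' V0 W (n + 1)" if "W : Ob A.T" "x : hom_set E.T V0 W n" for W n x
 proof (rule hx_eqI[OF that(1) _ _ _ that(2)])
  show "linear_map (Hom E.T V0 W n) (Hom E' V0 W (n + 1)) (hx (0 + 1) 0 W n)" using hx_lin[OF H.zero_chom[of 1] that(1), of n] by simp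
  show "linear_map (Hom E.T V0 W n) (Hom E' V0 W (n + 1)) (%x. hzero E' V0 W (n + 1))"
   by (rule linear_map_zero[OF Fn.T.kmod_hom]) (use that in simp_all)
  fix p a q b assume h: "a : hom_set P.Q x0 (pfst W) p" "b : hom_set R.Q y0 (psnd W) q" "p + q = n"
  show "hvE W (n + 1) (hx (0 + 1) 0 W n (E.pt V0 W p a q b)) = hvE W (n + 1) (hzero E' V0 W (n + 1))"
   using hv_hx[OF H.zero_chom[of 1] that(1) h, of "n + 1"] that by (simp add: fun_app)
 qed
 have dif: "?g W (n + 1) (Dif E.T V0 W n x) = Dif E' V0 W n (?g W n x)" if "W : Ob A.T" "x : hom_set E.T V0 W n" for W n x
 proof (rule Fn.T.hv_inj[of V0 W "n + 1"])
  have P0: "H.chom (0 + 1) 0" by (rule H.zero_chom)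
  show "hvE W (n + 1) (?g W (n + 1) (Dif E.T V0 W n x)) = hvE W (n + 1) (Dif E' V0 W n (?g W n x))"
   using E_cocycle_step[OF Psi that dPsi P0] hx0[OF that] that by (simp add: sg_def)
 qed (use that Vo gc in simp_all)
 have act: "?g W' (m + n) (Cmp E.T V0 W W' m n (far ii W W' m a) x) = Cmp E' V0 W W' m n (far Fn W W' m a) (?g W n x)"
  if W: "W : Ob A.T" and W'': "W' : Ob A.T" and a: "a : hom_set A.T W W' m" and x: "x : hom_set E.T V0 W n" for W W' m n a x
 proof -
  note ob = W W''
  have VW: "W : Ob E.T" "W' : Ob E.T" using ob by simp_all
  have iic: "far ii W W' m a : hom_set E.T W W' m" if "a : hom_set A.T W W' m" for a m
   using dgfunctor.far_closed[OF dgfunctorI[OF A.dgc_T E.dgc_T ii_functor] ob that] ob by (simp add: ii_ob)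
  note il = dgfunctor.far_lin[OF dgfunctorI[OF A.dgc_T E.dgc_T ii_functor] ob, unfolded ii_ob[OF W] ii_ob[OF W'']]
  note fl = Fn.far_lin[OF ob, unfolded Fob[OF W] Fob[OF W'']]
  have l1: "linear_map (Hom E.T V0 W n) (Hom E' V0 W' (m + n)) (%x. ?g W' (m + n) (Cmp E.T V0 W W' m n (far ii W W' m a) x))"
   if "a : hom_set A.T W W' m" for a m
   by (rule linear_map_comp[OF E.cmpT_lin_right[OF Vo VW iic[OF that]] lin[OF W'']])
  have l2: "linear_map (Hom E.T V0 W n) (Hom E' V0 W' (m + n)) (%x. Cmp E' V0 W W' m n (far Fn W W' m a) (?g W n x))"
   if "a : hom_set A.T W W' m" for a m
   by (rule linear_map_comp[OF lin[OF W] Fn.T.cmp_lin_right]) (use ob that in simp_all)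
  from ob a show ?thesis
  proof (induction rule: A.tensor_hom_induct)
   case (pure m1 u m2 v)
   let ?a = "A.pt W W' m1 u m2 v"
   have a: "?a : hom_set A.T W W' m" using pure ob by simp
   have uv: "P.inc (pfst W) (pfst W') m1 u : hom_set P.Q (pfst W) (pfst W') m1" "R.inc (psnd W) (psnd W') m2 v : hom_set R.Q (psnd W) (psnd W') m2"
    using pure ob by (simp_all add: P.inc_closed R.inc_closed)
   show ?case
    using Vo VW(1) x
   proof (induction rule: E.tensor_hom_induct)
    case (pure p s q t)
    interpret dX: ctr D T fsc "RX (pfst W)" "aX (pfst W)" "dX (pfst W)" y0 "kX (pfst W)" by (rule ctrD) (use ob in simp)
    let ?x = "E.pt V0 W p s q t" and ?us = "Cmp P.Q x0 (pfst W) (pfst W') m1 p (P.inc (pfst W) (pfst W') m1 u) s"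
     and ?vt = "Cmp R.Q y0 (psnd W) (psnd W') m2 q (R.inc (psnd W) (psnd W') m2 v) t"
    have X: "pfst W : Ob C" "pfst W' : Ob C" "psnd W : Ob D" "psnd W' : Ob D" using ob by simp_all
    note uv' = \<open>u : _\<close> \<open>v : _\<close> \<open>m1 + m2 = m\<close> and st = pure
    have xc: "?x : hom_set E.T V0 W n" using st VW Vo by simp
    have c: "?us : hom_set P.Q x0 (pfst W') (m1 + p)" "?vt : hom_set R.Q y0 (psnd W') (m2 + q)" using st uv X by simp_all
    have t: "E.pt V0 W' (m1 + p) ?us (m2 + q) ?vt : hom_set E.T V0 W' (m + n)" using c VW Vo st(3) uv'(3) by simp
    have e: "m1 + p + (m2 + q) = m + n" using st(3) uv'(3) by simp
    have 1: "Cmp E.T V0 W W' m n (far ii W W' m ?a) ?x = hscale E.T V0 W' (m + n) (koszul (m2 * p)) (E.pt V0 W' (m1 + p) ?us (m2 + q) ?vt)"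
     using ob uv' st uv VW Vo by (simp add: ii_pt E.cmp_pt)
    have r: "\<Psi> (pfst W) p s (psnd W) q t : RE W n" using Theta_R[OF Psi X(1) st(1) X(3) st(2), of n] st(3) ob by simp
    have hs: "hchom (pfst W) p (\<Psi> (pfst W) p s)" using Theta_hchom[OF Psi X(1) st(1), of p] by simp
    have "\<Psi> (pfst W') (m1 + p) ?us = actH (pfst W) (pfst W') m1 p u (\<Psi> (pfst W) p s)"
     using H.chom_act[OF Psi X(1,2) uv'(1) st(1)] by (simp add: sg_def)
    then have "\<Psi> (pfst W') (m1 + p) ?us (psnd W') (m2 + q) ?vt = aC (pfst W) (pfst W') (psnd W') m1 (m2 + q + p) u (\<Psi> (pfst W) p s (psnd W') (m2 + q) ?vt)"
     using c X by (simp add: actH_def)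
    also have "\<Psi> (pfst W) p s (psnd W') (m2 + q) ?vt = sg (p * m2) (aX (pfst W) (psnd W) (psnd W') m2 n v (\<Psi> (pfst W) p s (psnd W) q t))"
     by (rule dX.chom_act[OF hs X(3,4) uv'(2) st(2)]) (use st in simp_all)
    also have "aC (pfst W) (pfst W') (psnd W') m1 (m2 + q + p) u (sg (p * m2) (aX (pfst W) (psnd W) (psnd W') m2 n v (\<Psi> (pfst W) p s (psnd W) q t)))
      = sg (p * m2) (actE W W' m n ?a (\<Psi> (pfst W) p s (psnd W) q t))"
    proof -
     let ?r = "\<Psi> (pfst W) p s (psnd W) q t" and ?P = "Pair (pfst W) (psnd W')"
     have k: "m2 + q + p = m2 + n" using st by simp
     have r': "?r : RE (Pair (pfst W) (psnd W)) n" using r ob by simp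
     have mem: "aX (pfst W) (psnd W) (psnd W') m2 n v ?r : RE ?P (m2 + n)"
      by (rule K.act_closed) (use X uv'(2) r' in simp_all)
     have pc: "?P : Ob A.T" "Pair (pfst W') (psnd W') : Ob A.T" "A.pt ?P (Pair (pfst W') (psnd W')) m1 u 0 (Id D (psnd W')) : hom_set A.T ?P (Pair (pfst W') (psnd W')) m1"
      using X uv'(1) by simp_all
     have "aC (pfst W) (pfst W') (psnd W') m1 (m2 + n) u (aX (pfst W) (psnd W) (psnd W') m2 n v ?r)
      = actE (Pair (pfst W) (psnd W)) (Pair (pfst W') (psnd W')) m n (A.pt (Pair (pfst W) (psnd W)) (Pair (pfst W') (psnd W')) m1 u m2 v) ?r"
      by (rule act_pt[OF X uv'(1,2) r' refl uv'(3)[symmetric]])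
     then show ?thesis unfolding k K.act_sg[OF pc mem] using ob by simp
    qed
    finally have 2: "\<Psi> (pfst W') (m1 + p) ?us (psnd W') (m2 + q) ?vt = sg (p * m2) (actE W W' m n ?a (\<Psi> (pfst W) p s (psnd W) q t))" .
    have "hvE W' (m + n) (?g W' (m + n) (Cmp E.T V0 W W' m n (far ii W W' m ?a) ?x)) =
     sg (m2 * p) (hvE W' (m + n) (?g W' (m + n) (E.pt V0 W' (m1 + p) ?us (m2 + q) ?vt)))"
     unfolding 1 using t ob gc[OF W'' t] by (simp add: linear_mapD(3)[OF lin[OF W''] t])
    also have "... = actE W W' m n ?a (hvE W n (?g W n ?x))"
     unfolding hg[OF W'' c e] 2 hg[OF W st] by (simp add: sg_def ac_simps)
    also have "... = hvE W' (m + n) (Cmp E' V0 W W' m n (far Fn W W' m ?a) (?g W n ?x))"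
     by (rule actE_hv[OF W gc[OF W xc]])
    finally show ?case
     by (rule Fn.T.hv_inj) (use ob gc[OF W xc] gc[OF W''] linear_mapD(1)[OF E.cmpT_lin_right[OF Vo VW iic[OF a]] xc] a in simp_all)
   next
    case (add y y')
    then show ?case using linear_mapD(2)[OF l1[OF a]] linear_mapD(2)[OF l2[OF a]] by simp
   next
    case (scale s y)
    then show ?case using linear_mapD(3)[OF l1[OF a]] linear_mapD(3)[OF l2[OF a]] by simp
   qed
  next
   case (add a a')
   have "far ii W W' m (hadd A.T W W' m a a') = hadd E.T W W' m (far ii W W' m a) (far ii W W' m a')"
    "far Fn W W' m (hadd A.T W W' m a a') = hadd E' W W' m (far Fn W W' m a) (far Fn W W' m a')"
    using add linear_mapD(2)[OF il] linear_mapD(2)[OF fl] by simp_all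
   then show ?case using add ob VW Vo x iic gc linear_mapD(2)[OF lin[OF W'']] by simp
  next
   case (scale s a)
   have "far ii W W' m (hscale A.T W W' m s a) = hscale E.T W W' m s (far ii W W' m a)"
    "far Fn W W' m (hscale A.T W W' m s a) = hscale E' W W' m s (far Fn W W' m a)"
    using scale linear_mapD(3)[OF il] linear_mapD(3)[OF fl] by simp_all
   then show ?case using scale ob VW Vo x iic gc linear_mapD(3)[OF lin[OF W'']] by simp
  qed
 qed
 show ?thesis by (rule exI[of _ ?g]) (use lin act dif one in blast)
qed

end

section \<open>Quasi-equivalences that are the identity on objects\<close>

text \<open>Cohomology consists of cosets, so bijectivity on cohomology is restated for cocycles.\<close>

lemma quasi_equivalenceI:
 assumes A: "dgc A" and B: "dgc B" and F: "dg_functor A B F"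
  and ob: "!!X. X : Ob A ==> fob F X = X" and Ob: "Ob B = Ob A"
  and surj: "!!X Y n e. [|X : Ob A; Y : Ob A; e : hom_set B X Y n; Dif B X Y n e = hzero B X Y (n + 1)|] ==>
   EX q:cocycles A X Y n. EX y:hom_set B X Y (n - 1). e = hadd B X Y n (far F X Y n q) (Dif B X Y (n - 1) y)"
  and inj: "!!X Y n q y. [|X : Ob A; Y : Ob A; q : hom_set A X Y n; Dif A X Y n q = hzero A X Y (n + 1);
    y : hom_set B X Y (n - 1); far F X Y n q = Dif B X Y (n - 1) y|] ==> EX z:hom_set A X Y (n - 1). q = Dif A X Y (n - 1) z"
 shows "quasi_equivalence A B F"
proof -
 interpret dgfunctor A B F by (rule dgfunctorI[OF A B F])
 have cls: "f : coh_class C X Y n f" "coh_class C X Y n f = coh_class C X Y n g \<longleftrightarrow> (EX h:hom_set C X Y (n - 1). g = hadd C X Y n f (Dif C X Y (n - 1) h))"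
  if C: "dgc C" and X: "X : Ob C" "Y : Ob C" and fg: "f : hom_set C X Y n" "g : hom_set C X Y n"
  for C :: "('a, 'b) dgcat" and X Y n f g
 proof -
  interpret C: dgc C by fact
  have d: "Dif C X Y (n - 1) h : hom_set C X Y n" if "h : hom_set C X Y (n - 1)" for h using X that by simp
  have refl: "f : coh_class C X Y n f" if "f : hom_set C X Y n" for f
  proof -
   have "f = hadd C X Y n f (Dif C X Y (n - 1) (hzero C X Y (n - 1)))"
    by (rule C.hv_inj[of X Y n]) (use X that in simp_all)
   then show ?thesis using C.hzero_closed[OF X, of "n - 1"] unfolding coh_class_def by blast
  qed
  show "f : coh_class C X Y n f" by (rule refl[OF fg(1)])
  show "coh_class C X Y n f = coh_class C X Y n g \<longleftrightarrow> (EX h:hom_set C X Y (n - 1). g = hadd C X Y n f (Dif C X Y (n - 1) h))"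
  proof
   assume "coh_class C X Y n f = coh_class C X Y n g"
   then have "g : coh_class C X Y n f" using refl[OF fg(2)] by simp
   then show "EX h:hom_set C X Y (n - 1). g = hadd C X Y n f (Dif C X Y (n - 1) h)" by (auto simp: coh_class_def)
  next
   assume "EX h:hom_set C X Y (n - 1). g = hadd C X Y n f (Dif C X Y (n - 1) h)"
   then obtain h where h: "h : hom_set C X Y (n - 1)" "g = hadd C X Y n f (Dif C X Y (n - 1) h)" by blast
   have 1: "hadd C X Y n g (Dif C X Y (n - 1) k) = hadd C X Y n f (Dif C X Y (n - 1) (hadd C X Y (n - 1) h k))" if "k : hom_set C X Y (n - 1)" for k
    by (rule C.hv_inj[of X Y n]) (use X fg h that d in "simp_all add: add.assoc")
   have 2: "hadd C X Y n f (Dif C X Y (n - 1) k) = hadd C X Y n g (Dif C X Y (n - 1) (hadd C X Y (n - 1) k (hscale C X Y (n - 1) (- 1) h)))" if "k : hom_set C X Y (n - 1)" for k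
    by (rule C.hv_inj[of X Y n]) (use X fg h that d in simp_all)
   show "coh_class C X Y n f = coh_class C X Y n g"
    unfolding coh_class_def using 1 2 X h by (intro equalityI subsetI; clarify; metis C.hadd_closed C.hscale_closed)
  qed
 qed
 have Fm: "coh_map B F X Y n (coh_class A X Y n q) = coh_class B X Y n (far F X Y n q)"
  if X: "X : Ob A" "Y : Ob A" and q: "q : hom_set A X Y n" for X Y n q
 proof -
  have Fc: "far F X Y m r : hom_set B X Y m" if "r : hom_set A X Y m" for r m using far_closed[OF X that] X by (simp add: ob)
  have XB: "X : Ob B" "Y : Ob B" using X Ob by simp_all
  have const: "coh_class B X Y n (far F X Y n z) = coh_class B X Y n (far F X Y n q)" if z: "z : coh_class A X Y n q" for z
  proof -
   obtain h where h: "h : hom_set A X Y (n - 1)" "z = hadd A X Y n q (Dif A X Y (n - 1) h)" using z by (auto simp: coh_class_def)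
   have d: "Dif A X Y (n - 1) h : hom_set A X Y n" using X h by simp
   have "far F X Y n z = hadd B X Y n (far F X Y n q) (Dif B X Y (n - 1) (far F X Y (n - 1) h))"
    using X q h d far_dif[OF X h(1)] far_add[OF X q d] by (simp add: ob)
   moreover have "z : hom_set A X Y n" using X q h(2) d by simp
   ultimately have "coh_class B X Y n (far F X Y n q) = coh_class B X Y n (far F X Y n z)"
    by (intro iffD2[OF cls(2)[OF B XB Fc[OF q] Fc]] bexI[OF _ Fc[OF h(1)]])
   then show ?thesis by simp
  qed
  have "coh_map B F X Y n (coh_class A X Y n q) = (\<Union>z\<in>coh_class A X Y n q. coh_class B X Y n (far F X Y n q))"
   unfolding coh_map_def ob[OF X(1)] ob[OF X(2)] by (rule SUP_cong[OF refl const])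
  also have "... = coh_class B X Y n (far F X Y n q)" using cls(1)[OF A X q q] by blast
  finally show ?thesis .
 qed
 show ?thesis
  unfolding quasi_equivalence_def
 proof (intro conjI ballI allI F)
  fix X Y n assume X: "X : Ob A" "Y : Ob A"
  have XB: "X : Ob B" "Y : Ob B" using X Ob by simp_all
  have Fc: "far F X Y m r : hom_set B X Y m" if "r : hom_set A X Y m" for r m using far_closed[OF X that] X by (simp add: ob)
  have Fd: "Dif B X Y m (far F X Y m r) = far F X Y (m + 1) (Dif A X Y m r)" if "r : hom_set A X Y m" for r m
   using far_dif[OF X that] X by (simp add: ob)
  have Fz: "far F X Y m (hzero A X Y m) = hzero B X Y m" for m using far_zero[OF X, of m] X by (simp add: ob)
  have "bij_betw (coh_map B F X Y n) (cohomology A X Y n) (cohomology B X Y n)"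
   unfolding bij_betw_def
  proof
   show "inj_on (coh_map B F X Y n) (cohomology A X Y n)"
   proof (rule inj_onI)
    fix u v assume "u : cohomology A X Y n" "v : cohomology A X Y n" and eq: "coh_map B F X Y n u = coh_map B F X Y n v"
    then obtain q r where q: "q : hom_set A X Y n" "Dif A X Y n q = hzero A X Y (n + 1)" "u = coh_class A X Y n q"
     and r: "r : hom_set A X Y n" "Dif A X Y n r = hzero A X Y (n + 1)" "v = coh_class A X Y n r"
     unfolding cohomology_def cocycles_def by blast
    have "coh_class B X Y n (far F X Y n q) = coh_class B X Y n (far F X Y n r)" using eq q r X Fm by simp
    then obtain h where h: "h : hom_set B X Y (n - 1)" "far F X Y n r = hadd B X Y n (far F X Y n q) (Dif B X Y (n - 1) h)"
     using cls(2)[OF B XB Fc[OF q(1)] Fc[OF r(1)]] by blast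
    let ?s = "hadd A X Y n r (hscale A X Y n (- 1) q)"
    have dh: "Dif B X Y (n - 1) h : hom_set B X Y n" using XB h by simp
    have s: "?s : hom_set A X Y n" using X q r by simp
    have ds: "Dif A X Y n ?s = hzero A X Y (n + 1)"
     by (rule S.hv_inj[of X Y "n + 1"]) (use X q r in simp_all)
    have "far F X Y n ?s = hadd B X Y n (far F X Y n r) (hscale B X Y n (- 1) (far F X Y n q))"
     using X q r far_add[OF X, of r n "hscale A X Y n (- 1) q"] far_scale[OF X q(1)] by (simp add: ob)
    also have "... = Dif B X Y (n - 1) h"
     by (rule T.hv_inj[of X Y n]) (use XB h dh Fc[OF q(1)] Fc[OF r(1)] in simp_all)
    finally obtain z where z: "z : hom_set A X Y (n - 1)" "?s = Dif A X Y (n - 1) z" using inj[OF X s ds h(1)] by blast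
    have dz: "Dif A X Y (n - 1) z : hom_set A X Y n" using X z(1) by simp
    have "r = hadd A X Y n q ?s"
     by (rule S.hv_inj[of X Y n]) (use X q r in simp_all)
    then have "r = hadd A X Y n q (Dif A X Y (n - 1) z)" unfolding z(2) .
    then show "u = v" using cls(2)[OF A X q(1) r(1)] z(1) q(3) r(3) by blast
   qed
   show "coh_map B F X Y n ` cohomology A X Y n = cohomology B X Y n"
   proof
    show "coh_map B F X Y n ` cohomology A X Y n \<subseteq> cohomology B X Y n"
    proof
     fix u assume "u : coh_map B F X Y n ` cohomology A X Y n"
     then obtain q where q: "q : hom_set A X Y n" "Dif A X Y n q = hzero A X Y (n + 1)" "u = coh_map B F X Y n (coh_class A X Y n q)"
      unfolding cohomology_def cocycles_def by blast
     have "far F X Y n q : cocycles B X Y n" using Fc[OF q(1)] Fd[OF q(1)] q(2) Fz by (simp add: cocycles_def)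
     then show "u : cohomology B X Y n" unfolding q(3) Fm[OF X q(1)] cohomology_def by (rule imageI)
    qed
    show "cohomology B X Y n \<subseteq> coh_map B F X Y n ` cohomology A X Y n"
    proof
     fix u assume "u : cohomology B X Y n"
     then obtain e where e: "e : hom_set B X Y n" "Dif B X Y n e = hzero B X Y (n + 1)" "u = coh_class B X Y n e"
      unfolding cohomology_def cocycles_def by blast
     obtain q y where q: "q : cocycles A X Y n" "y : hom_set B X Y (n - 1)" "e = hadd B X Y n (far F X Y n q) (Dif B X Y (n - 1) y)"
      using surj[OF X e(1,2)] by blast
     have q': "q : hom_set A X Y n" using q(1) by (simp add: cocycles_def)
     have "u = coh_map B F X Y n (coh_class A X Y n q)"
      using cls(2)[OF B XB Fc[OF q'] e(1)] q(2,3) e(3) Fm[OF X q'] by blast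
     then show "u : coh_map B F X Y n ` cohomology A X Y n" using q(1) unfolding cohomology_def by blast
    qed
   qed
  qed
  then show "bij_betw (coh_map B F X Y n) (cohomology A X Y n) (cohomology B (fob F X) (fob F Y) n)" using X by (simp add: ob)
 next
  fix U assume U: "U : Ob B"
  then have UA: "U : Ob A" by (simp add: Ob)
  have i: "Id B U : cocycles B U U 0" using U by (simp add: cocycles_def)
  have "Cmp B U U U 0 0 (Id B U) (Id B U) = Id B U" using U T.cmp_id_left[of U U "Id B U" 0] T.id_closed[OF U] by simp
  then have "homotopy_equivalent B U U" unfolding homotopy_equivalent_def using i by (intro bexI[of _ "Id B U"]) simp_all
  then show "EX X:Ob A. homotopy_equivalent B (fob F X) U" using UA ob by (intro bexI[of _ U]) simp_all
 qed
qed

section \<open>The comparison functor is a quasi-equivalence\<close>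

context dripair
begin

text \<open>Any index will do, since \<open>d\<epsilon> = 1\<close> for a single index.\<close>

definition cM :: "('a, 'k) univ => ('a, 'k) univ" where
 "cM W = M.eb W [SOME i. eps_index ST W [i]]"

definition cE :: "('a, 'k) univ => ('a, 'k) univ" where
 "cE W = far (beta (C, S) (D, T)) W W (- 1) (cM W)"

lemma cM_props:
 assumes W: "W : Ob A.T" "W : \<Union>(set ST)"
 shows "cM W : hom_set M.Q W W (- 1)" "Dif M.Q W W (- 1) (cM W) = Id M.Q W"
proof -
 obtain j where "j < length ST" "W : ST ! j" using W(2) by (auto simp: in_set_conv_nth)
 then have "eps_index ST W [Suc j]" by (simp add: eps_index_def)
 then have e: "eps_index ST W [SOME i. eps_index ST W [i]]" by (rule someI)
 then have v: "M.valid W [SOME i. eps_index ST W [i]]" using W by (simp add: M.valid_def)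
 show c: "cM W : hom_set M.Q W W (- 1)" unfolding cM_def by (rule M.eb_closed[OF v]) simp
 show "Dif M.Q W W (- 1) (cM W) = Id M.Q W"
 proof (rule M.Q.hv_inj[of W W 0])
  show "hv M.Q W W 0 (Dif M.Q W W (- 1) (cM W)) = hv M.Q W W 0 (Id M.Q W)"
   using M.hv_difQ_eb[OF v] by (simp add: cM_def rm_def M.eb_Nil)
 qed (use W c M.difQ_closed[OF W(1) W(1) c, of 0] M.Q.id_closed[of W] in simp_all)
qed

lemma beta_dgfunctor: "dgfunctor M.Q E.T (beta (C, S) (D, T))"
 by (rule dgfunctorI[OF M.dgc_Q E.dgc_T beta_functor])

lemma cE_props:
 assumes W: "W : Ob A.T" "W : \<Union>(set ST)"
 shows "cE W : hom_set E.T W W (- 1)" "Dif E.T W W (- 1) (cE W) = Id E.T W"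
proof -
 interpret b: dgfunctor M.Q E.T "beta (C, S) (D, T)" by (rule beta_dgfunctor)
 note c = cM_props[OF W]
 show "cE W : hom_set E.T W W (- 1)" unfolding cE_def using b.far_closed[OF _ _ c(1)] W by (simp add: beta_simps)
 show "Dif E.T W W (- 1) (cE W) = Id E.T W"
  unfolding cE_def using b.far_dif[OF _ _ c(1)] c(2) b.far_id[of W] W by (simp add: beta_simps)
qed

text \<open>The map \<open>\<gamma>\<close> exists only on the spaces of morphisms out of a fixed object; it need not be a functor.\<close>

theorem beta_quasi_equivalence: "quasi_equivalence M.Q E.T (beta (C, S) (D, T))"
proof (rule quasi_equivalenceI[OF M.dgc_Q E.dgc_T beta_functor])
 let ?b = "beta (C, S) (D, T)"
 interpret b: dgfunctor M.Q E.T ?b by (rule beta_dgfunctor)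
 note incl = dgfunctorI[OF A.dgc_T M.dgc_Q M.incl_functor] and iif = dgfunctorI[OF A.dgc_T E.dgc_T ii_functor]
 show "X : Ob M.Q ==> fob ?b X = X" for X by (simp add: beta_simps)
 show "Ob E.T = Ob M.Q" by simp
 have main: "EX \<gamma>. (ALL W n. W : Ob A.T --> linear_map (Hom E.T V W n) (Hom M.Q V W n) (\<gamma> W n)) &
   (ALL W n x. W : Ob A.T --> x : hom_set E.T V W n --> \<gamma> W (n + 1) (Dif E.T V W n x) = Dif M.Q V W n (\<gamma> W n x)) &
   (ALL W n q. W : Ob A.T --> q : hom_set M.Q V W n --> Dif M.Q V W n q = hzero M.Q V W (n + 1) -->
     (EX y:hom_set M.Q V W (n - 1). hadd M.Q V W n (\<gamma> W n (far ?b V W n q)) (hscale M.Q V W n (- 1) q) = Dif M.Q V W (n - 1) y)) &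
   (ALL W n x. W : Ob A.T --> x : hom_set E.T V W n --> Dif E.T V W n x = hzero E.T V W (n + 1) -->
     (EX y:hom_set E.T V W (n - 1). hadd E.T V W n (far ?b V W n (\<gamma> W n x)) (hscale E.T V W n (- 1) x) = Dif E.T V W (n - 1) y))"
  if V: "V : Ob A.T" for V
 proof -
  interpret m: repr C S D T M.Q M.incl V cM
   by (intro repr.intro repr_axioms.intro dripair_axioms incl) (simp_all add: V cM_props)
  interpret e: repr C S D T E.T ii V cE
   by (intro repr.intro repr_axioms.intro dripair_axioms iif) (simp_all add: V cE_props ii_ob)
  obtain \<gamma> where g: "!!W n. W : Ob A.T ==> linear_map (Hom E.T V W n) (Hom M.Q V W n) (\<gamma> W n)"
   and gact: "!!W W' m n a x. [|W : Ob A.T; W' : Ob A.T; a : hom_set A.T W W' m; x : hom_set E.T V W n|] ==>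
    \<gamma> W' (m + n) (Cmp E.T V W W' m n (far ii W W' m a) x) = Cmp M.Q V W W' m n (far M.incl W W' m a) (\<gamma> W n x)"
   and gdif: "!!W n x. [|W : Ob A.T; x : hom_set E.T V W n|] ==> \<gamma> W (n + 1) (Dif E.T V W n x) = Dif M.Q V W n (\<gamma> W n x)"
   and g1: "\<gamma> V 0 (Id E.T V) = Id M.Q V"
   using m.E_lift by blast
  have gc: "\<gamma> W n x : hom_set M.Q V W n" if "W : Ob A.T" "x : hom_set E.T V W n" for W n x
   using linear_mapD(1)[OF g[OF that(1)] that(2)] .
  have bc: "far ?b W W' n q : hom_set E.T W W' n" if "W : Ob A.T" "W' : Ob A.T" "q : hom_set M.Q W W' n" for W W' n q
   using b.far_closed[of W W' q n] that by (simp add: beta_simps)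
  have bl: "linear_map (Hom M.Q V W n) (Hom E.T V W n) (far ?b V W n)" if "W : Ob A.T" for W n
   using b.far_lin[of V W n] V that by (simp add: beta_simps)
  have bdif: "far ?b V W (n + 1) (Dif M.Q V W n q) = Dif E.T V W n (far ?b V W n q)" if "W : Ob A.T" "q : hom_set M.Q V W n" for W n q
   using b.far_dif[of V W q n] V that by (simp add: beta_simps)
  have binc: "far ?b V W' (m + n) (Cmp M.Q V W W' m n (far M.incl W W' m a) q) = Cmp E.T V W W' m n (far ii W W' m a) (far ?b V W n q)"
   if "W : Ob A.T" "W' : Ob A.T" "a : hom_set A.T W W' m" "q : hom_set M.Q V W n" for W W' m n a q
   using b.far_cmp[of V W W' "M.inc W W' m a" m q n] V that by (simp add: beta_simps M.inc_closed)
  have iic: "far ii W W' m a : hom_set E.T W W' m" if "W : Ob A.T" "W' : Ob A.T" "a : hom_set A.T W W' m" for W W' m a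
   using dgfunctor.far_closed[OF iif, of W W' a m] that by (simp add: ii_ob)
  have inc: "far M.incl W W' m a : hom_set M.Q W W' m" if "W : Ob A.T" "W' : Ob A.T" "a : hom_set A.T W W' m" for W W' m a
   using that by (simp add: M.inc_closed)
  have b1: "far ?b V V 0 (Id M.Q V) = Id E.T V" using b.far_id[of V] V by (simp add: beta_simps)
  let ?fQ = "%W n q. hadd M.Q V W n (\<gamma> W n (far ?b V W n q)) (hscale M.Q V W n (- 1) q)"
  let ?fE = "%W n x. hadd E.T V W n (far ?b V W n (\<gamma> W n x)) (hscale E.T V W n (- 1) x)"
  have idl: "linear_map M0 M0 (%x. x)" for M0 :: "('k, ('a, 'k) univ) module" by (simp add: linear_map_def)
  have Q: "EX y:hom_set M.Q V W (n - 1). ?fQ W n q = Dif M.Q V W (n - 1) y"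
   if "W : Ob A.T" "q : hom_set M.Q V W n" "Dif M.Q V W n q = hzero M.Q V W (n + 1)" for W n q
  proof (rule m.Q_null[OF _ _ _ _ that])
   fix W n assume W: "W : Ob A.T"
   have k: "kmod (Hom M.Q V W n)" by (rule M.Q.kmod_hom) (use V W in simp_all)
   show "linear_map (Hom M.Q V W n) (Hom M.Q V W n) (?fQ W n)"
    by (rule linear_map_add[OF k k linear_map_comp[OF bl[OF W] g[OF W]] linear_map_scale[OF k k idl]])
   fix q assume q: "q : hom_set M.Q V W n"
   have c: "far ?b V W n q : hom_set E.T V W n" "\<gamma> W n (far ?b V W n q) : hom_set M.Q V W n" using bc[OF V W q] gc[OF W] by simp_all
   show "?fQ W (n + 1) (Dif M.Q V W n q) = Dif M.Q V W n (?fQ W n q)"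
    using V W q c by (simp add: bdif gdif)
   fix W' m a assume a: "W' : Ob A.T" "a : hom_set A.T W W' m"
   then show "?fQ W' (m + n) (Cmp M.Q V W W' m n (M.inc W W' m a) q) = Cmp M.Q V W W' m n (far M.incl W W' m a) (?fQ W n q)"
    using binc[OF W a q] gact[OF W a c(1)] V W q c inc[OF W a] by simp
  next
   show "?fQ V 0 (Id M.Q V) = hzero M.Q V V 0"
    unfolding b1 g1 by (rule kmod.add_neg[OF M.Q.kmod_hom]) (use V M.Q.id_closed[of V] in simp_all)
  qed
  have E: "EX y:hom_set E.T V W (n - 1). ?fE W n x = Dif E.T V W (n - 1) y"
   if "W : Ob A.T" "x : hom_set E.T V W n" "Dif E.T V W n x = hzero E.T V W (n + 1)" for W n x
  proof (rule e.E_null[OF _ _ _ _ that])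
   fix W n assume W: "W : Ob A.T"
   have k: "kmod (Hom E.T V W n)" by (rule E.T.kmod_hom) (use V W in simp_all)
   show "linear_map (Hom E.T V W n) (Hom E.T V W n) (?fE W n)"
    by (rule linear_map_add[OF k k linear_map_comp[OF g[OF W] bl[OF W]] linear_map_scale[OF k k idl]])
   fix x assume x: "x : hom_set E.T V W n"
   have c: "\<gamma> W n x : hom_set M.Q V W n" "far ?b V W n (\<gamma> W n x) : hom_set E.T V W n" using gc[OF W x] bc[OF V W] by simp_all
   show "?fE W (n + 1) (Dif E.T V W n x) = Dif E.T V W n (?fE W n x)"
    using V W x c by (simp add: bdif gdif)
   fix W' m a assume a: "W' : Ob A.T" "a : hom_set A.T W W' m"
   then show "?fE W' (m + n) (Cmp E.T V W W' m n (far ii W W' m a) x) = Cmp E.T V W W' m n (far ii W W' m a) (?fE W n x)"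
    unfolding gact[OF W a x] binc[OF W a c(1)] using V W x c iic[OF W a] by simp
  next
   show "?fE V 0 (Id E.T V) = hzero E.T V V 0"
    unfolding g1 b1 by (rule kmod.add_neg[OF E.T.kmod_hom]) (use V E.T.id_closed[of V] in simp_all)
  qed
  show ?thesis by (rule exI[of _ \<gamma>]) (use g gdif Q E in blast)
 qed
 fix X Y n
 assume "X : Ob M.Q" "Y : Ob M.Q"
 then have X: "X : Ob A.T" "Y : Ob A.T" "X : Ob E.T" "Y : Ob E.T" by simp_all
 obtain \<gamma> where g: "!!W n. W : Ob A.T ==> linear_map (Hom E.T X W n) (Hom M.Q X W n) (\<gamma> W n)"
  and gdif: "!!W n x. [|W : Ob A.T; x : hom_set E.T X W n|] ==> \<gamma> W (n + 1) (Dif E.T X W n x) = Dif M.Q X W n (\<gamma> W n x)"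
  and gb: "!!W n q. [|W : Ob A.T; q : hom_set M.Q X W n; Dif M.Q X W n q = hzero M.Q X W (n + 1)|] ==>
   EX y:hom_set M.Q X W (n - 1). hadd M.Q X W n (\<gamma> W n (far ?b X W n q)) (hscale M.Q X W n (- 1) q) = Dif M.Q X W (n - 1) y"
  and bg: "!!W n x. [|W : Ob A.T; x : hom_set E.T X W n; Dif E.T X W n x = hzero E.T X W (n + 1)|] ==>
   EX y:hom_set E.T X W (n - 1). hadd E.T X W n (far ?b X W n (\<gamma> W n x)) (hscale E.T X W n (- 1) x) = Dif E.T X W (n - 1) y"
  using main[OF X(1)] by blast
 have gc: "\<gamma> Y k x : hom_set M.Q X Y k" if "x : hom_set E.T X Y k" for k x
  using linear_mapD(1)[OF g[OF X(2)] that] .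
 have gz: "\<gamma> Y k (hzero E.T X Y k) = hzero M.Q X Y k" for k
  using linear_mapD(1,3)[OF g[OF X(2)], of "hzero E.T X Y k" k] X E.T.hscale_zero[of X Y "hzero E.T X Y k" k]
   M.Q.hscale_zero[of X Y "\<gamma> Y k (hzero E.T X Y k)" k] by (metis E.T.hzero_closed M.Q_simps(1))
 {
  fix e assume e: "e : hom_set E.T X Y n" "Dif E.T X Y n e = hzero E.T X Y (n + 1)"
  obtain y where y: "y : hom_set E.T X Y (n - 1)" "hadd E.T X Y n (far ?b X Y n (\<gamma> Y n e)) (hscale E.T X Y n (- 1) e) = Dif E.T X Y (n - 1) y"
   using bg[OF X(2) e] by blast
  have c: "far ?b X Y n (\<gamma> Y n e) : hom_set E.T X Y n" using b.far_closed[of X Y "\<gamma> Y n e" n] gc[OF e(1)] X by (simp add: beta_simps)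
  have dy: "Dif E.T X Y (n - 1) y : hom_set E.T X Y n" using X y(1) by simp
  have h: "hv E.T X Y n (Dif E.T X Y (n - 1) y) = hv E.T X Y n (far ?b X Y n (\<gamma> Y n e)) - hv E.T X Y n e"
   unfolding y(2)[symmetric] using X e c by simp
  have "e = hadd E.T X Y n (far ?b X Y n (\<gamma> Y n e)) (Dif E.T X Y (n - 1) (hscale E.T X Y (n - 1) (- 1) y))"
   by (rule E.T.hv_inj[of X Y n]) (use X e c y(1) dy h in simp_all)
  moreover have "\<gamma> Y n e : cocycles M.Q X Y n" using gc[OF e(1)] gdif[OF X(2) e(1)] e(2) gz by (simp add: cocycles_def)
  ultimately show "EX q:cocycles M.Q X Y n. EX y:hom_set E.T X Y (n - 1). e = hadd E.T X Y n (far ?b X Y n q) (Dif E.T X Y (n - 1) y)"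
   using X y(1) E.T.hscale_closed[OF X(3,4) y(1)] by blast
 next
  fix q e assume q: "q : hom_set M.Q X Y n" "Dif M.Q X Y n q = hzero M.Q X Y (n + 1)"
   and e: "e : hom_set E.T X Y (n - 1)" "far ?b X Y n q = Dif E.T X Y (n - 1) e"
  obtain y where y: "y : hom_set M.Q X Y (n - 1)" "hadd M.Q X Y n (\<gamma> Y n (far ?b X Y n q)) (hscale M.Q X Y n (- 1) q) = Dif M.Q X Y (n - 1) y"
   using gb[OF X(2) q] by blast
  let ?w = "\<gamma> Y (n - 1) e"
  have w: "?w : hom_set M.Q X Y (n - 1)" "Dif M.Q X Y (n - 1) ?w = \<gamma> Y n (far ?b X Y n q)"
   using gc[OF e(1)] gdif[OF X(2) e(1)] e(2) by simp_all
  have d: "Dif M.Q X Y (n - 1) y : hom_set M.Q X Y n" "Dif M.Q X Y (n - 1) ?w : hom_set M.Q X Y n" using X y(1) w(1) by simp_all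
  have h: "hv M.Q X Y n (Dif M.Q X Y (n - 1) y) = hv M.Q X Y n (Dif M.Q X Y (n - 1) ?w) - hv M.Q X Y n q"
   unfolding y(2)[symmetric] w(2)[symmetric] using X q d by simp
  have "q = Dif M.Q X Y (n - 1) (hadd M.Q X Y (n - 1) ?w (hscale M.Q X Y (n - 1) (- 1) y))"
   by (rule M.Q.hv_inj[of X Y n]) (use X q w(1) y(1) d h in simp_all)
  then show "EX z:hom_set M.Q X Y (n - 1). q = Dif M.Q X Y (n - 1) z"
   using X w(1) y(1) by (intro bexI[of _ "hadd M.Q X Y (n - 1) ?w (hscale M.Q X Y (n - 1) (- 1) y)"]) simp_all
 }
qed

end

section \<open>The colax-monoidal functor\<close>

lemma PDGCat_objD: "P : obj PDGCat_minus ==> P : pobj"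
 by (auto simp: PDGCat_minus_def pdg_obj_def DGCat_minus_def DGCat_def pobj_def dgc_iff)

lemma PDGCat_simps:
 "arr PDGCat_minus = parr" "tobj PDGCat_minus = ptensor" "unit_obj PDGCat_minus = (unit_dg, [])"
 "ident PDGCat_minus (C, S) = (Delta_id (length S), id_fun C)"
 "compose PDGCat_minus (C, S) (D, T) (B, U) (\<tau>, G) (\<sigma>, F) = (restrict (%j. \<sigma> (\<tau> j)) {0..length U}, comp_fun C G F)"
 "tarr PDGCat_minus (C, S) (C', S') (D, T) (D', T') (\<sigma>, F) (\<tau>, G) = (tsum (length S) (length S') (length T') \<sigma> \<tau>, tensor_fun C C' D D' F G)"
 "associator PDGCat_minus (C, S) (D, T) (B, U) = (Delta_id (length S + length T + length U), tensor_assoc C D B)"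
 "lunitor PDGCat_minus (C, S) = (Delta_id (length S), tensor_lunit C)"
 "runitor PDGCat_minus (C, S) = (Delta_id (length S), tensor_runit C)"
 by (simp_all add: PDGCat_minus_def DGCat_minus_def DGCat_def tsum_def parr_def ptensor_def tS_def fun_eq_iff)

lemma DGCat_simps:
 "obj DGCat = {C. dg_category C}" "arr DGCat C D = {F. dg_functor C D F}" "ident DGCat = id_fun"
 "compose DGCat C D E G F = comp_fun C G F" "tobj DGCat = tensor_dg" "tarr DGCat = tensor_fun"
 "unit_obj DGCat = unit_dg" "associator DGCat = tensor_assoc" "lunitor DGCat = tensor_lunit" "runitor DGCat = tensor_runit"
 by (simp_all add: DGCat_def)

lemma parr_comp:
 assumes f: "(\<sigma>, F) : parr (C, S) (D, T)" and g: "(\<tau>, G) : parr (D, T) (B, U)" and P: "(C, S) : pobj"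
  and R: "(D, T) : pobj" and Z: "(B, U) : pobj"
 shows "(restrict (%j. \<sigma> (\<tau> j)) {0..length U}, comp_fun C G F) : parr (C, S) (B, U)"
proof -
 have s: "\<sigma> : Delta_f (length T) (length S)" and t: "\<tau> : Delta_f (length U) (length T)"
  and F: "dg_functor C D F" and G: "dg_functor D B G"
  using f g by (auto simp: parr_def)
 have fs: "fob F ` (S ! (i - 1)) \<subseteq> T ! (j - 1)" if "1 <= j" "j <= length T" "\<sigma> (j - 1) < i" "i <= \<sigma> j" for i j
  using f that by (auto simp: parr_def)
 have gs: "fob G ` (T ! (i - 1)) \<subseteq> U ! (j - 1)" if "1 <= j" "j <= length U" "\<tau> (j - 1) < i" "i <= \<tau> j" for i j
  using g that by (auto simp: parr_def)
 note S = Delta_fD[OF s] and T = Delta_fD[OF t]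
 have tle: "\<tau> j <= length T" if "j <= length U" for j using T(3)[OF that order_refl] T(2) by simp
 have sle: "\<sigma> j <= length S" if "j <= length T" for j using S(3)[OF that order_refl] S(2) by simp
 have "restrict (%j. \<sigma> (\<tau> j)) {0..length U} : Delta_f (length U) (length S)"
  unfolding Delta_f_def using S T tle sle by (auto simp: mono_on_def)
 moreover have "dg_functor C B (comp_fun C G F)"
  by (rule dg_functor_comp[OF _ _ _ F G]) (use P R Z in "auto simp: pobj_def")
 moreover have "fob (comp_fun C G F) ` (S ! (i - 1)) \<subseteq> U ! (j - 1)"
  if j: "1 <= j" "j <= length U" and i: "\<sigma> (\<tau> (j - 1)) < i" "i <= \<sigma> (\<tau> j)" for i j
 proof -
  have j1: "j - 1 <= length U" using j by simp
  have i': "1 <= i" "i <= length S" using i sle[OF tle[OF j(2)]] by simp_all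
  note l = idx[OF s i']
  have "idx \<sigma> i <= \<tau> j" using l(5)[OF tle[OF j(2)]] i(2) by simp
  moreover have "\<tau> (j - 1) < idx \<sigma> i" using l(5)[OF tle[OF j1]] i(1) by simp
  ultimately have 1: "fob G ` (T ! (idx \<sigma> i - 1)) \<subseteq> U ! (j - 1)" by (intro gs[OF j])
  have 2: "fob F ` (S ! (i - 1)) \<subseteq> T ! (idx \<sigma> i - 1)" by (rule fs[OF l(2,3,4,1)])
  have i1: "i - 1 < length S" using i' by linarith
  have "S ! (i - 1) \<subseteq> Ob C" by (rule pobj_nth[OF P i1])
  then show ?thesis using 1 2 by (auto simp: comp_fun_simps subset_iff)
 qed
 moreover have "restrict (%j. \<sigma> (\<tau> j)) {0..length U} j = \<sigma> (\<tau> j)" if "j <= length U" for j using that by simp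
 ultimately show ?thesis unfolding parr_def by auto
qed

lemma dr_arr_is_functor: "is_functor (PDGCat_minus :: (('a, 'k::field) pdg, ('a, 'k) pdgf) moncat) DGCat drinfeld dr_arr"
 unfolding is_functor_def PDGCat_simps(1) DGCat_simps
proof (intro conjI ballI)
 fix P :: "('a, 'k::field) pdg" assume "P : obj PDGCat_minus"
 note P = PDGCat_objD[OF this]
 obtain C S where e: "P = (C, S)" by (metis surj_pair)
 have C: "dgc C" using P e by (simp add: pobj_def)
 show "drinfeld P : {C. dg_category C}"
  using dri.dgc_Q[OF dri.intro[OF C]] by (simp add: e dgc_iff)
 have "(Delta_id (length S), id_fun C) : parr (C, S) (C, S)"
 proof (rule parr_Delta_id[OF dg_functor_id[OF C] refl refl])
  fix j assume j: "1 <= j" "j <= length S"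
  then have "j - 1 < length S" by linarith
  then have "S ! (j - 1) \<subseteq> Ob C" by (rule pobj_nth[OF P[unfolded e]])
  then show "fob (id_fun C) ` (S ! (j - 1)) \<subseteq> S ! (j - 1)" by (auto simp: id_fun_simps subset_iff)
 qed
 then show "dr_arr P P (ident PDGCat_minus P) = id_fun (drinfeld P)"
  unfolding e PDGCat_simps by (rule dr_arr_id[OF P[unfolded e]])
 fix R :: "('a, 'k) pdg" assume "R : obj PDGCat_minus"
 note R = PDGCat_objD[OF this]
 fix f assume f: "f : parr P R"
 show "dr_arr P R f : {F. dg_functor (drinfeld P) (drinfeld R) F}" using dr_arr_functor[OF P R f] by simp
next
 fix P R Z :: "('a, 'k::field) pdg" and f g
 assume "P : obj PDGCat_minus" "R : obj PDGCat_minus" "Z : obj PDGCat_minus" and f: "f : parr P R" and g: "g : parr R Z"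
 note o = this(1,2,3)[THEN PDGCat_objD]
 obtain C S D T B U \<sigma> F \<tau> G where e: "P = (C, S)" "R = (D, T)" "Z = (B, U)" "f = (\<sigma>, F)" "g = (\<tau>, G)" by (metis surj_pair)
 show "dr_arr P Z (compose PDGCat_minus P R Z g f) = comp_fun (drinfeld P) (dr_arr R Z g) (dr_arr P R f)"
  unfolding e PDGCat_simps
  by (rule dr_arr_comp[OF o[unfolded e] f[unfolded e] g[unfolded e] parr_comp[OF f[unfolded e] g[unfolded e] o[unfolded e]]])
qed

lemma dr_arr_fibre:
 assumes P: "P : pdg_obj n" and R: "R : pdg_obj n" and F: "F : pdg_arr n P R"
 shows "dr_arr P R (Delta_id n, F) = drinfeld_fun P R F"
proof -
 obtain C S D T where e: "P = (C, S)" "R = (D, T)" by (metis surj_pair)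
 have "P : obj PDGCat_minus" "R : obj PDGCat_minus" using P R by (auto simp: PDGCat_minus_def)
 note o = this[THEN PDGCat_objD, unfolded e]
 have len: "length S = n" "length T = n" using P R by (auto simp: e pdg_obj_def)
 have "(Delta_id n, F) : parr (C, S) (D, T)"
 proof (rule parr_Delta_id)
  show "dg_functor C D F" using F by (auto simp: e pdg_arr_def DGCat_minus_def DGCat_def)
  fix j assume "1 <= j" "j <= n"
  then show "fob F ` (S ! (j - 1)) \<subseteq> T ! (j - 1)" using F unfolding e pdg_arr_def by auto
 qed (use len in simp_all)
 then interpret drmap C S D T F "idx (Delta_id n)" by (rule drmap_parr[OF o])
 have "dr_arr P R (Delta_id n, F) = U.lift" by (simp add: dr_arr_def e)
 also have "... = drinfeld_fun P R F" unfolding e by (rule lift_eq_drinfeld_fun) (use len idx_Delta_id in simp)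
 finally show ?thesis .
qed

lemma beta_colax: "colax_monoidal (PDGCat_minus :: (('a, 'k::field) pdg, ('a, 'k) pdgf) moncat) DGCat drinfeld dr_arr beta eta"
 unfolding colax_monoidal_def PDGCat_simps(1-3) DGCat_simps
proof (intro conjI ballI)
 fix P R :: "('a, 'k::field) pdg" assume "P : obj PDGCat_minus" "R : obj PDGCat_minus"
 note o = this[THEN PDGCat_objD]
 obtain C S D T where e: "P = (C, S)" "R = (D, T)" by (metis surj_pair)
 interpret dripair C S D T by (rule dripair.intro[OF pobj_dri[OF o(1)[unfolded e]] pobj_dri[OF o(2)[unfolded e]]])
 show "beta P R : {F. dg_functor (drinfeld (ptensor P R)) (tensor_dg (drinfeld P) (drinfeld R)) F}"
  using beta_functor by (simp add: e ptensor_def)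
next
 interpret driunit unit_dg "[]" by (intro driunit.intro driunit_axioms.intro dri.intro[OF dgc_unit] unit_pobj)
 show "eta : {F. dg_functor (drinfeld (unit_dg, [])) unit_dg F}" using eta_functor by simp
next
 fix P P' R R' :: "('a, 'k::field) pdg" and f g
 assume "P : obj PDGCat_minus" "P' : obj PDGCat_minus" "R : obj PDGCat_minus" "R' : obj PDGCat_minus"
  and f: "f : parr P P'" and g: "g : parr R R'"
 note o = this(1-4)[THEN PDGCat_objD]
 obtain C S C' S' D T D' T' \<sigma> F \<tau> G where e: "P = (C, S)" "P' = (C', S')" "R = (D, T)" "R' = (D', T')" "f = (\<sigma>, F)" "g = (\<tau>, G)"
  by (metis surj_pair)
 note o = o[unfolded e] and fg = f[unfolded e] g[unfolded e]
 interpret drinat C S C' S' F \<sigma> D T D' T' G \<tau>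
  by (intro drinat.intro drinat_axioms.intro drmap_parr[OF o(1,2) fg(1)] drmap_parr[OF o(3,4) fg(2)] o fg)
 show "comp_fun (drinfeld (ptensor P R)) (beta P' R') (dr_arr (ptensor P R) (ptensor P' R') (tarr PDGCat_minus P P' R R' f g)) =
  comp_fun (drinfeld (ptensor P R)) (tensor_fun (drinfeld P) (drinfeld P') (drinfeld R) (drinfeld R') (dr_arr P P' f) (dr_arr R R' g)) (beta P R)"
  unfolding e PDGCat_simps using beta_natural by (simp add: ptensor_def)
next
 fix P R Z :: "('a, 'k::field) pdg" assume "P : obj PDGCat_minus" "R : obj PDGCat_minus" "Z : obj PDGCat_minus"
 note o = this[THEN PDGCat_objD]
 obtain C S D T B U where e: "P = (C, S)" "R = (D, T)" "Z = (B, U)" by (metis surj_pair)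
 note o = o[unfolded e]
 interpret dritriple C S D T B U by (intro dritriple.intro dritriple_axioms.intro o pobj_dri[OF o(1)] pobj_dri[OF o(2)] pobj_dri[OF o(3)])
 show "let XY_Z = drinfeld (ptensor (ptensor P R) Z); X_YZ = drinfeld (ptensor P (ptensor R Z)); target = tensor_dg (drinfeld P) (tensor_dg (drinfeld R) (drinfeld Z))
  in comp_fun XY_Z (tensor_assoc (drinfeld P) (drinfeld R) (drinfeld Z))
    (comp_fun XY_Z (tensor_fun (drinfeld (ptensor P R)) (tensor_dg (drinfeld P) (drinfeld R)) (drinfeld Z) (drinfeld Z) (beta P R) (id_fun (drinfeld Z)))
     (beta (ptensor P R) Z)) =
    comp_fun XY_Z
    (comp_fun X_YZ (tensor_fun (drinfeld P) (drinfeld P) (drinfeld (ptensor R Z)) (tensor_dg (drinfeld R) (drinfeld Z)) (id_fun (drinfeld P)) (beta R Z))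
     (beta P (ptensor R Z)))
    (dr_arr (ptensor (ptensor P R) Z) (ptensor P (ptensor R Z)) (associator PDGCat_minus P R Z))"
  unfolding e PDGCat_simps Let_def using coassoc by (simp add: ptensor_def)
next
 fix P :: "('a, 'k::field) pdg" assume "P : obj PDGCat_minus"
 note o = PDGCat_objD[OF this]
 obtain C S where e: "P = (C, S)" by (metis surj_pair)
 note o = o[unfolded e]
 interpret driunit C S by (intro driunit.intro driunit_axioms.intro o pobj_dri[OF o])
 show "comp_fun (drinfeld (ptensor (unit_dg, []) P)) (tensor_lunit (drinfeld P))
   (comp_fun (drinfeld (ptensor (unit_dg, []) P)) (tensor_fun (drinfeld (unit_dg, [])) unit_dg (drinfeld P) (drinfeld P) eta (id_fun (drinfeld P)))
    (beta (unit_dg, []) P)) = dr_arr (ptensor (unit_dg, []) P) P (lunitor PDGCat_minus P)"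
  unfolding e PDGCat_simps using left_counit by (simp add: ptensor_def)
 show "comp_fun (drinfeld (ptensor P (unit_dg, []))) (tensor_runit (drinfeld P))
   (comp_fun (drinfeld (ptensor P (unit_dg, []))) (tensor_fun (drinfeld P) (drinfeld P) (drinfeld (unit_dg, [])) unit_dg (id_fun (drinfeld P)) eta)
    (beta P (unit_dg, []))) = dr_arr (ptensor P (unit_dg, [])) P (runitor PDGCat_minus P)"
  unfolding e PDGCat_simps using right_counit by (simp add: ptensor_def)
qed

lemma beta_quasi:
 assumes "P : obj PDGCat_minus" "R : obj PDGCat_minus"
 shows "quasi_equivalence (drinfeld (tobj PDGCat_minus P R)) (tobj DGCat (drinfeld P) (drinfeld R)) (beta P R)"
proof -
 note o = assms[THEN PDGCat_objD]
 obtain C S D T where e: "P = (C, S)" "R = (D, T)" by (metis surj_pair)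
 interpret dripair C S D T by (rule dripair.intro[OF pobj_dri[OF o(1)[unfolded e]] pobj_dri[OF o(2)[unfolded e]]])
 show ?thesis using beta_quasi_equivalence by (simp add: e PDGCat_simps DGCat_simps ptensor_def)
qed

theorem proposition4p7:
  shows "\<exists>Dr. is_functor (PDGCat_minus :: (('a, 'k::field_char_0) pdg, ('a, 'k) pdgf) moncat) DGCat drinfeld Dr \<and>
    (\<forall>n. \<forall>X\<in>pdg_obj n. \<forall>Y\<in>pdg_obj n. \<forall>F\<in>pdg_arr n X Y.
       Dr X Y (Delta_id n, F) = drinfeld_fun X Y F) \<and>
    (\<exists>\<beta> \<eta>. colax_monoidal PDGCat_minus DGCat drinfeld Dr \<beta> \<eta> \<and>
       (\<forall>X\<in>obj PDGCat_minus. \<forall>Y\<in>obj PDGCat_minus.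
          quasi_equivalence (drinfeld (tobj PDGCat_minus X Y))
            (tobj DGCat (drinfeld X) (drinfeld Y)) (\<beta> X Y)))"
  by (rule exI[of _ dr_arr]) (use dr_arr_is_functor dr_arr_fibre beta_colax beta_quasi in blast)


end
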